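(* Fix $\lambda>1$ independent of $\epsilon$, and set $\mu:=\epsilon^2\lambda$. Let $W_{\rm stat}$ be the unique positive and even solution in $H^\infty(\mathbb{R})$ of the stationary log--KdV equation $$\lambda W(x)=\frac{1}{12}W''(x)+(1+W)\log(1+W),\quad x\in\mathbb{R}.$$ There exist positive constants $\epsilon_0$ and $C_0$ such that for every $\epsilon\in(0,\epsilon_0)$ there exists a unique even solution $w_{{\rm stat},\epsilon}\in L^2(\mathbb{R})\cap L^\infty(\mathbb{R})$ of the differential advance-delay equation $$(1+\mu)\,w''(z)=\Delta \tilde V_\epsilon'(w)(z),\quad z\in\mathbb{R},$$ such that $$\sup_{z\in\mathbb{R}}|w_{{\rm stat},\epsilon}(z)-W_{\rm stat}(\epsilon z)|\leq C_0\,\epsilon^{1/6}.$$ Moreover, $w_{{\rm stat},\epsilon}\in H^\infty(\mathbb{R})$, and for every $k\in\mathbb{N}$ there is a positive $\epsilon$-independent constant $C_k$ such that $$\sup_{z\in\mathbb{R}}|\partial_z^k w_{{\rm stat},\epsilon}(z)-\epsilon^k\partial_x^kW_{\rm stat}(\epsilon z)|\leq C_k\,\epsilon^{k+1/6}.$$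
   Context: For a function $f$ on $\mathbb{R}$, $\Delta f(z):=f(z+1)-2f(z)+f(z-1)$. For $\epsilon>0$ and $w>-1$, $$\tilde V_\epsilon(w):=\frac{1}{2+\epsilon^2}\left[(1+w)^{2+\epsilon^2}-1\right]-w,\qquad \tilde V_\epsilon'(w)=(1+w)^{1+\epsilon^2}-1,$$ and $\tilde V_\epsilon'(w)(z)$ means $\tilde V_\epsilon'(w(z))$. Solutions $w$ of the advance-delay equation are considered with values in an interval $[C_-,C_+]\subset(-1,\infty)$ with $C_\pm$ independent of $\epsilon$. For $w\in L^2(\mathbb{R})\cap L^\infty(\mathbb{R})$ the equation is understood in the sense of distributions, equivalently as $w(z)=\frac{1}{1+\mu}\int_{-1}^{1}(1-|y|)\,\tilde V_\epsilon'(w(z-y))\,dy$. $H^\infty(\mathbb{R})=\bigcap_{k\geq0}H^k(\mathbb{R})$. For $\lambda>1$, the stationary log--KdV equation has a positive solution in $H^1(\mathbb{R})$, unique up to translation, which belongs to $H^\infty(\mathbb{R})$; $W_{\rm stat}$ is the translate that is even. *)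

theory Defs
  imports "HOL-Analysis.Analysis"
begin

section \<open>Function spaces on the real line\<close>

text \<open>Elements of Lebesgue and Sobolev spaces are represented by Borel functions; equality in these
  spaces is equality almost everywhere with respect to \<^const>\<open>lborel\<close>.\<close>

definition L2 :: "(real \<Rightarrow> real) set" where
  "L2 = {f. f \<in> borel_measurable lborel \<and> integrable lborel (\<lambda>x. (f x)\<^sup>2)}"

definition Linf :: "(real \<Rightarrow> real) set" where
  "Linf = {f. f \<in> borel_measurable lborel \<and> (\<exists>B. AE x in lborel. \<bar>f x\<bar> \<le> B)}"

definition locally_integrable :: "(real \<Rightarrow> real) \<Rightarrow> bool" where
  "locally_integrable f \<longleftrightarrow> (\<forall>K. compact K \<longrightarrow> set_integrable lborel K f)"

definition smooth :: "(real \<Rightarrow> real) \<Rightarrow> bool" where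
  "smooth f \<longleftrightarrow> (\<forall>k x. (deriv ^^ k) f differentiable (at x))"

definition test_function :: "(real \<Rightarrow> real) \<Rightarrow> bool" where
  "test_function \<phi> \<longleftrightarrow> smooth \<phi> \<and> compact (closure {x. \<phi> x \<noteq> 0})"

text \<open>\<open>weak_deriv k f g\<close>: the \<open>k\<close>-th derivative of \<open>f\<close> in the sense of distributions is \<open>g\<close>.\<close>

definition weak_deriv :: "nat \<Rightarrow> (real \<Rightarrow> real) \<Rightarrow> (real \<Rightarrow> real) \<Rightarrow> bool" where
  "weak_deriv k f g \<longleftrightarrow> locally_integrable f \<and> locally_integrable g \<and>
     (\<forall>\<phi>. test_function \<phi> \<longrightarrow>
        (LINT x|lborel. f x * (deriv ^^ k) \<phi> x) = (-1) ^ k * (LINT x|lborel. g x * \<phi> x))"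

definition Sobolev_H :: "nat \<Rightarrow> (real \<Rightarrow> real) set" where
  "Sobolev_H k = {f. f \<in> L2 \<and> (\<forall>j\<le>k. \<exists>g\<in>L2. weak_deriv j f g)}"

definition H_infinity :: "(real \<Rightarrow> real) set" where
  "H_infinity = (\<Inter>k. Sobolev_H k)"


section \<open>The differential advance-delay equation\<close>

definition second_diff :: "(real \<Rightarrow> real) \<Rightarrow> real \<Rightarrow> real" where
  "second_diff f z = f (z + 1) - 2 * f z + f (z - 1)"

text \<open>Both functions are meaningful for \<open>w > -1\<close> only.\<close>

definition V :: "real \<Rightarrow> real \<Rightarrow> real" where
  "V \<epsilon> w = 1 / (2 + \<epsilon>\<^sup>2) * ((1 + w) powr (2 + \<epsilon>\<^sup>2) - 1) - w"

definition dV :: "real \<Rightarrow> real \<Rightarrow> real" where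
  "dV \<epsilon> w = (1 + w) powr (1 + \<epsilon>\<^sup>2) - 1"

lemma V_has_derivative_dV:
  assumes "w > -1"
  shows "(V \<epsilon> has_real_derivative dV \<epsilon> w) (at w)"
proof -
  have pos: "2 + \<epsilon>\<^sup>2 > 0"
    by (simp add: add_pos_nonneg)
  have "((\<lambda>w. 1 / (2 + \<epsilon>\<^sup>2) * ((1 + w) powr (2 + \<epsilon>\<^sup>2) - 1) - w) has_real_derivative
          1 / (2 + \<epsilon>\<^sup>2) * ((2 + \<epsilon>\<^sup>2) * (1 + w) powr (2 + \<epsilon>\<^sup>2 - 1)) - 1) (at w)"
    using assms by (auto intro!: derivative_eq_intros)
  moreover have "1 / (2 + \<epsilon>\<^sup>2) * ((2 + \<epsilon>\<^sup>2) * (1 + w) powr (2 + \<epsilon>\<^sup>2 - 1)) - 1 = dV \<epsilon> w"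
    using pos by (simp add: dV_def)
  moreover have "V \<epsilon> = (\<lambda>w. 1 / (2 + \<epsilon>\<^sup>2) * ((1 + w) powr (2 + \<epsilon>\<^sup>2) - 1) - w)"
    by (simp add: V_def fun_eq_iff)
  ultimately show ?thesis
    by simp
qed

text \<open>\<open>(1 + \<mu>) w'' = \<Delta> V'(w)\<close> in the sense of distributions, for \<open>w\<close> in \<open>L\<^sup>2 \<inter> L\<^sup>\<infinity>\<close>.\<close>

definition advance_delay_solution :: "real \<Rightarrow> real \<Rightarrow> (real \<Rightarrow> real) \<Rightarrow> bool" where
  "advance_delay_solution \<epsilon> \<mu> w \<longleftrightarrow>
     w \<in> L2 \<inter> Linf \<and> (AE z in lborel. w z > -1) \<and>
     weak_deriv 2 (\<lambda>z. (1 + \<mu>) * w z) (second_diff (\<lambda>z. dV \<epsilon> (w z)))"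


section \<open>The stationary log-KdV equation\<close>

text \<open>\<open>smooth W\<close> selects the smooth representative of the element of \<^const>\<open>H_infinity\<close>,
  so that positivity, evenness and the equation can be read pointwise.\<close>

definition log_KdV_ground_state :: "real \<Rightarrow> (real \<Rightarrow> real) \<Rightarrow> bool" where
  "log_KdV_ground_state lam W \<longleftrightarrow>
     W \<in> H_infinity \<and> smooth W \<and> (\<forall>x. W x > 0) \<and> (\<forall>x. W (- x) = W x) \<and>
     (\<forall>x. lam * W x = 1 / 12 * (deriv ^^ 2) W x + (1 + W x) * ln (1 + W x))"


section \<open>Even solutions close to the rescaled ground state\<close>

text \<open>As \<open>w\<close> stands for an element of \<open>L\<^sup>2 \<inter> L\<^sup>\<infinity>\<close>, evenness and the supremum bound are
  required almost everywhere.\<close>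

definition even_solution_near :: "real \<Rightarrow> (real \<Rightarrow> real) \<Rightarrow> real \<Rightarrow> real \<Rightarrow> (real \<Rightarrow> real) \<Rightarrow> bool" where
  "even_solution_near lam W C \<epsilon> w \<longleftrightarrow>
     advance_delay_solution \<epsilon> (\<epsilon>\<^sup>2 * lam) w \<and>
     (AE z in lborel. w (- z) = w z) \<and>
     (AE z in lborel. \<bar>w z - W (\<epsilon> * z)\<bar> \<le> C * \<epsilon> powr (1 / 6))"

end

theory Submission
  imports Defs "HOL-Analysis.Radon_Nikodym"
begin

text \<open>The stationary equation is solved in the slow variable \<open>x = e z\<close>. Writing \<open>dV e u = u + e\<^sup>2 F\<^sub>e(u)\<close> and
  \<open>w z = u (e z)\<close>, the equation, integrated twice against the tent kernel, becomes
  \<open>(1 + e\<^sup>2 lam) u = T\<^sub>e (u + e\<^sup>2 F\<^sub>e(u))\<close>, where \<open>T\<^sub>e\<close> averages over a window of width \<open>e\<close> with tent weights.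
  Since \<open>T\<^sub>e - 1\<close> is \<open>(e\<^sup>2/12) d\<^sup>2/dx\<^sup>2\<close> to leading order and \<open>F\<^sub>e(u)\<close> tends to \<open>(1 + u) log (1 + u)\<close>, dividing
  by \<open>e\<^sup>2\<close> and letting \<open>e\<close> tend to zero gives the log-KdV profile equation. The construction takes place in the
  space of bounded continuous even functions with the sup norm, by comparison arguments on the real line.

  Four ingredients carry the argument.

  (1) The linear problem \<open>(1 + e\<^sup>2 lam) u = T\<^sub>e (u + e\<^sup>2 f)\<close> has a unique bounded solution, and \<open>u\<close> is Lipschitz at
  scales above \<open>e\<close> with a constant that does not depend on \<open>e\<close> (resolves_oscillation). The proof compares
  \<open>u (m + x) - u (m - x)\<close>, which is odd in \<open>x\<close>, with an explicit odd barrier. A Taylor expansion of \<open>T\<^sub>e\<close> then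
  shows that \<open>u\<close> lies within \<open>O(e) sup |f|\<close> of a function \<open>k\<close> with \<open>k'' = 12 (lam u - f)\<close>
  (resolves_near_second_order), and that the resolvent gains one derivative uniformly in \<open>e\<close>.

  (2) The linearisation of the profile equation at \<open>W\<close> is invertible on even functions. Its kernel contains the
  odd function \<open>W'\<close>; a second solution, which is even and grows like \<open>1/W\<close>, is given by the Rofe-Beketov formula,
  whose denominator \<open>W'\<^sup>2 + W''\<^sup>2\<close> does not vanish by conservation of energy. Variation of constants
  with these two solutions yields a bounded Green operator (green_exists).

  (3) With the resolvent and the Green operator the rescaled equation becomes a fixed point equation for a map
  that contracts a small sup-norm ball around \<open>W\<close> and moves \<open>W\<close> by \<open>O(e)\<close>
  (Psi_contraction, Psi_W, continuous_solution). This gives existence, uniqueness near \<open>W\<close>, and an error of size \<open>O(e)\<close>.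

  (4) The gain of a derivative bootstraps to bounds on all derivatives of \<open>u\<close> that are uniform in \<open>e\<close>, and
  interpolation between these bounds and the \<open>O(e)\<close> error shows that every derivative of \<open>u - W\<close> is
  \<open>O(e powr (1/6))\<close> (derivative_rates): each derivative costs an arbitrarily small part of the exponent, and the total
  loss is kept below \<open>5/6\<close>.

  It remains to relate the continuous fixed point to the solution classes of the statement. Outside a compact set \<open>u\<close> is
  small, so the mild equation bounds \<open>|w|\<close> by a fixed fraction of its own local average; this forces exponential decay
  of \<open>w\<close> and all its derivatives (solution_decay), hence membership in every Sobolev space. Conversely a distributional
  solution in \<open>L\<^sup>2\<close> and \<open>L\<^sup>\<infinity>\<close> satisfies the mild equation almost everywhere (mild_of_weak), therefore has a continuous
  version, and the uniqueness of the fixed point applies.\<close>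

section \<open>Averaging against the tent kernel\<close>

definition tent :: "real \<Rightarrow> real" where
  "tent y = max 0 (1 - \<bar>y\<bar>)"

definition tent_avg :: "real \<Rightarrow> (real \<Rightarrow> real) \<Rightarrow> real \<Rightarrow> real" where
  "tent_avg e f x = (LINT y|lborel. tent y * f (x + e * y))"

lemma tent_nonneg [simp]: "0 \<le> tent y"
  by (simp add: tent_def)

lemma tent_minus [simp]: "tent (- y) = tent y"
  by (simp add: tent_def)

lemma tent_outside: "1 \<le> \<bar>y\<bar> \<Longrightarrow> tent y = 0"
  by (simp add: tent_def)

lemma continuous_on_tent [continuous_intros]: "continuous_on S tent"
  unfolding tent_def by (intro continuous_intros)

lemma borel_measurable_tent [measurable]: "tent \<in> borel_measurable borel"
  by (intro borel_measurable_continuous_onI continuous_intros)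

text \<open>The second distributional derivative of the tent is the symmetric second difference, so averaging against the
  tent inverts that difference: with \<open>Ph'' = f\<close> the average is a difference quotient of \<open>Ph\<close>. This turns smoothness
  questions about averages into the fundamental theorem of calculus.\<close>
lemma tent_avg_FTC:
  assumes "0 < e" and f: "continuous_on UNIV f"
    and Th: "\<And>x. (Th has_real_derivative f x) (at x)"
    and Ph: "\<And>x. (Ph has_real_derivative Th x) (at x)"
  shows "tent_avg e f x = (Ph (x + e) - 2 * Ph x + Ph (x - e)) / e\<^sup>2"
    and "integrable lborel (\<lambda>y. tent y * f (x + e * y))"
proof -
  have cont: "continuous_on S (\<lambda>y. tent y * f (x + e * y))" for S
    by (intro continuous_intros continuous_on_compose2[OF f]) auto
  have si: "set_integrable lborel {-1..1} (\<lambda>y. tent y * f (x + e * y))"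
    using cont by (intro borel_integrable_atLeastAtMost') 
  have eq: "indicator {-1..1} y *\<^sub>R (tent y * f (x + e * y)) = tent y * f (x + e * y)" for y :: real
    by (auto simp: indicator_def tent_def)
  show "integrable lborel (\<lambda>y. tent y * f (x + e * y))"
    using si unfolding set_integrable_def eq .
  have lin: "((\<lambda>y. x + e * y) has_real_derivative e) (at y)" for y
    by (auto intro!: derivative_eq_intros)
  have dTh: "((\<lambda>y. Th (x + e * y)) has_real_derivative f (x + e * y) * e) (at y)" for y
    by (rule DERIV_chain'[OF lin Th])
  have dPh: "((\<lambda>y. Ph (x + e * y)) has_real_derivative Th (x + e * y) * e) (at y)" for y
    by (rule DERIV_chain'[OF lin Ph])
  have d: "((\<lambda>y. (1 + s * y) * Th (x + e * y) / e - s * Ph (x + e * y) / e\<^sup>2)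
      has_real_derivative (1 + s * y) * f (x + e * y)) (at y)" for s y
  proof -
    have l1: "((\<lambda>y. 1 + s * y) has_real_derivative s) (at y)"
      by (auto intro!: derivative_eq_intros)
    have "((\<lambda>y. (1 + s * y) * Th (x + e * y) / e - s * Ph (x + e * y) / e\<^sup>2)
      has_real_derivative (s * Th (x + e * y) + (f (x + e * y) * e) * (1 + s * y)) / e
         - s * (Th (x + e * y) * e) / e\<^sup>2) (at y)"
      by (intro DERIV_diff DERIV_cdivide DERIV_mult DERIV_cmult dTh dPh l1)
    then show ?thesis using \<open>0 < e\<close>
      by (simp add: add_divide_distrib power2_eq_square mult.commute)
  qed
  have h: "((\<lambda>y. (1 + s * y) * f (x + e * y)) has_integral
      ((1 + s * b) * Th (x + e * b) / e - s * Ph (x + e * b) / e\<^sup>2 - ((1 + s * a) * Th (x + e * a) / e - s * Ph (x + e * a) / e\<^sup>2))) {a..b}"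
    if "a \<le> b" for s a b
    using that has_field_derivative_at_within[OF d]
    by (intro fundamental_theorem_of_calculus) (auto simp flip: has_real_derivative_iff_has_vector_derivative)
  have h1: "((\<lambda>y. tent y * f (x + e * y)) has_integral (Ph (x + e) / e\<^sup>2 - (Th x / e + Ph x / e\<^sup>2))) {0..1}"
    using has_integral_eq[OF _ h[of 0 1 "-1"], of "\<lambda>y. tent y * f (x + e * y)"]
    by (simp add: tent_def)
  have h2: "((\<lambda>y. tent y * f (x + e * y)) has_integral (Th x / e - Ph x / e\<^sup>2 + Ph (x - e) / e\<^sup>2)) {-1..0}"
    using has_integral_eq[OF _ h[of "-1" 0 1], of "\<lambda>y. tent y * f (x + e * y)"]
    by (simp add: tent_def)
  have "((\<lambda>y. tent y * f (x + e * y)) has_integral (Ph (x + e) - 2 * Ph x + Ph (x - e)) / e\<^sup>2) {-1..1}"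
    using has_integral_combine[OF _ _ h2 h1]
    by (simp add: diff_divide_distrib add_divide_distrib algebra_simps)
  then have "integral {-1..1} (\<lambda>y. tent y * f (x + e * y)) = (Ph (x + e) - 2 * Ph x + Ph (x - e)) / e\<^sup>2"
    by (rule integral_unique)
  then have "(LINT y:{-1..1}|lborel. tent y * f (x + e * y)) = (Ph (x + e) - 2 * Ph x + Ph (x - e)) / e\<^sup>2"
    using set_borel_integral_eq_integral(2)[OF si] by simp
  then show "tent_avg e f x = (Ph (x + e) - 2 * Ph x + Ph (x - e)) / e\<^sup>2"
    unfolding set_lebesgue_integral_def eq tent_avg_def .
qed

lemma integrable_tent [simp]: "integrable lborel tent"
  and tent_mass [simp]: "(LINT y|lborel. tent y) = 1"
proof -
  have d: "((\<lambda>x. x\<^sup>2 / 2) has_real_derivative x) (at x)" "((\<lambda>x. x) has_real_derivative 1) (at x)" for x :: real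
    by (auto intro!: derivative_eq_intros)
  show "integrable lborel tent" "(LINT y|lborel. tent y) = 1"
    using tent_avg_FTC(1)[OF zero_less_one _ d(2) d(1), of 0] tent_avg_FTC(2)[OF zero_less_one _ d(2) d(1)]
    by (simp_all add: tent_avg_def)
qed

lemma integrable_tent_square [simp]: "integrable lborel (\<lambda>y. tent y * y\<^sup>2)"
  and tent_second_moment: "(LINT y|lborel. tent y * y\<^sup>2) = 1 / 6"
proof -
  have d3: "((\<lambda>x. x ^ 3 / 3) has_real_derivative x\<^sup>2) (at x)" for x :: real
    by (auto intro!: derivative_eq_intros)
  have d4: "((\<lambda>x. x ^ 4 / 12) has_real_derivative x ^ 3 / 3) (at x)" for x :: real
    by (auto intro!: derivative_eq_intros)
  have c: "continuous_on UNIV (\<lambda>x::real. x\<^sup>2)"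
    by (intro continuous_intros)
  show "integrable lborel (\<lambda>y. tent y * y\<^sup>2)"
    using tent_avg_FTC(2)[OF zero_less_one c d3 d4, of 0] by simp
  show "(LINT y|lborel. tent y * y\<^sup>2) = 1 / 6"
    using tent_avg_FTC(1)[OF zero_less_one c d3 d4, of 0] by (simp add: tent_avg_def)
qed

lemma exists_antiderivative:
  fixes f :: "real \<Rightarrow> real"
  assumes "continuous_on UNIV f"
  obtains F where "\<And>x. (F has_real_derivative f x) (at x)" "F 0 = 0"
proof -
  define F where "F x = (LBINT y=0..x. f y)" for x :: real
  have "(F has_real_derivative f x) (at x)" for x
  proof -
    define a b where "a = min 0 x - 1" and "b = max 0 x + 1"
    have ab: "a < x" "x < b" "a < 0" "0 < b" "a \<le> b" by (auto simp: a_def b_def)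
    have "((\<lambda>u. LBINT y=0..u. f y) has_vector_derivative (f x)) (at x within {a..b})"
      using interval_integral_FTC2[of a 0 b f x] ab continuous_on_subset[OF assms]
      by (simp add: zero_ereal_def)
    then have "(F has_vector_derivative f x) (at x)"
      unfolding F_def using ab
      by (simp add: at_within_Icc_at)
    then show ?thesis by (simp add: has_real_derivative_iff_has_vector_derivative)
  qed
  moreover have "F 0 = 0" by (simp add: F_def zero_ereal_def)
  ultimately show ?thesis using that by blast
qed

lemma integrable_tent_mult:
  assumes "f \<in> borel_measurable borel" "\<And>y. \<bar>f y\<bar> \<le> B"
  shows "integrable lborel (\<lambda>y. tent y * f (x + e * y))"
proof (rule Bochner_Integration.integrable_bound[where f="\<lambda>y. B * tent y"])
  show "(\<lambda>y. tent y * f (x + e * y)) \<in> borel_measurable lborel"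
    using assms(1) by measurable
  show "AE y in lborel. norm (tent y * f (x + e * y)) \<le> norm (B * tent y)"
  proof (rule AE_I2)
    fix y
    have "tent y * \<bar>f (x + e * y)\<bar> \<le> tent y * B" by (intro mult_left_mono assms(2)) simp
    moreover have "0 \<le> B" using assms(2)[of 0] by linarith
    ultimately show "norm (tent y * f (x + e * y)) \<le> norm (B * tent y)"
      by (simp add: abs_mult mult.commute)
  qed
qed simp

lemma integrable_tent_continuous:
  assumes f: "continuous_on UNIV f"
  shows "integrable lborel (\<lambda>y. tent y * f (x + e * y))"
proof -
  have "set_integrable lborel {-1..1} (\<lambda>y. tent y * f (x + e * y))"
    by (intro borel_integrable_atLeastAtMost' continuous_intros continuous_on_compose2[OF f]) auto
  moreover have "indicator {-1..1} y *\<^sub>R (tent y * f (x + e * y)) = tent y * f (x + e * y)" for y :: real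
    by (auto simp: indicator_def tent_def)
  ultimately show ?thesis by (simp only: set_integrable_def)
qed

lemma tent_avg_linear:
  assumes "integrable lborel (\<lambda>y. tent y * f (x + e * y))" "integrable lborel (\<lambda>y. tent y * g (x + e * y))"
  shows "tent_avg e (\<lambda>y. a * f y + b * g y) x = a * tent_avg e f x + b * tent_avg e g x"
proof -
  have "(\<lambda>y. tent y * (a * f (x + e * y) + b * g (x + e * y)))
      = (\<lambda>y. a * (tent y * f (x + e * y)) + b * (tent y * g (x + e * y)))"
    by (simp add: algebra_simps)
  then show ?thesis using assms by (simp add: tent_avg_def)
qed

lemma tent_avg_const [simp]: "tent_avg e (\<lambda>_. c) x = c"
  by (simp add: tent_avg_def)

lemma tent_avg_mono:
  assumes "integrable lborel (\<lambda>y. tent y * f (x + e * y))" "integrable lborel (\<lambda>y. tent y * g (x + e * y))"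
    and "\<And>y. \<bar>y\<bar> \<le> 1 \<Longrightarrow> f (x + e * y) \<le> g (x + e * y)"
  shows "tent_avg e f x \<le> tent_avg e g x"
  unfolding tent_avg_def
proof (rule integral_mono[OF assms(1,2)])
  fix y
  show "tent y * f (x + e * y) \<le> tent y * g (x + e * y)"
  proof (cases "\<bar>y\<bar> \<le> 1")
    case True
    then show ?thesis using assms(3) by (intro mult_left_mono) auto
  next
    case False
    then show ?thesis using tent_outside[of y] by simp
  qed
qed

lemma tent_avg_abs_le:
  assumes f: "f \<in> borel_measurable borel" "\<And>y. \<bar>f y\<bar> \<le> B"
  shows "\<bar>tent_avg e f x\<bar> \<le> B"
proof -
  have i: "integrable lborel (\<lambda>y. tent y * f (x + e * y))"
    by (rule integrable_tent_mult[OF f])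
  have ic: "integrable lborel (\<lambda>y. tent y * c)" for c
    by simp
  have le: "f y \<le> B" "- B \<le> f y" for y using f(2)[of y] by linarith+
  have "tent_avg e f x \<le> tent_avg e (\<lambda>_. B) x" "tent_avg e (\<lambda>_. - B) x \<le> tent_avg e f x"
    by (rule tent_avg_mono[OF i ic] tent_avg_mono[OF ic i], rule le)+
  then show ?thesis by simp
qed

lemma tent_avg_shift: "tent_avg e (\<lambda>y. f (m + y)) x = tent_avg e f (m + x)"
  by (simp add: tent_avg_def add.assoc)

lemma tent_avg_reflect: "tent_avg e (\<lambda>y. f (m - y)) x = tent_avg e f (m - x)"
proof -
  have "tent_avg e f (m - x) = (LINT y|lborel. tent (0 + (-1) * y) * f (m - x + e * (0 + (-1) * y)))"
    unfolding tent_avg_def by (subst lborel_integral_real_affine[where c="-1" and t=0]) auto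
  also have "\<dots> = tent_avg e (\<lambda>y. f (m - y)) x"
    by (simp add: tent_avg_def algebra_simps)
  finally show ?thesis ..
qed

lemma integrable_tent_reflect:
  assumes "integrable lborel (\<lambda>y. tent y * f (x + e * y))"
  shows "integrable lborel (\<lambda>y. tent y * f (x - e * y))"
  using lborel_integrable_real_affine[OF assms, of "-1" 0] by simp

text \<open>Averaging sees only the even part of \<open>f\<close> around \<open>x\<close>, so midpoint concavity alone bounds an average from above.\<close>
lemma tent_avg_sym:
  assumes "integrable lborel (\<lambda>y. tent y * f (x + e * y))"
  shows "tent_avg e f x = (LINT y|lborel. tent y * ((f (x + e * y) + f (x - e * y)) / 2))"
    and "integrable lborel (\<lambda>y. tent y * ((f (x + e * y) + f (x - e * y)) / 2))"
proof -
  have eq: "tent y * ((f (x + e * y) + f (x - e * y)) / 2)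
     = (tent y * f (x + e * y) + tent y * f (x - e * y)) / 2" for y
    by (simp add: algebra_simps)
  note i = assms integrable_tent_reflect[OF assms]
  have "tent_avg e f x = (LINT y|lborel. tent y * f (x - e * y))"
    unfolding tent_avg_def by (subst lborel_integral_real_affine[where c="-1" and t=0]) auto
  then show "tent_avg e f x = (LINT y|lborel. tent y * ((f (x + e * y) + f (x - e * y)) / 2))"
    unfolding eq using i by (simp add: tent_avg_def)
  show "integrable lborel (\<lambda>y. tent y * ((f (x + e * y) + f (x - e * y)) / 2))"
    unfolding eq using i by simp
qed

lemma tent_avg_has_derivative:
  assumes "0 < e" and f: "continuous_on UNIV f"
    and Th: "\<And>x. (Th has_real_derivative f x) (at x)"
  shows "(tent_avg e f has_real_derivative (Th (x + e) - 2 * Th x + Th (x - e)) / e\<^sup>2) (at x)"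
proof -
  have "continuous_on UNIV Th"
    using Th by (meson DERIV_isCont continuous_at_imp_continuous_on)
  then obtain Ph where Ph: "\<And>x. (Ph has_real_derivative Th x) (at x)"
    using exists_antiderivative by blast
  have eq: "tent_avg e f = (\<lambda>x. (Ph (x + e) - 2 * Ph x + Ph (x - e)) / e\<^sup>2)"
    using tent_avg_FTC(1)[OF \<open>0 < e\<close> f Th Ph] by (rule ext)
  have "((\<lambda>x. Ph (x + c)) has_real_derivative Th (x + c)) (at x)" for c
    using Ph[of "x + c"] by (simp add: DERIV_shift)
  from DERIV_cdivide[OF DERIV_add[OF DERIV_diff[OF this[of e] DERIV_cmult[OF Ph[of x], of 2]] this[of "- e"]], of "e\<^sup>2"]
  show ?thesis unfolding eq by simp
qed

lemma tent_avg_second_derivative: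
  assumes "0 < e" and f: "continuous_on UNIV f"
    and Th: "\<And>x. (Th has_real_derivative f x) (at x)"
  shows "((\<lambda>x. (Th (x + e) - 2 * Th x + Th (x - e)) / e\<^sup>2) has_real_derivative
     (f (x + e) - 2 * f x + f (x - e)) / e\<^sup>2) (at x)"
proof -
  have "((\<lambda>x. Th (x + c)) has_real_derivative f (x + c)) (at x)" for c
    using Th[of "x + c"] by (simp add: DERIV_shift)
  from DERIV_cdivide[OF DERIV_add[OF DERIV_diff[OF this[of e] DERIV_cmult[OF Th[of x], of 2]] this[of "- e"]], of "e\<^sup>2"]
  show ?thesis by simp
qed

lemma tent_avg_deriv:
  assumes "0 < e" and f': "continuous_on UNIV f'"
    and f: "\<And>x. (f has_real_derivative f' x) (at x)"
  shows "(tent_avg e f has_real_derivative tent_avg e f' x) (at x)"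
proof -
  have c: "continuous_on UNIV f"
    using f by (meson DERIV_isCont continuous_at_imp_continuous_on)
  then obtain F where F: "\<And>x. (F has_real_derivative f x) (at x)"
    using exists_antiderivative by blast
  show ?thesis
    using tent_avg_has_derivative[OF \<open>0 < e\<close> c F, of x] tent_avg_FTC(1)[OF \<open>0 < e\<close> f' f F, of x]
    by simp
qed

lemma continuous_on_tent_avg:
  assumes "0 < e" "continuous_on UNIV f"
  shows "continuous_on UNIV (tent_avg e f)"
  using exists_antiderivative[OF assms(2)] tent_avg_has_derivative[OF assms]
  by (metis DERIV_isCont continuous_at_imp_continuous_on)

text \<open>A mean value inequality with a variable bound: the primitive of the bound controls the increment. Later proofs
  use it in place of integrals of derivatives.\<close>
lemma abs_diff_le_of_deriv:
  fixes f g :: "real \<Rightarrow> real"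
  assumes "a \<le> b"
    and f: "\<And>s. a \<le> s \<Longrightarrow> s \<le> b \<Longrightarrow> (f has_real_derivative f' s) (at s)"
    and g: "\<And>s. a \<le> s \<Longrightarrow> s \<le> b \<Longrightarrow> (g has_real_derivative g' s) (at s)"
    and le: "\<And>s. a \<le> s \<Longrightarrow> s \<le> b \<Longrightarrow> \<bar>f' s\<bar> \<le> g' s"
  shows "\<bar>f b - f a\<bar> \<le> g b - g a"
proof -
  have "(\<lambda>s. g s - f s) a \<le> (\<lambda>s. g s - f s) b"
    using \<open>a \<le> b\<close>
  proof (rule DERIV_nonneg_imp_nondecreasing)
    fix s assume s: "a \<le> s" "s \<le> b"
    show "\<exists>y. ((\<lambda>s. g s - f s) has_real_derivative y) (at s) \<and> 0 \<le> y"
      using DERIV_diff[OF g[OF s] f[OF s]] le[OF s] by force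
  qed
  moreover have "(\<lambda>s. g s + f s) a \<le> (\<lambda>s. g s + f s) b"
    using \<open>a \<le> b\<close>
  proof (rule DERIV_nonneg_imp_nondecreasing)
    fix s assume s: "a \<le> s" "s \<le> b"
    show "\<exists>y. ((\<lambda>s. g s + f s) has_real_derivative y) (at s) \<and> 0 \<le> y"
      using DERIV_add[OF g[OF s] f[OF s]] le[OF s] by force
  qed
  ultimately show ?thesis by simp
qed

lemma second_difference_near:
  fixes Ph Th h :: "real \<Rightarrow> real"
  assumes Th: "\<And>x. (Th has_real_derivative h x) (at x)"
    and Ph: "\<And>x. (Ph has_real_derivative Th x) (at x)"
    and om: "\<And>s. \<bar>s\<bar> \<le> t \<Longrightarrow> \<bar>h (x + s) - h x\<bar> \<le> om"
    and "0 \<le> t"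
  shows "\<bar>Ph (x + t) - 2 * Ph x + Ph (x - t) - t\<^sup>2 * h x\<bar> \<le> t\<^sup>2 * om"
proof -
  have sh: "((\<lambda>s. F (x + s)) has_real_derivative F' (x + s)) (at s)"
           "((\<lambda>s. F (x - s)) has_real_derivative - F' (x - s)) (at s)"
    if "\<And>x. (F has_real_derivative F' x) (at x)" for F F' :: "real \<Rightarrow> real" and s
  proof -
    have l: "((\<lambda>s. x + s) has_real_derivative 1) (at s)" "((\<lambda>s. x - s) has_real_derivative -1) (at s)"
      by (auto intro!: derivative_eq_intros)
    show "((\<lambda>s. F (x + s)) has_real_derivative F' (x + s)) (at s)"
      using DERIV_chain'[OF l(1) that] by simp
    show "((\<lambda>s. F (x - s)) has_real_derivative - F' (x - s)) (at s)"
      using DERIV_chain'[OF l(2) that] by simp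
  qed
  have 1: "\<bar>Th (x + s) - Th (x - s) - 2 * s * h x\<bar> \<le> 2 * om * s" if "0 \<le> s" "s \<le> t" for s
  proof -
    have "\<bar>(Th (x + s) - Th (x - s) - 2 * s * h x) - (Th (x + 0) - Th (x - 0) - 2 * 0 * h x)\<bar>
       \<le> 2 * om * s - 2 * om * 0"
    proof (rule abs_diff_le_of_deriv[OF \<open>0 \<le> s\<close>,
          where f'="\<lambda>r. h (x + r) - (- h (x - r)) - 2 * h x" and g'="\<lambda>_. 2 * om"])
      fix r assume r: "0 \<le> r" "r \<le> s"
      show "((\<lambda>r. Th (x + r) - Th (x - r) - 2 * r * h x) has_real_derivative
             h (x + r) - (- h (x - r)) - 2 * h x) (at r)"
        by (rule derivative_eq_intros sh[OF Th] refl)+ simp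
      show "((\<lambda>r. 2 * om * r) has_real_derivative 2 * om) (at r)"
        by (auto intro!: derivative_eq_intros)
      show "\<bar>h (x + r) - (- h (x - r)) - 2 * h x\<bar> \<le> 2 * om"
        using om[of r] om[of "- r"] r \<open>s \<le> t\<close> by simp
    qed
    then show ?thesis by simp
  qed
  have "\<bar>(Ph (x + t) - 2 * Ph x + Ph (x - t) - t\<^sup>2 * h x) - (Ph (x + 0) - 2 * Ph x + Ph (x - 0) - 0\<^sup>2 * h x)\<bar>
       \<le> om * t\<^sup>2 - om * 0\<^sup>2"
  proof (rule abs_diff_le_of_deriv[OF \<open>0 \<le> t\<close>,
        where f'="\<lambda>r. Th (x + r) - 0 + (- Th (x - r)) - 2 * r * h x" and g'="\<lambda>r. om * (2 * r)"])
    fix r assume r: "0 \<le> r" "r \<le> t"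
    show "((\<lambda>t. Ph (x + t) - 2 * Ph x + Ph (x - t) - t\<^sup>2 * h x) has_real_derivative
        Th (x + r) - 0 + (- Th (x - r)) - 2 * r * h x) (at r)"
      by (rule derivative_eq_intros sh[OF Ph] refl)+ simp
    show "((\<lambda>t. om * t\<^sup>2) has_real_derivative om * (2 * r)) (at r)"
      by (auto intro!: derivative_eq_intros)
    show "\<bar>Th (x + r) - 0 + - Th (x - r) - 2 * r * h x\<bar> \<le> om * (2 * r)"
      using 1[OF r] by simp
  qed
  then show ?thesis by (simp add: mult.commute)
qed

text \<open>The constant 12 is twice the reciprocal of the second moment 1/6 of the tent. Only the modulus of continuity
  of the second derivative enters, so the error does not require a third derivative.\<close>
lemma tent_avg_taylor:
  fixes Ph Th h :: "real \<Rightarrow> real"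
  assumes "0 < e"
    and Th: "\<And>x. (Th has_real_derivative h x) (at x)"
    and Ph: "\<And>x. (Ph has_real_derivative Th x) (at x)"
    and om: "\<And>s. \<bar>s\<bar> \<le> e \<Longrightarrow> \<bar>h (x + s) - h x\<bar> \<le> om"
  shows "\<bar>12 * (tent_avg e Ph x - Ph x) / e\<^sup>2 - h x\<bar> \<le> om"
proof -
  have "continuous_on UNIV Ph"
    using Ph by (meson DERIV_isCont continuous_at_imp_continuous_on)
  note i = integrable_tent_continuous[OF this, of x e]
  note s = tent_avg_sym[OF i]
  define G where "G y = tent y * ((Ph (x + e * y) + Ph (x - e * y)) / 2) - Ph x * tent y - (e\<^sup>2 * h x / 2) * (tent y * y\<^sup>2)" for y
  have iG: "integrable lborel G"
    unfolding G_def using s(2) by (intro Bochner_Integration.integrable_diff) auto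
  have LG: "(LINT y|lborel. G y) = tent_avg e Ph x - Ph x - e\<^sup>2 * h x / 12"
    unfolding G_def s(1) using s(2) tent_second_moment by simp
  have le: "\<bar>G y\<bar> \<le> (e\<^sup>2 * om / 2) * (tent y * y\<^sup>2)" for y
  proof (cases "\<bar>y\<bar> \<le> 1")
    case True
    have t: "\<bar>Ph (x + e * \<bar>y\<bar>) - 2 * Ph x + Ph (x - e * \<bar>y\<bar>) - (e * \<bar>y\<bar>)\<^sup>2 * h x\<bar> \<le> (e * \<bar>y\<bar>)\<^sup>2 * om"
    proof (rule second_difference_near[OF Th Ph])
      have "e * \<bar>y\<bar> \<le> e" using True \<open>0 < e\<close> by (simp add: mult_left_le)
      then show "\<bar>h (x + s) - h x\<bar> \<le> om" if "\<bar>s\<bar> \<le> e * \<bar>y\<bar>" for s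
        using om[of s] that by linarith
    qed (use \<open>0 < e\<close> in simp)
    have "Ph (x + e * \<bar>y\<bar>) + Ph (x - e * \<bar>y\<bar>) = Ph (x + e * y) + Ph (x - e * y)"
      by (cases "0 \<le> y") auto
    with t have t': "\<bar>Ph (x + e * y) + Ph (x - e * y) - 2 * Ph x - e\<^sup>2 * y\<^sup>2 * h x\<bar> \<le> e\<^sup>2 * y\<^sup>2 * om"
      by (simp add: power_mult_distrib algebra_simps)
    have "G y = tent y / 2 * (Ph (x + e * y) + Ph (x - e * y) - 2 * Ph x - e\<^sup>2 * y\<^sup>2 * h x)"
      by (simp add: G_def field_simps)
    then have "\<bar>G y\<bar> = tent y / 2 * \<bar>Ph (x + e * y) + Ph (x - e * y) - 2 * Ph x - e\<^sup>2 * y\<^sup>2 * h x\<bar>"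
      by (simp only: abs_mult) simp
    also have "\<dots> \<le> tent y / 2 * (e\<^sup>2 * y\<^sup>2 * om)"
      by (intro mult_left_mono t') simp
    finally show ?thesis by (simp add: algebra_simps)
  next
    case False
    then show ?thesis using tent_outside[of y] by (simp add: G_def)
  qed
  have "\<bar>LINT y|lborel. G y\<bar> \<le> (LINT y|lborel. \<bar>G y\<bar>)"
    by (rule integral_abs_bound)
  also have "\<dots> \<le> (LINT y|lborel. (e\<^sup>2 * om / 2) * (tent y * y\<^sup>2))"
    by (rule integral_mono[OF integrable_abs[OF iG] integrable_mult_right[OF integrable_tent_square] le])
  finally have "\<bar>tent_avg e Ph x - Ph x - e\<^sup>2 * h x / 12\<bar> \<le> e\<^sup>2 * om / 12"
    using LG tent_second_moment by simp
  moreover have "12 * (tent_avg e Ph x - Ph x) / e\<^sup>2 - h x = (tent_avg e Ph x - Ph x - e\<^sup>2 * h x / 12) * (12 / e\<^sup>2)"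
    using \<open>0 < e\<close> by (simp add: field_simps)
  ultimately have "\<bar>12 * (tent_avg e Ph x - Ph x) / e\<^sup>2 - h x\<bar> \<le> e\<^sup>2 * om / 12 * (12 / e\<^sup>2)"
    using om[of 0] \<open>0 < e\<close> by (simp only: abs_mult) (intro mult_mono, auto)
  then show ?thesis using \<open>0 < e\<close> by simp
qed

text \<open>A maximum principle without attained maxima: if every nonnegative upper bound can be improved by a factor
  \<open>c < 1\<close>, then the a priori bound shrinks to zero. It replaces the maximum principle for nonlocal averages on the
  non-compact line.\<close>
lemma nonpos_of_contraction:
  fixes E :: "'a \<Rightarrow> real"
  assumes step: "\<And>s x. 0 \<le> s \<Longrightarrow> (\<And>x. x \<in> S \<Longrightarrow> E x \<le> s) \<Longrightarrow> x \<in> S \<Longrightarrow> E x \<le> c * s"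
    and "0 \<le> c" "c < 1" and K: "\<And>x. x \<in> S \<Longrightarrow> E x \<le> K" and "x \<in> S"
  shows "E x \<le> 0"
proof -
  have b: "x \<in> S \<Longrightarrow> E x \<le> c ^ n * \<bar>K\<bar>" for n x
  proof (induction n arbitrary: x)
    case 0
    then show ?case using K[of x] by simp
  next
    case (Suc n)
    then show ?case using step[of "c ^ n * \<bar>K\<bar>" x] \<open>0 \<le> c\<close> by simp
  qed
  have "(\<lambda>n. c ^ n * \<bar>K\<bar>) \<longlonglongrightarrow> 0 * \<bar>K\<bar>"
    using assms by (intro tendsto_intros LIMSEQ_power_zero) auto
  then show ?thesis
    using b[OF \<open>x \<in> S\<close>] by (intro LIMSEQ_le_const[of _ _ "E x"]) auto
qed

text \<open>By oddness the part of the average taken over the negative half line can be folded onto the positive one, where it enters with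
  the weight of the reflected tent. Folded weights are nonnegative on the positive half line with mass at most one, so
  only the bound \<open>s\<close> on positive arguments is felt.\<close>
lemma tent_avg_odd_le:
  assumes E: "E \<in> borel_measurable borel" "\<And>y. \<bar>E y\<bar> \<le> B" "\<And>y. E (- y) = - E y"
    and s: "0 \<le> s" "\<And>y. 0 < y \<Longrightarrow> E y \<le> s"
    and "0 < x" "0 < e"
  shows "tent_avg e E x \<le> s"
proof -
  define a where "a = x / e"
  have "0 < a" using assms by (simp add: a_def)
  have ea: "x = e * a" using \<open>0 < e\<close> by (simp add: a_def)
  have i0: "integrable lborel (\<lambda>y. tent y * E (x + e * y))"
    by (rule integrable_tent_mult[OF E(1,2)])
  have t1: "tent_avg e E x = (LINT t|lborel. tent (t - a) * E (e * t))"
    and i1: "integrable lborel (\<lambda>t. tent (t - a) * E (e * t))"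
    using lborel_integral_real_affine[of 1 "\<lambda>y. tent y * E (x + e * y)" "- a"]
      lborel_integrable_real_affine[OF i0, of 1 "-a"]
    by (simp_all add: tent_avg_def ea algebra_simps)
  have tr: "tent (- a - t) = tent (t + a)" for t
  proof -
    have "- a - t = - (t + a)" by simp
    then show ?thesis by (simp only: tent_minus)
  qed
  have eq: "tent (- a - t) * E (x + e * (- a - t)) = - (tent (t + a) * E (e * t))" for t
    using E(3)[of "e * t"] by (simp add: ea algebra_simps tr)
  have t2: "tent_avg e E x = - (LINT t|lborel. tent (t + a) * E (e * t))"
    and i2: "integrable lborel (\<lambda>t. tent (t + a) * E (e * t))"
    using lborel_integral_real_affine[of "-1" "\<lambda>y. tent y * E (x + e * y)" "- a"]
      lborel_integrable_real_affine[OF i0, of "-1" "-a"]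
    by (simp_all add: tent_avg_def eq)
  have i3: "integrable lborel (\<lambda>t. tent (t - a))" "integrable lborel (\<lambda>t. tent (t + a))"
    and m3: "(LINT t|lborel. tent (t - a)) = 1" "(LINT t|lborel. tent (t + a)) = 1"
    using lborel_integral_real_affine[of 1 tent "- a"] lborel_integral_real_affine[of 1 tent a]
      lborel_integrable_real_affine[OF integrable_tent, of 1 "-a"] lborel_integrable_real_affine[OF integrable_tent, of 1 a]
    by (simp_all add: add.commute)
  have pt: "tent (t - a) * E (e * t) - tent (t + a) * E (e * t) \<le> s * tent (t - a) + s * tent (t + a)" for t
  proof (cases "0 < t")
    case True
    then have ge: "tent (t + a) \<le> tent (t - a)" using \<open>0 < a\<close> by (auto simp: tent_def)
    have "(tent (t - a) - tent (t + a)) * E (e * t) \<le> (tent (t - a) - tent (t + a)) * s"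
      using s(2)[of "e * t"] True \<open>0 < e\<close> ge by (intro mult_left_mono) auto
    also have "\<dots> \<le> (tent (t - a) + tent (t + a)) * s" using s by (intro mult_right_mono) auto
    finally show ?thesis by (simp add: algebra_simps)
  next
    case False
    show ?thesis
    proof (cases "t = 0")
      case True
      then show ?thesis using E(3)[of 0] s by simp
    next
      case False
      with \<open>\<not> 0 < t\<close> have "t < 0" by simp
      then have ge: "tent (t - a) \<le> tent (t + a)" using \<open>0 < a\<close> by (auto simp: tent_def)
      have "0 < e * (- t)" using \<open>t < 0\<close> \<open>0 < e\<close> by (intro mult_pos_pos) auto
      then have "- E (e * t) \<le> s" using s(2)[of "e * (- t)"] E(3)[of "e * t"] by simp
      then have "(tent (t + a) - tent (t - a)) * (- E (e * t)) \<le> (tent (t + a) - tent (t - a)) * s"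
        using ge by (intro mult_left_mono) auto
      also have "\<dots> \<le> (tent (t - a) + tent (t + a)) * s" using s by (intro mult_right_mono) auto
      finally show ?thesis by (simp add: algebra_simps)
    qed
  qed
  have "2 * tent_avg e E x = (LINT t|lborel. tent (t - a) * E (e * t) - tent (t + a) * E (e * t))"
    using t1 t2 i1 i2 by simp
  also have "\<dots> \<le> (LINT t|lborel. s * tent (t - a) + s * tent (t + a))"
    using i1 i2 i3 pt by (intro integral_mono) auto
  also have "\<dots> = 2 * s" using i3 m3 by simp
  finally show ?thesis by simp
qed

section \<open>The rescaled resolvent\<close>

lemma bcontfunD:
  fixes f :: "real \<Rightarrow> real"
  assumes "f \<in> bcontfun"
  shows "continuous_on UNIV f" "f \<in> borel_measurable borel" "\<exists>B\<ge>0. \<forall>x. \<bar>f x\<bar> \<le> B"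
proof -
  show c: "continuous_on UNIV f" using assms by (simp add: bcontfun_def)
  show "f \<in> borel_measurable borel" by (rule borel_measurable_continuous_onI[OF c])
  obtain B where "\<forall>x. \<bar>f x\<bar> \<le> B" using assms by (auto simp: bcontfun_def bounded_iff)
  then show "\<exists>B\<ge>0. \<forall>x. \<bar>f x\<bar> \<le> B" by (metis abs_ge_zero order_trans)
qed

lemma bcontfunI':
  fixes f :: "real \<Rightarrow> real"
  assumes "continuous_on UNIV f" "\<And>x. \<bar>f x\<bar> \<le> B"
  shows "f \<in> bcontfun"
  using assms by (auto simp: bcontfun_def bounded_iff)

lemma bcontfun_lincomb:
  fixes f g :: "real \<Rightarrow> real"
  assumes "f \<in> bcontfun" "g \<in> bcontfun"
  shows "(\<lambda>x. a * f x + b * g x) \<in> bcontfun"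
proof -
  obtain A B where AB: "\<And>x. \<bar>f x\<bar> \<le> A" "\<And>x. \<bar>g x\<bar> \<le> B"
    using bcontfunD(3)[OF assms(1)] bcontfunD(3)[OF assms(2)] by metis
  show ?thesis
  proof (rule bcontfunI')
    show "continuous_on UNIV (\<lambda>x. a * f x + b * g x)"
      using bcontfunD(1)[OF assms(1)] bcontfunD(1)[OF assms(2)] by (intro continuous_intros)
    fix x
    have "\<bar>a * f x + b * g x\<bar> \<le> \<bar>a\<bar> * \<bar>f x\<bar> + \<bar>b\<bar> * \<bar>g x\<bar>"
      by (metis abs_mult abs_triangle_ineq)
    also have "\<dots> \<le> \<bar>a\<bar> * A + \<bar>b\<bar> * B"
      by (intro add_mono mult_left_mono AB) auto
    finally show "\<bar>a * f x + b * g x\<bar> \<le> \<bar>a\<bar> * A + \<bar>b\<bar> * B" .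
  qed
qed

lemma bcontfun_mult:
  fixes f g :: "real \<Rightarrow> real"
  assumes "f \<in> bcontfun" "g \<in> bcontfun"
  shows "(\<lambda>x. f x * g x) \<in> bcontfun"
proof -
  obtain A B where AB: "\<And>x. \<bar>f x\<bar> \<le> A" "\<And>x. \<bar>g x\<bar> \<le> B"
    using bcontfunD(3)[OF assms(1)] bcontfunD(3)[OF assms(2)] by metis
  show ?thesis
  proof (rule bcontfunI')
    show "continuous_on UNIV (\<lambda>x. f x * g x)"
      using bcontfunD(1)[OF assms(1)] bcontfunD(1)[OF assms(2)] by (intro continuous_intros)
    fix x
    have "\<bar>f x * g x\<bar> \<le> \<bar>A\<bar> * \<bar>B\<bar>"
      unfolding abs_mult using AB[of x] by (intro mult_mono) auto
    then show "\<bar>f x * g x\<bar> \<le> \<bar>A\<bar> * \<bar>B\<bar>" .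
  qed
qed

lemma le_inverse_mult:
  fixes c x s :: real
  assumes "c * x \<le> s" "0 < c"
  shows "x \<le> 1 / c * s"
  using assms by (simp add: field_simps)

text \<open>Here \<open>u\<close> is the image of the source \<open>f\<close> under \<open>e\<^sup>2 (1 + e\<^sup>2 lam - T\<^sub>e)\<^sup>-\<^sup>1 T\<^sub>e\<close>, which approximates the resolvent
  \<open>(lam - (1/12) d\<^sup>2/dx\<^sup>2)\<^sup>-\<^sup>1\<close>. A relation rather than a function, because uniqueness holds only among bounded functions.\<close>
definition resolves :: "real \<Rightarrow> real \<Rightarrow> (real \<Rightarrow> real) \<Rightarrow> (real \<Rightarrow> real) \<Rightarrow> bool" where
  "resolves lam e f u \<longleftrightarrow> u \<in> bcontfun \<and>
     (\<forall>x. (1 + e\<^sup>2 * lam) * u x = tent_avg e (\<lambda>y. u y + e\<^sup>2 * f y) x)"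

lemma tent_avg_lincomb:
  assumes "f \<in> bcontfun" "g \<in> bcontfun"
  shows "tent_avg e (\<lambda>y. a * f y + b * g y) x = a * tent_avg e f x + b * tent_avg e g x"
  using assms by (intro tent_avg_linear integrable_tent_continuous bcontfunD)

lemma tent_avg_abs_le_bcontfun:
  assumes "f \<in> bcontfun" "\<And>y. \<bar>f y\<bar> \<le> B"
  shows "\<bar>tent_avg e f x\<bar> \<le> B"
  using assms by (intro tent_avg_abs_le bcontfunD)

text \<open>The averaging operator has norm one, so \<open>u \<mapsto> T\<^sub>e (u + e\<^sup>2 f) / (1 + e\<^sup>2 lam)\<close> contracts the bounded continuous functions.\<close>
lemma resolves_exists:
  assumes "0 < e" "0 < lam" and f: "f \<in> bcontfun"
  shows "\<exists>u. resolves lam e f u"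
proof -
  define c where "c = 1 / (1 + e\<^sup>2 * lam)"
  have el: "0 < e\<^sup>2 * lam" using assms by simp
  then have c: "0 < c" "c < 1" by (auto simp: c_def)
  define T where "T u = (\<lambda>x. c * tent_avg e (\<lambda>y. 1 * apply_bcontfun u y + e\<^sup>2 * f y) x)" for u
  have b: "(\<lambda>y. 1 * apply_bcontfun u y + e\<^sup>2 * f y) \<in> bcontfun" for u
    by (intro bcontfun_lincomb f) (simp add: apply_bcontfun)
  have T: "T u \<in> bcontfun" for u
  proof -
    obtain B where B: "\<And>x. \<bar>1 * apply_bcontfun u x + e\<^sup>2 * f x\<bar> \<le> B"
      using bcontfunD(3)[OF b] by metis
    show ?thesis unfolding T_def
    proof (rule bcontfunI')
      show "continuous_on UNIV (\<lambda>x. c * tent_avg e (\<lambda>y. 1 * apply_bcontfun u y + e\<^sup>2 * f y) x)"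
        by (intro continuous_intros continuous_on_tent_avg \<open>0 < e\<close> bcontfunD(1) b)
      show "\<bar>c * tent_avg e (\<lambda>y. 1 * apply_bcontfun u y + e\<^sup>2 * f y) x\<bar> \<le> c * B" for x
        using tent_avg_abs_le_bcontfun[OF b B] c by (simp add: abs_mult)
    qed
  qed
  have "\<exists>!u. Bcontfun (T u) = u"
  proof (rule banach_fix_type)
    show "0 \<le> c" "c < 1" using c by auto
    show "\<forall>u v. dist (Bcontfun (T u)) (Bcontfun (T v)) \<le> c * dist u v"
    proof (intro allI dist_bound)
      fix u v x
      have "T u x - T v x = c * tent_avg e (\<lambda>y. 1 * (1 * apply_bcontfun u y + e\<^sup>2 * f y) + (-1) * (1 * apply_bcontfun v y + e\<^sup>2 * f y)) x"
        unfolding tent_avg_lincomb[OF b b] by (simp add: T_def algebra_simps)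
      also have "\<bar>\<dots>\<bar> \<le> c * dist u v"
      proof -
        have "\<bar>1 * (1 * apply_bcontfun u y + e\<^sup>2 * f y) + (-1) * (1 * apply_bcontfun v y + e\<^sup>2 * f y)\<bar> \<le> dist u v" for y
          using dist_bounded[of u y v] by (simp add: dist_real_def)
        from tent_avg_abs_le_bcontfun[OF bcontfun_lincomb[OF b b] this]
        show ?thesis using c by (simp add: abs_mult)
      qed
      finally show "dist (apply_bcontfun (Bcontfun (T u)) x) (apply_bcontfun (Bcontfun (T v)) x) \<le> c * dist u v"
        by (simp add: Bcontfun_inverse T dist_real_def)
    qed
  qed
  then obtain u where u: "Bcontfun (T u) = u" by blast
  have ux: "apply_bcontfun u x = T u x" for x
    using u T by (metis Bcontfun_inverse)
  have "(1 + e\<^sup>2 * lam) * apply_bcontfun u x = tent_avg e (\<lambda>y. apply_bcontfun u y + e\<^sup>2 * f y) x" for x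
  proof -
    have "(1 + e\<^sup>2 * lam) * apply_bcontfun u x = (1 + e\<^sup>2 * lam) * T u x"
      by (simp only: ux)
    also have "\<dots> = tent_avg e (\<lambda>y. apply_bcontfun u y + e\<^sup>2 * f y) x"
      using el by (simp add: T_def c_def)
    finally show ?thesis .
  qed
  then show ?thesis
    unfolding resolves_def using apply_bcontfun[of u] by blast
qed

lemma resolves_lincomb:
  assumes "resolves lam e f u" "resolves lam e g v" "f \<in> bcontfun" "g \<in> bcontfun"
  shows "resolves lam e (\<lambda>x. a * f x + b * g x) (\<lambda>x. a * u x + b * v x)"
proof -
  have uv: "u \<in> bcontfun" "v \<in> bcontfun" using assms by (auto simp: resolves_def)
  have b: "(\<lambda>y. u y + e\<^sup>2 * f y) \<in> bcontfun" "(\<lambda>y. v y + e\<^sup>2 * g y) \<in> bcontfun"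
    using bcontfun_lincomb[OF uv(1) assms(3), of 1 "e\<^sup>2"] bcontfun_lincomb[OF uv(2) assms(4), of 1 "e\<^sup>2"]
    by simp_all
  have "(1 + e\<^sup>2 * lam) * (a * u x + b * v x) = tent_avg e (\<lambda>x. (a * u x + b * v x) + e\<^sup>2 * (a * f x + b * g x)) x" for x
  proof -
    have "(1 + e\<^sup>2 * lam) * (a * u x + b * v x) = a * ((1 + e\<^sup>2 * lam) * u x) + b * ((1 + e\<^sup>2 * lam) * v x)"
      by (simp add: algebra_simps)
    also have "\<dots> = tent_avg e (\<lambda>y. a * (u y + e\<^sup>2 * f y) + b * (v y + e\<^sup>2 * g y)) x"
      using assms(1,2) unfolding tent_avg_lincomb[OF b] resolves_def by simp
    finally show ?thesis by (simp add: algebra_simps)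
  qed
  then show ?thesis using bcontfun_lincomb[OF uv] by (simp add: resolves_def)
qed

text \<open>The bound does not depend on \<open>e\<close>: the contraction factor is \<open>1 / (1 + e\<^sup>2 lam)\<close> and the source carries the
  factor \<open>e\<^sup>2\<close>, so the two cancel in the excess of \<open>|u|\<close> over \<open>M / lam\<close>.\<close>
lemma resolves_bound:
  assumes "0 < e" "0 < lam" and f: "f \<in> bcontfun" "\<And>x. \<bar>f x\<bar> \<le> M" and u: "resolves lam e f u"
  shows "\<bar>u x\<bar> \<le> M / lam"
proof -
  have ub: "u \<in> bcontfun" using u by (simp add: resolves_def)
  have b: "(\<lambda>y. u y + e\<^sup>2 * f y) \<in> bcontfun"
    using bcontfun_lincomb[OF ub f(1), of 1 "e\<^sup>2"] by simp
  obtain K where K: "\<And>x. \<bar>u x\<bar> \<le> K" using bcontfunD(3)[OF ub] by metis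
  have el: "0 < e\<^sup>2 * lam" using assms by simp
  have "\<bar>u x\<bar> - M / lam \<le> 0"
  proof (rule nonpos_of_contraction[where S=UNIV and c="1 / (1 + e\<^sup>2 * lam)" and E="\<lambda>x. \<bar>u x\<bar> - M / lam" and K="K - M / lam"])
    fix s x assume s: "0 \<le> s" "\<And>x. x \<in> UNIV \<Longrightarrow> \<bar>u x\<bar> - M / lam \<le> s"
    have "\<bar>u y + e\<^sup>2 * f y\<bar> \<le> s + M / lam + e\<^sup>2 * M" for y
    proof -
      have "\<bar>u y + e\<^sup>2 * f y\<bar> \<le> \<bar>u y\<bar> + e\<^sup>2 * \<bar>f y\<bar>"
        using abs_triangle_ineq[of "u y" "e\<^sup>2 * f y"] by (simp add: abs_mult)
      also have "\<dots> \<le> (s + M / lam) + e\<^sup>2 * M"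
        using s(2)[of y] f(2)[of y] by (intro add_mono mult_left_mono) auto
      finally show ?thesis .
    qed
    from tent_avg_abs_le_bcontfun[OF b this]
    have "\<bar>(1 + e\<^sup>2 * lam) * u x\<bar> \<le> s + M / lam + e\<^sup>2 * M"
      using u by (simp add: resolves_def)
    moreover have "\<bar>(1 + e\<^sup>2 * lam) * u x\<bar> = (1 + e\<^sup>2 * lam) * \<bar>u x\<bar>"
      using el by (simp only: abs_mult)
    moreover have "s + M / lam + e\<^sup>2 * M = s + (M / lam) * (1 + e\<^sup>2 * lam)"
      using \<open>0 < lam\<close> by (simp add: field_simps)
    ultimately have "(1 + e\<^sup>2 * lam) * \<bar>u x\<bar> \<le> s + (M / lam) * (1 + e\<^sup>2 * lam)"
      by linarith
    moreover have "(1 + e\<^sup>2 * lam) * (\<bar>u x\<bar> - M / lam) = (1 + e\<^sup>2 * lam) * \<bar>u x\<bar> - (M / lam) * (1 + e\<^sup>2 * lam)"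
      by (simp only: left_diff_distrib mult.commute[of "1 + e\<^sup>2 * lam"])
    ultimately have "(1 + e\<^sup>2 * lam) * (\<bar>u x\<bar> - M / lam) \<le> s" by linarith
    then show "\<bar>u x\<bar> - M / lam \<le> 1 / (1 + e\<^sup>2 * lam) * s"
      by (rule le_inverse_mult) (use el in simp)
  qed (use K el in auto)
  then show ?thesis by simp
qed

lemma resolves_unique:
  assumes "0 < e" "0 < lam" "f \<in> bcontfun" "resolves lam e f u" "resolves lam e f v"
  shows "u x = v x"
proof -
  have "resolves lam e (\<lambda>x. 1 * f x + (-1) * f x) (\<lambda>x. 1 * u x + (-1) * v x)"
    using assms by (intro resolves_lincomb)
  then have r: "resolves lam e (\<lambda>x. 0) (\<lambda>x. u x - v x)" by simp
  have "(\<lambda>x::real. 0::real) \<in> bcontfun" by (intro bcontfunI'[of _ 0]) auto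
  from resolves_bound[OF assms(1,2) this _ r, of 0 x] show ?thesis by simp
qed

lemma resolves_even:
  assumes "0 < e" "0 < lam" "f \<in> bcontfun" "resolves lam e f u" "\<And>x. f (- x) = f x"
  shows "u (- x) = u x"
proof (rule resolves_unique[OF assms(1-3) _ assms(4), of "\<lambda>x. u (- x)"])
  have ub: "u \<in> bcontfun" using assms by (simp add: resolves_def)
  obtain K where K: "\<And>x. \<bar>u x\<bar> \<le> K" using bcontfunD(3)[OF ub] by metis
  have "(\<lambda>x. u (- x)) \<in> bcontfun"
    by (rule bcontfunI'[of _ K]) (auto intro!: continuous_on_compose2[OF bcontfunD(1)[OF ub]] continuous_intros K)
  moreover have "(1 + e\<^sup>2 * lam) * u (- x) = tent_avg e (\<lambda>y. u (- y) + e\<^sup>2 * f y) x" for x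
    using tent_avg_reflect[of e "\<lambda>y. u y + e\<^sup>2 * f y" 0 x] assms(4,5) by (simp add: resolves_def)
  ultimately show "resolves lam e f (\<lambda>x. u (- x))" by (simp add: resolves_def)
qed

text \<open>The concave profile \<open>al (1 - exp (- be |x|))\<close>, extended to an odd function, is convex on the negative half line, which spoils
  midpoint concavity for windows that straddle the origin. The jump of height \<open>al be\<^sup>2 e\<^sup>2 / 2\<close> on either side is of
  the size of the defect that such a window, of width \<open>e\<close>, can produce.\<close>
definition barrier :: "real \<Rightarrow> real \<Rightarrow> real \<Rightarrow> real \<Rightarrow> real" where
  "barrier al be e x = sgn x * (al * be\<^sup>2 * e\<^sup>2 / 2 + al * (1 - exp (- be * \<bar>x\<bar>)))"

lemma exp_plus_exp_minus_ge: "2 + t\<^sup>2 \<le> exp t + exp (- t)" for t :: real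
proof -
  have pos: "2 + t\<^sup>2 \<le> exp t + exp (- t)" if "0 \<le> t" for t :: real
  proof -
    have 1: "2 * s \<le> exp s - exp (- s)" if "0 \<le> s" for s :: real
    proof -
      have "\<bar>2 * s - 2 * 0\<bar> \<le> (exp s - exp (- s)) - (exp 0 - exp (- 0))"
      proof (rule abs_diff_le_of_deriv[OF that, where f'="\<lambda>_. 2" and g'="\<lambda>s. exp s + exp (- s)"])
        fix r :: real
        show "((*) 2 has_real_derivative 2) (at r)" by (auto intro!: derivative_eq_intros)
        show "((\<lambda>s. exp s - exp (- s)) has_real_derivative exp r + exp (- r)) (at r)"
          by (auto intro!: derivative_eq_intros)
        have "0 \<le> (exp (r / 2) - exp (- (r / 2)))\<^sup>2" by simp
        also have "\<dots> = exp r + exp (- r) - 2"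
          by (simp add: power2_diff exp_minus_inverse flip: exp_double exp_add)
        finally show "\<bar>2\<bar> \<le> exp r + exp (- r)" by simp
      qed
      then show ?thesis using that by simp
    qed
    have "\<bar>t\<^sup>2 - 0\<^sup>2\<bar> \<le> (exp t + exp (- t)) - (exp 0 + exp (- 0))"
    proof (rule abs_diff_le_of_deriv[OF that, where f'="\<lambda>t. 2 * t" and g'="\<lambda>s. exp s - exp (- s)"])
      fix r :: real assume "0 \<le> r"
      show "((\<lambda>t. t\<^sup>2) has_real_derivative 2 * r) (at r)" by (auto intro!: derivative_eq_intros)
      show "((\<lambda>s. exp s + exp (- s)) has_real_derivative exp r - exp (- r)) (at r)"
        by (auto intro!: derivative_eq_intros)
      show "\<bar>2 * r\<bar> \<le> exp r - exp (- r)" using 1[OF \<open>0 \<le> r\<close>] \<open>0 \<le> r\<close> by simp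
    qed
    then show ?thesis by simp
  qed
  show ?thesis using pos[of t] pos[of "- t"] by (cases "0 \<le> t") auto
qed

text \<open>Strict midpoint concavity at every positive point and every step up to \<open>e\<close>, including steps that reach across the origin.\<close>
lemma barrier_concave:
  assumes "0 < x" "\<bar>s\<bar> \<le> e" "0 \<le> al" "0 \<le> be"
  shows "(barrier al be e (x + s) + barrier al be e (x - s)) / 2
     \<le> barrier al be e x - al * be\<^sup>2 * exp (- be * x) * s\<^sup>2 / 2"
proof -
  have main: "(barrier al be e (x + s) + barrier al be e (x - s)) / 2
     \<le> barrier al be e x - al * be\<^sup>2 * exp (- be * x) * s\<^sup>2 / 2" if s: "0 \<le> s" "s \<le> e" for s
  proof -
    define u v N where "u = exp (- be * x)" and "v = exp (- be * s)" and "N = al * be\<^sup>2 * e\<^sup>2 / 2"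
    have u: "0 < u" "u \<le> 1" and v: "0 < v" "v \<le> 1"
      using assms s by (auto simp: u_def v_def)
    have N0: "0 \<le> N" using assms by (simp add: N_def)
    have uv: "exp (- be * (x + s)) = u * v" "exp (- be * (x - s)) = u / v" "exp (- be * (s - x)) = v / u"
      by (simp_all add: u_def v_def algebra_simps flip: exp_add exp_diff)
    have ch: "be\<^sup>2 * s\<^sup>2 \<le> v + 1 / v - 2"
      using exp_plus_exp_minus_ge[of "be * s"]
      by (simp add: v_def power_mult_distrib exp_minus inverse_eq_divide)
    have Bx: "barrier al be e x = N + al * (1 - u)"
      using \<open>0 < x\<close> by (simp add: barrier_def N_def u_def)
    have Bp: "barrier al be e (x + s) = N + al * (1 - u * v)"
      using \<open>0 < x\<close> s by (simp add: barrier_def N_def flip: uv)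
    have k: "al * be\<^sup>2 * u * s\<^sup>2 \<le> al * (u * (v + 1 / v - 2))"
      using mult_left_mono[OF ch, of "al * u"] assms u by (simp add: algebra_simps)
    consider "s < x" | "s = x" | "x < s" by linarith
    then have "(barrier al be e (x + s) + barrier al be e (x - s)) / 2
        \<le> barrier al be e x - al * be\<^sup>2 * u * s\<^sup>2 / 2"
    proof cases
      case 1
      then have Bm: "barrier al be e (x - s) = N + al * (1 - u / v)"
        by (simp add: barrier_def N_def flip: uv)
      have "(barrier al be e (x + s) + barrier al be e (x - s)) / 2 = N + al - al * (u * (v + 1 / v)) / 2"
        unfolding Bp Bm by (simp add: algebra_simps add_divide_distrib diff_divide_distrib)
      moreover define A P R where "A = al * (u * (v + 1 / v))" and "P = al * be\<^sup>2 * u * s\<^sup>2" and "R = al * u"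
      moreover have "P \<le> A - 2 * R" using k by (simp add: A_def P_def R_def algebra_simps)
      moreover have "al * (1 - u) = al - R" by (simp add: R_def algebra_simps)
      ultimately show ?thesis unfolding Bx by simp
    next
      case 2
      then have Bm: "barrier al be e (x - s) = 0" by (simp add: barrier_def)
      have "v = u" using 2 by (simp add: u_def v_def)
      have "u * (v + 1 / v - 2) = u * u + 1 - 2 * u" using u \<open>v = u\<close> by (simp add: field_simps)
      moreover define A P R where "A = al * (u * u)" and "P = al * be\<^sup>2 * u * s\<^sup>2" and "R = al * u"
      ultimately have "P \<le> A + al - 2 * R" using k by (simp add: algebra_simps)
      moreover have "al * (1 - u * u) = al - A" "al * (1 - u) = al - R"
        by (simp_all add: A_def R_def algebra_simps)
      ultimately show ?thesis using N0 unfolding Bx Bp Bm \<open>v = u\<close> P_def[symmetric] by simp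
    next
      case 3
      then have Bm: "barrier al be e (x - s) = - (N + al * (1 - v / u))"
        by (simp add: barrier_def N_def flip: uv)
      have "v \<le> u" using 3 \<open>0 \<le> be\<close> by (simp add: u_def v_def mult_left_mono)
      have "v * (1 - u * u) \<le> u * (1 - u * u)"
        using \<open>v \<le> u\<close> u by (intro mult_right_mono) (auto simp: mult_le_one)
      then have "v / u - u * v \<le> 1 - u * u"
        using u by (simp add: field_simps)
      also have "\<dots> \<le> 2 * (1 - u)"
        using zero_le_square[of "1 - u"] by (simp add: algebra_simps)
      finally have "al * (v / u - u * v) \<le> al * (2 * (1 - u))"
        using assms by (intro mult_left_mono)
      (* The window reaches across the origin, where the profile is convex; the jump N pays for the defect. *)
      moreover have "al * be\<^sup>2 * u * s\<^sup>2 / 2 \<le> N"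
      proof -
        have "u * s\<^sup>2 \<le> 1 * e\<^sup>2" using u s by (intro mult_mono power_mono) auto
        then have "al * be\<^sup>2 * (u * s\<^sup>2) \<le> al * be\<^sup>2 * e\<^sup>2"
          using assms by (intro mult_left_mono) auto
        then show ?thesis by (simp add: N_def algebra_simps)
      qed
      moreover define Z Y P where "Z = al * (v / u - u * v)" and "Y = al * (1 - u)" and "P = al * be\<^sup>2 * u * s\<^sup>2"
      moreover have "al * (2 * (1 - u)) = 2 * Y" by (simp add: Y_def)
      moreover have "(N + al * (1 - u * v) + - (N + al * (1 - v / u))) / 2 = Z / 2"
        by (simp add: Z_def right_diff_distrib)
      ultimately show ?thesis unfolding Bx Bp Bm by linarith
    qed
    then show ?thesis by (simp add: u_def)
  qed
  show ?thesis
  proof (cases "0 \<le> s")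
    case True
    then show ?thesis using main[of s] assms by simp
  next
    case False
    then show ?thesis using main[of "- s"] assms by (simp add: add.commute)
  qed
qed

lemma barrier_odd: "barrier al be e (- x) = - barrier al be e x"
  by (simp add: barrier_def sgn_minus)

lemma barrier_borel [measurable]: "barrier al be e \<in> borel_measurable borel"
  unfolding barrier_def[abs_def] by measurable

lemma barrier_bound:
  assumes "0 \<le> al" "0 \<le> be"
  shows "\<bar>barrier al be e x\<bar> \<le> al * be\<^sup>2 * e\<^sup>2 / 2 + al"
proof -
  have "0 \<le> al * (1 - exp (- be * \<bar>x\<bar>))" "al * (1 - exp (- be * \<bar>x\<bar>)) \<le> al"
    using assms by (auto simp: mult_left_le)
  then have "\<bar>al * be\<^sup>2 * e\<^sup>2 / 2 + al * (1 - exp (- be * \<bar>x\<bar>))\<bar> \<le> al * be\<^sup>2 * e\<^sup>2 / 2 + al"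
    using assms by (subst abs_of_nonneg) auto
  moreover have "\<bar>barrier al be e x\<bar> \<le> \<bar>al * be\<^sup>2 * e\<^sup>2 / 2 + al * (1 - exp (- be * \<bar>x\<bar>))\<bar>"
    unfolding barrier_def abs_mult by (simp add: abs_sgn_eq)
  ultimately show ?thesis by linarith
qed

text \<open>The strict concavity at step \<open>e y\<close> is proportional to \<open>y\<^sup>2\<close>; integrating it against the tent uses the second
  moment 1/6.\<close>
lemma tent_avg_barrier_le:
  assumes "0 < x" "0 < e" "0 \<le> al" "0 \<le> be"
  shows "tent_avg e (barrier al be e) x \<le> barrier al be e x - al * be\<^sup>2 * exp (- be * x) * e\<^sup>2 / 12"
proof -
  have i: "integrable lborel (\<lambda>y. tent y * barrier al be e (x + e * y))"
    by (rule integrable_tent_mult[OF barrier_borel barrier_bound]) (use assms in auto)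
  define c where "c = al * be\<^sup>2 * exp (- be * x) * e\<^sup>2 / 2"
  have "tent_avg e (barrier al be e) x
     = (LINT y|lborel. tent y * ((barrier al be e (x + e * y) + barrier al be e (x - e * y)) / 2))"
    by (rule tent_avg_sym(1)[OF i])
  also have "\<dots> \<le> (LINT y|lborel. barrier al be e x * tent y - c * (tent y * y\<^sup>2))"
  proof (rule integral_mono[OF tent_avg_sym(2)[OF i]])
    fix y
    show "tent y * ((barrier al be e (x + e * y) + barrier al be e (x - e * y)) / 2)
       \<le> barrier al be e x * tent y - c * (tent y * y\<^sup>2)"
    proof (cases "\<bar>y\<bar> \<le> 1")
      case True
      then have "\<bar>e * y\<bar> \<le> e" using \<open>0 < e\<close> by (simp add: abs_mult mult_left_le)
      from mult_left_mono[OF barrier_concave[OF \<open>0 < x\<close> this assms(3,4)] tent_nonneg[of y]]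
      show ?thesis by (simp add: c_def algebra_simps power_mult_distrib)
    next
      case False
      then show ?thesis using tent_outside[of y] by simp
    qed
  qed (intro Bochner_Integration.integrable_diff integrable_mult_right integrable_tent integrable_tent_square)
  also have "\<dots> = barrier al be e x - c / 6"
    using tent_second_moment by simp
  finally show ?thesis by (simp add: c_def)
qed

text \<open>For fixed \<open>m\<close> the difference \<open>u (m + x) - u (m - x)\<close> is odd in \<open>x\<close> and solves the same averaging equation with a source
  bounded by \<open>2 M\<close>. A multiple of the barrier is a supersolution on the positive half line, and the folding of odd functions
  supplies the maximum principle there. Reflection is what makes a two-point quantity accessible to a scalar comparison; the
  estimate is Lipschitz in \<open>h\<close> up to the unavoidable offset \<open>e\<^sup>2\<close>.\<close>
lemma resolves_oscillation_le:
  assumes "0 < e" "0 < lam" and f: "f \<in> bcontfun" "\<And>x. \<bar>f x\<bar> \<le> M" and u: "resolves lam e f u" and "0 < h"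
  shows "u (m + h) - u (m - h) \<le> M * (12 * e\<^sup>2 + 2 / lam * sqrt (12 * lam) * h)"
proof -
  (* With these values al * be^2 / 12 = 2 = lam * al: the concavity of the barrier contributes
     2 * exp (- be * x) and its zeroth-order term contributes 2 * (1 - exp (- be * x)), which
     together balance the source |f (m + x) - f (m - x)| <= 2 * M. *)
  define al be where "al = 2 / lam" and "be = sqrt (12 * lam)"
  have al: "0 \<le> al" "0 < al" and be: "0 \<le> be" and be2: "be\<^sup>2 = 12 * lam"
    using assms by (auto simp: al_def be_def)
  have M0: "0 \<le> M" using f(2)[of 0] by linarith
  have el: "0 < e\<^sup>2 * lam" using assms by simp
  have ub: "u \<in> bcontfun" using u by (simp add: resolves_def)
  obtain K where K: "\<And>x. \<bar>u x\<bar> \<le> K" using bcontfunD(3)[OF ub] by metis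
  let ?B = "barrier al be e"
  have bar: "(1 + e\<^sup>2 * lam) * ?B x \<ge> tent_avg e ?B x + 2 * e\<^sup>2" if "0 < x" for x
  proof -
    have "tent_avg e ?B x \<le> ?B x - al * be\<^sup>2 * exp (- be * x) * e\<^sup>2 / 12"
      using tent_avg_barrier_le[OF that \<open>0 < e\<close> al(1) be] .
    also have "al * be\<^sup>2 * exp (- be * x) * e\<^sup>2 / 12 = 2 * e\<^sup>2 * exp (- be * x)"
      using \<open>0 < lam\<close> by (simp add: be2 al_def)
    finally have 1: "tent_avg e ?B x \<le> ?B x - 2 * e\<^sup>2 * exp (- be * x)" .
    have "?B x \<ge> al * (1 - exp (- be * x))"
      using that al by (simp add: barrier_def)
    then have "e\<^sup>2 * lam * ?B x \<ge> e\<^sup>2 * lam * (al * (1 - exp (- be * x)))"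
      using el by (intro mult_left_mono) auto
    also have "e\<^sup>2 * lam * (al * (1 - exp (- be * x))) = 2 * e\<^sup>2 * (1 - exp (- be * x))"
      using \<open>0 < lam\<close> by (simp add: al_def)
    finally show ?thesis using 1 by (simp add: algebra_simps)
  qed
  have side: "u (m + x) - u (m - x) - M * ?B x \<le> 0" if "0 < x" for x m
  proof -
    define E where "E x = u (m + x) - u (m - x) - M * ?B x" for x
    define D where "D y = u (m + y) - u (m - y) + e\<^sup>2 * (f (m + y) - f (m - y))" for y
    have [measurable]: "u \<in> borel_measurable borel" "f \<in> borel_measurable borel"
      using bcontfunD(2) ub f(1) by auto
    have Em: "E \<in> borel_measurable borel" unfolding E_def[abs_def] by measurable
    have Bb: "\<bar>M * ?B x\<bar> \<le> M * (al * be\<^sup>2 * e\<^sup>2 / 2 + al)" for x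
      using barrier_bound[OF al(1) be, of e x] M0 by (simp add: abs_mult mult_left_mono)
    have Eb: "\<bar>E x\<bar> \<le> 2 * K + M * (al * be\<^sup>2 * e\<^sup>2 / 2 + al)" for x
      using Bb[of x] K[of "m + x"] K[of "m - x"] unfolding E_def by linarith
    have Eo: "E (- x) = - E x" for x by (simp add: E_def barrier_odd)
    have iE: "integrable lborel (\<lambda>y. tent y * E (x + e * y))" for x
      by (rule integrable_tent_mult[OF Em Eb])
    have iB: "integrable lborel (\<lambda>y. tent y * (M * ?B (x + e * y)))" for x
      by (rule integrable_tent_mult[OF _ Bb]) measurable
    have "E x \<le> 0"
    proof (rule nonpos_of_contraction[where S="{0<..}" and c="1 / (1 + e\<^sup>2 * lam)" and E=E
            and K="2 * K + M * (al * be\<^sup>2 * e\<^sup>2 / 2 + al)"])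
      fix s x :: real assume s: "0 \<le> s" "\<And>x. x \<in> {0<..} \<Longrightarrow> E x \<le> s" and "x \<in> {0<..}"
      then have "0 < x" by simp
      have le: "tent_avg e E x \<le> s"
        by (rule tent_avg_odd_le[OF Em Eb Eo s(1) _ \<open>0 < x\<close> \<open>0 < e\<close>]) (use s in auto)
      define g where "g y = u y + e\<^sup>2 * f y" for y
      have gb: "g \<in> bcontfun" using bcontfun_lincomb[OF ub f(1), of 1 "e\<^sup>2"] by (simp add: g_def[abs_def])
      have cg: "continuous_on UNIV (\<lambda>y. g (m + y))" "continuous_on UNIV (\<lambda>y. g (m - y))"
        by (intro continuous_on_compose2[OF bcontfunD(1)[OF gb]] continuous_intros; simp)+
      have "(1 + e\<^sup>2 * lam) * (u (m + x) - u (m - x)) = tent_avg e g (m + x) - tent_avg e g (m - x)"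
        using u by (simp add: resolves_def g_def[abs_def] right_diff_distrib)
      also have "\<dots> = 1 * tent_avg e (\<lambda>y. g (m + y)) x + (-1) * tent_avg e (\<lambda>y. g (m - y)) x"
        by (simp add: tent_avg_shift tent_avg_reflect)
      also have "\<dots> = tent_avg e (\<lambda>y. 1 * g (m + y) + (-1) * g (m - y)) x"
        by (rule tent_avg_linear[symmetric]; rule integrable_tent_continuous[OF cg(1)] integrable_tent_continuous[OF cg(2)])
      also have "\<dots> \<le> tent_avg e (\<lambda>y. 1 * E y + 1 * (M * ?B y + 2 * e\<^sup>2 * M)) x"
      proof (rule tent_avg_mono)
        show "integrable lborel (\<lambda>y. tent y * (1 * g (m + (x + e * y)) + (-1) * g (m - (x + e * y))))"
          using integrable_tent_continuous[OF continuous_on_diff[OF cg], of x e] by simp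
        have "integrable lborel (\<lambda>y. tent y * E (x + e * y) + tent y * (M * ?B (x + e * y)) + 2 * e\<^sup>2 * M * tent y)"
          using iE iB by simp
        then show "integrable lborel (\<lambda>y. tent y * (1 * E (x + e * y) + 1 * (M * ?B (x + e * y) + 2 * e\<^sup>2 * M)))"
          by (simp add: algebra_simps)
        fix y
        have ff: "f (m + (x + e * y)) - f (m - (x + e * y)) \<le> 2 * M"
          using f(2)[of "m + (x + e * y)"] f(2)[of "m - (x + e * y)"] by linarith
        have "e\<^sup>2 * (f (m + (x + e * y)) - f (m - (x + e * y))) \<le> e\<^sup>2 * (2 * M)"
          by (rule mult_left_mono[OF ff]) simp
        then show "1 * g (m + (x + e * y)) + (-1) * g (m - (x + e * y))
            \<le> 1 * E (x + e * y) + 1 * (M * ?B (x + e * y) + 2 * e\<^sup>2 * M)"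
          by (simp add: g_def E_def algebra_simps)
      qed
      also have "\<dots> = 1 * tent_avg e E x + 1 * tent_avg e (\<lambda>y. M * ?B y + 2 * e\<^sup>2 * M) x"
      proof (rule tent_avg_linear[OF iE])
        have "integrable lborel (\<lambda>y. tent y * (M * ?B (x + e * y)) + 2 * e\<^sup>2 * M * tent y)"
          using iB by simp
        then show "integrable lborel (\<lambda>y. tent y * (M * ?B (x + e * y) + 2 * e\<^sup>2 * M))"
          by (simp add: algebra_simps)
      qed
      also have "tent_avg e (\<lambda>y. M * ?B y + 2 * e\<^sup>2 * M) x = M * (tent_avg e ?B x + 2 * e\<^sup>2)"
      proof -
        have i1: "integrable lborel (\<lambda>y. tent y * ?B (x + e * y))"
          by (rule integrable_tent_mult[OF barrier_borel barrier_bound[OF al(1) be]])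
        have i2: "integrable lborel (\<lambda>y. tent y * 1)" by simp
        from tent_avg_linear[OF i1 i2, of M "2 * e\<^sup>2 * M"] show ?thesis
          by (simp add: algebra_simps)
      qed
      also have "\<dots> \<le> M * ((1 + e\<^sup>2 * lam) * ?B x)"
        using bar[OF \<open>0 < x\<close>] M0 by (intro mult_left_mono) auto
      finally have "(1 + e\<^sup>2 * lam) * E x \<le> s"
        using le unfolding E_def by (simp add: algebra_simps)
      then show "E x \<le> 1 / (1 + e\<^sup>2 * lam) * s"
        by (rule le_inverse_mult) (use el in simp)
    qed (use el Eb that in \<open>auto simp: abs_le_iff\<close>)
    then show ?thesis by (simp add: E_def)
  qed
  have Bh: "?B h \<le> 12 * e\<^sup>2 + 2 / lam * sqrt (12 * lam) * h"
  proof -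
    have "1 - exp (- be * h) \<le> be * h" using exp_ge_add_one_self[of "- be * h"] by simp
    then have "al * (1 - exp (- be * h)) \<le> al * (be * h)" using al by (intro mult_left_mono) auto
    moreover have "al * be\<^sup>2 * e\<^sup>2 / 2 = 12 * e\<^sup>2" using \<open>0 < lam\<close> by (simp add: be2 al_def)
    ultimately show ?thesis using \<open>0 < h\<close> by (simp add: barrier_def al_def be_def mult.assoc)
  qed
  from side[OF \<open>0 < h\<close>, of m] have "u (m + h) - u (m - h) \<le> M * ?B h" by simp
  also have "\<dots> \<le> M * (12 * e\<^sup>2 + 2 / lam * sqrt (12 * lam) * h)"
    using Bh M0 by (rule mult_left_mono)
  finally show ?thesis .
qed

lemma resolves_oscillation:
  assumes "0 < e" "0 < lam" and f: "f \<in> bcontfun" "\<And>x. \<bar>f x\<bar> \<le> M" and u: "resolves lam e f u"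
  shows "\<bar>u (x + s) - u x\<bar> \<le> M * (12 * e\<^sup>2 + 1 / lam * sqrt (12 * lam) * \<bar>s\<bar>)"
proof -
  have pos: "\<bar>u (x + s) - u x\<bar> \<le> M * (12 * e\<^sup>2 + 1 / lam * sqrt (12 * lam) * s)" if "0 < s" for x s
  proof -
    have r: "resolves lam e (\<lambda>x. - f x) (\<lambda>x. - u x)"
      using resolves_lincomb[OF u u f(1) f(1), of "-1" 0] by simp
    have b: "(\<lambda>x. - f x) \<in> bcontfun" using bcontfun_lincomb[OF f(1) f(1), of "-1" 0] by simp
    have fb: "\<bar>- f x\<bar> \<le> M" for x using f(2)[of x] by simp
    have h: "0 < s / 2" using that by simp
    have eq: "x + s / 2 + s / 2 = x + s" by simp
    show ?thesis
      using resolves_oscillation_le[OF assms(1,2) f u h, of "x + s / 2"]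
        resolves_oscillation_le[OF assms(1,2) b fb r h, of "x + s / 2"]
      unfolding eq by (simp add: abs_le_iff)
  qed
  have M0: "0 \<le> M" using f(2)[of 0] by linarith
  consider "0 < s" | "s = 0" | "s < 0" by linarith
  then show ?thesis
  proof cases
    case 1
    then show ?thesis using pos[of s x] by simp
  next
    case 2
    then show ?thesis using M0 by simp
  next
    case 3
    then show ?thesis using pos[of "- s" "x + s"] by (simp add: abs_minus_commute)
  qed
qed

text \<open>For steps of length at most \<open>2 e\<close> the oscillation estimate gives \<open>12 + (2 / lam) sqrt (12 lam)\<close> in units of \<open>M e\<close>, the term
  \<open>e\<^sup>2 f\<close> in the averaged function adds 2, and one more unit covers the passage from that function to \<open>u\<close>.\<close>
definition Cres :: "real \<Rightarrow> real" where
  "Cres lam = 15 + 2 / lam * sqrt (12 * lam)"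

lemma Cres_pos: "0 < lam \<Longrightarrow> 0 < Cres lam"
  by (simp add: Cres_def add_pos_nonneg)

lemma resolves_source_oscillation:
  assumes "0 < e" "e \<le> 1" "0 < lam" and f: "f \<in> bcontfun" "\<And>x. \<bar>f x\<bar> \<le> M" and u: "resolves lam e f u"
    and s: "\<bar>s\<bar> \<le> 2 * e"
  shows "\<bar>(u (x + s) + e\<^sup>2 * f (x + s)) - (u x + e\<^sup>2 * f x)\<bar> \<le> M * e * (Cres lam - 1)"
proof -
  have M0: "0 \<le> M" using f(2)[of 0] by linarith
  have e2: "e\<^sup>2 \<le> e" using assms by (simp add: power2_eq_square mult_left_le)
  have "\<bar>f (x + s) - f x\<bar> \<le> 2 * M" using f(2)[of "x + s"] f(2)[of x] by linarith
  then have 1: "\<bar>e\<^sup>2 * f (x + s) - e\<^sup>2 * f x\<bar> \<le> e * (2 * M)"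
    using mult_mono[OF e2, of "\<bar>f (x + s) - f x\<bar>" "2 * M"] assms(1) by (simp add: abs_mult flip: right_diff_distrib)
  have "12 * e\<^sup>2 + 1 / lam * sqrt (12 * lam) * \<bar>s\<bar> \<le> 12 * e + 1 / lam * sqrt (12 * lam) * (2 * e)"
    using s e2 assms by (intro add_mono mult_left_mono) auto
  then have "M * (12 * e\<^sup>2 + 1 / lam * sqrt (12 * lam) * \<bar>s\<bar>) \<le> M * (12 * e + 1 / lam * sqrt (12 * lam) * (2 * e))"
    using M0 by (rule mult_left_mono)
  with resolves_oscillation[OF assms(1,3) f u, of x s]
  have 2: "\<bar>u (x + s) - u x\<bar> \<le> M * (12 * e + 1 / lam * sqrt (12 * lam) * (2 * e))" by linarith
  have "e * (2 * M) + M * (12 * e + 1 / lam * sqrt (12 * lam) * (2 * e)) = M * e * (Cres lam - 1)"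
    by (simp add: Cres_def algebra_simps)
  with 1 2 show ?thesis by linarith
qed

text \<open>The derivative of \<open>T\<^sub>e h\<close> is \<open>e\<^sup>-\<^sup>2\<close> times a second difference of a primitive of \<open>h\<close>. That second difference integrates \<open>h (x + r) -
  h (x - r)\<close> over a window of length \<open>e\<close>, and each such difference is \<open>O(e)\<close> by the oscillation estimate, so the powers of \<open>e\<close>
  cancel. This is the smoothing that is uniform in \<open>e\<close>.\<close>
lemma resolves_derivative:
  assumes "0 < e" "e \<le> 1" "0 < lam" and f: "f \<in> bcontfun" "\<And>x. \<bar>f x\<bar> \<le> M" and u: "resolves lam e f u"
  obtains u' where "\<And>x. (u has_real_derivative u' x) (at x)" "u' \<in> bcontfun" "\<And>x. \<bar>u' x\<bar> \<le> Cres lam * M"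
proof -
  have el: "0 < 1 + e\<^sup>2 * lam" using assms by (simp add: add_pos_nonneg)
  have M0: "0 \<le> M" using f(2)[of 0] by linarith
  have ub: "u \<in> bcontfun" using u by (simp add: resolves_def)
  define h where "h y = u y + e\<^sup>2 * f y" for y
  have hb: "h \<in> bcontfun" using bcontfun_lincomb[OF ub f(1), of 1 "e\<^sup>2"] by (simp add: h_def[abs_def])
  obtain Th where Th: "\<And>x. (Th has_real_derivative h x) (at x)"
    using exists_antiderivative[OF bcontfunD(1)[OF hb]] by blast
  define u' where "u' x = (Th (x + e) - 2 * Th x + Th (x - e)) / e\<^sup>2 / (1 + e\<^sup>2 * lam)" for x
  have ueq: "u = (\<lambda>x. tent_avg e h x / (1 + e\<^sup>2 * lam))"
    using u el by (auto simp: resolves_def h_def[abs_def] fun_eq_iff field_simps)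
  have d: "(u has_real_derivative u' x) (at x)" for x
    unfolding u'_def
    by (subst ueq) (intro DERIV_cdivide tent_avg_has_derivative \<open>0 < e\<close> bcontfunD(1)[OF hb] Th)
  have cTh: "continuous_on UNIV Th"
    using Th by (meson DERIV_isCont continuous_at_imp_continuous_on)
  have c: "continuous_on UNIV u'"
    unfolding u'_def[abs_def] using el \<open>0 < e\<close>
    by (intro continuous_intros continuous_on_compose2[OF cTh]) auto
  have b: "\<bar>u' x\<bar> \<le> Cres lam * M" for x
  proof -
    let ?om = "M * e * (Cres lam - 1)"
    have "\<bar>(Th (x + e) - 2 * Th x + Th (x - e)) - (Th (x + 0) - 2 * Th x + Th (x - 0))\<bar> \<le> ?om * e - ?om * 0"
    proof (rule abs_diff_le_of_deriv[where f'="\<lambda>r. h (x + r) - h (x - r)" and g'="\<lambda>_. ?om"])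
      fix r assume r: "0 \<le> r" "r \<le> e"
      have l: "((\<lambda>r. x + r) has_real_derivative 1) (at r)" "((\<lambda>r. x - r) has_real_derivative -1) (at r)"
        by (auto intro!: derivative_eq_intros)
      show "((\<lambda>r. Th (x + r) - 2 * Th x + Th (x - r)) has_real_derivative h (x + r) - h (x - r)) (at r)"
        using DERIV_add[OF DERIV_diff[OF DERIV_chain'[OF l(1) Th] DERIV_const[of "2 * Th x"]] DERIV_chain'[OF l(2) Th]]
        by simp
      show "((*) ?om has_real_derivative ?om) (at r)" by (auto intro!: derivative_eq_intros)
      have "\<bar>2 * r\<bar> \<le> 2 * e" using r by simp
      from resolves_source_oscillation[OF assms(1-3) f u this, of "x - r"]
      show "\<bar>h (x + r) - h (x - r)\<bar> \<le> ?om" by (simp add: h_def add.commute)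
    qed (use assms in auto)
    then have 1: "\<bar>Th (x + e) - 2 * Th x + Th (x - e)\<bar> \<le> M * (Cres lam - 1) * e\<^sup>2"
      by (simp add: power2_eq_square algebra_simps)
    have "\<bar>u' x\<bar> * (e\<^sup>2 * (1 + e\<^sup>2 * lam)) = \<bar>Th (x + e) - 2 * Th x + Th (x - e)\<bar>"
      using el \<open>0 < e\<close> by (simp add: u'_def)
    then have "\<bar>u' x\<bar> * e\<^sup>2 * (1 + e\<^sup>2 * lam) \<le> M * (Cres lam - 1) * e\<^sup>2" using 1 by (simp add: mult.assoc)
    moreover have "\<bar>u' x\<bar> * e\<^sup>2 * 1 \<le> \<bar>u' x\<bar> * e\<^sup>2 * (1 + e\<^sup>2 * lam)"
      using assms by (intro mult_left_mono) auto
    ultimately have "\<bar>u' x\<bar> * e\<^sup>2 \<le> M * (Cres lam - 1) * e\<^sup>2" by linarith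
    then have "\<bar>u' x\<bar> \<le> M * (Cres lam - 1)" using \<open>0 < e\<close> by simp
    also have "\<dots> \<le> Cres lam * M" using M0 by (simp add: algebra_simps)
    finally show ?thesis .
  qed
  show thesis by (rule that[OF d bcontfunI'[OF c b] b])
qed

text \<open>Averages commute with differentiation, so the derivative of the solution solves the problem with the differentiated source.\<close>
lemma resolves_commutes_derivative:
  assumes "0 < e" "e \<le> 1" "0 < lam" and f: "f \<in> bcontfun" and u: "resolves lam e f u"
    and f': "f' \<in> bcontfun" "\<And>x. (f has_real_derivative f' x) (at x)"
  obtains u' where "\<And>x. (u has_real_derivative u' x) (at x)" "resolves lam e f' u'"
proof -
  obtain M where M: "\<And>x. \<bar>f x\<bar> \<le> M" using bcontfunD(3)[OF f] by metis
  obtain u' where u': "\<And>x. (u has_real_derivative u' x) (at x)" "u' \<in> bcontfun"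
    using resolves_derivative[OF assms(1-3) f M u] by metis
  have c: "continuous_on UNIV (\<lambda>y. u' y + e\<^sup>2 * f' y)"
    using bcontfunD(1)[OF u'(2)] bcontfunD(1)[OF f'(1)] by (intro continuous_intros)
  have "(1 + e\<^sup>2 * lam) * u' x = tent_avg e (\<lambda>y. u' y + e\<^sup>2 * f' y) x" for x
  proof (rule DERIV_unique)
    show "((\<lambda>x. (1 + e\<^sup>2 * lam) * u x) has_real_derivative (1 + e\<^sup>2 * lam) * u' x) (at x)"
      by (rule DERIV_cmult[OF u'(1)])
    have "(\<lambda>x. (1 + e\<^sup>2 * lam) * u x) = tent_avg e (\<lambda>y. u y + e\<^sup>2 * f y)"
      using u by (auto simp: resolves_def)
    moreover have "(tent_avg e (\<lambda>y. u y + e\<^sup>2 * f y) has_real_derivative tent_avg e (\<lambda>y. u' y + e\<^sup>2 * f' y) x) (at x)"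
      by (intro tent_avg_deriv \<open>0 < e\<close> c DERIV_add DERIV_cmult u' f')
    ultimately show "((\<lambda>x. (1 + e\<^sup>2 * lam) * u x) has_real_derivative tent_avg e (\<lambda>y. u' y + e\<^sup>2 * f' y) x) (at x)"
      by simp
  qed
  with u' show thesis by (intro that[of u']) (auto simp: resolves_def)
qed

text \<open>The function \<open>k\<close> is the second-order quotient \<open>12 (T\<^sub>e - 1) e\<^sup>-\<^sup>2\<close> applied to a double primitive of \<open>u + e\<^sup>2 f\<close>. Its second
  derivative is computed exactly from the equation, while Taylor expansion places it close to \<open>u\<close>. In this way
  \<open>u\<close> is compared with a solution of a differential equation without a bound on its second derivative.\<close>
lemma resolves_near_second_order:
  assumes "0 < e" "e \<le> 1" "0 < lam" and f: "f \<in> bcontfun" "\<And>x. \<bar>f x\<bar> \<le> M" and u: "resolves lam e f u"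
  obtains k k' where "\<And>x. (k has_real_derivative k' x) (at x)"
    "\<And>x. (k' has_real_derivative 12 * (lam * u x - f x)) (at x)"
    "\<And>x. \<bar>k x - u x\<bar> \<le> Cres lam * M * e"
    "(\<And>x. f (- x) = f x) \<Longrightarrow> k' 0 = 0"
proof -
  have M0: "0 \<le> M" using f(2)[of 0] by linarith
  have ub: "u \<in> bcontfun" using u by (simp add: resolves_def)
  define h where "h y = u y + e\<^sup>2 * f y" for y
  have hb: "h \<in> bcontfun" using bcontfun_lincomb[OF ub f(1), of 1 "e\<^sup>2"] by (simp add: h_def[abs_def])
  obtain Th where Th: "\<And>x. (Th has_real_derivative h x) (at x)" "Th 0 = 0"
    using exists_antiderivative[OF bcontfunD(1)[OF hb]] by blast
  have cTh: "continuous_on UNIV Th"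
    using Th by (meson DERIV_isCont continuous_at_imp_continuous_on)
  obtain Ph where Ph: "\<And>x. (Ph has_real_derivative Th x) (at x)"
    using exists_antiderivative[OF cTh] by blast
  define k where "k x = 12 * (tent_avg e Ph x - Ph x) / e\<^sup>2" for x
  define k' where "k' x = 12 * (tent_avg e Th x - Th x) / e\<^sup>2" for x
  have 1: "(k has_real_derivative k' x) (at x)" for x
    unfolding k_def[abs_def] k'_def
    by (intro DERIV_cdivide DERIV_cmult DERIV_diff tent_avg_deriv \<open>0 < e\<close> cTh Ph)
  have "(k' has_real_derivative 12 * (tent_avg e h x - h x) / e\<^sup>2) (at x)" for x
    unfolding k'_def[abs_def]
    by (intro DERIV_cdivide DERIV_cmult DERIV_diff tent_avg_deriv \<open>0 < e\<close> bcontfunD(1)[OF hb] Th)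
  moreover have "12 * (tent_avg e h x - h x) / e\<^sup>2 = 12 * (lam * u x - f x)" for x
  proof -
    have "tent_avg e h x = (1 + e\<^sup>2 * lam) * u x" using u by (simp add: resolves_def h_def[abs_def])
    then show ?thesis using \<open>0 < e\<close> by (simp add: h_def field_simps)
  qed
  ultimately have 2: "(k' has_real_derivative 12 * (lam * u x - f x)) (at x)" for x by simp
  have 3: "\<bar>k x - u x\<bar> \<le> Cres lam * M * e" for x
  proof -
    have "\<bar>k x - h x\<bar> \<le> M * e * (Cres lam - 1)"
      unfolding k_def
    proof (rule tent_avg_taylor[OF \<open>0 < e\<close> Th(1) Ph])
      fix s assume "\<bar>s\<bar> \<le> e"
      then show "\<bar>h (x + s) - h x\<bar> \<le> M * e * (Cres lam - 1)"
        unfolding h_def using \<open>0 < e\<close> by (intro resolves_source_oscillation[OF assms(1-3) f u]) auto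
    qed
    moreover have "\<bar>h x - u x\<bar> \<le> e * M"
    proof -
      have "e\<^sup>2 \<le> e" using assms by (simp add: power2_eq_square mult_left_le)
      then show ?thesis using mult_mono[OF _ f(2), of "e\<^sup>2" e x] assms(1) by (simp add: h_def abs_mult)
    qed
    moreover have "M * e * (Cres lam - 1) + e * M = Cres lam * M * e" by (simp add: algebra_simps)
    ultimately show ?thesis by linarith
  qed
  have 4: "k' 0 = 0" if ev: "\<And>x. f (- x) = f x"
  proof -
    have hev: "h (- x) = h x" for x
      using resolves_even[OF assms(1,3) f(1) u ev] ev by (simp add: h_def)
    have "((\<lambda>x. Th (- x) + Th x) has_real_derivative 0) (at x)" for x
    proof -
      have l: "((\<lambda>r. - r) has_real_derivative -1) (at x)" by (auto intro!: derivative_eq_intros)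
      show ?thesis using DERIV_add[OF DERIV_chain'[OF l Th(1)] Th(1)[of x]] hev by simp
    qed
    then have "Th (- x) + Th x = Th (- 0) + Th 0" for x
      using DERIV_isconst_all[of "\<lambda>x. Th (- x) + Th x"] by blast
    then have o: "Th (- x) = - Th x" for x using Th(2) by (simp add: eq_neg_iff_add_eq_0)
    have "tent_avg e Th 0 = tent_avg e (\<lambda>y. Th (0 - y)) 0" by (simp only: tent_avg_reflect) simp
    also have "\<dots> = - tent_avg e Th 0" by (simp add: o tent_avg_def)
    finally show ?thesis by (simp add: k'_def Th(2))
  qed
  show thesis by (rule that[OF 1 2 3 4])
qed

section \<open>The ground state\<close>

lemma has_derivative_continuous_on_UNIV:
  assumes "\<And>x. (f has_real_derivative f' x) (at x)"
  shows "continuous_on UNIV f"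
  using assms by (meson DERIV_isCont continuous_at_imp_continuous_on)

text \<open>Comparison on the whole line: \<open>k - del x\<^sup>2\<close> attains a maximum, the second derivative is nonpositive there, and \<open>del\<close>
  tends to zero afterwards.\<close>
lemma bounded_solution_le:
  fixes k k' r :: "real \<Rightarrow> real"
  assumes k: "\<And>x. (k has_real_derivative k' x) (at x)"
    and k': "\<And>x. (k' has_real_derivative c * k x + r x) (at x)"
    and r: "\<And>x. \<bar>r x\<bar> \<le> c * m" and "0 < c" and K: "\<And>x. \<bar>k x\<bar> \<le> K"
  shows "k x \<le> m"
proof (rule field_le_epsilon)
  fix \<eta> :: real assume "0 < \<eta>"
  (* The correction contributes del * x^2 at the point of evaluation and 2 * del / c through the second derivative at the maximum. *)
  define del where "del = \<eta> / (x\<^sup>2 + 2 / c)"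
  have pos: "0 < x\<^sup>2 + 2 / c" using \<open>0 < c\<close> by (simp add: add_nonneg_pos)
  then have del: "0 < del" "del * (x\<^sup>2 + 2 / c) = \<eta>" using \<open>0 < \<eta>\<close> by (auto simp: del_def)
  define g where "g y = k y - del * y\<^sup>2" for y
  have g: "(g has_real_derivative k' y - 2 * del * y) (at y)" for y
    unfolding g_def[abs_def] using DERIV_diff[OF k DERIV_cmult[OF DERIV_pow[of 2 y UNIV], of del]] by (simp add: mult.assoc mult.left_commute)
  have g': "((\<lambda>y. k' y - 2 * del * y) has_real_derivative (c * k y + r y) - 2 * del) (at y)" for y
  proof -
    have "((\<lambda>y. 2 * del * y) has_real_derivative 2 * del) (at y)" by (auto intro!: derivative_eq_intros)
    from DERIV_diff[OF k' this] show ?thesis .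
  qed
  have K0: "0 \<le> K" using K[of 0] by linarith
  define R where "R = sqrt (2 * K / del) + 1"
  have R: "0 < R" using K0 del by (simp add: R_def add_nonneg_pos)
  have far: "g y < g 0" if "R < \<bar>y\<bar>" for y
  proof -
    have "(sqrt (2 * K / del))\<^sup>2 < \<bar>y\<bar>\<^sup>2"
      using that K0 del by (intro power_strict_mono) (auto simp: R_def)
    then have "2 * K < del * y\<^sup>2" using K0 del by (simp add: field_simps)
    then show ?thesis using K[of y] K[of 0] by (simp add: g_def)
  qed
  have "continuous_on {-R..R} g"
    using has_derivative_continuous_on_UNIV[OF g] continuous_on_subset by blast
  then obtain x0 where x0: "x0 \<in> {-R..R}" "\<And>y. y \<in> {-R..R} \<Longrightarrow> g y \<le> g x0"
    using continuous_attains_sup[of "{-R..R}" g] R by auto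
  have max: "g y \<le> g x0" for y
  proof (cases "\<bar>y\<bar> \<le> R")
    case False
    then show ?thesis using far[of y] x0(2)[of 0] R by force
  next
    case True
    then show ?thesis using x0(2)[of y] by (auto simp: abs_le_iff)
  qed
  have z: "k' x0 - 2 * del * x0 = 0"
    using DERIV_local_max[OF g, of 1 x0] max by auto
  have "(c * k x0 + r x0) - 2 * del \<le> 0"
  proof (rule ccontr)
    assume "\<not> ?thesis"
    then obtain d where d: "0 < d" "\<And>h. 0 < h \<Longrightarrow> h < d \<Longrightarrow> k' x0 - 2 * del * x0 < k' (x0 + h) - 2 * del * (x0 + h)"
      using DERIV_pos_inc_right[OF g'[of x0]] by auto
    obtain z where z': "x0 < z" "z < x0 + d / 2" "g (x0 + d / 2) - g x0 = (x0 + d / 2 - x0) * (k' z - 2 * del * z)"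
      using MVT2[of x0 "x0 + d / 2" g, OF _ g] d(1) by auto
    have "0 < k' z - 2 * del * z" using d(2)[of "z - x0"] z z' d(1) by auto
    then have "0 < g (x0 + d / 2) - g x0" unfolding z'(3) using d(1) by simp
    then show False using max[of "x0 + d / 2"] by simp
  qed
  then have "c * k x0 \<le> c * (m + 2 * del / c)"
    using r[of x0] \<open>0 < c\<close> by (simp add: distrib_left abs_le_iff)
  then have "k x0 \<le> m + 2 * del / c" using \<open>0 < c\<close> by simp
  moreover have "k x - del * x\<^sup>2 \<le> k x0 - del * x0\<^sup>2" using max[of x] by (simp add: g_def)
  moreover have "0 \<le> del * x0\<^sup>2" using del by simp
  moreover have "del * x\<^sup>2 + 2 * del / c = \<eta>" using del(2) by (simp add: algebra_simps)
  ultimately show "k x \<le> m + \<eta>" by linarith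
qed

lemma bounded_solution_abs_le:
  fixes k k' r :: "real \<Rightarrow> real"
  assumes k: "\<And>x. (k has_real_derivative k' x) (at x)"
    and k': "\<And>x. (k' has_real_derivative c * k x + r x) (at x)"
    and r: "\<And>x. \<bar>r x\<bar> \<le> c * m" and "0 < c" and K: "\<And>x. \<bar>k x\<bar> \<le> K"
  shows "\<bar>k x\<bar> \<le> m"
proof -
  have "- k x \<le> m"
  proof (rule bounded_solution_le[where r="\<lambda>x. - r x" and c=c and K=K and k="\<lambda>x. - k x" and k'="\<lambda>x. - k' x"])
    show "((\<lambda>x. - k x) has_real_derivative - k' x) (at x)" for x by (rule DERIV_minus[OF k])
    show "((\<lambda>x. - k' x) has_real_derivative c * - k x + - r x) (at x)" for x
      using DERIV_minus[OF k'[of x]] by simp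
  qed (use r \<open>0 < c\<close> K in auto)
  moreover have "k x \<le> m" by (rule bounded_solution_le[OF k k' r \<open>0 < c\<close> K])
  ultimately show ?thesis by simp
qed

text \<open>Landau's inequality before optimising the step \<open>h\<close>.\<close>
lemma deriv_le_difference_quotient:
  fixes f f' f'' :: "real \<Rightarrow> real"
  assumes f: "\<And>s. x \<le> s \<Longrightarrow> s \<le> x + h \<Longrightarrow> (f has_real_derivative f' s) (at s)"
    and f': "\<And>s. x \<le> s \<Longrightarrow> s \<le> x + h \<Longrightarrow> (f' has_real_derivative f'' s) (at s)"
    and M: "\<And>s. x \<le> s \<Longrightarrow> s \<le> x + h \<Longrightarrow> \<bar>f'' s\<bar> \<le> M" and "0 < h"
  shows "\<bar>f' x\<bar> \<le> \<bar>f (x + h) - f x\<bar> / h + h * M"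
proof -
  have M0: "0 \<le> M" using M[of x] \<open>0 < h\<close> by (meson abs_ge_zero less_add_same_cancel1 less_imp_le order_refl order_trans)
  obtain z where z: "x < z" "z < x + h" "f (x + h) - f x = (x + h - x) * f' z"
    using MVT2[of x "x + h" f f'] f \<open>0 < h\<close> by auto
  have "\<bar>f' z - f' x\<bar> \<le> M * z - M * x"
  proof (rule abs_diff_le_of_deriv[where f'=f'' and g'="\<lambda>_. M"])
    show "((*) M has_real_derivative M) (at s)" for s by (auto intro!: derivative_eq_intros)
  qed (use z f' M in auto)
  also have "\<dots> \<le> M * h" using z M0 by (simp add: mult_left_mono flip: right_diff_distrib)
  finally have "\<bar>f' x\<bar> \<le> \<bar>f' z\<bar> + h * M" unfolding mult.commute[of M h] by linarith
  moreover have "f' z = (f (x + h) - f x) / h" using z(3) \<open>0 < h\<close> by simp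
  ultimately show ?thesis using \<open>0 < h\<close> by simp
qed

lemma tendsto_deriv_zero:
  fixes f f' f'' :: "real \<Rightarrow> real"
  assumes f: "\<And>x. (f has_real_derivative f' x) (at x)"
    and f': "\<And>x. (f' has_real_derivative f'' x) (at x)"
    and M: "\<And>x. \<bar>f'' x\<bar> \<le> M" and lim: "(f \<longlongrightarrow> 0) at_top"
  shows "(f' \<longlongrightarrow> 0) at_top"
proof (rule tendstoI)
  fix r :: real assume "0 < r"
  have M0: "0 \<le> M" using M[of 0] by linarith
  define h where "h = r / 2 / (M + 1)"
  have h: "0 < h" using \<open>0 < r\<close> M0 by (simp add: h_def)
  have hM: "h * M < r / 2"
  proof -
    have "h * M < h * (M + 1)" using h by simp
    also have "\<dots> = r / 2"
    proof -
      have "M + 1 \<noteq> 0" using M0 by simp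
      then show ?thesis unfolding h_def by (metis nonzero_mult_div_cancel_right times_divide_eq_left)
    qed
    finally show ?thesis .
  qed
  have "\<forall>\<^sub>F x in at_top. \<bar>f x\<bar> < h * r / 8"
    using tendstoD[OF lim, of "h * r / 8"] h \<open>0 < r\<close> by (simp add: dist_real_def)
  then obtain N where N: "\<And>x. N \<le> x \<Longrightarrow> \<bar>f x\<bar> < h * r / 8"
    by (auto simp: eventually_at_top_linorder)
  show "\<forall>\<^sub>F x in at_top. dist (f' x) 0 < r"
    unfolding eventually_at_top_linorder
  proof (intro exI allI impI)
    fix x assume "N \<le> x"
    then have "\<bar>f (x + h) - f x\<bar> \<le> h * r / 4" using N[of x] N[of "x + h"] h by linarith
    then have "\<bar>f (x + h) - f x\<bar> / h \<le> (h * r / 4) / h" using h by (intro divide_right_mono) auto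
    also have "\<dots> = r / 4" using h by simp
    finally have "\<bar>f (x + h) - f x\<bar> / h \<le> r / 4" .
    moreover have "\<bar>f' x\<bar> \<le> \<bar>f (x + h) - f x\<bar> / h + h * M"
      by (rule deriv_le_difference_quotient[OF f f' M h])
    ultimately have "\<bar>f' x\<bar> \<le> r / 4 + h * M" by linarith
    then show "dist (f' x) 0 < r" using hM \<open>0 < r\<close> by (simp add: dist_real_def)
  qed
qed

text \<open>A Lipschitz function that stays above \<open>r\<close> at \<open>x\<close> stays above \<open>r / 2\<close> on an interval of fixed length, whereas the integrals of
  the square over intervals moving to infinity tend to zero by dominated convergence.\<close>
lemma square_integrable_lipschitz_tendsto_zero:
  fixes g g' :: "real \<Rightarrow> real"
  assumes g: "\<And>x. (g has_real_derivative g' x) (at x)" and L: "\<And>x. \<bar>g' x\<bar> \<le> L"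
    and i: "integrable lborel (\<lambda>x. (g x)\<^sup>2)"
  shows "(g \<longlongrightarrow> 0) at_top"
proof (rule tendstoI)
  fix r :: real assume "0 < r"
  have L0: "0 \<le> L" using L[of 0] by linarith
  (* Over a step s a function with Lipschitz constant L changes by at most r / 2. *)
  define s where "s = r / 2 / (L + 1)"
  have s: "0 < s" using \<open>0 < r\<close> L0 by (simp add: s_def)
  have Ls: "L * s \<le> r / 2"
  proof -
    have "L * s \<le> (L + 1) * s" using s by simp
    also have "\<dots> = r / 2"
    proof -
      have "L + 1 \<noteq> 0" using L0 by simp
      then show ?thesis unfolding s_def by (metis nonzero_mult_div_cancel_left times_divide_eq_right)
    qed
    finally show ?thesis .
  qed
  have lip: "\<bar>g t - g x\<bar> \<le> L * t - L * x" if "x \<le> t" for x t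
  proof (rule abs_diff_le_of_deriv[OF that, where f'=g' and g'="\<lambda>_. L"])
    show "((*) L has_real_derivative L) (at s)" for s by (auto intro!: derivative_eq_intros)
  qed (use g L in auto)
  have [measurable]: "g \<in> borel_measurable borel"
    by (intro borel_measurable_continuous_onI has_derivative_continuous_on_UNIV[OF g])
  have "((\<lambda>x. LINT t|lborel. indicator {x..x + s} t * (g t)\<^sup>2) \<longlongrightarrow> integral\<^sup>L lborel (\<lambda>t::real. 0::real)) at_top"
  proof (rule integral_dominated_convergence_at_top[where s="\<lambda>x t. indicator {x..x + s} t * (g t)\<^sup>2" and f="\<lambda>_. 0" and w="\<lambda>t. (g t)\<^sup>2" and M=lborel])
    show "AE t in lborel. ((\<lambda>x. indicator {x..x + s} t * (g t)\<^sup>2) \<longlongrightarrow> (0::real)) at_top"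
    proof (rule AE_I2)
      fix t :: real
      have "\<forall>\<^sub>F x in at_top. indicator {x..x + s} t * (g t)\<^sup>2 = 0"
        using eventually_gt_at_top[of t] by eventually_elim (auto simp: indicator_def)
      then show "((\<lambda>x. indicator {x..x + s} t * (g t)\<^sup>2) \<longlongrightarrow> 0) at_top"
        by (rule tendsto_eventually)
    qed
    show "\<forall>\<^sub>F x in at_top. AE t in lborel. norm (indicator {x..x + s} t * (g t)\<^sup>2) \<le> (g t)\<^sup>2"
      by (intro always_eventually allI AE_I2) (auto simp: indicator_def)
  qed (use i in auto)
  then have "\<forall>\<^sub>F x in at_top. dist (LINT t|lborel. indicator {x..x + s} t * (g t)\<^sup>2) 0 < s * (r / 2)\<^sup>2"
    using tendstoD[of _ _ _ "s * (r / 2)\<^sup>2"] s \<open>0 < r\<close> by force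
  then show "\<forall>\<^sub>F x in at_top. dist (g x) 0 < r"
  proof eventually_elim
    case (elim x)
    show ?case
    proof (rule ccontr)
      assume "\<not> dist (g x) 0 < r"
      then have gx: "r \<le> \<bar>g x\<bar>" by (simp add: dist_real_def)
      have pt: "indicator {x..x + s} t * (r / 2)\<^sup>2 \<le> indicator {x..x + s} t * (g t)\<^sup>2" for t
      proof (cases "t \<in> {x..x + s}")
        case True
        then have "L * t - L * x \<le> L * s" using L0 by (simp add: mult_left_mono flip: right_diff_distrib)
        then have "r / 2 \<le> \<bar>g t\<bar>" using lip[of x t] True gx Ls by auto
        then have "(r / 2)\<^sup>2 \<le> \<bar>g t\<bar>\<^sup>2" using \<open>0 < r\<close> by (intro power_mono) auto
        then show ?thesis using True by simp
      qed auto
      have "s * (r / 2)\<^sup>2 = (LINT t|lborel. indicator {x..x + s} t * (r / 2)\<^sup>2)"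
        using s by simp
      also have "\<dots> \<le> (LINT t|lborel. indicator {x..x + s} t * (g t)\<^sup>2)"
      proof (rule integral_mono[OF _ _ pt])
        show "integrable lborel (\<lambda>t. indicator {x..x + s} t * (r / 2)\<^sup>2)"
          by (intro integrable_mult_left integrable_real_indicator) (auto simp: emeasure_lborel_Icc_eq)
        show "integrable lborel (\<lambda>t. indicator {x..x + s} t * (g t)\<^sup>2)"
          by (rule Bochner_Integration.integrable_bound[OF i]) (auto simp: indicator_def)
      qed
      finally show False using elim by (simp add: dist_real_def)
    qed
  qed
qed

lemma antimono_tendsto_zero_nonneg:
  fixes f f' :: "real \<Rightarrow> real"
  assumes f: "\<And>x. a \<le> x \<Longrightarrow> (f has_real_derivative f' x) (at x)"
    and le: "\<And>x. a \<le> x \<Longrightarrow> f' x \<le> 0" and lim: "(f \<longlongrightarrow> 0) at_top" and "a \<le> x"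
  shows "0 \<le> f x"
proof (rule tendsto_upperbound[OF lim])
  show "\<forall>\<^sub>F y in at_top. f y \<le> f x"
    using eventually_ge_at_top[of x]
  proof eventually_elim
    case (elim y)
    show ?case
      by (rule DERIV_nonpos_imp_nonincreasing[OF elim]) (use \<open>a \<le> x\<close> f le in \<open>meson order_trans\<close>)
  qed
qed simp

lemma bounded_from_tail:
  fixes f :: "real \<Rightarrow> real"
  assumes "continuous_on UNIV f" "\<And>x. x0 \<le> x \<Longrightarrow> \<bar>f x\<bar> \<le> C1"
  obtains C where "0 < C" "\<And>x. 0 \<le> x \<Longrightarrow> \<bar>f x\<bar> \<le> C"
proof -
  have "compact (f ` {0..x0})"
    using assms(1) continuous_on_subset by (intro compact_continuous_image) blast+
  then obtain B where B: "\<And>x. x \<in> {0..x0} \<Longrightarrow> \<bar>f x\<bar> \<le> B"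
    using compact_imp_bounded by (fastforce simp: bounded_iff)
  have "\<bar>f x\<bar> \<le> \<bar>B\<bar> + \<bar>C1\<bar> + 1" if "0 \<le> x" for x
    using B[of x] assms(2)[of x] that by (cases "x \<le> x0") auto
  then show thesis by (intro that[of "\<bar>B\<bar> + \<bar>C1\<bar> + 1"]) auto
qed

text \<open>The strict inequality that excludes a common zero of \<open>W'\<close> and \<open>W''\<close>.\<close>
lemma u_log_u_less: "(1 + u) * ln (1 + u) < u + u\<^sup>2 / 2" if "0 < u" for u :: real
proof -
  have "(\<lambda>t. t + t\<^sup>2 / 2 - (1 + t) * ln (1 + t)) 0 < (\<lambda>t. t + t\<^sup>2 / 2 - (1 + t) * ln (1 + t)) u"
  proof (rule DERIV_pos_imp_increasing_open[OF that])
    fix x :: real assume x: "0 < x" "x < u"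
    have "((\<lambda>t. t + t\<^sup>2 / 2 - (1 + t) * ln (1 + t)) has_real_derivative x - ln (1 + x)) (at x)"
      using x by (auto intro!: derivative_eq_intros)
    moreover have "0 < x - ln (1 + x)" using ln_add_one_self_less_self[OF x(1)] by simp
    ultimately show "\<exists>y. ((\<lambda>t. t + t\<^sup>2 / 2 - (1 + t) * ln (1 + t)) has_real_derivative y) (at x) \<and> 0 < y" by blast
  qed (auto intro!: continuous_intros)
  then show ?thesis by simp
qed

locale ground_state =
  fixes lam :: real and W :: "real \<Rightarrow> real"
  assumes lam: "1 < lam" and gs: "log_KdV_ground_state lam W"
begin

definition F0 :: "real \<Rightarrow> real" where "F0 u = (1 + u) * ln (1 + u)"
definition W1 :: "real \<Rightarrow> real" where "W1 = deriv W"
text \<open>The second derivative of \<open>W\<close>, taken from the profile equation so that further derivatives are explicit.\<close>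
definition W2 :: "real \<Rightarrow> real" where "W2 x = 12 * (lam * W x - F0 (W x))"
text \<open>The potential of the linearised equation \<open>d'' + Q d = 0\<close>, solved by \<open>W'\<close>.\<close>
definition Q :: "real \<Rightarrow> real" where "Q x = 12 * (1 + ln (1 + W x) - lam)"

lemma W_pos: "0 < W x" and W_even: "W (- x) = W x" and W_smooth: "smooth W"
  and W_L2: "integrable lborel (\<lambda>x. (W x)\<^sup>2)"
  using gs by (auto simp: log_KdV_ground_state_def H_infinity_def Sobolev_H_def L2_def)

lemma W_deriv: "(W has_real_derivative W1 x) (at x)"
  using W_smooth unfolding smooth_def W1_def
  by (metis DERIV_deriv_iff_real_differentiable funpow_0)

lemma W1_deriv: "(W1 has_real_derivative W2 x) (at x)"
proof -
  have "(deriv ^^ 1) W differentiable (at x)" using W_smooth unfolding smooth_def by blast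
  then have "(W1 has_real_derivative deriv W1 x) (at x)"
    by (simp add: W1_def DERIV_deriv_iff_real_differentiable)
  moreover have "deriv W1 x = (deriv ^^ 2) W x" by (simp add: W1_def numeral_2_eq_2)
  moreover have "(deriv ^^ 2) W x = W2 x"
    using gs by (simp add: log_KdV_ground_state_def W2_def F0_def field_simps)
  ultimately show ?thesis by simp
qed

lemma F0_nonneg: "0 \<le> u \<Longrightarrow> 0 \<le> F0 u" and F0_le: "0 \<le> u \<Longrightarrow> F0 u \<le> u * (1 + u)"
proof -
  assume u: "0 \<le> u"
  have l: "0 \<le> ln (1 + u)" "ln (1 + u) \<le> u" using u ln_add_one_self_le_self by auto
  then show "0 \<le> F0 u" using u by (simp add: F0_def)
  have "(1 + u) * ln (1 + u) \<le> (1 + u) * u" using l u by (intro mult_left_mono) auto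
  then show "F0 u \<le> u * (1 + u)" by (simp add: F0_def mult.commute)
qed

lemma W2_deriv: "(W2 has_real_derivative - Q x * W1 x) (at x)"
proof -
  have n: "1 + W x \<noteq> 0" using W_pos[of x] by linarith
  have "((\<lambda>x. 12 * (lam * W x - (1 + W x) * ln (1 + W x))) has_real_derivative
      12 * (lam * W1 x - ((0 + W1 x) * ln (1 + W x) + inverse (1 + W x) * (0 + W1 x) * (1 + W x)))) (at x)"
    using W_pos[of x]
    by (intro DERIV_cmult DERIV_diff DERIV_mult DERIV_add DERIV_const W_deriv DERIV_chain'[OF _ DERIV_ln]) auto
  moreover have "12 * (lam * W1 x - ((0 + W1 x) * ln (1 + W x) + inverse (1 + W x) * (0 + W1 x) * (1 + W x))) = - Q x * W1 x"
  proof -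
    have "inverse (1 + W x) * (0 + W1 x) * (1 + W x) = W1 x" using n by simp
    then show ?thesis by (simp only: Q_def) (simp add: algebra_simps)
  qed
  ultimately show ?thesis by (simp only: W2_def[abs_def] F0_def)
qed

text \<open>The primitive of \<open>(1 + u) log (1 + u)\<close> that vanishes at the origin, so that the profile equation has an energy integral.\<close>
definition Phi :: "real \<Rightarrow> real" where "Phi u = (1 + u)\<^sup>2 * ln (1 + u) / 2 - ((1 + u)\<^sup>2 - 1) / 4"

lemma energy_constant: "(W1 x)\<^sup>2 / 24 - lam * (W x)\<^sup>2 / 2 + Phi (W x) = (W1 0)\<^sup>2 / 24 - lam * (W 0)\<^sup>2 / 2 + Phi (W 0)"
proof -
  have "((\<lambda>x. (W1 x)\<^sup>2 / 24 - lam * (W x)\<^sup>2 / 2 + Phi (W x)) has_real_derivative 0) (at x)" for x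
  proof -
    define v where "v = W x"
    have v: "0 < v" using W_pos[of x] by (simp add: v_def)
    have d2: "((\<lambda>u. (1 + u)\<^sup>2) has_real_derivative 2 * (1 + v)) (at v)"
      by (auto intro!: derivative_eq_intros)
    have dl: "((\<lambda>u. ln (1 + u)) has_real_derivative 1 / (1 + v)) (at v)"
      using v by (auto intro!: derivative_eq_intros)
    have "1 / (1 + v) * (1 + v)\<^sup>2 = 1 + v" using v by (simp add: power2_eq_square)
    then have "(2 * (1 + v) * ln (1 + v) + 1 / (1 + v) * (1 + v)\<^sup>2) / 2 - (2 * (1 + v) - 0) / 4 = (1 + v) * ln (1 + v)"
      by (simp add: field_simps)
    then have "(Phi has_real_derivative F0 (W x)) (at (W x))"
      using DERIV_diff[OF DERIV_cdivide[OF DERIV_mult[OF d2 dl], of 2] DERIV_cdivide[OF DERIV_diff[OF d2 DERIV_const[of 1]], of 4]]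
      unfolding Phi_def[abs_def] F0_def v_def[symmetric] by simp
    from DERIV_chain'[OF W_deriv this]
    have "((\<lambda>x. Phi (W x)) has_real_derivative F0 (W x) * W1 x) (at x)" .
    moreover have "((\<lambda>x. (W1 x)\<^sup>2) has_real_derivative 2 * W1 x * W2 x) (at x)"
      "((\<lambda>x. (W x)\<^sup>2) has_real_derivative 2 * W x * W1 x) (at x)"
      by (auto intro!: derivative_eq_intros W_deriv W1_deriv)
    ultimately have "((\<lambda>x. (W1 x)\<^sup>2 / 24 - lam * (W x)\<^sup>2 / 2 + Phi (W x)) has_real_derivative
       2 * W1 x * W2 x / 24 - lam * (2 * W x * W1 x) / 2 + F0 (W x) * W1 x) (at x)"
      by (intro DERIV_add DERIV_diff DERIV_cdivide DERIV_cmult)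
    moreover have "2 * W1 x * W2 x / 24 - lam * (2 * W x * W1 x) / 2 + F0 (W x) * W1 x = 0"
      by (simp add: W2_def field_simps)
    ultimately show ?thesis by simp
  qed
  then show ?thesis
    using DERIV_isconst_all[of "\<lambda>x. (W1 x)\<^sup>2 / 24 - lam * (W x)\<^sup>2 / 2 + Phi (W x)"] by blast
qed

text \<open>The definition of the ground state gives only smoothness and square integrability. Boundedness follows from conservation of energy, because
  \<open>Phi\<close> grows faster than \<open>u\<^sup>2\<close>.\<close>
lemma W_bounded: "\<exists>B>0. \<forall>x. W x \<le> B"
proof -
  define E where "E = (W1 0)\<^sup>2 / 24 - lam * (W 0)\<^sup>2 / 2 + Phi (W 0)"
  (* Above this level ln (1 + W) exceeds 2 * lam + 2, and then Phi (W) alone exceeds lam * W^2 / 2 + E. *)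
  have "W x \<le> exp (2 * lam + 2) + \<bar>E\<bar>" for x
  proof (rule ccontr)
    assume a: "\<not> ?thesis"
    define u where "u = W x"
    have u: "exp (2 * lam + 2) < u" "\<bar>E\<bar> < u"
      using a by (auto simp: u_def) (smt (verit) exp_gt_zero)
    have u0: "0 < u" using W_pos by (simp add: u_def)
    have "2 * lam + 2 < ln u" using u u0 by (metis exp_less_cancel_iff exp_ln)
    also have "\<dots> \<le> ln (1 + u)" using u0 by simp
    finally have L: "2 * lam + 2 \<le> ln (1 + u)" by simp
    define S where "S = (1 + u)\<^sup>2"
    have "S * (2 * lam + 2) \<le> S * ln (1 + u)"
      by (rule mult_left_mono[OF L]) (simp add: S_def)
    moreover have "S * (2 * lam + 2) = 2 * (S * lam) + 2 * S" "S * (lam + 3 / 4) = S * lam + 3 / 4 * S"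
      by (simp_all add: distrib_left)
    moreover have "0 \<le> S" by (simp add: S_def)
    moreover have "c \<le> b / 2 - (S - 1) / 4"
      if "d \<le> b" "d = 2 * a + 2 * S" "c = a + 3 / 4 * S" "0 \<le> S" for a b c d S :: real
      using that by argo
    ultimately have "S * ln (1 + u) / 2 - (S - 1) / 4 \<ge> S * (lam + 3 / 4)" by blast
    then have "Phi u \<ge> (1 + u)\<^sup>2 * (lam + 3 / 4)" by (simp add: Phi_def S_def)
    moreover have "lam * u\<^sup>2 / 2 \<le> (1 + u)\<^sup>2 * lam"
    proof -
      have "u\<^sup>2 / 2 \<le> (1 + u)\<^sup>2" using u0 by (simp add: power2_eq_square algebra_simps)
      from mult_right_mono[OF this, of lam] lam show ?thesis by (simp add: mult.commute)
    qed
    moreover have "(1 + u)\<^sup>2 * (3 / 4) \<ge> u"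
    proof -
      have "(1 + u)\<^sup>2 = 1 + 2 * u + u\<^sup>2" "0 \<le> u\<^sup>2" by (simp_all add: power2_sum)
      then show ?thesis using u0 by argo
    qed
    moreover have "E = (W1 x)\<^sup>2 / 24 - lam * u\<^sup>2 / 2 + Phi u"
      unfolding E_def u_def by (rule energy_constant[symmetric])
    moreover have "(1 + u)\<^sup>2 * (lam + 3 / 4) = (1 + u)\<^sup>2 * lam + (1 + u)\<^sup>2 * (3 / 4)" by (simp add: distrib_left)
    moreover have "0 \<le> (W1 x)\<^sup>2 / 24" by simp
    ultimately have "u \<le> E" by linarith
    then show False using u by linarith
  qed
  then show ?thesis by (intro exI[of _ "exp (2 * lam + 2) + \<bar>E\<bar>"]) (auto simp: add_pos_nonneg)
qed

lemma W1_bounded: "\<exists>B. \<forall>x. \<bar>W1 x\<bar> \<le> B"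
proof -
  obtain B where B: "0 < B" "\<And>x. W x \<le> B" using W_bounded by auto
  define E where "E = (W1 0)\<^sup>2 / 24 - lam * (W 0)\<^sup>2 / 2 + Phi (W 0)"
  have "(W1 x)\<^sup>2 \<le> 24 * (\<bar>E\<bar> + lam * B\<^sup>2 / 2 + (1 + B)\<^sup>2 / 4)" for x
  proof -
    have "E = (W1 x)\<^sup>2 / 24 - lam * (W x)\<^sup>2 / 2 + Phi (W x)"
      unfolding E_def by (rule energy_constant[symmetric])
    moreover have "lam * (W x)\<^sup>2 / 2 \<le> lam * B\<^sup>2 / 2"
      using lam W_pos[of x] B by (intro divide_right_mono mult_left_mono power_mono) (auto simp: less_imp_le)
    moreover have "(1 + W x)\<^sup>2 \<le> (1 + B)\<^sup>2"
      using W_pos[of x] B by (intro power_mono) (auto simp: less_imp_le)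
    moreover have "- ((1 + W x)\<^sup>2 / 4) \<le> Phi (W x)"
    proof -
      have "0 \<le> (1 + W x)\<^sup>2 * ln (1 + W x)" using W_pos[of x] by (intro mult_nonneg_nonneg) auto
      moreover define S where "S = (1 + W x)\<^sup>2"
      ultimately have "- (S / 4) \<le> S * ln (1 + W x) / 2 - (S - 1) / 4" by (simp add: field_simps)
      then show ?thesis by (simp add: Phi_def S_def)
    qed
    moreover have "w \<le> 24 * (\<bar>E\<bar> + l + s / 4)" if "E = w / 24 - l' + P" "l' \<le> l" "t \<le> s" "- (t / 4) \<le> P"
      for w l l' s t P :: real using that by argo
    ultimately show ?thesis by blast
  qed
  then show ?thesis by (metis real_le_rsqrt power2_abs)
qed

lemma W2_bounded: "\<exists>B. \<forall>x. \<bar>W2 x\<bar> \<le> B"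
proof -
  obtain B where B: "0 < B" "\<And>x. W x \<le> B" using W_bounded by auto
  have "\<bar>W2 x\<bar> \<le> 12 * (lam * B + B * (1 + B))" for x
  proof -
    have "0 \<le> F0 (W x)" "F0 (W x) \<le> W x * (1 + W x)"
      using F0_nonneg F0_le W_pos[of x] by (auto simp: less_imp_le)
    moreover have "W x * (1 + W x) \<le> B * (1 + B)"
      using B(1) B(2)[of x] W_pos[of x] by (intro mult_mono) auto
    moreover have "0 \<le> lam * W x" "lam * W x \<le> lam * B" "0 \<le> lam * B" "0 \<le> B * (1 + B)"
      using B(1) B(2)[of x] W_pos[of x] lam by auto
    moreover have "\<bar>12 * (l - f)\<bar> \<le> 12 * (l' + g')"
      if "0 \<le> f" "f \<le> g" "g \<le> g'" "0 \<le> l" "l \<le> l'" "0 \<le> l'" "0 \<le> g'" for l f l' g g' :: real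
      using that by argo
    ultimately show ?thesis unfolding W2_def by blast
  qed
  then show ?thesis by blast
qed

lemma W_tendsto: "(W \<longlongrightarrow> 0) at_top"
  using W1_bounded square_integrable_lipschitz_tendsto_zero[OF W_deriv _ W_L2] by blast

lemma W1_tendsto: "(W1 \<longlongrightarrow> 0) at_top"
  using W2_bounded tendsto_deriv_zero[OF W_deriv W1_deriv _ W_tendsto] by blast

lemma W2_tendsto: "(W2 \<longlongrightarrow> 0) at_top"
proof -
  have "((\<lambda>x. 12 * (lam * W x - (1 + W x) * ln (1 + W x))) \<longlongrightarrow> 12 * (lam * 0 - (1 + 0) * ln (1 + 0))) at_top"
    by (intro tendsto_intros W_tendsto) auto
  then show ?thesis by (simp add: W2_def[abs_def] F0_def)
qed

text \<open>The conserved energy is evaluated at infinity, where \<open>W\<close> and \<open>W'\<close> vanish.\<close>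
lemma energy_zero: "(W1 x)\<^sup>2 / 24 - lam * (W x)\<^sup>2 / 2 + Phi (W x) = 0"
proof -
  have "((\<lambda>x. (W1 x)\<^sup>2 / 24 - lam * (W x)\<^sup>2 / 2 + ((1 + W x)\<^sup>2 * ln (1 + W x) / 2 - ((1 + W x)\<^sup>2 - 1) / 4)) \<longlongrightarrow>
     0\<^sup>2 / 24 - lam * 0\<^sup>2 / 2 + ((1 + 0)\<^sup>2 * ln (1 + 0) / 2 - ((1 + 0)\<^sup>2 - 1) / 4)) at_top"
    by (intro tendsto_intros W_tendsto W1_tendsto) auto
  then have "((\<lambda>x. (W1 x)\<^sup>2 / 24 - lam * (W x)\<^sup>2 / 2 + Phi (W x)) \<longlongrightarrow> 0) at_top"
    by (simp add: Phi_def)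
  moreover have "(\<lambda>y. (W1 y)\<^sup>2 / 24 - lam * (W y)\<^sup>2 / 2 + Phi (W y)) = (\<lambda>y. (W1 x)\<^sup>2 / 24 - lam * (W x)\<^sup>2 / 2 + Phi (W x))"
    using energy_constant by (metis (no_types, lifting))
  ultimately show ?thesis by (simp add: tendsto_const_iff)
qed

text \<open>At a common zero the equation gives \<open>F0 W = lam W\<close>, and the vanishing energy then fixes \<open>lam = 1 + W / 2\<close>; the two relations
  contradict the strict logarithmic inequality. Equivalently, \<open>W\<close> cannot meet a rest point of the flow.\<close>
lemma W1_W2_not_both_zero: "0 < (W1 x)\<^sup>2 + (W2 x)\<^sup>2"
proof (rule ccontr)
  assume "\<not> ?thesis"
  then have z: "W1 x = 0" "W2 x = 0" by (simp_all add: sum_power2_gt_zero_iff)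
  define u where "u = W x"
  have u: "0 < u" using W_pos by (simp add: u_def)
  have eq: "F0 u = lam * u" using z(2) by (simp add: W2_def u_def)
  have "Phi u = (1 + u) * F0 u / 2 - (2 * u + u\<^sup>2) / 4"
    by (simp add: Phi_def F0_def power2_eq_square algebra_simps)
  moreover have "Phi u = lam * u\<^sup>2 / 2" using energy_zero[of x] z(1) by (simp add: u_def)
  ultimately have "u * lam = u * (1 + u / 2)"
    unfolding eq by (simp add: power2_eq_square field_simps)
  then have "lam = 1 + u / 2" using u by simp
  then have "F0 u = u + u\<^sup>2 / 2" using eq by (simp add: power2_eq_square algebra_simps)
  then show False using u_log_u_less[OF u] by (simp add: F0_def)
qed

lemma W1_odd: "W1 (- x) = - W1 x"
proof -
  have l: "((\<lambda>r::real. - r) has_real_derivative -1) (at x)" by (auto intro!: derivative_eq_intros)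
  have "((\<lambda>r. W (- r)) has_real_derivative W1 (- x) * -1) (at x)" by (rule DERIV_chain'[OF l W_deriv])
  then have "(W has_real_derivative - W1 (- x)) (at x)" by (simp add: W_even)
  then show ?thesis using DERIV_unique[OF _ W_deriv] by fastforce
qed

lemma W1_zero: "W1 0 = 0" using W1_odd[of 0] by simp

lemma W2_even: "W2 (- x) = W2 x" by (simp add: W2_def W_even)

definition tail_rate :: real where "tail_rate = sqrt (6 * (lam - 1))"

lemma tail_rate_pos: "0 < tail_rate" using lam by (simp add: tail_rate_def)

text \<open>Once \<open>W\<close> is small, \<open>W''\<close> lies between two multiples of \<open>W\<close>. The expressions \<open>W'\<^sup>2 - c W\<^sup>2\<close> for the two constants are then
  monotone and vanish at infinity, which traps the logarithmic derivative of \<open>W\<close> without an exact asymptotic expansion.\<close>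
lemma tail:
  obtains x0 where "0 < x0" "\<And>x. x0 \<le> x \<Longrightarrow> tail_rate * W x \<le> - W1 x"
    "\<And>x. x0 \<le> x \<Longrightarrow> - W1 x \<le> sqrt (12 * lam) * W x"
    "\<And>x. x0 \<le> x \<Longrightarrow> \<bar>W2 x\<bar> \<le> 12 * lam * W x"
proof -
  (* Below this height F0 W <= (1 + lam) / 2 * W, whence W2 >= 6 * (lam - 1) * W. *)
  have "\<forall>\<^sub>F x in at_top. \<bar>W x\<bar> < (lam - 1) / 2"
    using tendstoD[OF W_tendsto, of "(lam - 1) / 2"] lam by (simp add: dist_real_def)
  then obtain X where X': "\<forall>x\<ge>X. \<bar>W x\<bar> < (lam - 1) / 2"
    by (auto simp: eventually_at_top_linorder)
  have X: "W x < (lam - 1) / 2" if "X \<le> x" for x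
    using X'[rule_format, OF that] by linarith
  define x0 where "x0 = max X 1"
  have W2_ge: "6 * (lam - 1) * W x \<le> W2 x" and W2_le: "W2 x \<le> 12 * lam * W x" if "x0 \<le> x" for x
  proof -
    have "W x < (lam - 1) / 2" using X[of x] that by (simp add: x0_def)
    then have "W x * (1 + W x) \<le> W x * (1 + (lam - 1) / 2)"
      using W_pos[of x] by (intro mult_left_mono) auto
    then have "F0 (W x) \<le> W x * (1 + (lam - 1) / 2)"
      using F0_le[of "W x"] W_pos[of x] by linarith
    then have "F0 (W x) \<le> (W x + lam * W x) / 2" by (simp add: field_simps)
    then have "6 * (lam * W x) - 6 * W x \<le> W2 x" by (simp add: W2_def)
    then show "6 * (lam - 1) * W x \<le> W2 x" by (simp add: algebra_simps)
    show "W2 x \<le> 12 * lam * W x" using F0_nonneg[of "W x"] W_pos[of x] by (simp add: W2_def)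
  qed
  have W2_nn: "0 \<le> W2 x" if "x0 \<le> x" for x
    using W2_ge[OF that] W_pos[of x] lam by (meson less_imp_le diff_ge_0_iff_ge mult_nonneg_nonneg order_trans zero_le_numeral)
  have W1_le: "W1 x \<le> 0" if "x0 \<le> x" for x
  proof -
    have "0 \<le> - W1 x"
    proof (rule antimono_tendsto_zero_nonneg[of x0 "\<lambda>x. - W1 x" "\<lambda>x. - W2 x", OF _ _ _ that])
      show "((\<lambda>x. - W1 x) has_real_derivative - W2 x) (at x)" for x by (rule DERIV_minus[OF W1_deriv])
      show "((\<lambda>x. - W1 x) \<longlongrightarrow> 0) at_top" using tendsto_minus[OF W1_tendsto] by simp
    qed (use W2_nn in auto)
    then show ?thesis by simp
  qed
  have lower: "0 \<le> (W1 x)\<^sup>2 - 6 * (lam - 1) * (W x)\<^sup>2" if "x0 \<le> x" for x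
  proof (rule antimono_tendsto_zero_nonneg[of x0 _ "\<lambda>x. 2 * (W1 x * (W2 x - 6 * (lam - 1) * W x))", OF _ _ _ that])
    show "((\<lambda>x. (W1 x)\<^sup>2 - 6 * (lam - 1) * (W x)\<^sup>2) has_real_derivative 2 * (W1 x * (W2 x - 6 * (lam - 1) * W x))) (at x)" for x
      by (auto intro!: derivative_eq_intros W_deriv W1_deriv simp: algebra_simps)
    show "2 * (W1 x * (W2 x - 6 * (lam - 1) * W x)) \<le> 0" if "x0 \<le> x" for x
      using W1_le[OF that] W2_ge[OF that] by (simp add: mult_nonpos_nonneg)
    have "((\<lambda>x. (W1 x)\<^sup>2 - 6 * (lam - 1) * (W x)\<^sup>2) \<longlongrightarrow> 0\<^sup>2 - 6 * (lam - 1) * 0\<^sup>2) at_top"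
      by (intro tendsto_intros W_tendsto W1_tendsto)
    then show "((\<lambda>x. (W1 x)\<^sup>2 - 6 * (lam - 1) * (W x)\<^sup>2) \<longlongrightarrow> 0) at_top" by simp
  qed
  have upper: "0 \<le> 12 * lam * (W x)\<^sup>2 - (W1 x)\<^sup>2" if "x0 \<le> x" for x
  proof (rule antimono_tendsto_zero_nonneg[of x0 _ "\<lambda>x. 2 * (W1 x * (12 * lam * W x - W2 x))", OF _ _ _ that])
    show "((\<lambda>x. 12 * lam * (W x)\<^sup>2 - (W1 x)\<^sup>2) has_real_derivative 2 * (W1 x * (12 * lam * W x - W2 x))) (at x)" for x
      by (auto intro!: derivative_eq_intros W_deriv W1_deriv simp: algebra_simps)
    show "2 * (W1 x * (12 * lam * W x - W2 x)) \<le> 0" if "x0 \<le> x" for x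
      using W1_le[OF that] W2_le[OF that] by (simp add: mult_nonpos_nonneg)
    have "((\<lambda>x. 12 * lam * (W x)\<^sup>2 - (W1 x)\<^sup>2) \<longlongrightarrow> 12 * lam * 0\<^sup>2 - 0\<^sup>2) at_top"
      by (intro tendsto_intros W_tendsto W1_tendsto)
    then show "((\<lambda>x. 12 * lam * (W x)\<^sup>2 - (W1 x)\<^sup>2) \<longlongrightarrow> 0) at_top" by simp
  qed
  show thesis
  proof (rule that[of x0])
    show "0 < x0" by (simp add: x0_def)
    fix x assume x: "x0 \<le> x"
    have "(tail_rate * W x)\<^sup>2 \<le> (- W1 x)\<^sup>2"
      using lower[OF x] lam by (simp add: tail_rate_def power_mult_distrib)
    then show "tail_rate * W x \<le> - W1 x" by (rule power2_le_imp_le) (use W1_le[OF x] in simp)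
    have "(- W1 x)\<^sup>2 \<le> (sqrt (12 * lam) * W x)\<^sup>2"
      using upper[OF x] lam by (simp add: power_mult_distrib)
    then show "- W1 x \<le> sqrt (12 * lam) * W x"
      by (rule power2_le_imp_le) (use W_pos[of x] lam in simp)
    show "\<bar>W2 x\<bar> \<le> 12 * lam * W x" using W2_nn[OF x] W2_le[OF x] by simp
  qed
qed

end

section \<open>Inverting the linearised operator on even functions\<close>

lemma odd_of_even_derivative:
  fixes f :: "real \<Rightarrow> real"
  assumes f: "\<And>x. (f has_real_derivative f' x) (at x)" and "f 0 = 0" and ev: "\<And>x. f' (- x) = f' x"
  shows "f (- x) = - f x"
proof -
  have "((\<lambda>x. f (- x) + f x) has_real_derivative 0) (at x)" for x
  proof -
    have l: "((\<lambda>r. - r) has_real_derivative -1) (at x)" by (auto intro!: derivative_eq_intros)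
    show ?thesis using DERIV_add[OF DERIV_chain'[OF l f] f[of x]] ev by simp
  qed
  then have "f (- x) + f x = f (- 0) + f 0"
    using DERIV_isconst_all[of "\<lambda>x. f (- x) + f x"] by blast
  then show ?thesis using \<open>f 0 = 0\<close> by simp
qed

lemma even_of_odd_derivative:
  fixes f :: "real \<Rightarrow> real"
  assumes f: "\<And>x. (f has_real_derivative f' x) (at x)" and od: "\<And>x. f' (- x) = - f' x"
  shows "f (- x) = f x"
proof -
  have "((\<lambda>x. f (- x) - f x) has_real_derivative 0) (at x)" for x
  proof -
    have l: "((\<lambda>r. - r) has_real_derivative -1) (at x)" by (auto intro!: derivative_eq_intros)
    show ?thesis using DERIV_diff[OF DERIV_chain'[OF l f] f[of x]] od by simp
  qed
  then have "f (- x) - f x = f (- 0) - f 0"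
    using DERIV_isconst_all[of "\<lambda>x. f (- x) - f x"] by blast
  then show ?thesis by simp
qed

context ground_state
begin

definition kernel_sq :: "real \<Rightarrow> real" where "kernel_sq x = (W1 x)\<^sup>2 + (W2 x)\<^sup>2"

lemma kernel_sq_pos: "0 < kernel_sq x" using W1_W2_not_both_zero by (simp add: kernel_sq_def)

lemma continuous_W: "continuous_on UNIV W" and continuous_W1: "continuous_on UNIV W1"
  and continuous_W2: "continuous_on UNIV W2" and continuous_Q: "continuous_on UNIV Q"
  and continuous_kernel_sq: "continuous_on UNIV kernel_sq"
proof -
  show 0: "continuous_on UNIV W" by (rule has_derivative_continuous_on_UNIV[OF W_deriv])
  show 1: "continuous_on UNIV W1" by (rule has_derivative_continuous_on_UNIV[OF W1_deriv])
  show 2: "continuous_on UNIV W2" by (rule has_derivative_continuous_on_UNIV[OF W2_deriv])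
  have "1 + W x \<noteq> 0" for x using W_pos[of x] by linarith
  then show "continuous_on UNIV Q"
    unfolding Q_def[abs_def] by (intro continuous_intros 0) auto
  show "continuous_on UNIV kernel_sq"
    unfolding kernel_sq_def[abs_def] by (intro continuous_intros 1 2)
qed

text \<open>The Rofe-Beketov integrand. The usual reduction of order would divide by \<open>W'\<^sup>2\<close>, which vanishes at the origin; here the
  denominator is \<open>(W'\<^sup>2 + W''\<^sup>2)\<^sup>2\<close>.\<close>
definition rofe_beketov' :: "real \<Rightarrow> real" where "rofe_beketov' x = (1 - Q x) * ((W1 x)\<^sup>2 - (W2 x)\<^sup>2) / (kernel_sq x)\<^sup>2"
definition rofe_beketov :: "real \<Rightarrow> real" where "rofe_beketov = (SOME F. (\<forall>x. (F has_real_derivative rofe_beketov' x) (at x)) \<and> F 0 = 0)"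

lemma rofe_beketov_deriv: "(rofe_beketov has_real_derivative rofe_beketov' x) (at x)" and rofe_beketov_0: "rofe_beketov 0 = 0"
proof -
  have "continuous_on UNIV rofe_beketov'"
    unfolding rofe_beketov'_def[abs_def] using kernel_sq_pos
    by (intro continuous_intros continuous_Q continuous_W1 continuous_W2 continuous_kernel_sq) (auto simp: less_imp_neq[THEN not_sym])
  then have "\<exists>F. (\<forall>x. (F has_real_derivative rofe_beketov' x) (at x)) \<and> F 0 = 0"
    using exists_antiderivative by metis
  from someI_ex[OF this] show "(rofe_beketov has_real_derivative rofe_beketov' x) (at x)" "rofe_beketov 0 = 0"
    unfolding rofe_beketov_def by auto
qed

text \<open>The second solution of \<open>d'' + Q d = 0\<close>, normalised to Wronskian one with \<open>W'\<close>.\<close>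
definition even_kernel :: "real \<Rightarrow> real" where "even_kernel x = W1 x * rofe_beketov x - W2 x / kernel_sq x"
definition even_kernel' :: "real \<Rightarrow> real" where "even_kernel' x = W2 x * rofe_beketov x + W1 x / kernel_sq x"

lemma kernel_sq_deriv: "(kernel_sq has_real_derivative 2 * W1 x * W2 x * (1 - Q x)) (at x)"
  unfolding kernel_sq_def[abs_def]
  by (auto intro!: derivative_eq_intros W1_deriv W2_deriv simp: algebra_simps)

lemma even_kernel_deriv: "(even_kernel has_real_derivative even_kernel' x) (at x)"
proof -
  have n: "kernel_sq x \<noteq> 0" using kernel_sq_pos[of x] by simp
  have "(even_kernel has_real_derivative W2 x * rofe_beketov x + rofe_beketov' x * W1 x
      - ((- Q x * W1 x) * kernel_sq x - W2 x * (2 * W1 x * W2 x * (1 - Q x))) / (kernel_sq x * kernel_sq x)) (at x)"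
    unfolding even_kernel_def[abs_def]
    by (intro DERIV_diff DERIV_mult DERIV_divide W1_deriv W2_deriv rofe_beketov_deriv kernel_sq_deriv n)
  moreover have "rofe_beketov' x * W1 x
      - ((- Q x * W1 x) * kernel_sq x - W2 x * (2 * W1 x * W2 x * (1 - Q x))) / (kernel_sq x * kernel_sq x) = W1 x / kernel_sq x"
  proof -
    define p r q where "p = W1 x" and "r = W2 x" and "q = Q x"
    have "rofe_beketov' x * p - ((- q * p) * kernel_sq x - r * (2 * p * r * (1 - q))) / (kernel_sq x * kernel_sq x)
       = ((1 - q) * (p\<^sup>2 - r\<^sup>2) * p - ((- q * p) * kernel_sq x - r * (2 * p * r * (1 - q)))) / (kernel_sq x * kernel_sq x)"
      by (simp add: rofe_beketov'_def p_def r_def q_def power2_eq_square diff_divide_distrib)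
    also have "(1 - q) * (p\<^sup>2 - r\<^sup>2) * p - ((- q * p) * kernel_sq x - r * (2 * p * r * (1 - q))) = p * kernel_sq x"
      by (simp add: kernel_sq_def p_def r_def q_def power2_eq_square algebra_simps)
    also have "p * kernel_sq x / (kernel_sq x * kernel_sq x) = p / kernel_sq x" using n by simp
    finally show ?thesis by (simp add: p_def r_def q_def)
  qed
  ultimately show ?thesis by (simp add: even_kernel'_def add_diff_eq[symmetric])
qed

lemma even_kernel'_deriv: "(even_kernel' has_real_derivative - Q x * even_kernel x) (at x)"
proof -
  have n: "kernel_sq x \<noteq> 0" using kernel_sq_pos[of x] by simp
  have "(even_kernel' has_real_derivative (- Q x * W1 x) * rofe_beketov x + rofe_beketov' x * W2 x
      + (W2 x * kernel_sq x - W1 x * (2 * W1 x * W2 x * (1 - Q x))) / (kernel_sq x * kernel_sq x)) (at x)"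
    unfolding even_kernel'_def[abs_def]
    by (intro DERIV_add DERIV_mult DERIV_divide W1_deriv W2_deriv rofe_beketov_deriv kernel_sq_deriv n)
  moreover have "rofe_beketov' x * W2 x + (W2 x * kernel_sq x - W1 x * (2 * W1 x * W2 x * (1 - Q x))) / (kernel_sq x * kernel_sq x) = Q x * (W2 x / kernel_sq x)"
  proof -
    define p r q where "p = W1 x" and "r = W2 x" and "q = Q x"
    have "rofe_beketov' x * r + (r * kernel_sq x - p * (2 * p * r * (1 - q))) / (kernel_sq x * kernel_sq x)
       = ((1 - q) * (p\<^sup>2 - r\<^sup>2) * r + (r * kernel_sq x - p * (2 * p * r * (1 - q)))) / (kernel_sq x * kernel_sq x)"
      by (simp add: rofe_beketov'_def p_def r_def q_def power2_eq_square add_divide_distrib)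
    also have "(1 - q) * (p\<^sup>2 - r\<^sup>2) * r + (r * kernel_sq x - p * (2 * p * r * (1 - q))) = q * r * kernel_sq x"
      by (simp add: kernel_sq_def p_def r_def q_def power2_eq_square algebra_simps)
    also have "q * r * kernel_sq x / (kernel_sq x * kernel_sq x) = q * (r / kernel_sq x)" using n by simp
    finally show ?thesis by (simp add: p_def r_def q_def)
  qed
  ultimately show ?thesis by (simp add: even_kernel_def algebra_simps)
qed

lemma wronskian: "W1 x * even_kernel' x - W2 x * even_kernel x = 1"
proof -
  have n: "kernel_sq x \<noteq> 0" using kernel_sq_pos[of x] by simp
  have "W1 x * even_kernel' x - W2 x * even_kernel x = ((W1 x)\<^sup>2 + (W2 x)\<^sup>2) / kernel_sq x"
    by (simp add: even_kernel_def even_kernel'_def power2_eq_square algebra_simps add_divide_distrib)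
  then show ?thesis using n by (simp add: kernel_sq_def)
qed

lemma even_kernel'_zero: "even_kernel' 0 = 0" by (simp add: even_kernel'_def rofe_beketov_0 W1_zero)

lemma Q_even: "Q (- x) = Q x" by (simp add: Q_def W_even)
lemma kernel_sq_even: "kernel_sq (- x) = kernel_sq x" by (simp add: kernel_sq_def W1_odd W2_even)
lemma rofe_beketov_odd: "rofe_beketov (- x) = - rofe_beketov x"
  by (rule odd_of_even_derivative[OF rofe_beketov_deriv rofe_beketov_0]) (simp add: rofe_beketov'_def Q_even kernel_sq_even W1_odd W2_even)
lemma even_kernel_even: "even_kernel (- x) = even_kernel x" by (simp add: even_kernel_def rofe_beketov_odd W1_odd W2_even kernel_sq_even)

lemma continuous_even_kernel: "continuous_on UNIV even_kernel" by (rule has_derivative_continuous_on_UNIV[OF even_kernel_deriv])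

lemma Q_bounded: "\<exists>B>0. \<forall>x. \<bar>Q x\<bar> \<le> B"
proof -
  obtain B where B: "0 < B" "\<And>x. W x \<le> B" using W_bounded by auto
  have "\<bar>Q x\<bar> \<le> 12 * (1 + B + lam)" for x
  proof -
    have "0 \<le> ln (1 + W x)" "ln (1 + W x) \<le> W x" using W_pos[of x] ln_add_one_self_le_self[of "W x"] by auto
    then show ?thesis unfolding Q_def using B(2)[of x] B(1) lam by argo
  qed
  then show ?thesis using B lam by (intro exI[of _ "12 * (1 + B + lam)"]) auto
qed

text \<open>A bounded solution has a vanishing Wronskian with the decaying solution \<open>W'\<close>, by evaluation at infinity, and a solution with zero slope
  at the origin has a vanishing Wronskian with the even solution, by evaluation at the origin. Together they determine \<open>d\<close>.\<close>
lemma even_kernel_trivial: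
  assumes d: "\<And>x. (d has_real_derivative d' x) (at x)" "\<And>x. (d' has_real_derivative - Q x * d x) (at x)"
    and K: "\<And>x. \<bar>d x\<bar> \<le> K" and "d' 0 = 0"
  shows "d x = 0"
proof -
  obtain B where B: "0 < B" "\<And>x. \<bar>Q x\<bar> \<le> B" using Q_bounded by auto
  have K0: "0 \<le> K" using K[of 0] by linarith
  have d2: "\<bar>- Q x * d x\<bar> \<le> B * K" for x
    using B K K0 by (simp add: abs_mult mult_mono)
  have d'b: "\<bar>d' x\<bar> \<le> 2 * K + B * K" for x
  proof -
    have "\<bar>d' x\<bar> \<le> \<bar>d (x + 1) - d x\<bar> / 1 + 1 * (B * K)"
      by (rule deriv_le_difference_quotient[OF d d2]) auto
    then have "\<bar>d' x\<bar> \<le> \<bar>d (x + 1) - d x\<bar> + B * K" by simp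
    then show ?thesis using K[of x] K[of "x + 1"] by linarith
  qed
  define Y where "Y x = d x * W2 x - d' x * W1 x" for x
  have "(Y has_real_derivative 0) (at x)" for x
  proof -
    have "(Y has_real_derivative (d' x * W2 x + (- Q x * W1 x) * d x) - ((- Q x * d x) * W1 x + W2 x * d' x)) (at x)"
      unfolding Y_def[abs_def] by (intro DERIV_diff DERIV_mult d W1_deriv W2_deriv)
    then show ?thesis by (simp add: algebra_simps)
  qed
  then have Yc: "Y x = Y y" for x y using DERIV_isconst_all by blast
  have "(Y \<longlongrightarrow> 0) at_top"
  proof (rule Lim_null_comparison)
    show "\<forall>\<^sub>F x in at_top. norm (Y x) \<le> K * \<bar>W2 x\<bar> + (2 * K + B * K) * \<bar>W1 x\<bar>"
    proof (intro always_eventually allI)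
      fix x
      have "\<bar>Y x\<bar> \<le> \<bar>d x\<bar> * \<bar>W2 x\<bar> + \<bar>d' x\<bar> * \<bar>W1 x\<bar>" unfolding Y_def by (metis abs_mult abs_triangle_ineq4)
      also have "\<dots> \<le> K * \<bar>W2 x\<bar> + (2 * K + B * K) * \<bar>W1 x\<bar>" by (intro add_mono mult_right_mono K d'b) auto
      finally show "norm (Y x) \<le> K * \<bar>W2 x\<bar> + (2 * K + B * K) * \<bar>W1 x\<bar>" by simp
    qed
    have "((\<lambda>x. K * \<bar>W2 x\<bar> + (2 * K + B * K) * \<bar>W1 x\<bar>) \<longlongrightarrow> K * \<bar>0\<bar> + (2 * K + B * K) * \<bar>0\<bar>) at_top"
      by (intro tendsto_intros W1_tendsto W2_tendsto)
    then show "((\<lambda>x. K * \<bar>W2 x\<bar> + (2 * K + B * K) * \<bar>W1 x\<bar>) \<longlongrightarrow> 0) at_top" by simp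
  qed
  moreover have "Y = (\<lambda>_. Y x)" using Yc by blast
  ultimately have Y0: "Y x = 0" by (metis tendsto_const_iff trivial_limit_at_top_linorder)
  define Z where "Z x = d x * even_kernel' x - d' x * even_kernel x" for x
  have "(Z has_real_derivative 0) (at x)" for x
  proof -
    have "(Z has_real_derivative (d' x * even_kernel' x + (- Q x * even_kernel x) * d x) - ((- Q x * d x) * even_kernel x + even_kernel' x * d' x)) (at x)"
      unfolding Z_def[abs_def] by (intro DERIV_diff DERIV_mult d even_kernel_deriv even_kernel'_deriv)
    then show ?thesis by (simp add: algebra_simps)
  qed
  then have "Z x = Z 0" using DERIV_isconst_all by blast
  also have "\<dots> = 0" by (simp add: Z_def even_kernel'_zero \<open>d' 0 = 0\<close>)
  finally have Z0: "Z x = 0" .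
  (* Cramer's rule for the two Wronskians Y and Z. *)
  have "d x = d x * (W1 x * even_kernel' x - W2 x * even_kernel x)" by (simp add: wronskian)
  also have "\<dots> = W1 x * Z x - even_kernel x * Y x" by (simp add: Z_def Y_def algebra_simps)
  finally show ?thesis by (simp add: Y0 Z0)
qed

text \<open>In the tail \<open>W'\<close> is comparable to \<open>W\<close>, and the Rofe-Beketov integrand is at most a multiple of \<open>W\<^sup>-\<^sup>2\<close>, which is dominated by the derivative
  of a multiple of the same expression. Hence the integral is \<open>O(W\<^sup>-\<^sup>2)\<close> and its product with \<open>W'\<close> is \<open>O(W\<^sup>-\<^sup>1)\<close>.\<close>
lemma kernel_bounds:
  obtains C where "0 < C" "\<And>x. 0 \<le> x \<Longrightarrow> \<bar>even_kernel x\<bar> \<le> C / W x" "\<And>x. 0 \<le> x \<Longrightarrow> \<bar>W1 x\<bar> \<le> C * W x"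
proof -
  obtain x0 where x0: "0 < x0" "\<And>x. x0 \<le> x \<Longrightarrow> tail_rate * W x \<le> - W1 x"
    "\<And>x. x0 \<le> x \<Longrightarrow> - W1 x \<le> sqrt (12 * lam) * W x"
    "\<And>x. x0 \<le> x \<Longrightarrow> \<bar>W2 x\<bar> \<le> 12 * lam * W x" using tail by metis
  define c k where "c = tail_rate" and "k = sqrt (12 * lam)"
  have c: "0 < c" by (simp add: c_def tail_rate_pos)
  have k: "0 < k" "k\<^sup>2 = 12 * lam" using lam by (simp_all add: k_def)
  obtain B where B: "0 < B" "\<And>x. \<bar>Q x\<bar> \<le> B" using Q_bounded by auto
  obtain Bw where Bw: "0 < Bw" "\<And>x. W x \<le> Bw" using W_bounded by auto
  have W1n: "W1 x < 0" if "x0 \<le> x" for x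
    using x0(2)[OF that] c W_pos[of x] unfolding c_def[symmetric] by (smt (verit) mult_pos_pos)
  have W1u: "\<bar>W1 x\<bar> \<le> k * W x" if "x0 \<le> x" for x
    using x0(3)[OF that] W1n[OF that] by (simp add: k_def)
  have Nl: "c\<^sup>2 * (W x)\<^sup>2 \<le> kernel_sq x" if "x0 \<le> x" for x
  proof -
    have "(c * W x)\<^sup>2 \<le> (- W1 x)\<^sup>2"
      using x0(2)[OF that] c W_pos[of x] by (intro power_mono) (auto simp: c_def)
    then show ?thesis unfolding kernel_sq_def by (simp add: power_mult_distrib) (smt (verit) zero_le_power2)
  qed
  have W2n: "\<bar>W2 x\<bar> / kernel_sq x \<le> (12 * lam / c\<^sup>2) / W x" if "x0 \<le> x" for x
  proof -
    have "\<bar>W2 x\<bar> / kernel_sq x \<le> (12 * lam * W x) / (c\<^sup>2 * (W x)\<^sup>2)"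
      using x0(4)[OF that] Nl[OF that] c W_pos[of x] by (intro frac_le) auto
    also have "\<dots> = (12 * lam / c\<^sup>2) / W x" using W_pos[of x] by (simp add: power2_eq_square)
    finally show ?thesis .
  qed
  define D where "D = (1 + B) / c\<^sup>2"
  have D: "0 < D" using B c by (simp add: D_def)
  have I'b: "\<bar>rofe_beketov' x\<bar> \<le> D / (W x)\<^sup>2" if "x0 \<le> x" for x
  proof -
    have "\<bar>(W1 x)\<^sup>2 - (W2 x)\<^sup>2\<bar> \<le> kernel_sq x" by (simp add: kernel_sq_def abs_le_iff)
    moreover have "\<bar>1 - Q x\<bar> \<le> 1 + B" using B(2)[of x] by linarith
    ultimately have "\<bar>(1 - Q x) * ((W1 x)\<^sup>2 - (W2 x)\<^sup>2)\<bar> \<le> (1 + B) * kernel_sq x"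
      using B unfolding abs_mult by (intro mult_mono) auto
    then have "\<bar>rofe_beketov' x\<bar> \<le> (1 + B) * kernel_sq x / (kernel_sq x)\<^sup>2"
      unfolding rofe_beketov'_def abs_divide by (simp add: divide_right_mono)
    also have "\<dots> = (1 + B) / kernel_sq x" using kernel_sq_pos[of x] by (simp add: power2_eq_square)
    also have "\<dots> \<le> (1 + B) / (c\<^sup>2 * (W x)\<^sup>2)"
      using Nl[OF that] B c W_pos[of x] by (intro divide_left_mono) (auto intro!: mult_pos_pos kernel_sq_pos)
    also have "\<dots> = D / (W x)\<^sup>2" by (simp add: D_def)
    finally show ?thesis .
  qed
  have inv2: "((\<lambda>x. (D / (2 * c)) * inverse ((W x)\<^sup>2)) has_real_derivative (D / (2 * c)) * (- (2 * W1 x / (W x) ^ 3))) (at x)" for x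
  proof (rule DERIV_cmult)
    have n: "W x \<noteq> 0" using W_pos[of x] by simp
    have "((\<lambda>x. (W x)\<^sup>2) has_real_derivative 2 * W x * W1 x) (at x)"
      by (auto intro!: derivative_eq_intros W_deriv)
    from DERIV_inverse'[OF this] n
    show "((\<lambda>x. inverse ((W x)\<^sup>2)) has_real_derivative - (2 * W1 x / (W x) ^ 3)) (at x)"
      by (simp add: field_simps power2_eq_square power3_eq_cube)
  qed
  have It: "\<bar>rofe_beketov x - rofe_beketov x0\<bar> \<le> (D / (2 * c)) * inverse ((W x)\<^sup>2)" if "x0 \<le> x" for x
  proof -
    have "\<bar>rofe_beketov x - rofe_beketov x0\<bar> \<le> (D / (2 * c)) * inverse ((W x)\<^sup>2) - (D / (2 * c)) * inverse ((W x0)\<^sup>2)"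
    proof (rule abs_diff_le_of_deriv[OF that rofe_beketov_deriv inv2])
      fix s assume s: "x0 \<le> s" "s \<le> x"
      have "D / (W s)\<^sup>2 \<le> (D / (2 * c)) * (- (2 * W1 s / (W s) ^ 3))"
      proof -
        have "D / (2 * c) * (2 * (c * W s) / (W s) ^ 3) \<le> D / (2 * c) * (2 * (- W1 s) / (W s) ^ 3)"
          using x0(2)[OF s(1)] D c W_pos[of s] by (intro mult_left_mono divide_right_mono) (auto simp: c_def)
        moreover have "D / (2 * c) * (2 * (c * W s) / (W s) ^ 3) = D / (W s)\<^sup>2"
          using c W_pos[of s] by (simp add: power2_eq_square power3_eq_cube)
        ultimately show ?thesis by simp
      qed
      then show "\<bar>rofe_beketov' s\<bar> \<le> (D / (2 * c)) * (- (2 * W1 s / (W s) ^ 3))" using I'b[OF s(1)] by linarith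
    qed
    also have "\<dots> \<le> (D / (2 * c)) * inverse ((W x)\<^sup>2)" using D c by simp
    finally show ?thesis .
  qed
  define D2 where "D2 = D / (2 * c) + \<bar>rofe_beketov x0\<bar> * Bw\<^sup>2"
  have IW: "\<bar>rofe_beketov x\<bar> * (W x)\<^sup>2 \<le> D2" if "x0 \<le> x" for x
  proof -
    have w: "0 < (W x)\<^sup>2" using W_pos[of x] by simp
    have "\<bar>rofe_beketov x\<bar> \<le> (D / (2 * c)) * inverse ((W x)\<^sup>2) + \<bar>rofe_beketov x0\<bar>" using It[OF that] by linarith
    then have "\<bar>rofe_beketov x\<bar> * (W x)\<^sup>2 \<le> ((D / (2 * c)) * inverse ((W x)\<^sup>2) + \<bar>rofe_beketov x0\<bar>) * (W x)\<^sup>2"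
      using w by (intro mult_right_mono) auto
    also have "\<dots> = D / (2 * c) + \<bar>rofe_beketov x0\<bar> * (W x)\<^sup>2" using w by (simp add: distrib_right)
    also have "\<dots> \<le> D2" unfolding D2_def using W_pos[of x] Bw(2)[of x]
      by (intro add_mono mult_left_mono power_mono) auto
    finally show ?thesis .
  qed
  have vW: "\<bar>even_kernel x * W x\<bar> \<le> k * D2 + 12 * lam / c\<^sup>2" if "x0 \<le> x" for x
  proof -
    have w: "0 < W x" by (rule W_pos)
    have "\<bar>even_kernel x * W x\<bar> \<le> (\<bar>W1 x\<bar> * \<bar>rofe_beketov x\<bar> + \<bar>W2 x\<bar> / kernel_sq x) * W x"
      using kernel_sq_pos[of x] w abs_triangle_ineq4[of "W1 x * rofe_beketov x" "W2 x / kernel_sq x"]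
      by (simp add: even_kernel_def abs_mult mult_right_mono)
    also have "\<dots> \<le> ((k * W x) * \<bar>rofe_beketov x\<bar> + (12 * lam / c\<^sup>2) / W x) * W x"
      using w by (intro mult_right_mono add_mono W1u[OF that] W2n[OF that]) auto
    also have "\<dots> = k * (\<bar>rofe_beketov x\<bar> * (W x)\<^sup>2) + 12 * lam / c\<^sup>2"
      using w by (simp add: distrib_right power2_eq_square)
    also have "\<dots> \<le> k * D2 + 12 * lam / c\<^sup>2"
      using IW[OF that] k by (intro add_right_mono mult_left_mono) auto
    finally show ?thesis .
  qed
  have cv: "continuous_on UNIV (\<lambda>x. even_kernel x * W x)" by (intro continuous_intros continuous_even_kernel continuous_W)
  obtain C1 where C1: "0 < C1" "\<And>x. 0 \<le> x \<Longrightarrow> \<bar>even_kernel x * W x\<bar> \<le> C1"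
    using bounded_from_tail[OF cv vW] by blast
  have cp: "continuous_on UNIV (\<lambda>x. W1 x / W x)"
    using W_pos by (intro continuous_intros continuous_W1 continuous_W) (auto simp: less_imp_neq[THEN not_sym])
  have "\<bar>W1 x / W x\<bar> \<le> k" if "x0 \<le> x" for x
    using W1u[OF that] W_pos[of x] by (simp add: field_simps)
  then obtain C2 where C2: "0 < C2" "\<And>x. 0 \<le> x \<Longrightarrow> \<bar>W1 x / W x\<bar> \<le> C2"
    using bounded_from_tail[OF cp] by blast
  show thesis
  proof (rule that[of "C1 + C2"])
    fix x :: real assume x: "0 \<le> x"
    have w: "0 < W x" by (rule W_pos)
    show "\<bar>even_kernel x\<bar> \<le> (C1 + C2) / W x" using C1(2)[OF x] C2(1) w by (simp add: abs_mult field_simps)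
    have "\<bar>W1 x\<bar> \<le> C2 * W x" using C2(2)[OF x] w by (simp add: field_simps)
    also have "\<dots> \<le> (C1 + C2) * W x" using C1 w by simp
    finally show "\<bar>W1 x\<bar> \<le> (C1 + C2) * W x" .
  qed (use C1 C2 in auto)
qed

text \<open>Exponential growth of \<open>1 / W\<close>: in the tail it is bounded by the derivative of a multiple of itself.\<close>
lemma inverse_W_primitive_bound:
  obtains H C where "\<And>x. (H has_real_derivative 1 / W x) (at x)" "H 0 = 0" "0 < C"
    "\<And>x. 0 \<le> x \<Longrightarrow> \<bar>H x\<bar> \<le> C / W x"
proof -
  obtain x0 where x0: "0 < x0" "\<And>x. x0 \<le> x \<Longrightarrow> tail_rate * W x \<le> - W1 x" using tail by metis
  define c where "c = tail_rate"
  have c: "0 < c" by (simp add: c_def tail_rate_pos)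
  obtain Bw where Bw: "0 < Bw" "\<And>x. W x \<le> Bw" using W_bounded by auto
  have cH: "continuous_on UNIV (\<lambda>x. 1 / W x)"
    using W_pos by (intro continuous_intros continuous_W) (auto simp: less_imp_neq[THEN not_sym])
  then obtain H where H: "\<And>x. (H has_real_derivative 1 / W x) (at x)" "H 0 = 0"
    using exists_antiderivative by blast
  have inv: "((\<lambda>x. (1 / c) * inverse (W x)) has_real_derivative (1 / c) * (- W1 x / (W x)\<^sup>2)) (at x)" for x
  proof (rule DERIV_cmult)
    show "((\<lambda>x. inverse (W x)) has_real_derivative - W1 x / (W x)\<^sup>2) (at x)"
      using DERIV_inverse'[OF W_deriv, of x] W_pos[of x] by (simp add: field_simps power2_eq_square)
  qed
  have t: "\<bar>H x * W x\<bar> \<le> 1 / c + \<bar>H x0\<bar> * Bw" if "x0 \<le> x" for x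
  proof -
    have w: "0 < W x" by (rule W_pos)
    have "\<bar>H x - H x0\<bar> \<le> (1 / c) * inverse (W x) - (1 / c) * inverse (W x0)"
    proof (rule abs_diff_le_of_deriv[OF that H(1) inv])
      fix s assume s: "x0 \<le> s" "s \<le> x"
      have "(1 / c) * ((c * W s) / (W s)\<^sup>2) \<le> (1 / c) * (- W1 s / (W s)\<^sup>2)"
        using x0(2)[OF s(1)] c by (intro mult_left_mono divide_right_mono) (auto simp: c_def)
      moreover have "(1 / c) * ((c * W s) / (W s)\<^sup>2) = 1 / W s"
        using c W_pos[of s] by (simp add: power2_eq_square)
      ultimately show "\<bar>1 / W s\<bar> \<le> (1 / c) * (- W1 s / (W s)\<^sup>2)" using W_pos[of s] by simp
    qed
    also have "\<dots> \<le> (1 / c) * inverse (W x)" using c W_pos[of x0] by simp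
    finally have "\<bar>H x\<bar> \<le> (1 / c) * inverse (W x) + \<bar>H x0\<bar>" by linarith
    then have "\<bar>H x\<bar> * W x \<le> ((1 / c) * inverse (W x) + \<bar>H x0\<bar>) * W x" using w by (intro mult_right_mono) auto
    also have "\<dots> = 1 / c + \<bar>H x0\<bar> * W x" using w by (simp add: distrib_right)
    also have "\<dots> \<le> 1 / c + \<bar>H x0\<bar> * Bw" by (intro add_left_mono mult_left_mono Bw) auto
    finally show ?thesis using w by (simp add: abs_mult)
  qed
  have "continuous_on UNIV (\<lambda>x. H x * W x)"
    by (intro continuous_intros continuous_W has_derivative_continuous_on_UNIV[OF H(1)])
  from bounded_from_tail[OF this t] obtain C where C: "0 < C" "\<And>x. 0 \<le> x \<Longrightarrow> \<bar>H x * W x\<bar> \<le> C" by blast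
  show thesis
  proof (rule that[OF H C(1)])
    fix x :: real assume "0 \<le> x"
    then show "\<bar>H x\<bar> \<le> C / W x" using C(2)[of x] W_pos[of x] by (simp add: abs_mult field_simps)
  qed
qed

text \<open>The solution operator of \<open>u'' + Q u = - 12 g\<close> on even bounded functions. The slope condition at the origin is a consequence of
  evenness and is recorded because uniqueness uses it directly.\<close>
definition green :: "(real \<Rightarrow> real) \<Rightarrow> (real \<Rightarrow> real) \<Rightarrow> bool" where
  "green g u \<longleftrightarrow> u \<in> bcontfun \<and> (\<forall>x. u (- x) = u x) \<and>
     (\<exists>u'. (\<forall>x. (u has_real_derivative u' x) (at x)) \<and>
        (\<forall>x. (u' has_real_derivative - Q x * u x - 12 * g x) (at x)) \<and> u' 0 = 0)"

text \<open>Variation of constants. The coefficient of the decaying \<open>W'\<close> is integrated from the origin and grows at most like \<open>1 / W\<close>; the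
  coefficient of the growing solution is integrated from infinity and decays like \<open>W\<close>. Each product is bounded. Evenness holds because \<open>W' g\<close> is
  odd, so the two integrals to plus and minus infinity agree; this is the only place where solvability on the whole line
  would otherwise impose an orthogonality condition.\<close>
lemma green_exists:
  obtains C where "0 < C"
    "\<And>g M. g \<in> bcontfun \<Longrightarrow> (\<And>x. g (- x) = g x) \<Longrightarrow> (\<And>x. \<bar>g x\<bar> \<le> M) \<Longrightarrow>
       \<exists>u. green g u \<and> (\<forall>x. \<bar>u x\<bar> \<le> C * M)"
proof -
  obtain C where C: "0 < C" "\<And>x. 0 \<le> x \<Longrightarrow> \<bar>even_kernel x\<bar> \<le> C / W x" "\<And>x. 0 \<le> x \<Longrightarrow> \<bar>W1 x\<bar> \<le> C * W x"
    using kernel_bounds by metis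
  obtain H CH where H: "\<And>x. (H has_real_derivative 1 / W x) (at x)" "H 0 = 0" and CH: "0 < CH"
    "\<And>x. 0 \<le> x \<Longrightarrow> \<bar>H x\<bar> \<le> CH / W x"
    using inverse_W_primitive_bound by metis
  obtain x0 where x0: "0 < x0" "\<And>x. x0 \<le> x \<Longrightarrow> tail_rate * W x \<le> - W1 x" using tail by metis
  have W1n: "W1 x \<le> 0" if "x0 \<le> x" for x
    using x0(2)[OF that] tail_rate_pos W_pos[of x] by (smt (verit) mult_pos_pos)
  obtain Bw where Bw: "0 < Bw" "\<And>x. W x \<le> Bw" using W_bounded by auto
  have "continuous_on UNIV (\<lambda>x. 1 / W (min x x0))"
    using W_pos by (intro continuous_intros continuous_on_compose2[OF continuous_W]) (auto simp: less_imp_neq[THEN not_sym])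
  moreover have "\<bar>1 / W (min x x0)\<bar> \<le> 1 / W x0" if "x0 \<le> x" for x
    using that W_pos[of x0] by simp
  ultimately obtain m where m: "0 < m" "\<And>x. 0 \<le> x \<Longrightarrow> \<bar>1 / W (min x x0)\<bar> \<le> m"
    using bounded_from_tail[of "\<lambda>x. 1 / W (min x x0)" x0 "1 / W x0"] by blast
  have mW: "1 \<le> m * W x" if "0 \<le> x" "x \<le> x0" for x
    using m(2)[of x] that W_pos[of x] by (simp add: field_simps)
  (* Converts the tail bound M * W beyond x0 into a bound on all of the half line: on the compact part 1 <= m * W. *)
  define C3 where "C3 = 1 + (W x0 + C * Bw * x0) * m"
  have C3: "0 < C3" using C x0 Bw m W_pos[of x0] by (auto simp: C3_def intro!: add_pos_nonneg mult_nonneg_nonneg add_nonneg_nonneg)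
  have "\<exists>u. green g u \<and> (\<forall>x. \<bar>u x\<bar> \<le> 12 * C * (C * CH + C3) * M)"
    if g: "g \<in> bcontfun" "\<And>x. g (- x) = g x" "\<And>x. \<bar>g x\<bar> \<le> M" for g M
  proof -
    have M0: "0 \<le> M" using g(3)[of 0] by linarith
    note cg = bcontfunD(1)[OF g(1)]
    obtain J where J: "\<And>x. (J has_real_derivative even_kernel x * g x) (at x)" "J 0 = 0"
      using exists_antiderivative[of "\<lambda>x. even_kernel x * g x"] cg continuous_even_kernel by (metis continuous_on_mult)
    obtain T where T: "\<And>x. (T has_real_derivative W1 x * g x) (at x)" "T 0 = 0"
      using exists_antiderivative[of "\<lambda>x. W1 x * g x"] cg continuous_W1 by (metis continuous_on_mult)
    have Jb: "\<bar>J x\<bar> \<le> M * C * (CH / W x)" if "0 \<le> x" for x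
    proof -
      have "\<bar>J x - J 0\<bar> \<le> M * C * H x - M * C * H 0"
      proof (rule abs_diff_le_of_deriv[OF that J(1) DERIV_cmult[OF H(1)]])
        fix s assume s: "0 \<le> s" "s \<le> x"
        have "\<bar>even_kernel s\<bar> * \<bar>g s\<bar> \<le> (C / W s) * M"
          using C(2)[OF s(1)] g(3)[of s] C W_pos[of s] by (intro mult_mono) auto
        then show "\<bar>even_kernel s * g s\<bar> \<le> M * C * (1 / W s)" by (simp add: abs_mult mult.commute)
      qed
      also have "\<dots> \<le> M * C * (CH / W x)"
      proof -
        have "H x \<le> CH / W x" using CH(2)[OF that] by linarith
        from mult_left_mono[OF this, of "M * C"] show ?thesis using M0 C(1) H(2) by simp
      qed
      finally show ?thesis using J(2) by simp
    qed
    have Tt: "\<bar>T y - T x\<bar> \<le> M * W x" if "x0 \<le> x" "x \<le> y" for x y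
    proof -
      have "\<bar>T y - T x\<bar> \<le> - M * W y - - M * W x"
      proof (rule abs_diff_le_of_deriv[OF that(2) T(1) DERIV_cmult[OF W_deriv]])
        fix s assume s: "x \<le> s" "s \<le> y"
        have "\<bar>W1 s * g s\<bar> \<le> (- W1 s) * M"
          using W1n[of s] mult_left_mono[OF g(3)[of s], of "- W1 s"] that s by (simp add: abs_mult)
        then show "\<bar>W1 s * g s\<bar> \<le> - M * W1 s" by (simp add: mult.commute)
      qed
      then show ?thesis using M0 W_pos[of y] by (smt (verit) mult_minus_left mult_nonneg_nonneg)
    qed
    (* The integral of W1 * g up to infinity is obtained as the limit Ti of its primitive T. *)
    have "Cauchy (\<lambda>n. T (real n))"
    proof (rule CauchyI)
      fix r :: real assume "0 < r"
      have "((\<lambda>x. M * W x) \<longlongrightarrow> M * 0) at_top" by (intro tendsto_intros W_tendsto)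
      then have "\<forall>\<^sub>F x in at_top. \<bar>M * W x\<bar> < r / 2" using tendstoD[of _ 0 _ "r / 2"] \<open>0 < r\<close> by (force simp: dist_real_def)
      then obtain X where X: "\<forall>x\<ge>X. \<bar>M * W x\<bar> < r / 2" by (auto simp: eventually_at_top_linorder)
      obtain n0 where n0: "max X x0 \<le> real n0" using real_arch_simple by blast
      have "\<bar>T (real n) - T (real n0)\<bar> < r / 2" if "n0 \<le> n" for n
        using Tt[of "real n0" "real n"] X[rule_format, of "real n0"] n0 that by fastforce
      note N = this
      show "\<exists>N. \<forall>m\<ge>N. \<forall>n\<ge>N. norm (T (real m) - T (real n)) < r"
      proof (intro exI allI impI)
        fix m n assume "n0 \<le> m" "n0 \<le> n"
        then show "norm (T (real m) - T (real n)) < r" using N[of m] N[of n] by (simp add: abs_less_iff) argo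
      qed
    qed
    then obtain Ti where Ti: "(\<lambda>n. T (real n)) \<longlonglongrightarrow> Ti" by (meson Cauchy_convergent convergent_def)
    have Tb1: "\<bar>Ti - T x\<bar> \<le> M * W x" if "x0 \<le> x" for x
    proof (rule LIMSEQ_le_const2)
      show "(\<lambda>n. \<bar>T (real n) - T x\<bar>) \<longlonglongrightarrow> \<bar>Ti - T x\<bar>" by (intro tendsto_intros Ti)
      obtain n0 where "x \<le> real n0" using real_arch_simple by blast
      then show "\<exists>N. \<forall>n\<ge>N. \<bar>T (real n) - T x\<bar> \<le> M * W x"
        using Tt[OF that] by (intro exI[of _ n0] allI impI) (meson of_nat_le_iff order_trans)
    qed
    have Tb: "\<bar>Ti - T x\<bar> \<le> M * (C3 * W x)" if "0 \<le> x" for x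
    proof (cases "x0 \<le> x")
      case True
      have "1 \<le> C3" using C x0 Bw m W_pos[of x0] by (auto simp: C3_def intro!: mult_nonneg_nonneg add_nonneg_nonneg)
      then have "M * W x \<le> M * (C3 * W x)" using M0 W_pos[of x] by (intro mult_left_mono) auto
      then show ?thesis using Tb1[OF True] by linarith
    next
      case False
      then have xx: "x \<le> x0" by simp
      have "\<bar>T x0 - T x\<bar> \<le> M * C * Bw * x0 - M * C * Bw * x"
      proof (rule abs_diff_le_of_deriv[OF xx T(1), where g'="\<lambda>_. M * C * Bw"])
        fix s assume s: "x \<le> s" "s \<le> x0"
        show "((*) (M * C * Bw) has_real_derivative M * C * Bw) (at s)" by (auto intro!: derivative_eq_intros)
        have "\<bar>W1 s\<bar> \<le> C * Bw" using C(3)[of s] C(1) Bw(2)[of s] s that by (meson mult_left_mono less_imp_le order_trans)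
        then have "\<bar>W1 s\<bar> * \<bar>g s\<bar> \<le> (C * Bw) * M" using g(3)[of s] C Bw by (intro mult_mono) auto
        then show "\<bar>W1 s * g s\<bar> \<le> M * C * Bw" by (simp add: abs_mult mult.commute mult.left_commute)
      qed
      also have "\<dots> \<le> M * (C * Bw * x0)" using M0 C Bw that by simp
      finally have "\<bar>Ti - T x\<bar> \<le> M * W x0 + M * (C * Bw * x0)" using Tb1[of x0] by linarith
      also have "\<dots> = M * (W x0 + C * Bw * x0) * 1" by (simp add: distrib_left)
      also have "\<dots> \<le> M * (W x0 + C * Bw * x0) * (m * W x)"
        using mW[OF that xx] M0 C x0 Bw W_pos[of x0] by (intro mult_left_mono mult_nonneg_nonneg add_nonneg_nonneg) auto
      also have "\<dots> \<le> M * (C3 * W x)"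
      proof -
        have "M * (C3 * W x) = M * (W x0 + C * Bw * x0) * (m * W x) + M * W x" by (simp add: C3_def algebra_simps)
        then show ?thesis using M0 W_pos[of x] by simp
      qed
      finally show ?thesis .
    qed
    define u where "u x = 12 * (W1 x * J x + even_kernel x * (Ti - T x))" for x
    define u' where "u' x = 12 * (W2 x * J x + even_kernel' x * (Ti - T x))" for x
    have u: "(u has_real_derivative u' x) (at x)" for x
    proof -
      have "(u has_real_derivative 12 * ((W2 x * J x + (even_kernel x * g x) * W1 x) + (even_kernel' x * (Ti - T x) + (0 - W1 x * g x) * even_kernel x))) (at x)"
        unfolding u_def[abs_def]
        by (intro DERIV_cmult DERIV_add DERIV_diff DERIV_mult DERIV_const W1_deriv J T even_kernel_deriv)
      then show ?thesis by (simp add: u'_def algebra_simps)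
    qed
    have u': "(u' has_real_derivative - Q x * u x - 12 * g x) (at x)" for x
    proof -
      have "(u' has_real_derivative 12 * (((- Q x * W1 x) * J x + (even_kernel x * g x) * W2 x) + ((- Q x * even_kernel x) * (Ti - T x) + (0 - W1 x * g x) * even_kernel' x))) (at x)"
        unfolding u'_def[abs_def]
        by (intro DERIV_cmult DERIV_add DERIV_diff DERIV_mult DERIV_const W2_deriv J T even_kernel'_deriv)
      also have "12 * (((- Q x * W1 x) * J x + (even_kernel x * g x) * W2 x) + ((- Q x * even_kernel x) * (Ti - T x) + (0 - W1 x * g x) * even_kernel' x))
          = - Q x * u x - 12 * g x * (W1 x * even_kernel' x - W2 x * even_kernel x)" by (simp add: u_def algebra_simps)
      finally show ?thesis by (simp add: wronskian)
    qed
    have Jo: "J (- x) = - J x" for x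
      by (rule odd_of_even_derivative[OF J]) (simp add: even_kernel_even g)
    have Te: "T (- x) = T x" for x
      by (rule even_of_odd_derivative[OF T(1)]) (simp add: W1_odd g)
    have ue: "u (- x) = u x" for x by (simp add: u_def Jo Te W1_odd even_kernel_even)
    have ub0: "\<bar>u x\<bar> \<le> 12 * C * (C * CH + C3) * M" if "0 \<le> x" for x
    proof -
      have w: "0 < W x" by (rule W_pos)
      have 1: "\<bar>W1 x\<bar> * \<bar>J x\<bar> \<le> (C * W x) * (M * C * (CH / W x))"
        using C(3)[OF that] Jb[OF that] by (intro mult_mono) auto
      have 2: "\<bar>even_kernel x\<bar> * \<bar>Ti - T x\<bar> \<le> (C / W x) * (M * (C3 * W x))"
        using C(2)[OF that] Tb[OF that] by (intro mult_mono) auto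
      have "\<bar>u x\<bar> \<le> 12 * (\<bar>W1 x\<bar> * \<bar>J x\<bar> + \<bar>even_kernel x\<bar> * \<bar>Ti - T x\<bar>)"
      proof -
        have t: "\<bar>W1 x * J x + even_kernel x * (Ti - T x)\<bar> \<le> \<bar>W1 x\<bar> * \<bar>J x\<bar> + \<bar>even_kernel x\<bar> * \<bar>Ti - T x\<bar>"
          by (metis abs_mult abs_triangle_ineq)
        have "\<bar>12 * z\<bar> \<le> 12 * w" if "\<bar>z\<bar> \<le> w" for z w :: real using that by (simp add: abs_mult)
        from this[OF t] show ?thesis by (simp only: u_def)
      qed
      also have "\<dots> \<le> 12 * ((C * W x) * (M * C * (CH / W x)) + (C / W x) * (M * (C3 * W x)))"
        using 1 2 by simp
      also have "\<dots> = 12 * C * (C * CH + C3) * M" using w by (simp add: field_simps)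
      finally show ?thesis .
    qed
    have ub: "\<bar>u x\<bar> \<le> 12 * C * (C * CH + C3) * M" for x
      using ub0[of x] ub0[of "- x"] ue by (cases "0 \<le> x") auto
    have "u' 0 = 0" by (simp add: u'_def J(2) even_kernel'_zero)
    then have "green g u"
      unfolding green_def using u u' ue bcontfunI'[OF has_derivative_continuous_on_UNIV[OF u] ub] by blast
    then show ?thesis using ub by blast
  qed
  then show thesis using C CH C3 by (intro that[of "12 * C * (C * CH + C3)"]) (auto intro!: mult_pos_pos add_pos_pos)
qed

lemma green_unique:
  assumes "green g u" and k: "\<And>x. (k has_real_derivative k' x) (at x)"
    "\<And>x. (k' has_real_derivative - Q x * k x - 12 * g x) (at x)" "k' 0 = 0" "\<And>x. \<bar>k x\<bar> \<le> K"
  shows "k x = u x"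
proof -
  obtain u' where u: "\<And>x. (u has_real_derivative u' x) (at x)"
    "\<And>x. (u' has_real_derivative - Q x * u x - 12 * g x) (at x)" "u' 0 = 0"
    using assms(1) by (auto simp: green_def)
  obtain B where B: "\<And>x. \<bar>u x\<bar> \<le> B" using assms(1) bcontfunD(3) unfolding green_def by metis
  have "k x - u x = 0"
  proof (rule even_kernel_trivial[where d="\<lambda>x. k x - u x" and d'="\<lambda>x. k' x - u' x" and K="K + B"])
    show "((\<lambda>x. k x - u x) has_real_derivative k' x - u' x) (at x)" for x by (rule DERIV_diff[OF k(1) u(1)])
    show "((\<lambda>x. k' x - u' x) has_real_derivative - Q x * (k x - u x)) (at x)" for x
      using DERIV_diff[OF k(2)[of x] u(2)[of x]] by (simp add: algebra_simps)
    show "\<bar>k x - u x\<bar> \<le> K + B" for x using k(4)[of x] B[of x] by linarith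
  qed (use k u in simp)
  then show ?thesis by simp
qed

lemma green_lincomb:
  assumes "green g u" "green h w"
  shows "green (\<lambda>x. a * g x + b * h x) (\<lambda>x. a * u x + b * w x)"
proof -
  obtain u' where u: "\<And>x. (u has_real_derivative u' x) (at x)"
    "\<And>x. (u' has_real_derivative - Q x * u x - 12 * g x) (at x)" "u' 0 = 0"
    using assms(1) by (auto simp: green_def)
  obtain w' where w: "\<And>x. (w has_real_derivative w' x) (at x)"
    "\<And>x. (w' has_real_derivative - Q x * w x - 12 * h x) (at x)" "w' 0 = 0"
    using assms(2) by (auto simp: green_def)
  have 1: "((\<lambda>x. a * u x + b * w x) has_real_derivative a * u' x + b * w' x) (at x)" for x
    by (intro DERIV_add DERIV_cmult u w)
  have "((\<lambda>x. a * u' x + b * w' x) has_real_derivative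
      a * (- Q x * u x - 12 * g x) + b * (- Q x * w x - 12 * h x)) (at x)" for x
    by (intro DERIV_add DERIV_cmult u w)
  then have 2: "((\<lambda>x. a * u' x + b * w' x) has_real_derivative
      - Q x * (a * u x + b * w x) - 12 * (a * g x + b * h x)) (at x)" for x
    by (simp add: algebra_simps)
  have 3: "a * u' 0 + b * w' 0 = 0" using u w by simp
  have "(\<lambda>x. a * u x + b * w x) \<in> bcontfun" "\<forall>x. a * u (- x) + b * w (- x) = a * u x + b * w x"
    using assms by (auto simp: green_def bcontfun_lincomb)
  with 1 2 3 show ?thesis unfolding green_def
    by (intro conjI exI[of _ "\<lambda>x. a * u' x + b * w' x"]) auto
qed

end

section \<open>The fixed point problem\<close>

text \<open>The domain of the fixed point argument is complete.\<close>
lemma closed_bcontfun_pointwise: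
  fixes a :: "real \<Rightarrow> real"
  shows "closed {u :: real \<Rightarrow>\<^sub>C real. (\<forall>x. apply_bcontfun u (- x) = apply_bcontfun u x) \<and> (\<forall>x. \<bar>apply_bcontfun u x - a x\<bar> \<le> del)}"
  unfolding closed_sequential_limits
proof (intro allI impI, elim conjE)
  fix X :: "nat \<Rightarrow> real \<Rightarrow>\<^sub>C real" and l
  assume X: "\<forall>n. X n \<in> {u. (\<forall>x. apply_bcontfun u (- x) = apply_bcontfun u x) \<and> (\<forall>x. \<bar>apply_bcontfun u x - a x\<bar> \<le> del)}"
    and l: "X \<longlonglongrightarrow> l"
  have lim: "(\<lambda>n. apply_bcontfun (X n) x) \<longlonglongrightarrow> apply_bcontfun l x" for x
  proof (rule metric_LIMSEQ_I)
    fix r :: real assume "0 < r"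
    then obtain N where "\<forall>n\<ge>N. dist (X n) l < r" using metric_LIMSEQ_D[OF l] by blast
    then show "\<exists>N. \<forall>n\<ge>N. dist (apply_bcontfun (X n) x) (apply_bcontfun l x) < r"
      using dist_bounded le_less_trans by blast
  qed
  have "apply_bcontfun l (- x) = apply_bcontfun l x" for x
    using lim[of "- x"] lim[of x] X by (intro LIMSEQ_unique[of "\<lambda>n. apply_bcontfun (X n) x"]) auto
  moreover have "\<bar>apply_bcontfun l x - a x\<bar> \<le> del" for x
  proof (rule LIMSEQ_le_const2)
    show "(\<lambda>n. \<bar>apply_bcontfun (X n) x - a x\<bar>) \<longlonglongrightarrow> \<bar>apply_bcontfun l x - a x\<bar>" by (intro tendsto_intros lim)
  qed (use X in auto)
  ultimately show "l \<in> {u. (\<forall>x. apply_bcontfun u (- x) = apply_bcontfun u x) \<and> (\<forall>x. \<bar>apply_bcontfun u x - a x\<bar> \<le> del)}" by blast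
qed

text \<open>The nonlinearity after removing the identity and the factor \<open>e\<^sup>2\<close>.\<close>
definition F :: "real \<Rightarrow> real \<Rightarrow> real" where "F e u = ((1 + u) powr (1 + e\<^sup>2) - 1 - u) / e\<^sup>2"
definition F' :: "real \<Rightarrow> real \<Rightarrow> real" where "F' e u = ((1 + e\<^sup>2) * (1 + u) powr (e\<^sup>2) - 1) / e\<^sup>2"

lemma dV_eq: "e \<noteq> 0 \<Longrightarrow> dV e u = u + e\<^sup>2 * F e u"
  by (simp add: dV_def F_def)

lemma F_deriv:
  assumes "-1 < u"
  shows "(F e has_real_derivative F' e u) (at u)"
proof -
  have "((\<lambda>u. (1 + u) powr (1 + e\<^sup>2)) has_real_derivative (1 + e\<^sup>2) * (1 + u) powr (1 + e\<^sup>2 - 1)) (at u)"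
    using assms by (auto intro!: derivative_eq_intros)
  from DERIV_cdivide[OF DERIV_diff[OF DERIV_diff[OF this DERIV_const[of 1]] DERIV_ident], of "e\<^sup>2"]
  show ?thesis by (simp add: F_def[abs_def] F'_def)
qed

lemma F_zero: "F e 0 = 0" by (simp add: F_def)

lemma exp_second_order: "\<bar>exp t - 1 - t\<bar> \<le> t\<^sup>2" if "\<bar>t\<bar> \<le> 1" for t :: real
proof -
  have "1 + t \<le> exp t" by (rule exp_ge_add_one_self)
  moreover have "exp t \<le> 1 + t + t\<^sup>2"
  proof (cases "0 \<le> t")
    case True
    then show ?thesis using exp_bound[of t] that by simp
  next
    case False
    have p: "0 < 1 - t" using False by simp
    have "1 - t \<le> exp (- t)" using exp_ge_add_one_self[of "- t"] by simp
    then have "exp t * (1 - t) \<le> exp t * exp (- t)" by (intro mult_left_mono) auto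
    also have "\<dots> = 1" by (simp flip: exp_add)
    also have "1 \<le> (1 + t + t\<^sup>2) * (1 - t)"
    proof -
      have "(1 + t + t\<^sup>2) * (1 - t) = 1 + t\<^sup>2 * (- t)" by (simp add: power2_eq_square algebra_simps)
      moreover have "0 \<le> t\<^sup>2 * (- t)" using False by (intro mult_nonneg_nonneg) auto
      ultimately show ?thesis by simp
    qed
    finally show ?thesis using p by (simp add: mult_le_cancel_right)
  qed
  ultimately show ?thesis by (intro abs_leI) (use zero_le_power2[of t] in linarith)+
qed

text \<open>Both are second-order Taylor remainders of \<open>exp (e\<^sup>2 ln (1 + u))\<close>; the condition \<open>e\<^sup>2 l \<le> 1\<close> keeps the exponent in the unit interval.\<close>
lemma F_approx:
  assumes "0 < e" "-1 < u" "\<bar>ln (1 + u)\<bar> \<le> l" "1 \<le> l" "e\<^sup>2 * l \<le> 1"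
  shows "\<bar>F' e u - (1 + ln (1 + u))\<bar> \<le> 3 * l\<^sup>2 * e\<^sup>2"
    and "\<bar>F e u - (1 + u) * ln (1 + u)\<bar> \<le> (1 + u) * l\<^sup>2 * e\<^sup>2"
proof -
  define s L t where "s = e\<^sup>2" and "L = ln (1 + u)" and "t = s * L"
  have s: "0 < s" "s \<le> 1" using assms by (auto simp: s_def) (metis mult_left_le mult.right_neutral order_trans mult_le_cancel_left_pos zero_less_power zero_le_power2)
  have tl: "\<bar>t\<bar> \<le> s * l" using assms s by (simp add: t_def abs_mult L_def)
  then have t1: "\<bar>t\<bar> \<le> 1" using assms by (simp add: s_def)
  have p: "(1 + u) powr s = exp t" using assms by (simp add: powr_def t_def L_def)
  have p1: "(1 + u) powr (1 + s) = (1 + u) * exp t" using assms p by (simp add: powr_add)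
  have q: "\<bar>exp t - 1 - t\<bar> \<le> s * (s * l\<^sup>2)"
  proof -
    have "t\<^sup>2 \<le> (s * l)\<^sup>2" using tl by (metis abs_ge_zero power2_abs power_mono)
    also have "\<dots> = s * (s * l\<^sup>2)" by (simp add: power2_eq_square)
    finally show ?thesis using exp_second_order[OF t1] by simp
  qed
  then have r: "\<bar>(exp t - 1 - t) / s\<bar> \<le> s * l\<^sup>2" using s by (simp add: field_simps)
  have e1: "F' e u - (1 + L) = (exp t - 1 - t) + t + (exp t - 1 - t) / s"
  proof -
    have "F' e u = ((1 + s) * exp t - 1) / s" by (simp add: F'_def s_def[symmetric] p)
    also have "\<dots> = exp t + (exp t - 1) / s" using s by (simp add: field_simps)
    also have "(exp t - 1) / s = (exp t - 1 - t) / s + L" using s by (simp add: t_def diff_divide_distrib)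
    finally show ?thesis by simp
  qed
  have "s * (s * l\<^sup>2) \<le> 1 * (s * l\<^sup>2)" using s by (intro mult_right_mono) auto
  moreover have "s * l \<le> s * l\<^sup>2"
    using s assms(4) by (intro mult_left_mono) (auto simp: power2_eq_square)
  ultimately have "\<bar>F' e u - (1 + L)\<bar> \<le> 3 * (s * l\<^sup>2)" unfolding e1 using q r tl by argo
  then show "\<bar>F' e u - (1 + ln (1 + u))\<bar> \<le> 3 * l\<^sup>2 * e\<^sup>2" by (simp add: s_def L_def mult.commute mult.left_commute)
  have e2: "F e u - (1 + u) * L = (1 + u) * ((exp t - 1 - t) / s)"
  proof -
    have "F e u = ((1 + u) * exp t - (1 + u)) / s" by (simp add: F_def s_def[symmetric] p1)
    also have "\<dots> = (1 + u) * ((exp t - 1 - t) / s) + (1 + u) * L" using s by (simp add: t_def field_simps)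
    finally show ?thesis by simp
  qed
  have "\<bar>F e u - (1 + u) * L\<bar> \<le> (1 + u) * (s * l\<^sup>2)"
    unfolding e2 abs_mult using r assms(2) by (intro mult_mono) auto
  then show "\<bar>F e u - (1 + u) * ln (1 + u)\<bar> \<le> (1 + u) * l\<^sup>2 * e\<^sup>2" by (simp add: s_def L_def mult.commute mult.left_commute)
qed

context ground_state
begin

definition wmax :: real where "wmax = (SOME B. 0 < B \<and> (\<forall>x. W x \<le> B))"

lemma wmax: "0 < wmax" "W x \<le> wmax"
proof -
  have "\<exists>B. 0 < B \<and> (\<forall>x. W x \<le> B)" using W_bounded by blast
  from someI_ex[OF this] show "0 < wmax" "W x \<le> wmax" unfolding wmax_def by auto
qed

text \<open>A constant rather than an existential, since the size of the ball for the contraction depends on it.\<close>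
definition C_green :: real where
  "C_green = (SOME C. 0 < C \<and> (\<forall>g M. g \<in> bcontfun \<and> (\<forall>x. g (- x) = g x) \<and> (\<forall>x. \<bar>g x\<bar> \<le> M) \<longrightarrow>
       (\<exists>u. green g u \<and> (\<forall>x. \<bar>u x\<bar> \<le> C * M))))"

lemma C_green_pos: "0 < C_green" and green_exists': "\<And>g M. g \<in> bcontfun \<Longrightarrow> (\<And>x. g (- x) = g x) \<Longrightarrow> (\<And>x. \<bar>g x\<bar> \<le> M) \<Longrightarrow>
       \<exists>u. green g u \<and> (\<forall>x. \<bar>u x\<bar> \<le> C_green * M)"
proof -
  have "\<exists>C. 0 < C \<and> (\<forall>g M. g \<in> bcontfun \<and> (\<forall>x. g (- x) = g x) \<and> (\<forall>x. \<bar>g x\<bar> \<le> M) \<longrightarrow>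
       (\<exists>u. green g u \<and> (\<forall>x. \<bar>u x\<bar> \<le> C * M)))"
    using green_exists by metis
  from someI_ex[OF this] show "0 < C_green" "\<And>g M. g \<in> bcontfun \<Longrightarrow> (\<And>x. g (- x) = g x) \<Longrightarrow> (\<And>x. \<bar>g x\<bar> \<le> M) \<Longrightarrow>
       \<exists>u. green g u \<and> (\<forall>x. \<bar>u x\<bar> \<le> C_green * M)"
    unfolding C_green_def[symmetric] by blast+
qed

lemma green_bound:
  assumes "green g u" "g \<in> bcontfun" "\<And>x. g (- x) = g x" "\<And>x. \<bar>g x\<bar> \<le> M"
  shows "\<bar>u x\<bar> \<le> C_green * M"
proof -
  obtain w where w: "green g w" "\<And>x. \<bar>w x\<bar> \<le> C_green * M" using green_exists'[OF assms(2-4)] by blast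
  then obtain w' where "\<And>x. (w has_real_derivative w' x) (at x)"
     "\<And>x. (w' has_real_derivative - Q x * w x - 12 * g x) (at x)" "w' 0 = 0"
    by (auto simp: green_def)
  from green_unique[OF assms(1) this w(2)] show ?thesis using w(2) by metis
qed

text \<open>The derivative of \<open>F0\<close> along \<open>W\<close>, that is, the coefficient of the linearisation.\<close>
definition a :: "real \<Rightarrow> real" where "a x = 1 + ln (1 + W x)"

lemma Q_a: "Q x = 12 * (a x - lam)" by (simp add: Q_def a_def)

definition A :: real where "A = 1 + wmax"

lemma a_bound: "\<bar>a x\<bar> \<le> A"
  using ln_add_one_self_le_self[of "W x"] W_pos[of x] wmax(2)[of x] by (simp add: a_def A_def)

lemma A_pos: "0 < A" using wmax by (simp add: A_def)

lemma a_bcontfun: "a \<in> bcontfun"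
proof (rule bcontfunI'[OF _ a_bound])
  have "1 + W x \<noteq> 0" for x using W_pos[of x] by linarith
  then show "continuous_on UNIV a"
    unfolding a_def[abs_def] by (intro continuous_intros continuous_W) auto
qed

lemma a_even: "a (- x) = a x" by (simp add: a_def W_even)

lemma W_bcontfun: "W \<in> bcontfun"
proof (rule bcontfunI'[OF continuous_W, of wmax])
  show "\<bar>W x\<bar> \<le> wmax" for x using W_pos[of x] wmax(2)[of x] by simp
qed

text \<open>The source \<open>f\<close> is nearly \<open>a d\<close>. The nearby function \<open>k\<close> is the Green solution of an explicit right-hand side,
  so \<open>s - k\<close> is the Green solution of \<open>(a d - f) + (lam - a) (y - k)\<close>, a small function. The lemma says that the resolvent of \<open>a d\<close>, corrected by the Green operator applied to \<open>a (d - y)\<close>, is small: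
  the exact cancellation in the limit equation.\<close>
lemma linearised_estimate:
  assumes e: "0 < e" "e \<le> 1" and f: "f \<in> bcontfun" "\<And>x. f (- x) = f x" "\<And>x. \<bar>f x\<bar> \<le> M"
    and y: "resolves lam e f y" and d: "d \<in> bcontfun" "\<And>x. d (- x) = d x"
    and m: "\<And>x. \<bar>a x * d x - f x\<bar> \<le> m"
    and s: "green (\<lambda>x. a x * (d x - y x)) s"
  shows "\<bar>y x - s x\<bar> \<le> (Cres lam * M * e) * (1 + C_green * (lam + A)) + C_green * m"
proof -
  have lam0: "0 < lam" using lam by simp
  obtain k k' where k: "\<And>x. (k has_real_derivative k' x) (at x)"
    "\<And>x. (k' has_real_derivative 12 * (lam * y x - f x)) (at x)"
    "\<And>x. \<bar>k x - y x\<bar> \<le> Cres lam * M * e" "k' 0 = 0"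
    using resolves_near_second_order[OF e lam0 f(1,3) y] f(2) by metis
  have yb: "y \<in> bcontfun" using y by (simp add: resolves_def)
  have ye: "y (- x) = y x" for x by (rule resolves_even[OF e(1) lam0 f(1) y f(2)])
  have k'o: "k' (- x) = - k' x" for x
    by (rule odd_of_even_derivative[OF k(2,4)]) (simp add: ye f)
  have ke: "k (- x) = k x" for x by (rule even_of_odd_derivative[OF k(1) k'o])
  obtain By where By: "\<And>x. \<bar>y x\<bar> \<le> By" using bcontfunD(3)[OF yb] by metis
  have kb: "\<bar>k x\<bar> \<le> By + Cres lam * M * e" for x using k(3)[of x] By[of x] by linarith
  have kB: "k \<in> bcontfun" by (rule bcontfunI'[OF has_derivative_continuous_on_UNIV[OF k(1)] kb])
  (* The right-hand side for which k solves the linearised equation exactly. *)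
  define g where "g x = f x - lam * y x + (lam - a x) * k x" for x
  have gk: "green g k"
    unfolding green_def using kB ke k(1,4)
  proof (intro conjI exI[of _ k'])
    have "12 * (lam * y x - f x) = - Q x * k x - 12 * g x" for x
      by (simp add: g_def Q_a algebra_simps)
    then show "\<forall>x. (k' has_real_derivative - Q x * k x - 12 * g x) (at x)" using k(2) by metis
  qed auto
  have "green (\<lambda>x. 1 * (a x * (d x - y x)) + (-1) * g x) (\<lambda>x. 1 * s x + (-1) * k x)"
    by (rule green_lincomb[OF s gk])
  moreover have "(\<lambda>x. 1 * (a x * (d x - y x)) + (-1) * g x) = (\<lambda>x. (a x * d x - f x) + (lam - a x) * (y x - k x))"
    by (simp add: g_def algebra_simps fun_eq_iff)
  ultimately have gr: "green (\<lambda>x. (a x * d x - f x) + (lam - a x) * (y x - k x)) (\<lambda>x. s x - k x)"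
    by simp
  have bb: "(\<lambda>x. (a x * d x - f x) + (lam - a x) * (y x - k x)) \<in> bcontfun"
  proof -
    have c1: "(\<lambda>x::real. lam) \<in> bcontfun" by (intro bcontfunI'[of _ "\<bar>lam\<bar>"]) auto
    have 1: "(\<lambda>x. 1 * (a x * d x) + (-1) * f x) \<in> bcontfun" by (intro bcontfun_lincomb bcontfun_mult a_bcontfun d f)
    have 2: "(\<lambda>x. (1 * lam + (-1) * a x) * (1 * y x + (-1) * k x)) \<in> bcontfun"
      by (intro bcontfun_mult bcontfun_lincomb[OF c1 a_bcontfun] bcontfun_lincomb[OF yb kB])
    show ?thesis using bcontfun_lincomb[OF 1 2, of 1 1] by simp
  qed
  have bd: "\<bar>(a x * d x - f x) + (lam - a x) * (y x - k x)\<bar> \<le> m + (lam + A) * (Cres lam * M * e)" for x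
  proof -
    have "\<bar>lam - a x\<bar> \<le> lam + A" using a_bound[of x] lam by argo
    then have "\<bar>(lam - a x) * (y x - k x)\<bar> \<le> (lam + A) * (Cres lam * M * e)"
      unfolding abs_mult using k(3)[of x] lam A_pos by (intro mult_mono) auto
    then show ?thesis using m[of x] by linarith
  qed
  have "\<bar>s x - k x\<bar> \<le> C_green * (m + (lam + A) * (Cres lam * M * e))"
    by (rule green_bound[OF gr bb _ bd]) (simp add: a_even d f ye ke)
  then have "\<bar>y x - s x\<bar> \<le> Cres lam * M * e + C_green * (m + (lam + A) * (Cres lam * M * e))"
    using k(3)[of x] by linarith
  then show ?thesis by (simp add: algebra_simps)
qed

text \<open>A bound for \<open>|ln (1 + u)|\<close> over the range of values that occurs.\<close>
definition ell :: real where "ell = 2 + wmax"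

lemma ell_ge: "1 \<le> ell" using wmax by (simp add: ell_def)

lemma ln_near: "\<bar>ln (1 + u)\<bar> \<le> ell" if "- 1 / 2 \<le> u" "u \<le> wmax + 1"
proof -
  have "ln (1 + u) \<le> u" using that by (intro ln_add_one_self_le_self2) auto
  moreover have "- 1 \<le> ln (1 + u)"
  proof -
    have "exp (- 1) \<le> (1 / 2 :: real)"
      using exp_ge_add_one_self[of 1] by (simp add: exp_minus field_simps)
    also have "\<dots> \<le> 1 + u" using that by simp
    finally show ?thesis using that by (subst ln_ge_iff) auto
  qed
  ultimately show ?thesis using that wmax(1) by (simp add: ell_def abs_le_iff)
qed

definition C_F :: real where "C_F = 3 * ell\<^sup>2 + (2 + wmax) * ell\<^sup>2"

lemma C_F_pos: "0 < C_F" using ell_ge wmax by (auto simp: C_F_def intro!: add_pos_pos mult_pos_pos)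

lemma F_near:
  assumes "0 < e" "e\<^sup>2 * ell \<le> 1" "- 1 / 2 \<le> u" "u \<le> wmax + 1"
  shows "\<bar>F' e u - (1 + ln (1 + u))\<bar> \<le> C_F * e\<^sup>2" "\<bar>F e u - F0 u\<bar> \<le> C_F * e\<^sup>2"
proof -
  have u: "-1 < u" using assms by simp
  note b = F_approx[OF assms(1) u ln_near[OF assms(3,4)] ell_ge assms(2)]
  have "3 * ell\<^sup>2 * e\<^sup>2 \<le> C_F * e\<^sup>2" unfolding C_F_def using wmax by (intro mult_right_mono) auto
  with b(1) show "\<bar>F' e u - (1 + ln (1 + u))\<bar> \<le> C_F * e\<^sup>2" by linarith
  have "(1 + u) * ell\<^sup>2 \<le> (2 + wmax) * ell\<^sup>2" using assms by (intro mult_right_mono) auto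
  then have "(1 + u) * ell\<^sup>2 \<le> C_F" unfolding C_F_def using zero_le_power2[of ell] by linarith
  then have "(1 + u) * ell\<^sup>2 * e\<^sup>2 \<le> C_F * e\<^sup>2" by (intro mult_right_mono) auto
  with b(2) show "\<bar>F e u - F0 u\<bar> \<le> C_F * e\<^sup>2" by (simp add: F0_def)
qed

lemma ln_diff_near: "\<bar>ln (1 + u) - ln (1 + w)\<bar> \<le> 2 * \<bar>u - w\<bar>" if "- 1 / 2 \<le> u" "- 1 / 2 \<le> w" for u w :: real
proof -
  have 1: "ln (1 + u) - ln (1 + w) \<le> 2 * \<bar>u - w\<bar>" if "- 1 / 2 \<le> u" "- 1 / 2 \<le> w" for u w :: real
  proof -
    have "ln (1 + u) - ln (1 + w) \<le> ((1 + u) - (1 + w)) / (1 + w)" using that by (intro ln_diff_le) auto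
    also have "\<dots> \<le> \<bar>u - w\<bar> / (1 + w)" using that by (intro divide_right_mono) auto
    also have "\<dots> \<le> \<bar>u - w\<bar> / (1 / 2)" using that by (intro divide_left_mono) auto
    finally show ?thesis by simp
  qed
  show ?thesis using 1[OF that] 1[OF that(2,1)] by (simp add: abs_minus_commute)
qed

text \<open>The Lipschitz constant of the remainder is small with \<open>e\<close> and with the radius \<open>del\<close>, the latter through the variation of the logarithm.\<close>
lemma F_difference:
  assumes e: "0 < e" "e\<^sup>2 * ell \<le> 1" and del: "del \<le> 1 / 2"
    and u: "\<bar>u1 - W x\<bar> \<le> del" "\<bar>u2 - W x\<bar> \<le> del"
  shows "\<bar>F e u1 - F e u2 - a x * (u1 - u2)\<bar> \<le> (C_F * e\<^sup>2 + 2 * del) * \<bar>u1 - u2\<bar>"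
proof -
  have main: "\<bar>F e u1 - F e u2 - a x * (u1 - u2)\<bar> \<le> (C_F * e\<^sup>2 + 2 * del) * \<bar>u1 - u2\<bar>"
    if "u2 \<le> u1" "\<bar>u1 - W x\<bar> \<le> del" "\<bar>u2 - W x\<bar> \<le> del" for u1 u2
  proof -
    have "\<bar>(F e u1 - a x * u1) - (F e u2 - a x * u2)\<bar> \<le> (C_F * e\<^sup>2 + 2 * del) * u1 - (C_F * e\<^sup>2 + 2 * del) * u2"
    proof (rule abs_diff_le_of_deriv[OF that(1), where f'="\<lambda>s. F' e s - a x" and g'="\<lambda>_. C_F * e\<^sup>2 + 2 * del"])
      fix s assume s: "u2 \<le> s" "s \<le> u1"
      have sW: "\<bar>s - W x\<bar> \<le> del" using s that by (simp add: abs_le_iff)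
      then have sr: "- 1 / 2 \<le> s" "s \<le> wmax + 1" using del W_pos[of x] wmax(2)[of x] by (auto simp: abs_le_iff)
      show "((\<lambda>s. F e s - a x * s) has_real_derivative F' e s - a x) (at s)"
        using DERIV_diff[OF F_deriv DERIV_cmult_Id] sr(1) by simp
      show "((*) (C_F * e\<^sup>2 + 2 * del) has_real_derivative C_F * e\<^sup>2 + 2 * del) (at s)"
        by (rule DERIV_cmult_Id)
      have "\<bar>ln (1 + s) - ln (1 + W x)\<bar> \<le> 2 * \<bar>s - W x\<bar>"
        using W_pos[of x] sr(1) by (intro ln_diff_near) auto
      then show "\<bar>F' e s - a x\<bar> \<le> C_F * e\<^sup>2 + 2 * del"
        using F_near(1)[OF e sr] sW unfolding a_def by argo
    qed
    then show ?thesis using that(1) by (simp add: algebra_simps)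
  qed
  show ?thesis
  proof (cases "u2 \<le> u1")
    case True
    then show ?thesis using main u by blast
  next
    case False
    then have "\<bar>F e u2 - F e u1 - a x * (u2 - u1)\<bar> \<le> (C_F * e\<^sup>2 + 2 * del) * \<bar>u2 - u1\<bar>" using main u by simp
    moreover have "\<bar>F e u2 - F e u1 - a x * (u2 - u1)\<bar> = \<bar>F e u1 - F e u2 - a x * (u1 - u2)\<bar>"
      by (subst abs_minus_cancel[symmetric]) (simp add: algebra_simps)
    ultimately show ?thesis by (simp add: abs_minus_commute)
  qed
qed

text \<open>The sup-norm ball around \<open>W\<close> in which the solution is unique.\<close>
definition near :: "real \<Rightarrow> (real \<Rightarrow> real) \<Rightarrow> bool" where
  "near del u \<longleftrightarrow> u \<in> bcontfun \<and> (\<forall>x. u (- x) = u x) \<and> (\<forall>x. \<bar>u x - W x\<bar> \<le> del)"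

definition C_source :: real where "C_source = wmax * (1 + wmax) + A + C_F + 1"

lemma C_source_pos: "0 < C_source" using wmax A_pos C_F_pos by (simp add: C_source_def add_pos_pos)

lemma near_source:
  assumes e: "0 < e" "e \<le> 1" "e\<^sup>2 * ell \<le> 1" and del: "0 \<le> del" "del \<le> 1 / 2" and u: "near del u"
  shows "(\<lambda>x. F e (u x)) \<in> bcontfun" "F e (u (- x)) = F e (u x)" "\<bar>F e (W x)\<bar> \<le> C_source"
proof -
  have r: "- 1 / 2 \<le> u x" "u x \<le> wmax + 1" for x
    using u[unfolded near_def, THEN conjunct2, THEN conjunct2, rule_format, of x] del W_pos[of x] wmax(2)[of x]
    by (auto simp: abs_le_iff)
  have e2: "e\<^sup>2 \<le> 1" using e by (simp add: power_le_one)
  have b: "\<bar>F e w\<bar> \<le> (2 + wmax) * ell + C_F" if "- 1 / 2 \<le> w" "w \<le> wmax + 1" for w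
  proof -
    have "\<bar>F0 w\<bar> \<le> (2 + wmax) * ell"
      unfolding F0_def abs_mult using that ln_near[OF that] by (intro mult_mono) auto
    moreover have "C_F * e\<^sup>2 \<le> C_F" using e2 C_F_pos by (simp add: mult_left_le)
    ultimately show ?thesis using F_near(2)[OF e(1,3) that] by linarith
  qed
  show "(\<lambda>x. F e (u x)) \<in> bcontfun"
  proof (rule bcontfunI'[OF _ b[OF r]])
    have n: "1 + u x \<noteq> 0" for x using r(1)[of x] by linarith
    show "continuous_on UNIV (\<lambda>x. F e (u x))"
      unfolding F_def using u n e by (intro continuous_intros bcontfunD(1)) (auto simp: near_def)
  qed
  show "F e (u (- x)) = F e (u x)" using u by (simp add: near_def)
  have "\<bar>F0 (W x)\<bar> \<le> wmax * (1 + wmax)"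
  proof -
    have "W x * (1 + W x) \<le> wmax * (1 + wmax)"
      using wmax W_pos[of x] by (intro mult_mono) (auto intro: less_imp_le)
    then show ?thesis using F0_le[of "W x"] F0_nonneg[of "W x"] W_pos[of x] by simp
  qed
  moreover have "C_F * e\<^sup>2 \<le> C_F" using e2 C_F_pos by (simp add: mult_left_le)
  moreover have "\<bar>F e (W x) - F0 (W x)\<bar> \<le> C_F * e\<^sup>2"
    using W_pos[of x] wmax(2)[of x] by (intro F_near[OF e(1,3)]) auto
  ultimately show "\<bar>F e (W x)\<bar> \<le> C_source" using A_pos unfolding C_source_def by linarith
qed

definition C_resid :: real where "C_resid = 2 * Cres lam * C_source + C_F"

lemma C_resid_pos: "0 < C_resid" using Cres_pos[of lam] lam C_source_pos C_F_pos by (simp add: C_resid_def add_pos_pos)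

text \<open>The resolvent of \<open>F\<^sub>e(W)\<close> is compared with \<open>W\<close>, the resolvent of \<open>F0(W)\<close> for \<open>e = 0\<close>: their difference, up to \<open>O(e)\<close>, solves
  \<open>k'' = 12 lam k\<close> with a small right-hand side, to which the maximum principle applies.\<close>
lemma residual_small:
  assumes e: "0 < e" "e \<le> 1" "e\<^sup>2 * ell \<le> 1" and y: "resolves lam e (\<lambda>x. F e (W x)) y"
  shows "\<bar>y x - W x\<bar> \<le> C_resid * e"
proof -
  have lam0: "0 < lam" using lam by simp
  have nW: "near 0 W" by (simp add: near_def W_bcontfun W_even)
  note f = near_source[OF e _ _ nW, simplified]
  obtain k k' where k: "\<And>x. (k has_real_derivative k' x) (at x)"
    "\<And>x. (k' has_real_derivative 12 * (lam * y x - F e (W x))) (at x)"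
    "\<And>x. \<bar>k x - y x\<bar> \<le> Cres lam * C_source * e"
    using resolves_near_second_order[OF e(1,2) lam0 f(1,3) y] by metis
  have yb: "y \<in> bcontfun" using y by (simp add: resolves_def)
  obtain By where By: "\<And>x. \<bar>y x\<bar> \<le> By" using bcontfunD(3)[OF yb] by metis
  have "\<bar>k x - W x\<bar> \<le> Cres lam * C_source * e + C_F * e"
  proof (rule bounded_solution_abs_le[where c="12 * lam" and k="\<lambda>x. k x - W x" and k'="\<lambda>x. k' x - W1 x"
        and r="\<lambda>x. 12 * (lam * (y x - k x) - (F e (W x) - F0 (W x)))" and K="By + Cres lam * C_source * e + wmax"])
    show "((\<lambda>x. k x - W x) has_real_derivative k' x - W1 x) (at x)" for x by (rule DERIV_diff[OF k(1) W_deriv])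
    have "((\<lambda>x. k' x - W1 x) has_real_derivative 12 * (lam * y x - F e (W x)) - W2 x) (at x)" for x
      by (rule DERIV_diff[OF k(2) W1_deriv])
    then show "((\<lambda>x. k' x - W1 x) has_real_derivative 12 * lam * (k x - W x) + 12 * (lam * (y x - k x) - (F e (W x) - F0 (W x)))) (at x)" for x
      by (simp add: W2_def algebra_simps)
    show "\<bar>k x - W x\<bar> \<le> By + Cres lam * C_source * e + wmax" for x
      using k(3)[of x] By[of x] W_pos[of x] wmax(2)[of x] by linarith
    show "\<bar>12 * (lam * (y x - k x) - (F e (W x) - F0 (W x)))\<bar> \<le> 12 * lam * (Cres lam * C_source * e + C_F * e)" for x
    proof -
      have "\<bar>lam * (y x - k x)\<bar> \<le> lam * (Cres lam * C_source * e)"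
        using k(3)[of x] lam0 by (simp add: abs_mult abs_minus_commute)
      moreover have "\<bar>F e (W x) - F0 (W x)\<bar> \<le> C_F * e\<^sup>2"
        using W_pos[of x] wmax(2)[of x] by (intro F_near[OF e(1,3)]) auto
      moreover have "C_F * e\<^sup>2 \<le> lam * (C_F * e)"
      proof -
        have "C_F * e\<^sup>2 = (C_F * e) * e" by (simp add: power2_eq_square)
        also have "\<dots> \<le> (C_F * e) * lam" using e lam C_F_pos by (intro mult_left_mono) auto
        finally show ?thesis by (simp add: mult.commute)
      qed
      moreover have "12 * lam * (Cres lam * C_source * e + C_F * e) = 12 * (lam * (Cres lam * C_source * e) + lam * (C_F * e))"
        by (simp add: distrib_left)
      ultimately show ?thesis by argo
    qed
  qed (use lam in simp)
  moreover have "C_resid * e = Cres lam * C_source * e + (Cres lam * C_source * e + C_F * e)" by (simp add: C_resid_def algebra_simps)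
  ultimately show ?thesis using k(3)[of x] by linarith
qed

definition resolvent :: "real \<Rightarrow> (real \<Rightarrow> real) \<Rightarrow> real \<Rightarrow> real" where
  "resolvent e u = (SOME y. resolves lam e (\<lambda>x. F e (u x)) y)"

definition green_solution :: "(real \<Rightarrow> real) \<Rightarrow> real \<Rightarrow> real" where
  "green_solution g = (SOME s. green g s)"

text \<open>A quasi-Newton map for \<open>u = resolvent e u\<close>. The derivative of the resolvent map at \<open>W\<close> is close to \<open>R a\<close>, where \<open>R = (lam - (1/12) d\<^sup>2/dx\<^sup>2)\<^sup>-\<^sup>1\<close>, and
  \<open>(1 - R a)\<^sup>-\<^sup>1 = 1 + G a\<close> for the Green operator \<open>G\<close>. Written as a correction of the resolvent, the map has derivative close to zero at \<open>W\<close>.\<close>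
definition Psi :: "real \<Rightarrow> (real \<Rightarrow> real) \<Rightarrow> real \<Rightarrow> real" where
  "Psi e u = (\<lambda>x. resolvent e u x - green_solution (\<lambda>x. a x * (u x - resolvent e u x)) x)"

lemma resolvent:
  assumes "0 < e" "(\<lambda>x. F e (u x)) \<in> bcontfun"
  shows "resolves lam e (\<lambda>x. F e (u x)) (resolvent e u)"
  unfolding resolvent_def using lam by (intro someI_ex[of "resolves lam e (\<lambda>x. F e (u x))"] resolves_exists assms) auto

lemma green_solution:
  assumes "g \<in> bcontfun" "\<And>x. g (- x) = g x"
  shows "green g (green_solution g)"
proof -
  obtain M where "\<And>x. \<bar>g x\<bar> \<le> M" using bcontfunD(3)[OF assms(1)] by metis
  then have "\<exists>s. green g s" using green_exists'[OF assms] by blast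
  then show ?thesis unfolding green_solution_def by (rule someI_ex)
qed

text \<open>The coefficient of \<open>e D\<close> when the linearised estimate is applied to a difference of two functions at distance \<open>D\<close>.\<close>
definition K1 :: real where "K1 = Cres lam * (A + C_F + 1) * (1 + C_green * (lam + A)) + C_green * C_F"
definition K2 :: real where "K2 = (1 + C_green * A) * C_resid"

lemma K1_pos: "0 < K1" and K2_pos: "0 < K2"
  using Cres_pos[of lam] lam A_pos C_F_pos C_green_pos C_resid_pos
  by (auto simp: K1_def K2_def intro!: add_pos_pos mult_pos_pos)

lemma Psi_parts:
  assumes e: "0 < e" "e \<le> 1" "e\<^sup>2 * ell \<le> 1" and del: "0 \<le> del" "del \<le> 1 / 2" and u: "near del u"
  shows "resolves lam e (\<lambda>x. F e (u x)) (resolvent e u)" "resolvent e u \<in> bcontfun" "resolvent e u (- x) = resolvent e u x"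
    "(\<lambda>x. a x * (u x - resolvent e u x)) \<in> bcontfun"
    "green (\<lambda>x. a x * (u x - resolvent e u x)) (green_solution (\<lambda>x. a x * (u x - resolvent e u x)))"
    "Psi e u \<in> bcontfun" "Psi e u (- x) = Psi e u x"
proof -
  note f = near_source[OF e del u]
  have lam0: "0 < lam" using lam by simp
  show y: "resolves lam e (\<lambda>x. F e (u x)) (resolvent e u)" by (rule resolvent[OF e(1) f(1)])
  then show yb: "resolvent e u \<in> bcontfun" by (simp add: resolves_def)
  have ye: "resolvent e u (- x) = resolvent e u x" for x by (rule resolves_even[OF e(1) lam0 f(1) y f(2)])
  then show "resolvent e u (- x) = resolvent e u x" .
  have ub: "u \<in> bcontfun" "\<And>x. u (- x) = u x" using u by (auto simp: near_def)
  show gb: "(\<lambda>x. a x * (u x - resolvent e u x)) \<in> bcontfun"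
    using bcontfun_mult[OF a_bcontfun bcontfun_lincomb[OF ub(1) yb, of 1 "-1"]] by simp
  show s: "green (\<lambda>x. a x * (u x - resolvent e u x)) (green_solution (\<lambda>x. a x * (u x - resolvent e u x)))"
    by (rule green_solution[OF gb]) (simp add: a_even ub ye)
  then have sb: "green_solution (\<lambda>x. a x * (u x - resolvent e u x)) \<in> bcontfun"
    and se: "green_solution (\<lambda>x. a x * (u x - resolvent e u x)) (- x) = green_solution (\<lambda>x. a x * (u x - resolvent e u x)) x" for x
    by (auto simp: green_def)
  show "Psi e u \<in> bcontfun" unfolding Psi_def using bcontfun_lincomb[OF yb sb, of 1 "-1"] by simp
  show "Psi e u (- x) = Psi e u x" by (simp add: Psi_def se ye)
qed

text \<open>The linearised estimate with \<open>d = u1 - u2\<close>. The terms of order \<open>e\<close> and the term of order \<open>del\<close> contribute at most a quarter each.\<close>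
lemma Psi_contraction:
  assumes e: "0 < e" "e \<le> 1" "e\<^sup>2 * ell \<le> 1" "K1 * e \<le> 1 / 4" and del: "0 \<le> del" "del \<le> 1 / 2" "8 * C_green * del \<le> 1"
    and u: "near del u1" "near del u2" and D: "\<And>x. \<bar>u1 x - u2 x\<bar> \<le> D"
  shows "\<bar>Psi e u1 x - Psi e u2 x\<bar> \<le> D / 2"
proof -
  have D0: "0 \<le> D" using D[of 0] by linarith
  have e2: "e\<^sup>2 \<le> e" "e\<^sup>2 \<le> 1" using e by (simp_all add: power2_eq_square mult_left_le mult_le_one)
  note p1 = Psi_parts[OF e(1-3) del(1,2) u(1)] and p2 = Psi_parts[OF e(1-3) del(1,2) u(2)]
  note f1 = near_source[OF e(1-3) del(1,2) u(1)] and f2 = near_source[OF e(1-3) del(1,2) u(2)]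
  define f where "f x = F e (u1 x) - F e (u2 x)" for x
  define d where "d x = u1 x - u2 x" for x
  define y where "y x = resolvent e u1 x - resolvent e u2 x" for x
  define m where "m = (C_F * e\<^sup>2 + 2 * del) * D"
  have fb: "f \<in> bcontfun" using bcontfun_lincomb[OF f1(1) f2(1), of 1 "-1"] by (simp add: f_def[abs_def])
  have db: "d \<in> bcontfun" using bcontfun_lincomb[of u1 u2 1 "-1"] u by (simp add: d_def[abs_def] near_def)
  have yr: "resolves lam e f y"
    using resolves_lincomb[OF p1(1) p2(1) f1(1) f2(1), of 1 "-1"] by (simp add: f_def[abs_def] y_def[abs_def])
  have mb: "\<bar>a x * d x - f x\<bar> \<le> m" for x
  proof -
    have "\<bar>F e (u1 x) - F e (u2 x) - a x * (u1 x - u2 x)\<bar> \<le> (C_F * e\<^sup>2 + 2 * del) * \<bar>u1 x - u2 x\<bar>"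
      using u by (intro F_difference[OF e(1,3) del(2)]) (auto simp: near_def)
    also have "\<dots> \<le> m" unfolding m_def using D[of x] C_F_pos del by (intro mult_left_mono) auto
    finally show ?thesis by (simp add: f_def d_def abs_minus_commute)
  qed
  have fM: "\<bar>f x\<bar> \<le> (A + C_F + 1) * D" for x
  proof -
    have "\<bar>a x * d x\<bar> \<le> A * D" unfolding abs_mult d_def using a_bound D A_pos by (intro mult_mono) auto
    moreover have "m \<le> (C_F + 1) * D"
    proof -
      have "C_F * e\<^sup>2 \<le> C_F" using e2 C_F_pos by (simp add: mult_left_le)
      then show ?thesis unfolding m_def using del D0 by (intro mult_right_mono) auto
    qed
    moreover have "(A + C_F + 1) * D = A * D + (C_F + 1) * D" by (simp add: algebra_simps)
    ultimately show ?thesis using mb[of x] by linarith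
  qed
  have "green (\<lambda>x. 1 * (a x * (u1 x - resolvent e u1 x)) + (-1) * (a x * (u2 x - resolvent e u2 x)))
     (\<lambda>x. 1 * green_solution (\<lambda>x. a x * (u1 x - resolvent e u1 x)) x + (-1) * green_solution (\<lambda>x. a x * (u2 x - resolvent e u2 x)) x)"
    by (rule green_lincomb[OF p1(5) p2(5)])
  moreover have "(\<lambda>x. 1 * (a x * (u1 x - resolvent e u1 x)) + (-1) * (a x * (u2 x - resolvent e u2 x))) = (\<lambda>x. a x * (d x - y x))"
    by (simp add: d_def y_def algebra_simps fun_eq_iff)
  ultimately have gs: "green (\<lambda>x. a x * (d x - y x)) (\<lambda>x. green_solution (\<lambda>x. a x * (u1 x - resolvent e u1 x)) x - green_solution (\<lambda>x. a x * (u2 x - resolvent e u2 x)) x)"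
    by simp
  have "\<bar>y x - (green_solution (\<lambda>x. a x * (u1 x - resolvent e u1 x)) x - green_solution (\<lambda>x. a x * (u2 x - resolvent e u2 x)) x)\<bar>
     \<le> (Cres lam * ((A + C_F + 1) * D) * e) * (1 + C_green * (lam + A)) + C_green * m"
    using u by (intro linearised_estimate[OF e(1,2) fb _ fM yr db _ mb gs])
      (auto simp: f_def d_def near_def)
  also have "\<dots> = (K1 * e + C_green * C_F * (e\<^sup>2 - e) + 2 * C_green * del) * D"
    by (simp add: K1_def m_def algebra_simps)
  also have "\<dots> \<le> (1 / 2) * D"
  proof (rule mult_right_mono[OF _ D0])
    have "C_green * C_F * (e\<^sup>2 - e) \<le> 0" using C_green_pos C_F_pos e2 by (intro mult_nonneg_nonpos) auto
    then show "K1 * e + C_green * C_F * (e\<^sup>2 - e) + 2 * C_green * del \<le> 1 / 2" using e(4) del(3) by argo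
  qed
  finally show ?thesis by (simp add: Psi_def y_def algebra_simps)
qed

lemma Psi_W:
  assumes e: "0 < e" "e \<le> 1" "e\<^sup>2 * ell \<le> 1"
  shows "\<bar>Psi e W x - W x\<bar> \<le> K2 * e"
proof -
  have nW: "near 0 W" by (simp add: near_def W_bcontfun W_even)
  note p = Psi_parts[OF e _ _ nW, simplified]
  have r: "\<bar>resolvent e W x - W x\<bar> \<le> C_resid * e" for x by (rule residual_small[OF e p(1)])
  have gb: "\<bar>a x * (W x - resolvent e W x)\<bar> \<le> A * (C_resid * e)" for x
    unfolding abs_mult using a_bound r[of x] A_pos by (intro mult_mono) (auto simp: abs_minus_commute)
  have "\<bar>green_solution (\<lambda>x. a x * (W x - resolvent e W x)) x\<bar> \<le> C_green * (A * (C_resid * e))"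
    by (rule green_bound[OF p(5,4) _ gb]) (simp add: a_even W_even p(3))
  moreover have "K2 * e = C_resid * e + C_green * (A * (C_resid * e))" by (simp add: K2_def algebra_simps)
  ultimately show ?thesis using r[of x] by (simp add: Psi_def abs_le_iff)
qed

text \<open>If \<open>u\<close> equals its resolvent, the correction is the Green solution of the zero source.\<close>
lemma Psi_fixed_of_solution:
  assumes e: "0 < e" "e \<le> 1" "e\<^sup>2 * ell \<le> 1" and del: "0 \<le> del" "del \<le> 1 / 2" and u: "near del u"
    and r: "resolves lam e (\<lambda>x. F e (u x)) u"
  shows "Psi e u x = u x"
proof -
  note p = Psi_parts[OF e del u]
  have eq: "resolvent e u x = u x" for x
    using lam by (intro resolves_unique[OF e(1) _ near_source(1)[OF e del u] p(1) r]) simp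
  have "\<bar>green_solution (\<lambda>x. a x * (u x - resolvent e u x)) x\<bar> \<le> C_green * 0"
    by (rule green_bound[OF p(5,4)]) (simp_all add: eq)
  then show ?thesis by (simp add: Psi_def eq)
qed

text \<open>At a fixed point the function \<open>d = u - resolvent e u\<close> equals \<open>- G (a d)\<close>, so it solves \<open>d'' = 12 lam d\<close> and is bounded; hence it vanishes.\<close>
lemma solution_of_Psi_fixed:
  assumes e: "0 < e" "e \<le> 1" "e\<^sup>2 * ell \<le> 1" and del: "0 \<le> del" "del \<le> 1 / 2" and u: "near del u"
    and fixp: "\<And>x. Psi e u x = u x"
  shows "resolves lam e (\<lambda>x. F e (u x)) u"
proof -
  note p = Psi_parts[OF e del u]
  define s where "s = green_solution (\<lambda>x. a x * (u x - resolvent e u x))"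
  have s: "s x = resolvent e u x - u x" for x using fixp[of x] by (simp add: Psi_def s_def)
  obtain s' where s': "\<And>x. (s has_real_derivative s' x) (at x)"
    "\<And>x. (s' has_real_derivative - Q x * s x - 12 * (a x * (u x - resolvent e u x))) (at x)"
    using p(5) unfolding s_def[symmetric] green_def by blast
  have s'': "(s' has_real_derivative 12 * lam * s x + 0) (at x)" for x
    using s'(2)[of x] by (simp add: s Q_a algebra_simps)
  obtain B where B: "\<And>x. \<bar>s x\<bar> \<le> B" using p(5) bcontfunD(3) unfolding s_def[symmetric] green_def by metis
  have "\<bar>s x\<bar> \<le> 0" for x
    by (rule bounded_solution_abs_le[OF s'(1) s'' _ _ B]) (use lam in auto)
  then have "resolvent e u = u" using s by (auto simp: fun_eq_iff)
  then show ?thesis using p(1) by simp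
qed

text \<open>Banach's theorem in the ball of radius \<open>del\<close>. The error is twice the displacement of the centre, which is \<open>O(e)\<close>.\<close>
theorem continuous_solution:
  assumes e: "0 < e" "e \<le> 1" "e\<^sup>2 * ell \<le> 1" "K1 * e \<le> 1 / 4" "K2 * e \<le> del / 2"
    and del: "0 < del" "del \<le> 1 / 2" "8 * C_green * del \<le> 1"
  obtains u where "near del u" "resolves lam e (\<lambda>x. F e (u x)) u" "\<And>x. \<bar>u x - W x\<bar> \<le> 2 * K2 * e"
    "\<And>w x. near del w \<Longrightarrow> resolves lam e (\<lambda>x. F e (w x)) w \<Longrightarrow> w x = u x"
proof -
  have del0: "0 \<le> del" using del by simp
  define X where "X = {u :: real \<Rightarrow>\<^sub>C real. (\<forall>x. apply_bcontfun u (- x) = apply_bcontfun u x) \<and> (\<forall>x. \<bar>apply_bcontfun u x - W x\<bar> \<le> del)}"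
  have nX: "near del (apply_bcontfun u) \<longleftrightarrow> u \<in> X" for u
    using apply_bcontfun[of u] by (auto simp: near_def X_def)
  have nW: "near del W" using del by (simp add: near_def W_bcontfun W_even)
  have self: "near del (Psi e u)" if "near del u" for u
  proof -
    note p = Psi_parts[OF e(1-3) del0 del(2) that]
    have "\<bar>Psi e u x - W x\<bar> \<le> del" for x
    proof -
      have "\<bar>Psi e u x - Psi e W x\<bar> \<le> del / 2"
        using that by (intro Psi_contraction[OF e(1-4) del0 del(2,3) that nW]) (auto simp: near_def)
      then show ?thesis using Psi_W[OF e(1-3), of x] e(5) by argo
    qed
    then show ?thesis using p by (simp add: near_def)
  qed
  have "\<exists>!u\<in>X. Bcontfun (Psi e (apply_bcontfun u)) = u"
  proof (rule Banach_fix[of X "1 / 2"])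
    show "complete X" unfolding X_def complete_eq_closed by (rule closed_bcontfun_pointwise)
    have "Bcontfun W \<in> X" using nW nX[of "Bcontfun W"] by (simp add: Bcontfun_inverse W_bcontfun)
    then show "X \<noteq> {}" by blast
    show "(\<lambda>u. Bcontfun (Psi e (apply_bcontfun u))) ` X \<subseteq> X"
    proof
      fix v assume "v \<in> (\<lambda>u. Bcontfun (Psi e (apply_bcontfun u))) ` X"
      then obtain u where u: "u \<in> X" "v = Bcontfun (Psi e (apply_bcontfun u))" by blast
      then have "near del (Psi e (apply_bcontfun u))" using self nX by blast
      moreover then have "apply_bcontfun v = Psi e (apply_bcontfun u)" using u by (simp add: Bcontfun_inverse near_def)
      ultimately show "v \<in> X" using nX by metis
    qed
    show "dist (Bcontfun (Psi e (apply_bcontfun u))) (Bcontfun (Psi e (apply_bcontfun w))) \<le> 1 / 2 * dist u w"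
      if "u \<in> X" "w \<in> X" for u w
    proof (rule dist_bound)
      fix x
      have n: "near del (apply_bcontfun u)" "near del (apply_bcontfun w)" using that nX by auto
      have "\<bar>Psi e (apply_bcontfun u) x - Psi e (apply_bcontfun w) x\<bar> \<le> dist u w / 2"
        using dist_bounded[of u _ w] by (intro Psi_contraction[OF e(1-4) del0 del(2,3) n]) (simp add: dist_real_def)
      moreover have "Psi e (apply_bcontfun u) \<in> bcontfun" "Psi e (apply_bcontfun w) \<in> bcontfun"
        using self[OF n(1)] self[OF n(2)] by (auto simp: near_def)
      ultimately show "dist (apply_bcontfun (Bcontfun (Psi e (apply_bcontfun u))) x) (apply_bcontfun (Bcontfun (Psi e (apply_bcontfun w))) x) \<le> 1 / 2 * dist u w"
        by (simp add: Bcontfun_inverse dist_real_def)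
    qed
  qed auto
  then obtain u where u: "u \<in> X" "Bcontfun (Psi e (apply_bcontfun u)) = u" by blast
  have n: "near del (apply_bcontfun u)" using u(1) nX by blast
  have fx: "Psi e (apply_bcontfun u) x = apply_bcontfun u x" for x
    using u(2) self[OF n] by (metis Bcontfun_inverse near_def)
  have contr: "w x - w' x \<le> 0"
    if "near del w" "near del w'" "\<And>x. \<bar>w x - w' x\<bar> \<le> \<bar>Psi e w x - Psi e w' x\<bar>" for w w' x
  proof -
    have "\<bar>w x - w' x\<bar> \<le> 0"
    proof (rule nonpos_of_contraction[where S=UNIV and c="1 / 2" and E="\<lambda>x. \<bar>w x - w' x\<bar>" and K="2 * del"])
      fix s x assume "0 \<le> s" "\<And>x. x \<in> UNIV \<Longrightarrow> \<bar>w x - w' x\<bar> \<le> s"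
      then have "\<bar>Psi e w x - Psi e w' x\<bar> \<le> s / 2"
        using that(1,2) by (intro Psi_contraction[OF e(1-4) del0 del(2,3)]) auto
      then show "\<bar>w x - w' x\<bar> \<le> 1 / 2 * s" using that(3)[of x] by simp
    next
      fix x
      have "\<bar>w x - W x\<bar> \<le> del" "\<bar>w' x - W x\<bar> \<le> del" using that by (auto simp: near_def)
      then show "\<bar>w x - w' x\<bar> \<le> 2 * del" by linarith
    qed auto
    then show ?thesis by simp
  qed
  show thesis
  proof (rule that[OF n])
    show r: "resolves lam e (\<lambda>x. F e (apply_bcontfun u x)) (apply_bcontfun u)"
      by (rule solution_of_Psi_fixed[OF e(1-3) del0 del(2) n fx])
    show "\<bar>apply_bcontfun u x - W x\<bar> \<le> 2 * K2 * e" for x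
    proof -
      have "\<bar>apply_bcontfun u x - W x\<bar> - 2 * K2 * e \<le> 0"
      proof (rule nonpos_of_contraction[where S=UNIV and c="1 / 2" and E="\<lambda>x. \<bar>apply_bcontfun u x - W x\<bar> - 2 * K2 * e" and K=del])
        fix s x assume "0 \<le> s" and s: "\<And>x. x \<in> UNIV \<Longrightarrow> \<bar>apply_bcontfun u x - W x\<bar> - 2 * K2 * e \<le> s"
        then have "\<bar>Psi e (apply_bcontfun u) x - Psi e W x\<bar> \<le> (s + 2 * K2 * e) / 2"
          by (intro Psi_contraction[OF e(1-4) del0 del(2,3) n nW]) (simp add: algebra_simps)
        then show "\<bar>apply_bcontfun u x - W x\<bar> - 2 * K2 * e \<le> 1 / 2 * s"
          using Psi_W[OF e(1-3), of x] unfolding fx by argo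
      next
        fix x
        have "\<bar>apply_bcontfun u x - W x\<bar> \<le> del" using n by (auto simp: near_def)
        moreover have "0 \<le> 2 * K2 * e" using K2_pos e by simp
        ultimately show "\<bar>apply_bcontfun u x - W x\<bar> - 2 * K2 * e \<le> del" by linarith
      qed auto
      then show ?thesis by simp
    qed
    show "w x = apply_bcontfun u x" if w: "near del w" "resolves lam e (\<lambda>x. F e (w x)) w" for w x
    proof -
      have fw: "Psi e w x = w x" for x by (rule Psi_fixed_of_solution[OF e(1-3) del0 del(2) w])
      have "w x - apply_bcontfun u x \<le> 0" by (rule contr[OF w(1) n]) (simp add: fw fx)
      moreover have "apply_bcontfun u x - w x \<le> 0" by (rule contr[OF n w(1)]) (simp add: fw fx)
      ultimately show ?thesis by simp
    qed
  qed
qed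

end

section \<open>Families of functions with bounded derivatives\<close>

text \<open>For a family \<open>f e\<close>, \<open>e \<in> E\<close>: \<open>k\<close> continuous derivatives, each bounded by a multiple of the weight \<open>om\<close> with a constant that does not
  depend on \<open>e\<close>. The constant weight is used for uniform bounds and an exponential weight for decay. Derivatives are existentially quantified so that induction on \<open>k\<close> can differentiate once
  and pass to the family of derivatives.\<close>
primrec ubd :: "nat \<Rightarrow> 'e set \<Rightarrow> (real \<Rightarrow> real) \<Rightarrow> ('e \<Rightarrow> real \<Rightarrow> real) \<Rightarrow> bool" where
  "ubd 0 E om f \<longleftrightarrow> (\<forall>e\<in>E. continuous_on UNIV (f e)) \<and> (\<exists>C. \<forall>e\<in>E. \<forall>x. \<bar>f e x\<bar> \<le> C * om x)"
| "ubd (Suc k) E om f \<longleftrightarrow> (\<exists>C. \<forall>e\<in>E. \<forall>x. \<bar>f e x\<bar> \<le> C * om x) \<and>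
     (\<exists>f'. (\<forall>e\<in>E. \<forall>x. (f e has_real_derivative f' e x) (at x)) \<and> ubd k E om f')"

lemma ubd_SucI:
  assumes "\<And>e x. e \<in> E \<Longrightarrow> \<bar>f e x\<bar> \<le> C * om x"
    "\<And>e x. e \<in> E \<Longrightarrow> (f e has_real_derivative f' e x) (at x)" "ubd k E om f'"
  shows "ubd (Suc k) E om f"
  unfolding ubd.simps(2) using assms by blast

lemma ubd_SucE:
  assumes "ubd (Suc k) E om f"
  obtains f' where "\<And>e x. e \<in> E \<Longrightarrow> (f e has_real_derivative f' e x) (at x)" "ubd k E om f'"
  using assms unfolding ubd.simps(2) by blast

lemma ubd_continuous: "ubd k E om f \<Longrightarrow> e \<in> E \<Longrightarrow> continuous_on UNIV (f e)"
proof (cases k)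
  case (Suc i)
  assume "ubd k E om f" and e: "e \<in> E"
  then obtain f' where "\<forall>e\<in>E. \<forall>x. (f e has_real_derivative f' e x) (at x)" using Suc by auto
  then show ?thesis using e by (intro has_derivative_continuous_on_UNIV[of "f e" "f' e"]) auto
qed auto

lemma ubd_bounded:
  assumes "ubd k E om f" "\<And>x. 0 \<le> om x"
  shows "\<exists>C\<ge>0. \<forall>e\<in>E. \<forall>x. \<bar>f e x\<bar> \<le> C * om x"
proof -
  obtain C where C: "\<forall>e\<in>E. \<forall>x. \<bar>f e x\<bar> \<le> C * om x" using assms(1) by (cases k) auto
  have "C * om x \<le> \<bar>C\<bar> * om x" for x by (rule mult_right_mono) (use assms in auto)
  then have "\<forall>e\<in>E. \<forall>x. \<bar>f e x\<bar> \<le> \<bar>C\<bar> * om x" using C by (meson order_trans)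
  then show ?thesis by (intro exI[of _ "\<bar>C\<bar>"]) auto
qed

lemma ubd_Suc_imp: "ubd (Suc k) E om f \<Longrightarrow> ubd k E om f"
proof (induction k arbitrary: f)
  case 0
  then show ?case using ubd_continuous[OF 0] by auto
next
  case (Suc k)
  have "\<exists>C. \<forall>e\<in>E. \<forall>x. \<bar>f e x\<bar> \<le> C * om x" using Suc.prems by (simp add: ubd.simps(2)[of "Suc k"] del: ubd.simps)
  moreover obtain f' where "\<And>e x. e \<in> E \<Longrightarrow> (f e has_real_derivative f' e x) (at x)" "ubd (Suc k) E om f'"
    using ubd_SucE[OF Suc.prems] by blast
  ultimately show ?case using Suc.IH[of f'] by (metis ubd_SucI)
qed

lemma ubd_weight:
  assumes "ubd k E om f" "\<And>x. 0 \<le> om x" "\<And>x. om x \<le> om' x"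
  shows "ubd k E om' f"
  using assms(1)
proof (induction k arbitrary: f)
  case 0
  obtain C where C: "0 \<le> C" "\<And>e x. e \<in> E \<Longrightarrow> \<bar>f e x\<bar> \<le> C * om x" using ubd_bounded[OF 0 assms(2)] by auto
  have "\<bar>f e x\<bar> \<le> C * om' x" if "e \<in> E" for e x
    using C(2)[OF that, of x] mult_left_mono[OF assms(3)[of x] C(1)] by linarith
  then show ?case using 0 by auto
next
  case (Suc k)
  obtain C where C: "0 \<le> C" "\<And>e x. e \<in> E \<Longrightarrow> \<bar>f e x\<bar> \<le> C * om x" using ubd_bounded[OF Suc.prems assms(2)] by auto
  have "\<bar>f e x\<bar> \<le> C * om' x" if "e \<in> E" for e x
    using C(2)[OF that, of x] mult_left_mono[OF assms(3)[of x] C(1)] by linarith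
  moreover obtain f' where "\<And>e x. e \<in> E \<Longrightarrow> (f e has_real_derivative f' e x) (at x)" "ubd k E om f'"
    using ubd_SucE[OF Suc.prems] by blast
  ultimately show ?case using Suc.IH by (intro ubd_SucI[where f'=f']) auto
qed

lemma ubd_add:
  assumes "ubd k E om f" "ubd k E om g" "\<And>x. 0 \<le> om x"
  shows "ubd k E om (\<lambda>e x. f e x + g e x)"
  using assms(1,2)
proof (induction k arbitrary: f g)
  case (0 f g)
  obtain C where C0: "0 \<le> C" and C: "\<And>e x. e \<in> E \<Longrightarrow> \<bar>f e x\<bar> \<le> C * om x" using ubd_bounded[OF 0(1) assms(3)] by auto
  obtain D where D0: "0 \<le> D" and D: "\<And>e x. e \<in> E \<Longrightarrow> \<bar>g e x\<bar> \<le> D * om x" using ubd_bounded[OF 0(2) assms(3)] by auto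
  have "\<bar>f e x + g e x\<bar> \<le> (C + D) * om x" if "e \<in> E" for e x
    using C[OF that, of x] D[OF that, of x] by (simp add: distrib_right abs_le_iff)
  then show ?case using 0 by (auto intro!: continuous_intros)
next
  case (Suc k f g)
  obtain C where C0: "0 \<le> C" and C: "\<And>e x. e \<in> E \<Longrightarrow> \<bar>f e x\<bar> \<le> C * om x" using ubd_bounded[OF Suc.prems(1) assms(3)] by auto
  obtain D where D0: "0 \<le> D" and D: "\<And>e x. e \<in> E \<Longrightarrow> \<bar>g e x\<bar> \<le> D * om x" using ubd_bounded[OF Suc.prems(2) assms(3)] by auto
  have "\<bar>f e x + g e x\<bar> \<le> (C + D) * om x" if "e \<in> E" for e x
    using C[OF that, of x] D[OF that, of x] by (simp add: distrib_right abs_le_iff)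
  moreover obtain f' where "\<And>e x. e \<in> E \<Longrightarrow> (f e has_real_derivative f' e x) (at x)" "ubd k E om f'"
    using ubd_SucE[OF Suc.prems(1)] by blast
  moreover obtain g' where "\<And>e x. e \<in> E \<Longrightarrow> (g e has_real_derivative g' e x) (at x)" "ubd k E om g'"
    using ubd_SucE[OF Suc.prems(2)] by blast
  ultimately show ?case using Suc.IH[of f' g']
    by (intro ubd_SucI[where f'="\<lambda>e x. f' e x + g' e x"]) (auto intro: DERIV_add)
qed

lemma ubd_mult:
  assumes "ubd k E (\<lambda>_. 1) f" "ubd k E om g" "\<And>x. 0 \<le> om x"
  shows "ubd k E om (\<lambda>e x. f e x * g e x)"
  using assms(1,2)
proof (induction k arbitrary: f g)
  case (0 f g)
  obtain C where C: "0 \<le> C" "\<And>e x. e \<in> E \<Longrightarrow> \<bar>f e x\<bar> \<le> C * 1" using ubd_bounded[OF 0(1) zero_le_one] by auto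
  obtain D where D0: "0 \<le> D" and D: "\<And>e x. e \<in> E \<Longrightarrow> \<bar>g e x\<bar> \<le> D * om x" using ubd_bounded[OF 0(2) assms(3)] by auto
  have "\<bar>f e x * g e x\<bar> \<le> (C * D) * om x" if "e \<in> E" for e x
    using mult_mono[OF C(2)[OF that, of x] D[OF that, of x]] C(1) by (simp add: abs_mult)
  then show ?case using 0 by (auto intro!: continuous_intros)
next
  case (Suc k f g)
  obtain C where C: "0 \<le> C" "\<And>e x. e \<in> E \<Longrightarrow> \<bar>f e x\<bar> \<le> C * 1" using ubd_bounded[OF Suc.prems(1) zero_le_one] by auto
  obtain D where D0: "0 \<le> D" and D: "\<And>e x. e \<in> E \<Longrightarrow> \<bar>g e x\<bar> \<le> D * om x" using ubd_bounded[OF Suc.prems(2) assms(3)] by auto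
  have "\<bar>f e x * g e x\<bar> \<le> (C * D) * om x" if "e \<in> E" for e x
    using mult_mono[OF C(2)[OF that, of x] D[OF that, of x]] C(1) by (simp add: abs_mult)
  moreover obtain f' where f': "\<And>e x. e \<in> E \<Longrightarrow> (f e has_real_derivative f' e x) (at x)" "ubd k E (\<lambda>_. 1) f'"
    using ubd_SucE[OF Suc.prems(1)] by blast
  moreover obtain g' where g': "\<And>e x. e \<in> E \<Longrightarrow> (g e has_real_derivative g' e x) (at x)" "ubd k E om g'"
    using ubd_SucE[OF Suc.prems(2)] by blast
  moreover have "ubd k E om (\<lambda>e x. f' e x * g e x + f e x * g' e x)"
    using Suc.IH[OF f'(2) ubd_Suc_imp[OF Suc.prems(2)]] Suc.IH[OF ubd_Suc_imp[OF Suc.prems(1)] g'(2)] assms(3)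
    by (rule ubd_add)
  moreover have "((\<lambda>x. f e x * g e x) has_real_derivative f' e x * g e x + f e x * g' e x) (at x)" if "e \<in> E" for e x
    using DERIV_mult[OF f'(1)[OF that] g'(1)[OF that]] by (simp add: mult.commute)
  ultimately show ?case by (intro ubd_SucI[where f'="\<lambda>e x. f' e x * g e x + f e x * g' e x"]) auto
qed

lemma ubd_const: "ubd k E (\<lambda>_. 1) (\<lambda>e x. c)"
proof (induction k arbitrary: c)
  case (0 c)
  show ?case unfolding ubd.simps by (intro conjI exI[of _ "\<bar>c\<bar>"]) auto
next
  case (Suc k c)
  show ?case by (rule ubd_SucI[where f'="\<lambda>_ _. 0" and C="\<bar>c\<bar>", OF _ _ Suc.IH]) auto
qed

text \<open>All \<open>G j\<close> are treated at once because the chain rule turns \<open>G j\<close> into \<open>G (Suc j)\<close>.\<close>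
lemma ubd_comp:
  fixes G :: "nat \<Rightarrow> 'e \<Rightarrow> real \<Rightarrow> real"
  assumes G: "\<And>j e u. e \<in> E \<Longrightarrow> u \<in> R \<Longrightarrow> (G j e has_real_derivative G (Suc j) e u) (at u)"
    and Gb: "\<And>j. \<exists>C. \<forall>e\<in>E. \<forall>u\<in>R. \<bar>G j e u\<bar> \<le> C"
    and U: "ubd k E (\<lambda>_. 1) U" and R: "\<And>e x. e \<in> E \<Longrightarrow> U e x \<in> R"
  shows "ubd k E (\<lambda>_. 1) (\<lambda>e x. G j e (U e x))"
  using U
proof (induction k arbitrary: j)
  case 0
  have "continuous_on UNIV (\<lambda>x. G j e (U e x))" if "e \<in> E" for e
  proof -
    have i1: "isCont (U e) x" for x
      using ubd_continuous[OF 0 that] by (simp add: continuous_on_eq_continuous_at)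
    have i2: "isCont (G j e) (U e x)" for x by (rule DERIV_isCont[OF G[OF that R[OF that]]])
    have "isCont (\<lambda>x. G j e (U e x)) x" for x by (rule isCont_o2[OF i1 i2])
    then show ?thesis by (simp add: continuous_on_eq_continuous_at)
  qed
  moreover obtain C where "\<forall>e\<in>E. \<forall>u\<in>R. \<bar>G j e u\<bar> \<le> C" using Gb by blast
  then have "\<forall>e\<in>E. \<forall>x. \<bar>G j e (U e x)\<bar> \<le> C * 1" using R by simp
  ultimately show ?case unfolding ubd.simps by blast
next
  case (Suc k)
  obtain U' where U': "\<And>e x. e \<in> E \<Longrightarrow> (U e has_real_derivative U' e x) (at x)" "ubd k E (\<lambda>_. 1) U'"
    using ubd_SucE[OF Suc.prems] by blast
  have "ubd k E (\<lambda>_. 1) (\<lambda>e x. G (Suc j) e (U e x) * U' e x)"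
    by (rule ubd_mult[OF Suc.IH[OF ubd_Suc_imp[OF Suc.prems]] U'(2)]) simp
  moreover have "((\<lambda>x. G j e (U e x)) has_real_derivative G (Suc j) e (U e x) * U' e x) (at x)" if "e \<in> E" for e x
    by (rule DERIV_chain'[OF U'(1)[OF that] G[OF that R[OF that]]])
  moreover obtain C where "\<forall>e\<in>E. \<forall>u\<in>R. \<bar>G j e u\<bar> \<le> C" using Gb by blast
  then have "\<bar>G j e (U e x)\<bar> \<le> C * 1" if "e \<in> E" for e x using R that by simp
  ultimately show ?case by (intro ubd_SucI[where f'="\<lambda>e x. G (Suc j) e (U e x) * U' e x"]) auto
qed

text \<open>If \<open>G 0\<close> vanishes to first order, the composition inherits the decay of \<open>U\<close>; the derivatives decay through the factor \<open>U'\<close> in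
  the chain rule, while \<open>G 1\<close> composed with \<open>U\<close> need only be bounded.\<close>
lemma ubd_comp_decay:
  fixes G :: "nat \<Rightarrow> 'e \<Rightarrow> real \<Rightarrow> real"
  assumes G: "\<And>j e u. e \<in> E \<Longrightarrow> u \<in> R \<Longrightarrow> (G j e has_real_derivative G (Suc j) e u) (at u)"
    and Gb: "\<And>j. \<exists>C. \<forall>e\<in>E. \<forall>u\<in>R. \<bar>G j e u\<bar> \<le> C"
    and G0: "0 \<le> C0" "\<And>e u. e \<in> E \<Longrightarrow> u \<in> R \<Longrightarrow> \<bar>G 0 e u\<bar> \<le> C0 * \<bar>u\<bar>"
    and U: "ubd k E om U" and R: "\<And>e x. e \<in> E \<Longrightarrow> U e x \<in> R" and om: "\<And>x. 0 \<le> om x" "\<And>x. om x \<le> 1"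
  shows "ubd k E om (\<lambda>e x. G 0 e (U e x))"
proof -
  obtain C where C: "0 \<le> C" "\<And>e x. e \<in> E \<Longrightarrow> \<bar>U e x\<bar> \<le> C * om x" using ubd_bounded[OF U om(1)] by auto
  have b: "\<bar>G 0 e (U e x)\<bar> \<le> (C0 * C) * om x" if "e \<in> E" for e x
    using G0(2)[OF that R[OF that, of x]] mult_left_mono[OF C(2)[OF that, of x] G0(1)] by (simp add: mult.assoc)
  have U1: "ubd k E (\<lambda>_. 1) U" by (rule ubd_weight[OF U om])
  show ?thesis
  proof (cases k)
    case 0
    have "ubd 0 E (\<lambda>_. 1) (\<lambda>e x. G 0 e (U e x))"
      using ubd_comp[where G=G and R=R and j=0, OF G Gb U1 R] 0 by simp
    then show ?thesis using b unfolding 0 ubd.simps by blast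
  next
    case (Suc i)
    obtain U' where U': "\<And>e x. e \<in> E \<Longrightarrow> (U e has_real_derivative U' e x) (at x)" "ubd i E om U'"
      using ubd_SucE[OF U[unfolded Suc]] by blast
    have "ubd i E (\<lambda>_. 1) U" using U1 Suc ubd_Suc_imp by blast
    then have "ubd i E om (\<lambda>e x. G 1 e (U e x) * U' e x)"
      by (intro ubd_mult[OF ubd_comp[where G=G and R=R and j=1, OF G Gb _ R] U'(2)] om) auto
    moreover have "((\<lambda>x. G 0 e (U e x)) has_real_derivative G 1 e (U e x) * U' e x) (at x)" if "e \<in> E" for e x
      using DERIV_chain'[OF U'(1)[OF that] G[OF that R[OF that]]] by simp
    ultimately show ?thesis unfolding Suc using b by (intro ubd_SucI[where f'="\<lambda>e x. G 1 e (U e x) * U' e x"]) auto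
  qed
qed

lemma ubd_deriv_bounded:
  assumes "ubd k E om f" "j \<le> k"
  shows "\<exists>C. \<forall>e\<in>E. \<forall>x. \<bar>(deriv ^^ j) (f e) x\<bar> \<le> C * om x"
  using assms
proof (induction j arbitrary: f k)
  case 0
  then show ?case by (cases k) auto
next
  case (Suc j)
  then obtain i where k: "k = Suc i" "j \<le> i" by (cases k) auto
  obtain f' where f': "\<And>e x. e \<in> E \<Longrightarrow> (f e has_real_derivative f' e x) (at x)" "ubd i E om f'"
    using ubd_SucE[OF Suc.prems(1)[unfolded k]] by blast
  have "deriv (f e) = f' e" if "e \<in> E" for e using f'(1)[OF that] by (intro ext DERIV_imp_deriv)
  then show ?case using Suc.IH[OF f'(2) k(2)] by (simp add: funpow_Suc_right del: funpow.simps)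
qed

lemma ubd_deriv_differentiable:
  assumes "ubd (Suc k) E om f" "e \<in> E"
  shows "(deriv ^^ k) (f e) differentiable (at x)"
  using assms(1)
proof (induction k arbitrary: f)
  case 0
  then obtain f' where "\<And>e x. e \<in> E \<Longrightarrow> (f e has_real_derivative f' e x) (at x)" using ubd_SucE by blast
  from this[OF assms(2), of x] show ?case by (auto simp: real_differentiable_def)
next
  case (Suc k)
  obtain f' where f': "\<And>e x. e \<in> E \<Longrightarrow> (f e has_real_derivative f' e x) (at x)" "ubd (Suc k) E om f'"
    using ubd_SucE[OF Suc.prems] by blast
  have "deriv (f e) = f' e" using f'(1)[OF assms(2)] by (intro ext DERIV_imp_deriv)
  then show ?case using Suc.IH[OF f'(2)] by (simp add: funpow_Suc_right del: funpow.simps)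
qed

lemma ubd_smooth:
  assumes "\<And>k. ubd k E om f" "e \<in> E"
  shows "smooth (f e)"
  unfolding smooth_def by (intro allI ubd_deriv_differentiable[OF assms])

lemma smooth_has_derivative:
  "smooth f \<Longrightarrow> ((deriv ^^ j) f has_real_derivative (deriv ^^ Suc j) f x) (at x)"
  by (simp add: smooth_def DERIV_deriv_iff_real_differentiable)

text \<open>The resolvent gains one derivative uniformly in \<open>e\<close>.\<close>
lemma ubd_resolves:
  assumes lam: "0 < lam" and E: "\<And>e. e \<in> E \<Longrightarrow> 0 < e \<and> e \<le> 1"
    and f: "ubd k E (\<lambda>_. 1) f" and u: "\<And>e. e \<in> E \<Longrightarrow> resolves lam e (f e) (u e)"
  shows "ubd (Suc k) E (\<lambda>_. 1) u"
  using f u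
proof (induction k arbitrary: f u)
  case (0 f u)
  obtain C where C0: "0 \<le> C" and C: "\<And>e x. e \<in> E \<Longrightarrow> \<bar>f e x\<bar> \<le> C * 1" using ubd_bounded[OF 0(1) zero_le_one] by auto
  have fb: "f e \<in> bcontfun" if "e \<in> E" for e
    using C[OF that] by (intro bcontfunI'[OF ubd_continuous[OF 0(1) that], of C]) auto
  have "\<forall>e\<in>E. \<exists>u'. (\<forall>x. (u e has_real_derivative u' x) (at x)) \<and> u' \<in> bcontfun \<and> (\<forall>x. \<bar>u' x\<bar> \<le> Cres lam * C)"
  proof
    fix e assume e: "e \<in> E"
    show "\<exists>u'. (\<forall>x. (u e has_real_derivative u' x) (at x)) \<and> u' \<in> bcontfun \<and> (\<forall>x. \<bar>u' x\<bar> \<le> Cres lam * C)"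
    proof -
      have e1: "0 < e" "e \<le> 1" using E[OF e] by auto
      have c: "\<bar>f e x\<bar> \<le> C" for x using C[OF e, of x] by simp
      show ?thesis by (rule resolves_derivative[OF e1 lam fb[OF e] c 0(2)[OF e]]) blast
    qed
  qed
  from bchoice[OF this] obtain u' where u': "\<forall>e\<in>E. (\<forall>x. (u e has_real_derivative u' e x) (at x)) \<and> u' e \<in> bcontfun \<and> (\<forall>x. \<bar>u' e x\<bar> \<le> Cres lam * C)"
    by blast
  have ub: "\<bar>u e x\<bar> \<le> C / lam * 1" if "e \<in> E" for e x
    using E[OF that] C[OF that] resolves_bound[OF _ lam fb[OF that] _ 0(2)[OF that], of C x] by simp
  have "ubd 0 E (\<lambda>_. 1) u'"
    unfolding ubd.simps using u' by (auto intro!: bcontfunD(1) exI[of _ "Cres lam * C"])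
  then show ?case using u' by (intro ubd_SucI[where f'=u', OF ub]) auto
next
  case (Suc k f u)
  obtain f' where f': "\<And>e x. e \<in> E \<Longrightarrow> (f e has_real_derivative f' e x) (at x)" "ubd k E (\<lambda>_. 1) f'"
    using ubd_SucE[OF Suc.prems(1)] by blast
  obtain C where C0: "0 \<le> C" and C: "\<And>e x. e \<in> E \<Longrightarrow> \<bar>f e x\<bar> \<le> C * 1" using ubd_bounded[OF Suc.prems(1) zero_le_one] by auto
  obtain C' where C'0: "0 \<le> C'" and C': "\<And>e x. e \<in> E \<Longrightarrow> \<bar>f' e x\<bar> \<le> C' * 1" using ubd_bounded[OF f'(2) zero_le_one] by auto
  have fb: "f e \<in> bcontfun" if "e \<in> E" for e
    using C[OF that] by (intro bcontfunI'[OF ubd_continuous[OF Suc.prems(1) that], of C]) auto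
  have fb': "f' e \<in> bcontfun" if "e \<in> E" for e
    using C'[OF that] by (intro bcontfunI'[OF ubd_continuous[OF f'(2) that], of C']) auto
  have "\<forall>e\<in>E. \<exists>u'. (\<forall>x. (u e has_real_derivative u' x) (at x)) \<and> resolves lam e (f' e) u'"
  proof
    fix e assume e: "e \<in> E"
    show "\<exists>u'. (\<forall>x. (u e has_real_derivative u' x) (at x)) \<and> resolves lam e (f' e) u'"
    proof -
      have e1: "0 < e" "e \<le> 1" using E[OF e] by auto
      show ?thesis
        by (rule resolves_commutes_derivative[OF e1 lam fb[OF e] Suc.prems(2)[OF e] fb'[OF e] f'(1)[OF e]]) blast
    qed
  qed
  from bchoice[OF this] obtain u' where u': "\<forall>e\<in>E. (\<forall>x. (u e has_real_derivative u' e x) (at x)) \<and> resolves lam e (f' e) (u' e)"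
    by blast
  have ub: "\<bar>u e x\<bar> \<le> C / lam * 1" if "e \<in> E" for e x
    using E[OF that] C[OF that] resolves_bound[OF _ lam fb[OF that] _ Suc.prems(2)[OF that], of C x] by simp
  have "ubd (Suc k) E (\<lambda>_. 1) u'" using Suc.IH[OF f'(2)] u' by blast
  then show ?case using u' by (intro ubd_SucI[where f'=u', OF ub]) auto
qed

text \<open>A Landau-Kolmogorov inequality with free step \<open>h\<close>. For one more derivative, the case already proved is applied to \<open>G'\<close>,
  where \<open>|G'|\<close> itself occurs on the right; a step longer by the factor \<open>K\<close> makes that term absorbable. Absorption needs the finiteness of all suprema,
  which is the reason for the boundedness assumption.\<close>
lemma interpolation:
  "\<exists>C>0. \<forall>(G :: nat \<Rightarrow> real \<Rightarrow> real) S0 S h. (\<forall>j x. (G j has_real_derivative G (Suc j) x) (at x)) \<longrightarrow> (\<forall>j. \<exists>B. \<forall>x. \<bar>G j x\<bar> \<le> B) \<longrightarrow>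
     (\<forall>x. \<bar>G 0 x\<bar> \<le> S0) \<longrightarrow> (\<forall>x. \<bar>G (m + 2) x\<bar> \<le> S) \<longrightarrow> 0 < h \<longrightarrow> (\<forall>x. \<bar>G 1 x\<bar> \<le> C * (S0 / h + h ^ (m + 1) * S))"
proof -
  have landau: "\<bar>G 1 x\<bar> \<le> 2 * S0 / h + h * S"
    if G: "\<forall>j x. (G j has_real_derivative G (Suc j) x) (at x)" "\<forall>x. \<bar>G 0 x\<bar> \<le> S0" "\<forall>x. \<bar>G 2 x\<bar> \<le> S" "0 < h"
    for G :: "nat \<Rightarrow> real \<Rightarrow> real" and S0 S h x
  proof -
    have d: "(G 0 has_real_derivative G 1 x) (at x)" "(G 1 has_real_derivative G 2 x) (at x)" for x
      using G(1)[rule_format, of 0 x] G(1)[rule_format, of 1 x] by (simp_all add: numeral_2_eq_2)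
    have "\<bar>G 1 x\<bar> \<le> \<bar>G 0 (x + h) - G 0 x\<bar> / h + h * S"
      by (rule deriv_le_difference_quotient[OF d _ G(4)]) (use G in auto)
    moreover have "\<bar>G 0 (x + h) - G 0 x\<bar> \<le> 2 * S0" using G(2)[rule_format, of "x + h"] G(2)[rule_format, of x] by linarith
    then have "\<bar>G 0 (x + h) - G 0 x\<bar> / h \<le> 2 * S0 / h" using G(4) by (intro divide_right_mono) auto
    ultimately show ?thesis by linarith
  qed
  show ?thesis
  proof (induction m)
    case 0
    show ?case
    proof (intro exI[of _ 2] conjI allI impI)
      fix G :: "nat \<Rightarrow> real \<Rightarrow> real" and S0 S h x
      assume a: "\<forall>j x. (G j has_real_derivative G (Suc j) x) (at x)" "\<forall>x. \<bar>G 0 x\<bar> \<le> S0" "\<forall>x. \<bar>G (0 + 2) x\<bar> \<le> S" "(0::real) < h"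
      have "0 \<le> S" using a(3) by (meson abs_ge_zero order_trans)
      then have "0 \<le> h * S" using a(4) by simp
      moreover have "\<forall>x. \<bar>G 2 x\<bar> \<le> S" using a(3) by (simp add: numeral_2_eq_2)
      from landau[OF a(1,2) this a(4), of x] have "\<bar>G 1 x\<bar> \<le> 2 * S0 / h + h * S" .
      moreover have "2 * (S0 / h + h ^ (0 + 1) * S) = 2 * S0 / h + 2 * (h * S)" by (simp add: algebra_simps)
      ultimately show "\<bar>G 1 x\<bar> \<le> 2 * (S0 / h + h ^ (0 + 1) * S)" by linarith
    qed simp
  next
    case (Suc m)
    then obtain C where C: "0 < C" "\<And>(G :: nat \<Rightarrow> real \<Rightarrow> real) S0 S h x. (\<forall>j x. (G j has_real_derivative G (Suc j) x) (at x)) \<Longrightarrow> (\<forall>j. \<exists>B. \<forall>x. \<bar>G j x\<bar> \<le> B) \<Longrightarrow>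
     (\<forall>x. \<bar>G 0 x\<bar> \<le> S0) \<Longrightarrow> (\<forall>x. \<bar>G (m + 2) x\<bar> \<le> S) \<Longrightarrow> 0 < h \<Longrightarrow> \<bar>G 1 x\<bar> \<le> C * (S0 / h + h ^ (m + 1) * S)"
      by meson
    (* The factor for which the term with |G 1| returns with coefficient 1/2. *)
    define K where "K = 2 * C"
    have K: "0 < K" using C by (simp add: K_def)
    define C' where "C' = 4 + 2 * C * K ^ (m + 1)"
    show ?case
    proof (intro exI[of _ C'] conjI allI impI)
      show "0 < C'" using C K by (auto simp: C'_def intro!: add_pos_pos)
      fix G :: "nat \<Rightarrow> real \<Rightarrow> real" and S0 S h x
      assume a: "\<forall>j x. (G j has_real_derivative G (Suc j) x) (at x)" "\<forall>j. \<exists>B. \<forall>x. \<bar>G j x\<bar> \<le> B"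
        "\<forall>x. \<bar>G 0 x\<bar> \<le> S0" "\<forall>x. \<bar>G (Suc m + 2) x\<bar> \<le> S" "(0::real) < h"
      have S: "0 \<le> S" "0 \<le> S0" using a(3,4) by (meson abs_ge_zero order_trans)+
      define c where "c = 2 * S0 / h + h * (C * ((K * h) ^ (m + 1) * S))"
      obtain B where B: "\<And>x. \<bar>G 1 x\<bar> \<le> B" using a(2) by blast
      have "\<bar>G 1 x\<bar> - 2 * c \<le> 0"
      proof (rule nonpos_of_contraction[where S=UNIV and c="1 / 2" and E="\<lambda>x. \<bar>G 1 x\<bar> - 2 * c" and K="B - 2 * c"])
        fix s x assume "0 \<le> s" and s: "\<And>x. x \<in> UNIV \<Longrightarrow> \<bar>G 1 x\<bar> - 2 * c \<le> s"
        then have T: "\<forall>x. \<bar>G (Suc 0) x\<bar> \<le> s + 2 * c" by (simp add: algebra_simps)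
        have "\<bar>G (Suc 1) x\<bar> \<le> C * ((s + 2 * c) / (K * h) + (K * h) ^ (m + 1) * S)" for x
          using a K T by (intro C(2)[of "\<lambda>j. G (Suc j)"]) auto
        then have G2: "\<forall>x. \<bar>G 2 x\<bar> \<le> C * ((s + 2 * c) / (K * h) + (K * h) ^ (m + 1) * S)" by (simp add: numeral_2_eq_2)
        have "\<bar>G 1 x\<bar> \<le> 2 * S0 / h + h * (C * ((s + 2 * c) / (K * h) + (K * h) ^ (m + 1) * S))"
          by (rule landau[OF a(1,3) G2 a(5)])
        also have "\<dots> = c + h * (C * ((s + 2 * c) / (K * h)))" by (simp add: c_def algebra_simps)
        also have "h * (C * ((s + 2 * c) / (K * h))) = (s + 2 * c) / 2" using a(5) C(1) by (simp add: K_def)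
        finally show "\<bar>G 1 x\<bar> - 2 * c \<le> 1 / 2 * s" by (simp add: field_simps)
      qed (use B in auto)
      then have "\<bar>G 1 x\<bar> \<le> 2 * c" by simp
      also have "2 * c = 4 * (S0 / h) + 2 * C * K ^ (m + 1) * (h ^ (Suc m + 1) * S)"
        by (simp add: c_def power_mult_distrib algebra_simps)
      also have "\<dots> \<le> C' * (S0 / h) + C' * (h ^ (Suc m + 1) * S)"
        using S a(5) C K by (intro add_mono mult_right_mono) (auto simp: C'_def)
      finally show "\<bar>G 1 x\<bar> \<le> C' * (S0 / h + h ^ (Suc m + 1) * S)" by (simp add: distrib_left)
    qed
  qed
qed

text \<open>With step \<open>e\<^sup>s\<close>, \<open>s = t - t'\<close>, the first term of the interpolation inequality has the order \<open>t'\<close>; the second one has at least this order once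
  sufficiently many bounded derivatives are used.\<close>
lemma interpolated_rate:
  fixes G :: "real \<Rightarrow> nat \<Rightarrow> real \<Rightarrow> real"
  assumes E: "\<And>e. e \<in> E \<Longrightarrow> 0 < e \<and> e \<le> 1"
    and G: "\<And>e j x. e \<in> E \<Longrightarrow> (G e j has_real_derivative G e (Suc j) x) (at x)"
    and Gb: "\<And>j. \<exists>B. \<forall>e\<in>E. \<forall>x. \<bar>G e j x\<bar> \<le> B"
    and G0: "\<And>e x. e \<in> E \<Longrightarrow> \<bar>G e 0 x\<bar> \<le> Kz * e powr t" and t: "0 < t'" "t' < t"
  shows "\<exists>C. \<forall>e\<in>E. \<forall>x. \<bar>G e 1 x\<bar> \<le> C * e powr t'"
proof -
  define s where "s = t - t'"
  have s: "0 < s" using t by (simp add: s_def)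
  obtain m where m: "t' / s \<le> real m" using real_arch_simple by blast
  have sm: "t' \<le> s * real (m + 1)"
  proof -
    have "t' \<le> real m * s" using m s by (simp add: field_simps)
    also have "\<dots> \<le> real (m + 1) * s" using s by (intro mult_right_mono) auto
    finally show ?thesis by (simp add: mult.commute)
  qed
  obtain C where C: "0 < C" "\<And>(G :: nat \<Rightarrow> real \<Rightarrow> real) S0 S h x. (\<forall>j x. (G j has_real_derivative G (Suc j) x) (at x)) \<Longrightarrow> (\<forall>j. \<exists>B. \<forall>x. \<bar>G j x\<bar> \<le> B) \<Longrightarrow>
     (\<forall>x. \<bar>G 0 x\<bar> \<le> S0) \<Longrightarrow> (\<forall>x. \<bar>G (m + 2) x\<bar> \<le> S) \<Longrightarrow> 0 < h \<Longrightarrow> \<bar>G 1 x\<bar> \<le> C * (S0 / h + h ^ (m + 1) * S)"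
    using interpolation[of m] by meson
  obtain B where B: "\<forall>e\<in>E. \<forall>x. \<bar>G e (m + 2) x\<bar> \<le> B" using Gb by blast
  have "\<bar>G e 1 x\<bar> \<le> (C * (Kz + \<bar>B\<bar>)) * e powr t'" if e: "e \<in> E" for e x
  proof -
    have e0: "0 < e" "e \<le> 1" using E[OF e] by auto
    have "\<bar>G e 1 x\<bar> \<le> C * (Kz * e powr t / e powr s + (e powr s) ^ (m + 1) * \<bar>B\<bar>)"
    proof (rule C(2)[of "G e"])
      show "\<forall>x. \<bar>G e (m + 2) x\<bar> \<le> \<bar>B\<bar>" using B e by (meson abs_ge_self order_trans)
      show "\<forall>j. \<exists>B. \<forall>x. \<bar>G e j x\<bar> \<le> B" using Gb e by meson
    qed (use G G0 e e0 in auto)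
    also have "Kz * e powr t / e powr s = Kz * e powr t'"
      using e0 by (simp add: s_def powr_diff)
    also have "(e powr s) ^ (m + 1) = e powr (s * real (m + 1))"
    proof -
      have "(e powr s) ^ (m + 1) = (e powr s) powr real (m + 1)" using e0 by (subst powr_realpow) auto
      then show ?thesis by (simp only: powr_powr)
    qed
    also have "C * (Kz * e powr t' + e powr (s * real (m + 1)) * \<bar>B\<bar>) \<le> C * (Kz * e powr t' + e powr t' * \<bar>B\<bar>)"
      using C(1) e0 sm by (intro mult_left_mono add_left_mono mult_right_mono powr_mono') auto
    also have "\<dots> = (C * (Kz + \<bar>B\<bar>)) * e powr t'" by (simp add: algebra_simps)
    finally show ?thesis .
  qed
  then show ?thesis by blast
qed

text \<open>The exponents decrease strictly from 1 at \<open>k = 0\<close> and stay above 1/6, so that each step leaves room for an interpolation loss.\<close>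
lemma interpolated_rate_all:
  fixes G :: "real \<Rightarrow> nat \<Rightarrow> real \<Rightarrow> real"
  assumes E: "\<And>e. e \<in> E \<Longrightarrow> 0 < e \<and> e \<le> 1"
    and G: "\<And>e j x. e \<in> E \<Longrightarrow> (G e j has_real_derivative G e (Suc j) x) (at x)"
    and Gb: "\<And>j. \<exists>B. \<forall>e\<in>E. \<forall>x. \<bar>G e j x\<bar> \<le> B"
    and G0: "\<And>e x. e \<in> E \<Longrightarrow> \<bar>G e 0 x\<bar> \<le> Kz * e"
  shows "\<exists>C. \<forall>e\<in>E. \<forall>x. \<bar>G e k x\<bar> \<le> C * e powr (1 / 6 + 5 / (6 * (real k + 1)))"
proof (induction k)
  case 0
  have "\<bar>G e 0 x\<bar> \<le> Kz * e powr 1" if "e \<in> E" for e x using G0[OF that, of x] E[OF that] by simp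
  then show ?case by auto
next
  case (Suc k)
  then obtain C where C: "\<And>e x. e \<in> E \<Longrightarrow> \<bar>G e k x\<bar> \<le> C * e powr (1 / 6 + 5 / (6 * (real k + 1)))" by auto
  have "\<exists>C. \<forall>e\<in>E. \<forall>x. \<bar>G e (k + 1) x\<bar> \<le> C * e powr (1 / 6 + 5 / (6 * (real (Suc k) + 1)))"
  proof (rule interpolated_rate[where G="\<lambda>e j. G e (k + j)" and Kz=C and t="1 / 6 + 5 / (6 * (real k + 1))" and E=E])
    show "1 / 6 + 5 / (6 * (real (Suc k) + 1)) < 1 / 6 + 5 / (6 * (real k + 1))"
      by (intro add_strict_left_mono divide_strict_left_mono) auto
    show "0 < 1 / 6 + 5 / (6 * (real (Suc k) + 1))" by (intro add_pos_pos divide_pos_pos) auto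
  qed (use E G Gb C in auto)
  then show ?case by simp
qed

section \<open>Convergence rates of the derivatives\<close>

primrec F_deriv_coeff :: "real \<Rightarrow> nat \<Rightarrow> real" where
  "F_deriv_coeff e 0 = 1 + e\<^sup>2"
| "F_deriv_coeff e (Suc n) = F_deriv_coeff e n * (e\<^sup>2 - (real n + 1))"

lemma F_deriv_coeff_bounded: "\<exists>C\<ge>0. \<forall>e. 0 \<le> e \<and> e \<le> 1 \<longrightarrow> \<bar>F_deriv_coeff e n\<bar> \<le> C"
proof (induction n)
  case 0
  have "\<bar>1 + e\<^sup>2\<bar> \<le> 2" if "0 \<le> e" "e \<le> 1" for e :: real
    using power_le_one[OF that, of 2] by simp
  then show ?case by (intro exI[of _ 2]) auto
next
  case (Suc n)
  then obtain C where C: "0 \<le> C" "\<And>e. 0 \<le> e \<and> e \<le> 1 \<Longrightarrow> \<bar>F_deriv_coeff e n\<bar> \<le> C" by auto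
  have "\<bar>F_deriv_coeff e (Suc n)\<bar> \<le> C * (real n + 1)" if "0 \<le> e \<and> e \<le> 1" for e
  proof -
    have "\<bar>e\<^sup>2 - (real n + 1)\<bar> \<le> real n + 1" using that power_le_one[of e 2] by (simp add: abs_le_iff)
    then show ?thesis using C that by (simp add: abs_mult mult_mono)
  qed
  then show ?case using C by (intro exI[of _ "C * (real n + 1)"]) auto
qed

context ground_state
begin

text \<open>The derivatives of \<open>F e\<close> in \<open>u\<close>. From the second one on, the factor \<open>e\<^sup>-\<^sup>2\<close> is cancelled by \<open>1 + e\<^sup>2 - 1\<close>, and the formula extends to \<open>e = 0\<close>. The value
  at \<open>e = 0\<close> is the limit nonlinearity, so that the solutions and \<open>W\<close> are instances of the same bounds.\<close>
definition F_derivs :: "nat \<Rightarrow> real \<Rightarrow> real \<Rightarrow> real" where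
  "F_derivs j e u = (case j of 0 \<Rightarrow> (if e = 0 then F0 u else F e u)
     | Suc i \<Rightarrow> (case i of 0 \<Rightarrow> (if e = 0 then 1 + ln (1 + u) else F' e u)
        | Suc n \<Rightarrow> F_deriv_coeff e n * (1 + u) powr (e\<^sup>2 - (real n + 1))))"

lemma F_derivs_deriv:
  assumes "-1 < u"
  shows "(F_derivs j e has_real_derivative F_derivs (Suc j) e u) (at u)"
proof -
  have pw: "((\<lambda>u. (1 + u) powr p) has_real_derivative p * (1 + u) powr (p - 1)) (at u)" for p
    using assms by (auto intro!: derivative_eq_intros)
  consider "j = 0" | "j = 1" | n where "j = Suc (Suc n)" by (metis One_nat_def nat.exhaust)
  then show ?thesis
  proof cases
    case 1
    have "(F0 has_real_derivative 1 + ln (1 + u)) (at u)"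
      unfolding F0_def[abs_def] using assms by (auto intro!: derivative_eq_intros)
    then show ?thesis using 1 F_deriv[OF assms] by (simp add: F_derivs_def[abs_def])
  next
    case 2
    have p: "0 < 1 + u" using assms by simp
    then have "((\<lambda>u. 1 + ln (1 + u)) has_real_derivative 1 / (1 + u)) (at u)"
      by (auto intro!: derivative_eq_intros)
    moreover have "(F' e has_real_derivative (1 + e\<^sup>2) * (1 + u) powr (e\<^sup>2 - 1)) (at u)" if "e \<noteq> 0"
    proof -
      have "(F' e has_real_derivative ((1 + e\<^sup>2) * (e\<^sup>2 * (1 + u) powr (e\<^sup>2 - 1)) - 0) / e\<^sup>2) (at u)"
        unfolding F'_def[abs_def] by (intro DERIV_cdivide DERIV_diff DERIV_cmult pw DERIV_const)
      then show ?thesis using that by simp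
    qed
    ultimately show ?thesis using 2 p by (cases "e = 0") (simp_all add: F_derivs_def[abs_def])
  next
    case (3 n)
    have "((\<lambda>u. F_deriv_coeff e n * (1 + u) powr (e\<^sup>2 - (real n + 1))) has_real_derivative
       F_deriv_coeff e n * ((e\<^sup>2 - (real n + 1)) * (1 + u) powr (e\<^sup>2 - (real n + 1) - 1))) (at u)"
      by (intro DERIV_cmult pw)
    then show ?thesis using 3 by (simp add: F_derivs_def[abs_def] algebra_simps)
  qed
qed

definition eps_range :: "real set" where "eps_range = {e. 0 \<le> e \<and> e \<le> 1 \<and> e\<^sup>2 * ell \<le> 1}"
definition value_range :: "real set" where "value_range = {- 1 / 2..wmax + 1}"

lemma F_derivs_bounded: "\<exists>C. \<forall>e\<in>eps_range. \<forall>u\<in>value_range. \<bar>F_derivs j e u\<bar> \<le> C"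
proof -
  have CFe: "C_F * e\<^sup>2 \<le> C_F" if "e \<in> eps_range" for e
    using that C_F_pos power_le_one[of e 2] by (simp add: eps_range_def mult_left_le)
  have r: "- 1 / 2 \<le> u" "u \<le> wmax + 1" if "u \<in> value_range" for u using that by (auto simp: value_range_def)
  consider "j = 0" | "j = 1" | n where "j = Suc (Suc n)" by (metis One_nat_def nat.exhaust)
  then show ?thesis
  proof cases
    case 1
    have "\<bar>F_derivs j e u\<bar> \<le> (2 + wmax) * ell + C_F" if "e \<in> eps_range" "u \<in> value_range" for e u
    proof -
      have "\<bar>F0 u\<bar> \<le> (2 + wmax) * ell"
        unfolding F0_def abs_mult using r[OF that(2)] ln_near[OF r[OF that(2)]] by (intro mult_mono) auto
      moreover have "\<bar>F e u - F0 u\<bar> \<le> C_F * e\<^sup>2" if "e \<noteq> 0"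
        using that \<open>e \<in> eps_range\<close> by (intro F_near[OF _ _ r[OF \<open>u \<in> value_range\<close>]]) (auto simp: eps_range_def)
      ultimately have "e \<noteq> 0 \<Longrightarrow> \<bar>F e u\<bar> \<le> (2 + wmax) * ell + C_F" "\<bar>F0 u\<bar> \<le> (2 + wmax) * ell + C_F"
        using CFe[OF that(1)] C_F_pos by linarith+
      then show ?thesis using 1 by (cases "e = 0") (auto simp: F_derivs_def)
    qed
    then show ?thesis by blast
  next
    case 2
    have "\<bar>F_derivs j e u\<bar> \<le> 1 + ell + C_F" if "e \<in> eps_range" "u \<in> value_range" for e u
    proof -
      have "\<bar>1 + ln (1 + u)\<bar> \<le> 1 + ell" using ln_near[OF r[OF that(2)]] by linarith
      moreover have "\<bar>F' e u - (1 + ln (1 + u))\<bar> \<le> C_F * e\<^sup>2" if "e \<noteq> 0"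
        using that \<open>e \<in> eps_range\<close> by (intro F_near[OF _ _ r[OF \<open>u \<in> value_range\<close>]]) (auto simp: eps_range_def)
      ultimately have "e \<noteq> 0 \<Longrightarrow> \<bar>F' e u\<bar> \<le> 1 + ell + C_F" "\<bar>1 + ln (1 + u)\<bar> \<le> 1 + ell + C_F"
        using CFe[OF that(1)] C_F_pos by linarith+
      then show ?thesis using 2 by (cases "e = 0") (auto simp: F_derivs_def)
    qed
    then show ?thesis by blast
  next
    case (3 n)
    obtain C where C: "0 \<le> C" "\<And>e. 0 \<le> e \<and> e \<le> 1 \<Longrightarrow> \<bar>F_deriv_coeff e n\<bar> \<le> C" using F_deriv_coeff_bounded by blast
    have "\<bar>F_derivs j e u\<bar> \<le> C * (1 / 2) powr (- (real n + 1))" if "e \<in> eps_range" "u \<in> value_range" for e u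
    proof -
      have e: "0 \<le> e" "e \<le> 1" "e\<^sup>2 \<le> 1" using that power_le_one[of e 2] by (auto simp: eps_range_def)
      have "(1 + u) powr (e\<^sup>2 - (real n + 1)) \<le> (1 / 2) powr (e\<^sup>2 - (real n + 1))"
        using r[OF that(2)] e by (intro powr_mono2') auto
      also have "\<dots> \<le> (1 / 2) powr (- (real n + 1))" by (intro powr_mono') auto
      finally show ?thesis using 3 C e by (simp add: F_derivs_def abs_mult mult_mono)
    qed
    then show ?thesis by blast
  qed
qed

lemma F_derivs_chain:
  assumes "E \<subseteq> eps_range" "ubd k E (\<lambda>_. 1) U" "\<And>e x. e \<in> E \<Longrightarrow> U e x \<in> value_range"
  shows "ubd k E (\<lambda>_. 1) (\<lambda>e x. F_derivs 0 e (U e x))"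
proof (rule ubd_comp[where G=F_derivs and R=value_range, OF _ _ assms(2,3)])
  show "(F_derivs j e has_real_derivative F_derivs (Suc j) e u) (at u)" if "u \<in> value_range" for j e u
    using that by (intro F_derivs_deriv) (auto simp: value_range_def)
  show "\<exists>C. \<forall>e\<in>E. \<forall>u\<in>value_range. \<bar>F_derivs j e u\<bar> \<le> C" for j
    using F_derivs_bounded[of j] assms(1) by blast
qed

lemma near_value_range: "near del u \<Longrightarrow> del \<le> 1 / 2 \<Longrightarrow> u x \<in> value_range"
  using W_pos[of x] wmax(2)[of x] unfolding near_def value_range_def
  by (auto dest!: spec[of _ x] simp: abs_le_iff)

text \<open>Bootstrapping: the solution is the resolvent of \<open>F e\<close> composed with itself.\<close>
lemma ubd_solution:
  assumes E: "E \<subseteq> eps_range - {0}" and U: "\<And>e. e \<in> E \<Longrightarrow> near (1 / 2) (U e)"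
    "\<And>e. e \<in> E \<Longrightarrow> resolves lam e (\<lambda>x. F e (U e x)) (U e)"
  shows "ubd k E (\<lambda>_. 1) U"
proof (induction k)
  case 0
  have "\<bar>U e x\<bar> \<le> (wmax + 1) * 1" if "e \<in> E" for e x
    using near_value_range[OF U(1)[OF that], of x] wmax(1) by (auto simp: value_range_def abs_le_iff)
  moreover have "continuous_on UNIV (U e)" if "e \<in> E" for e
    using U(1)[OF that] by (auto simp: near_def intro: bcontfunD)
  ultimately show ?case unfolding ubd.simps by blast
next
  case (Suc k)
  have "ubd k E (\<lambda>_. 1) (\<lambda>e x. F_derivs 0 e (U e x))"
    using E near_value_range[OF U(1)] by (intro F_derivs_chain Suc.IH) auto
  moreover have "resolves lam e (\<lambda>x. F_derivs 0 e (U e x)) (U e)" if "e \<in> E" for e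
  proof -
    have "e \<noteq> 0" using that E by auto
    then show ?thesis using U(2)[OF that] by (simp add: F_derivs_def)
  qed
  ultimately show ?case
    using lam E by (intro ubd_resolves[where f="\<lambda>e x. F_derivs 0 e (U e x)" and lam=lam]) (auto simp: eps_range_def)
qed

text \<open>Bootstrapping in the profile equation, whose nonlinearity is the member \<open>e = 0\<close> of the family.\<close>
lemma ubd_W: "ubd k {0::real} (\<lambda>_. 1) (\<lambda>_. W)"
proof (induction k)
  case 0
  have "\<bar>W x\<bar> \<le> wmax * 1" for x using W_pos[of x] wmax(2)[of x] by simp
  then show ?case unfolding ubd.simps using continuous_W by blast
next
  case (Suc k)
  have W: "\<bar>W x\<bar> \<le> wmax * 1" for x using W_pos[of x] wmax(2)[of x] by simp
  obtain B where B: "\<And>x. \<bar>W1 x\<bar> \<le> B" using W1_bounded by blast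
  have R: "W x \<in> value_range" for x using W_pos[of x] wmax(2)[of x] by (auto simp: value_range_def)
  have "ubd k {0::real} (\<lambda>_. 1) (\<lambda>e x. F_derivs 0 e (W x))"
    by (rule F_derivs_chain[where E="{0::real}" and U="\<lambda>_. W", OF _ Suc.IH]) (use R in \<open>auto simp: eps_range_def\<close>)
  then have g: "ubd k {0::real} (\<lambda>_. 1) (\<lambda>e x. (- 12) * F_derivs 0 e (W x))"
    by (intro ubd_mult ubd_const) auto
  have w: "ubd k {0::real} (\<lambda>_. 1) (\<lambda>e x. (12 * lam) * W x)"
    by (intro ubd_mult ubd_const Suc.IH) auto
  have "ubd k {0::real} (\<lambda>_. 1) (\<lambda>e x. (12 * lam) * W x + (- 12) * F_derivs 0 e (W x))"
    by (rule ubd_add[OF w g]) simp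
  then have "ubd (Suc k) {0::real} (\<lambda>_. 1) (\<lambda>_. W1)"
  proof (rule ubd_SucI[where C=B, rotated 2])
    show "(W1 has_real_derivative 12 * lam * W x + - 12 * F_derivs 0 e (W x)) (at x)" if "e \<in> {0}" for e x
      using W1_deriv[of x] that by (simp add: W2_def F_derivs_def right_diff_distrib mult.assoc)
  qed (use B in auto)
  then have "ubd k {0::real} (\<lambda>_. 1) (\<lambda>_. W1)" by (rule ubd_Suc_imp)
  then show ?case by (rule ubd_SucI[where C=wmax, rotated 2]) (use W W_deriv in auto)
qed

lemma derivative_rates:
  assumes E: "E \<subseteq> eps_range - {0}" and U: "\<And>e. e \<in> E \<Longrightarrow> near (1 / 2) (U e)"
    "\<And>e. e \<in> E \<Longrightarrow> resolves lam e (\<lambda>x. F e (U e x)) (U e)"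
    and C: "\<And>e x. e \<in> E \<Longrightarrow> \<bar>U e x - W x\<bar> \<le> C * e"
  shows "\<exists>C. \<forall>e\<in>E. \<forall>x. \<bar>(deriv ^^ k) (U e) x - (deriv ^^ k) W x\<bar> \<le> C * e powr (1 / 6)"
proof -
  note uU = ubd_solution[OF E U]
  have sU: "smooth (U e)" if "e \<in> E" for e by (rule ubd_smooth[OF uU that])
  have E1: "0 < e \<and> e \<le> 1" if "e \<in> E" for e using that E by (auto simp: eps_range_def)
  have "\<exists>C. \<forall>e\<in>E. \<forall>x. \<bar>(deriv ^^ k) (U e) x - (deriv ^^ k) W x\<bar> \<le> C * e powr (1 / 6 + 5 / (6 * (real k + 1)))"
  proof (rule interpolated_rate_all[where G="\<lambda>e j x. (deriv ^^ j) (U e) x - (deriv ^^ j) W x", OF E1])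
    show "((\<lambda>x. (deriv ^^ j) (U e) x - (deriv ^^ j) W x) has_real_derivative
        (deriv ^^ Suc j) (U e) x - (deriv ^^ Suc j) W x) (at x)" if "e \<in> E" for e j x
      by (intro DERIV_diff smooth_has_derivative sU[OF that] W_smooth)
    show "\<exists>B. \<forall>e\<in>E. \<forall>x. \<bar>(deriv ^^ j) (U e) x - (deriv ^^ j) W x\<bar> \<le> B" for j
    proof -
      obtain A B where "\<forall>e\<in>E. \<forall>x. \<bar>(deriv ^^ j) (U e) x\<bar> \<le> A * 1" "\<forall>e\<in>{0::real}. \<forall>x. \<bar>(deriv ^^ j) W x\<bar> \<le> B * 1"
        using ubd_deriv_bounded[OF uU[of j], of j] ubd_deriv_bounded[OF ubd_W[of j], of j] by auto
      then have "\<bar>(deriv ^^ j) (U e) x - (deriv ^^ j) W x\<bar> \<le> A + B" if "e \<in> E" for e x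
      proof -
        have "\<bar>(deriv ^^ j) (U e) x\<bar> \<le> A" "\<bar>(deriv ^^ j) W x\<bar> \<le> B"
          using \<open>\<forall>e\<in>E. \<forall>x. \<bar>(deriv ^^ j) (U e) x\<bar> \<le> A * 1\<close> \<open>\<forall>e\<in>{0::real}. \<forall>x. \<bar>(deriv ^^ j) W x\<bar> \<le> B * 1\<close> that by simp_all
        then show ?thesis by linarith
      qed
      then show ?thesis by blast
    qed
    show "\<bar>(deriv ^^ 0) (U e) x - (deriv ^^ 0) W x\<bar> \<le> C * e" if "e \<in> E" for e x using C[OF that] by simp
  qed
  then obtain D where D: "\<And>e x. e \<in> E \<Longrightarrow> \<bar>(deriv ^^ k) (U e) x - (deriv ^^ k) W x\<bar> \<le> D * e powr (1 / 6 + 5 / (6 * (real k + 1)))" by blast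
  have "\<bar>(deriv ^^ k) (U e) x - (deriv ^^ k) W x\<bar> \<le> \<bar>D\<bar> * e powr (1 / 6)" if "e \<in> E" for e x
  proof -
    have "D * e powr (1 / 6 + 5 / (6 * (real k + 1))) \<le> \<bar>D\<bar> * e powr (1 / 6 + 5 / (6 * (real k + 1)))"
      by (intro mult_right_mono) auto
    also have "\<dots> \<le> \<bar>D\<bar> * e powr (1 / 6)"
      using E1[OF that] by (intro mult_left_mono powr_mono') auto
    finally show ?thesis using D[OF that, of x] by linarith
  qed
  then show ?thesis by blast
qed

end

section \<open>Exponential decay and Sobolev regularity\<close>

lemma tent_avg_le_const:
  assumes "continuous_on UNIV g" "\<And>y. \<bar>y\<bar> \<le> 1 \<Longrightarrow> g (z + e * y) \<le> c"
  shows "tent_avg e g z \<le> c"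
proof -
  have "tent_avg e g z \<le> tent_avg e (\<lambda>_. c) z"
    using assms by (intro tent_avg_mono integrable_tent_continuous) auto
  then show ?thesis by simp
qed

lemma abs_tent_avg_le:
  assumes "continuous_on UNIV g"
  shows "\<bar>tent_avg e g z\<bar> \<le> tent_avg e (\<lambda>y. \<bar>g y\<bar>) z"
proof -
  have i: "integrable lborel (\<lambda>y. tent y * g (z + e * y))" "integrable lborel (\<lambda>y. tent y * \<bar>g (z + e * y)\<bar>)"
    using integrable_tent_continuous[OF assms] integrable_tent_continuous[OF continuous_on_rabs[OF assms]] by auto
  have im: "integrable lborel (\<lambda>y. tent y * (- \<bar>g (z + e * y)\<bar>))" using i by simp
  have "tent_avg e g z \<le> tent_avg e (\<lambda>y. \<bar>g y\<bar>) z" by (intro tent_avg_mono i) auto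
  moreover have "tent_avg e (\<lambda>y. - \<bar>g y\<bar>) z \<le> tent_avg e g z" by (intro tent_avg_mono i im) auto
  moreover have "tent_avg e (\<lambda>y. - \<bar>g y\<bar>) z = - tent_avg e (\<lambda>y. \<bar>g y\<bar>) z" by (simp add: tent_avg_def)
  ultimately show ?thesis by simp
qed

text \<open>Outside a compact set \<open>|w|\<close> is bounded by \<open>rho < 1\<close> times a local average of itself. A window of radius one changes \<open>exp (- th |z|)\<close> by at most the factor
  \<open>exp th = 1 / rho\<close>, so the exponential is a supersolution.\<close>
lemma exp_decay:
  fixes w g :: "real \<Rightarrow> real"
  assumes g: "continuous_on UNIV g" and wg: "\<And>z. \<bar>w z\<bar> \<le> tent_avg 1 g z"
    and far: "\<And>y. R \<le> \<bar>y\<bar> \<Longrightarrow> g y \<le> rho * \<bar>w y\<bar>" and rho: "0 < rho" "rho < 1"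
    and B: "\<And>z. \<bar>w z\<bar> \<le> B" and "0 \<le> R"
  obtains K th where "0 < th" "\<And>z. \<bar>w z\<bar> \<le> K * exp (- th * \<bar>z\<bar>)"
proof -
  define th where "th = - ln rho"
  have th: "0 < th" using rho by (simp add: th_def)
  have re: "rho * exp th = 1" using rho by (simp add: th_def exp_minus)
  define K where "K = B * exp (th * (R + 1))"
  have B0: "0 \<le> B" using B[of 0] by linarith
  have "\<bar>w z\<bar> - K * exp (- th * \<bar>z\<bar>) \<le> 0" for z
  proof (rule nonpos_of_contraction[where S=UNIV and c=rho and E="\<lambda>z. \<bar>w z\<bar> - K * exp (- th * \<bar>z\<bar>)" and K=B])
    fix s z assume s: "0 \<le> s" "\<And>x. x \<in> UNIV \<Longrightarrow> \<bar>w x\<bar> - K * exp (- th * \<bar>x\<bar>) \<le> s"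
    show "\<bar>w z\<bar> - K * exp (- th * \<bar>z\<bar>) \<le> rho * s"
    proof (cases "\<bar>z\<bar> \<le> R + 1")
      case True
      have "exp (th * \<bar>z\<bar>) \<le> exp (th * (R + 1))" using True th by simp
      then have "1 \<le> exp (th * (R + 1)) * exp (- th * \<bar>z\<bar>)" by (simp flip: exp_add)
      then have "B * 1 \<le> B * (exp (th * (R + 1)) * exp (- th * \<bar>z\<bar>))" using B0 by (intro mult_left_mono) auto
      then have "B \<le> K * exp (- th * \<bar>z\<bar>)" by (simp add: K_def mult.assoc)
      moreover have "0 \<le> rho * s" using rho s by simp
      ultimately show ?thesis using B[of z] by linarith
    next
      case False
      have "tent_avg 1 g z \<le> rho * s + K * exp (- th * \<bar>z\<bar>)"
      proof (rule tent_avg_le_const[OF g])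
        fix y :: real assume y: "\<bar>y\<bar> \<le> 1"
        have "R \<le> \<bar>z + 1 * y\<bar>" using False y by simp
        then have "g (z + 1 * y) \<le> rho * \<bar>w (z + 1 * y)\<bar>" by (rule far)
        also have "\<dots> \<le> rho * (s + K * exp (- th * \<bar>z + 1 * y\<bar>))"
          using s(2)[of "z + 1 * y"] rho by (intro mult_left_mono) (auto simp: algebra_simps)
        also have "K * exp (- th * \<bar>z + 1 * y\<bar>) \<le> K * (exp th * exp (- th * \<bar>z\<bar>))"
        proof (rule mult_left_mono)
          have "\<bar>z\<bar> - 1 \<le> \<bar>z + y\<bar>" using y by linarith
          then have "th * (\<bar>z\<bar> - 1) \<le> th * \<bar>z + y\<bar>" using th by (intro mult_left_mono) auto
          then show "exp (- th * \<bar>z + 1 * y\<bar>) \<le> exp th * exp (- th * \<bar>z\<bar>)"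
            by (simp add: algebra_simps flip: exp_add)
          show "0 \<le> K" using B0 by (simp add: K_def)
        qed
        then have "rho * (s + K * exp (- th * \<bar>z + 1 * y\<bar>)) \<le> rho * (s + K * (exp th * exp (- th * \<bar>z\<bar>)))"
          using rho by (intro mult_left_mono) auto
        also have "\<dots> = rho * s + (rho * exp th) * (K * exp (- th * \<bar>z\<bar>))" by (simp add: algebra_simps)
        finally show "g (z + 1 * y) \<le> rho * s + K * exp (- th * \<bar>z\<bar>)" by (simp add: re)
      qed
      then show ?thesis using wg[of z] by linarith
    qed
  next
    fix z
    have "0 \<le> K * exp (- th * \<bar>z\<bar>)" using B0 by (simp add: K_def)
    then show "\<bar>w z\<bar> - K * exp (- th * \<bar>z\<bar>) \<le> B" using B[of z] by linarith
  qed (use rho in auto)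
  then show thesis using th by (intro that[of th K]) (auto simp: algebra_simps)
qed

lemma integrable_exp_abs:
  assumes "0 < c"
  shows "integrable lborel (\<lambda>x::real. exp (- c * \<bar>x\<bar>))"
proof -
  have half: "integrable lborel (\<lambda>x::real. indicator {0..} x * exp (- c * x))"
  proof (rule integrableI_nn_integral_finite)
    have "(\<integral>\<^sup>+x. ennreal (exp (- c * x)) * indicator {0..} x \<partial>lborel) = ennreal (0 - (- exp (- c * 0) / c))"
    proof (rule nn_integral_FTC_atLeast)
      show "((\<lambda>x. - exp (- c * x) / c) has_real_derivative exp (- c * x)) (at x)" for x
        using assms by (auto intro!: derivative_eq_intros)
      have "((\<lambda>x. exp (- (c * x))) \<longlongrightarrow> 0) at_top"
        by (rule filterlim_compose[OF exp_at_bot]) (use assms in \<open>auto intro!: filterlim_tendsto_pos_mult_at_top filterlim_ident simp: filterlim_uminus_at_bot\<close>)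
      then have "((\<lambda>x. - exp (- (c * x)) / c) \<longlongrightarrow> - 0 / c) at_top" using assms by (intro tendsto_intros) auto
      then show "((\<lambda>x. - exp (- c * x) / c) \<longlongrightarrow> 0) at_top" by simp
    qed auto
    then show "(\<integral>\<^sup>+x. ennreal (indicator {0..} x * exp (- c * x)) \<partial>lborel) = ennreal (1 / c)"
      by (simp add: ennreal_mult' ennreal_indicator mult.commute)
  qed (use assms in auto)
  have "integrable lborel (\<lambda>x::real. indicator {0..} (0 + (-1) * x) * exp (- c * (0 + (-1) * x)))"
    using lborel_integrable_real_affine[OF half, of "-1" 0] by simp
  then have "integrable lborel (\<lambda>x::real. indicator {0..} x * exp (- c * x) + indicator {0..} (- x) * exp (- c * (- x)))"
    using half by (intro Bochner_Integration.integrable_add) auto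
  then show ?thesis
    by (rule Bochner_Integration.integrable_bound) (auto simp: indicator_def)
qed

lemma exp_decay_L2:
  assumes "continuous_on UNIV f" "0 < th" "\<And>x. \<bar>f x\<bar> \<le> C * exp (- th * \<bar>x\<bar>)"
  shows "f \<in> L2"
proof -
  have [measurable]: "f \<in> borel_measurable borel" by (rule borel_measurable_continuous_onI[OF assms(1)])
  have "integrable lborel (\<lambda>x. (f x)\<^sup>2)"
  proof (rule Bochner_Integration.integrable_bound)
    show "integrable lborel (\<lambda>x. C\<^sup>2 * exp (- (2 * th) * \<bar>x\<bar>))"
      using integrable_exp_abs[of "2 * th"] assms(2) by simp
    show "AE x in lborel. norm ((f x)\<^sup>2) \<le> norm (C\<^sup>2 * exp (- (2 * th) * \<bar>x\<bar>))"
    proof (rule AE_I2)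
      fix x
      have "\<bar>f x\<bar>\<^sup>2 \<le> (C * exp (- th * \<bar>x\<bar>))\<^sup>2" using assms(3)[of x] by (intro power_mono) auto
      also have "\<dots> = C\<^sup>2 * exp (- (2 * th) * \<bar>x\<bar>)" by (simp add: power_mult_distrib flip: exp_double)
      finally show "norm ((f x)\<^sup>2) \<le> norm (C\<^sup>2 * exp (- (2 * th) * \<bar>x\<bar>))" by simp
    qed
  qed measurable
  then show ?thesis by (simp add: L2_def)
qed

lemma continuous_locally_integrable:
  "continuous_on UNIV f \<Longrightarrow> locally_integrable f"
  unfolding locally_integrable_def set_integrable_def
  using borel_integrable_compact continuous_on_subset by blast

lemma smooth_continuous: "smooth f \<Longrightarrow> continuous_on UNIV ((deriv ^^ j) f)"
  by (rule has_derivative_continuous_on_UNIV[OF smooth_has_derivative])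

lemma smooth_deriv: "smooth f \<Longrightarrow> smooth (deriv f)"
  unfolding smooth_def by (metis funpow_Suc_right o_apply)

lemma test_function_support:
  assumes "test_function \<phi>"
  obtains R where "0 < R" "\<And>j x. R \<le> \<bar>x\<bar> \<Longrightarrow> (deriv ^^ j) \<phi> x = 0"
proof -
  have "bounded (closure {x. \<phi> x \<noteq> 0})" using assms compact_imp_bounded by (auto simp: test_function_def)
  then obtain R0 where R0: "\<And>x. x \<in> closure {x. \<phi> x \<noteq> 0} \<Longrightarrow> \<bar>x\<bar> \<le> R0" by (auto simp: bounded_iff)
  have z: "\<phi> x = 0" if "R0 < \<bar>x\<bar>" for x
    using R0[of x] that closure_subset[of "{x. \<phi> x \<noteq> 0}"] by force
  have "(deriv ^^ j) \<phi> x = 0" if "R0 < \<bar>x\<bar>" for j x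
    using that
  proof (induction j arbitrary: x)
    case 0
    then show ?case using z by simp
  next
    case (Suc j)
    have op: "open {x::real. R0 < \<bar>x\<bar>}" by (intro open_Collect_less continuous_intros)
    have "((\<lambda>_. 0) has_real_derivative 0) (at x)" by simp
    then have "((deriv ^^ j) \<phi> has_real_derivative 0) (at x)"
      by (rule DERIV_cong_ev[OF refl _ refl, THEN iffD2, rotated])
        (use Suc eventually_nhds_in_open[OF op, of x] in \<open>auto elim!: eventually_mono\<close>)
    then show ?case by (simp add: DERIV_imp_deriv)
  qed
  note zero = this
  show thesis
  proof (rule that[of "\<bar>R0\<bar> + 1"])
    show "(deriv ^^ j) \<phi> x = 0" if "\<bar>R0\<bar> + 1 \<le> \<bar>x\<bar>" for j x
      by (rule zero) (use that in linarith)
  qed simp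
qed

lemma integral_by_parts_compact_support:
  fixes f g :: "real \<Rightarrow> real"
  assumes f: "\<And>x. (f has_real_derivative f' x) (at x)" "continuous_on UNIV f'"
    and g: "\<And>x. (g has_real_derivative g' x) (at x)" "continuous_on UNIV g'"
    and R: "0 < R" "\<And>x. R \<le> \<bar>x\<bar> \<Longrightarrow> g x = 0" "\<And>x. R \<le> \<bar>x\<bar> \<Longrightarrow> g' x = 0"
  shows "(LINT x|lborel. f x * g' x) = - (LINT x|lborel. f' x * g x)"
proof -
  have cf: "continuous_on S f" "continuous_on S f'" "continuous_on S g" "continuous_on S g'" for S
    using has_derivative_continuous_on_UNIV[OF f(1)] f(2) has_derivative_continuous_on_UNIV[OF g(1)] g(2)
      continuous_on_subset by blast+
  have ind: "indicator {-R..R} x *\<^sub>R k x = k x" if "\<And>x. R \<le> \<bar>x\<bar> \<Longrightarrow> k x = 0" for k :: "real \<Rightarrow> real" and x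
  proof (cases "R \<le> \<bar>x\<bar>")
    case True
    then show ?thesis using that[of x] by simp
  next
    case False
    then have "x \<in> {-R..R}" by auto
    then show ?thesis by simp
  qed
  have int: "integrable lborel k" if "continuous_on UNIV k" "\<And>x. R \<le> \<bar>x\<bar> \<Longrightarrow> k x = 0" for k :: "real \<Rightarrow> real"
  proof -
    have "integrable lborel (\<lambda>x. indicator {-R..R} x *\<^sub>R k x)"
      using continuous_on_subset[OF that(1)] by (intro borel_integrable_compact) auto
    moreover have "(\<lambda>x. indicator {-R..R} x *\<^sub>R k x) = k" by (rule ext) (rule ind[OF that(2)])
    ultimately show ?thesis by (simp only:)
  qed
  have i1: "integrable lborel (\<lambda>x. f x * g' x)" by (rule int) (use R cf in \<open>auto intro!: continuous_on_mult\<close>)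
  have i2: "integrable lborel (\<lambda>x. f' x * g x)" by (rule int) (use R cf in \<open>auto intro!: continuous_on_mult\<close>)
  have eq: "(\<lambda>x. indicator {-R..R} x *\<^sub>R (f x * g' x + f' x * g x)) = (\<lambda>x. f x * g' x + f' x * g x)"
    by (rule ext) (rule ind, simp add: R)
  have "(LINT x|lborel. f x * g' x + f' x * g x) = (LINT x|lborel. indicator {-R..R} x *\<^sub>R (f x * g' x + f' x * g x))"
    by (rule arg_cong[where f="integral\<^sup>L lborel", OF eq[symmetric]])
  also have "\<dots> = f R * g R - f (- R) * g (- R)"
  proof -
    have "- R \<le> R" using R by simp
    moreover have "((\<lambda>x. f x * g x) has_vector_derivative f x * g' x + f' x * g x) (at x within {- R..R})" for x
      unfolding has_real_derivative_iff_has_vector_derivative[symmetric]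
    proof (rule has_field_derivative_at_within)
      have "f' x * g x + g' x * f x = f x * g' x + f' x * g x" by simp
      then show "((\<lambda>x. f x * g x) has_real_derivative f x * g' x + f' x * g x) (at x)"
        using DERIV_mult[OF f(1)[of x] g(1)[of x]] by (simp only:)
    qed
    moreover have "continuous_on {- R..R} (\<lambda>x. f x * g' x + f' x * g x)"
      by (intro continuous_intros cf)
    ultimately show ?thesis by (intro integral_FTC_Icc[where F="\<lambda>x. f x * g x" and a="- R" and b=R and f="\<lambda>x. f x * g' x + f' x * g x"]) auto
  qed
  also have "\<dots> = 0" using R(1) R(2)[of R] R(2)[of "-R"] by simp
  finally show ?thesis using i1 i2 by simp
qed

lemma smooth_weak_deriv:
  assumes "smooth f"
  shows "weak_deriv k f ((deriv ^^ k) f)"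
  unfolding weak_deriv_def
proof (intro conjI allI impI)
  show "locally_integrable f" using continuous_locally_integrable[OF smooth_continuous[OF assms, of 0]] by simp
  show "locally_integrable ((deriv ^^ k) f)" by (rule continuous_locally_integrable[OF smooth_continuous[OF assms]])
  fix \<phi> assume t: "test_function \<phi>"
  then have s: "smooth \<phi>" by (simp add: test_function_def)
  obtain R where R: "0 < R" "\<And>j x. R \<le> \<bar>x\<bar> \<Longrightarrow> (deriv ^^ j) \<phi> x = 0"
    using test_function_support[OF t] by blast
  show "(LINT x|lborel. f x * (deriv ^^ k) \<phi> x) = (-1) ^ k * (LINT x|lborel. (deriv ^^ k) f x * \<phi> x)"
    using assms
  proof (induction k arbitrary: f)
    case 0
    then show ?case by simp
  next
    case (Suc k)
    have "(LINT x|lborel. f x * (deriv ^^ Suc k) \<phi> x) = - (LINT x|lborel. deriv f x * (deriv ^^ k) \<phi> x)"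
    proof (rule integral_by_parts_compact_support[OF _ _ _ _ R(1)])
      show "(f has_real_derivative deriv f x) (at x)" for x using smooth_has_derivative[OF Suc.prems, of 0] by simp
      show "continuous_on UNIV (deriv f)" using smooth_continuous[OF Suc.prems, of 1] by simp
    qed (use R smooth_has_derivative[OF s] smooth_continuous[OF s] in blast)+
    also have "\<dots> = - ((-1) ^ k * (LINT x|lborel. (deriv ^^ k) (deriv f) x * \<phi> x))"
      by (simp only: Suc.IH[OF smooth_deriv[OF Suc.prems]])
    finally show ?case by (simp add: funpow_Suc_right del: funpow.simps)
  qed
qed

text \<open>Exponential decay of the classical derivatives makes them square integrable, and classical derivatives are weak derivatives.\<close>
lemma exp_decay_H_infinity:
  assumes "smooth f" "0 < th" "\<And>j. \<exists>C. \<forall>x. \<bar>(deriv ^^ j) f x\<bar> \<le> C * exp (- th * \<bar>x\<bar>)"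
  shows "f \<in> H_infinity"
proof -
  have "(deriv ^^ j) f \<in> L2" for j
    using assms(3)[of j] exp_decay_L2[OF smooth_continuous[OF assms(1)] assms(2)] by blast
  moreover from this[of 0] have "f \<in> L2" by simp
  ultimately show ?thesis
    unfolding H_infinity_def Sobolev_H_def using smooth_weak_deriv[OF assms(1)] by blast
qed

text \<open>Averaging over a fixed window preserves the exponential weight and gains one derivative.\<close>
lemma ubd_tent_avg:
  fixes th :: real
  assumes "0 < th" and h: "ubd k E (\<lambda>x. exp (- th * \<bar>x\<bar>)) h"
  shows "ubd (Suc k) E (\<lambda>x. exp (- th * \<bar>x\<bar>)) (\<lambda>e. tent_avg 1 (h e))"
  using h
proof (induction k arbitrary: h)
  have sh: "exp (- th * \<bar>z + y\<bar>) \<le> exp th * exp (- th * \<bar>z\<bar>)" if "\<bar>y\<bar> \<le> 1" for z y :: real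
  proof -
    have "\<bar>z\<bar> - 1 \<le> \<bar>z + y\<bar>" using that by linarith
    then have "th * (\<bar>z\<bar> - 1) \<le> th * \<bar>z + y\<bar>" using \<open>0 < th\<close> by (intro mult_left_mono) auto
    then show ?thesis by (simp add: algebra_simps flip: exp_add)
  qed
  have bd: "\<bar>tent_avg 1 h z\<bar> \<le> (C * exp th) * exp (- th * \<bar>z\<bar>)"
    if "continuous_on UNIV h" "0 \<le> C" "\<And>x. \<bar>h x\<bar> \<le> C * exp (- th * \<bar>x\<bar>)" for h :: "real \<Rightarrow> real" and C z
  proof -
    have "tent_avg 1 (\<lambda>y. \<bar>h y\<bar>) z \<le> (C * exp th) * exp (- th * \<bar>z\<bar>)"
    proof (rule tent_avg_le_const)
      show "continuous_on UNIV (\<lambda>y. \<bar>h y\<bar>)" using that by (intro continuous_intros)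
      fix y :: real assume "\<bar>y\<bar> \<le> 1"
      from mult_left_mono[OF sh[OF this, of z] that(2)] that(3)[of "z + 1 * y"]
      show "\<bar>h (z + 1 * y)\<bar> \<le> (C * exp th) * exp (- th * \<bar>z\<bar>)" by (simp add: mult.assoc)
    qed
    then show ?thesis using abs_tent_avg_le[OF that(1), of 1 z] by linarith
  qed
  {
    case (0 h)
    obtain C where C: "0 \<le> C" "\<And>e x. e \<in> E \<Longrightarrow> \<bar>h e x\<bar> \<le> C * exp (- th * \<bar>x\<bar>)"
      using ubd_bounded[OF 0] by auto
    note ch = ubd_continuous[OF 0]
    have "\<forall>e\<in>E. \<exists>Th. \<forall>x. (Th has_real_derivative h e x) (at x)" using exists_antiderivative[OF ch] by metis
    from bchoice[OF this] obtain Th where Th: "\<forall>e\<in>E. \<forall>x. (Th e has_real_derivative h e x) (at x)" by blast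
    define D where "D e x = Th e (x + 1) - 2 * Th e x + Th e (x - 1)" for e x
    have d: "(tent_avg 1 (h e) has_real_derivative D e x) (at x)" if "e \<in> E" for e x
      using tent_avg_has_derivative[OF zero_less_one ch[OF that], of "Th e"] Th that by (simp add: D_def)
    have cD: "continuous_on UNIV (D e)" if "e \<in> E" for e
    proof -
      have c: "continuous_on UNIV (Th e)" using Th that by (intro has_derivative_continuous_on_UNIV[of "Th e" "h e"]) auto
      have "continuous_on UNIV (\<lambda>x. Th e (x + 1))" "continuous_on UNIV (\<lambda>x. Th e (x - 1))"
        by (rule continuous_on_compose2[OF c]; auto intro!: continuous_intros)+
      then show ?thesis unfolding D_def[abs_def] using c
        by (intro continuous_on_add continuous_on_diff continuous_on_mult continuous_on_const) auto
    qed
    have bD: "\<bar>D e x\<bar> \<le> (2 * C * exp th) * exp (- th * \<bar>x\<bar>)" if "e \<in> E" for e x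
    proof -
      have te: "(Th e has_real_derivative h e x) (at x)" for x using Th that by blast
      obtain z1 where z1: "x < z1" "z1 < x + 1" "Th e (x + 1) - Th e x = (x + 1 - x) * h e z1"
        using MVT2[of x "x + 1" "Th e" "h e", OF _ te] by auto
      obtain z2 where z2: "x - 1 < z2" "z2 < x" "Th e x - Th e (x - 1) = (x - (x - 1)) * h e z2"
        using MVT2[of "x - 1" x "Th e" "h e", OF _ te] by auto
      have b: "\<bar>h e z\<bar> \<le> C * exp th * exp (- th * \<bar>x\<bar>)" if "\<bar>z - x\<bar> \<le> 1" for z
        using C(2)[OF \<open>e \<in> E\<close>, of z] mult_left_mono[OF sh[OF that, of x] C(1)] by (simp add: mult.assoc)
      have "D e x = h e z1 - h e z2" using z1 z2 by (simp add: D_def)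
      moreover have "2 * C * exp th * exp (- th * \<bar>x\<bar>) = C * exp th * exp (- th * \<bar>x\<bar>) + C * exp th * exp (- th * \<bar>x\<bar>)" by simp
      ultimately show ?thesis using b[of z1] b[of z2] z1 z2 abs_triangle_ineq4[of "h e z1" "h e z2"] by linarith
    qed
    have D0: "ubd 0 E (\<lambda>x. exp (- th * \<bar>x\<bar>)) D"
      unfolding ubd.simps using cD bD by blast
    show ?case
    proof (rule ubd_SucI[where C="C * exp th" and f'=D])
      fix e x assume e: "e \<in> E"
      show "\<bar>tent_avg 1 (h e) x\<bar> \<le> (C * exp th) * exp (- th * \<bar>x\<bar>)" by (rule bd[OF ch[OF e] C(1) C(2)[OF e]])
      show "(tent_avg 1 (h e) has_real_derivative D e x) (at x)" by (rule d[OF e])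
    qed (rule D0)
  next
    case (Suc k h)
    obtain C where C: "0 \<le> C" "\<And>e x. e \<in> E \<Longrightarrow> \<bar>h e x\<bar> \<le> C * exp (- th * \<bar>x\<bar>)"
      using ubd_bounded[OF Suc.prems] by auto
    obtain h' where h': "\<And>e x. e \<in> E \<Longrightarrow> (h e has_real_derivative h' e x) (at x)" "ubd k E (\<lambda>x. exp (- th * \<bar>x\<bar>)) h'"
      using ubd_SucE[OF Suc.prems] by blast
    show ?case
    proof (rule ubd_SucI[where C="C * exp th" and f'="\<lambda>e. tent_avg 1 (h' e)"])
      fix e x assume e: "e \<in> E"
      show "\<bar>tent_avg 1 (h e) x\<bar> \<le> (C * exp th) * exp (- th * \<bar>x\<bar>)"
        by (rule bd[OF ubd_continuous[OF Suc.prems e] C(1) C(2)[OF e]])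
      show "(tent_avg 1 (h e) has_real_derivative tent_avg 1 (h' e) x) (at x)"
        by (rule tent_avg_deriv[OF zero_less_one ubd_continuous[OF h'(2) e] h'(1)[OF e]])
    qed (rule Suc.IH[OF h'(2)])
  }
qed

section \<open>Test functions\<close>

text \<open>\<open>k\<close>-fold differentiability in a form suited to induction.\<close>
primrec diff_times :: "nat \<Rightarrow> (real \<Rightarrow> real) \<Rightarrow> bool" where
  "diff_times 0 f \<longleftrightarrow> True"
| "diff_times (Suc k) f \<longleftrightarrow> (\<exists>f'. (\<forall>x. (f has_real_derivative f' x) (at x)) \<and> diff_times k f')"

lemma diff_times_SucI: "(\<And>x. (f has_real_derivative f' x) (at x)) \<Longrightarrow> diff_times k f' \<Longrightarrow> diff_times (Suc k) f"
  by auto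

lemma diff_times_SucE:
  assumes "diff_times (Suc k) f"
  obtains f' where "\<And>x. (f has_real_derivative f' x) (at x)" "diff_times k f'"
  using assms by auto

lemma diff_times_Suc_imp: "diff_times (Suc k) f \<Longrightarrow> diff_times k f"
proof (induction k arbitrary: f)
  case (Suc k)
  obtain f' where "\<And>x. (f has_real_derivative f' x) (at x)" "diff_times (Suc k) f'" by (rule diff_times_SucE[OF Suc.prems]) blast
  then show ?case using Suc.IH by (intro diff_times_SucI[of f f']) auto
qed simp

lemma diff_times_lincomb: "diff_times k f \<Longrightarrow> diff_times k g \<Longrightarrow> diff_times k (\<lambda>x. a * f x + b * g x)"
proof (induction k arbitrary: f g)
  case (Suc k)
  obtain f' where f': "\<And>x. (f has_real_derivative f' x) (at x)" "diff_times k f'" by (rule diff_times_SucE[OF Suc.prems(1)]) blast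
  obtain g' where g': "\<And>x. (g has_real_derivative g' x) (at x)" "diff_times k g'" by (rule diff_times_SucE[OF Suc.prems(2)]) blast
  show ?case
    by (rule diff_times_SucI[OF _ Suc.IH[OF f'(2) g'(2)]]) (intro DERIV_add DERIV_cmult f' g')
qed simp

lemma diff_times_mult: "diff_times k f \<Longrightarrow> diff_times k g \<Longrightarrow> diff_times k (\<lambda>x. f x * g x)"
proof (induction k arbitrary: f g)
  case (Suc k)
  obtain f' where f': "\<And>x. (f has_real_derivative f' x) (at x)" "diff_times k f'" by (rule diff_times_SucE[OF Suc.prems(1)]) blast
  obtain g' where g': "\<And>x. (g has_real_derivative g' x) (at x)" "diff_times k g'" by (rule diff_times_SucE[OF Suc.prems(2)]) blast
  have c: "diff_times k (\<lambda>x. 1 * (f' x * g x) + 1 * (g' x * f x))"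
    by (intro diff_times_lincomb Suc.IH f' g' diff_times_Suc_imp[OF Suc.prems(1)] diff_times_Suc_imp[OF Suc.prems(2)])
  show ?case
    by (rule diff_times_SucI[OF _ c]) (use DERIV_mult[OF f'(1) g'(1)] in simp)
qed simp

lemma diff_times_affine: "diff_times k f \<Longrightarrow> diff_times k (\<lambda>x. f (a * x + b))"
proof (induction k arbitrary: f)
  case (Suc k)
  obtain f' where f': "\<And>x. (f has_real_derivative f' x) (at x)" "diff_times k f'" by (rule diff_times_SucE[OF Suc.prems(1)]) blast
  have c: "diff_times k (\<lambda>x. a * f' (a * x + b) + 0 * f' (a * x + b))" by (intro diff_times_lincomb Suc.IH f')
  have l: "((\<lambda>x. a * x + b) has_real_derivative a) (at x)" for x by (auto intro!: derivative_eq_intros)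
  show ?case
    by (rule diff_times_SucI[OF _ c]) (use DERIV_chain'[OF l f'(1)] in \<open>simp add: mult.commute\<close>)
qed simp

lemma diff_times_smooth:
  assumes "\<And>k. diff_times k f"
  shows "smooth f"
  unfolding smooth_def
proof (intro allI)
  fix k x
  show "(deriv ^^ k) f differentiable (at x)"
    using assms[of "Suc k"]
  proof (induction k arbitrary: f)
    case 0
    obtain f' where "\<And>x. (f has_real_derivative f' x) (at x)" by (rule diff_times_SucE[OF 0]) blast
    from this[of x] show ?case by (auto simp: real_differentiable_def)
  next
    case (Suc k)
    obtain f' where f': "\<And>x. (f has_real_derivative f' x) (at x)" "diff_times (Suc k) f'" by (rule diff_times_SucE[OF Suc.prems]) blast
    have "deriv f = f'" using f'(1) by (intro ext DERIV_imp_deriv)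
    then show ?case using Suc.IH[OF f'(2)] by (simp add: funpow_Suc_right del: funpow.simps)
  qed
qed

text \<open>The derivatives of \<open>exp (- 1 / x)\<close>, extended by zero, are combinations of these functions, so smoothness of all of them follows from one induction.\<close>
definition flat :: "nat \<Rightarrow> real \<Rightarrow> real" where
  "flat n x = (if 0 < x then exp (- 1 / x) / x ^ n else 0)"

lemma flat_limit: "(flat n \<longlongrightarrow> 0) (at_right 0)"
proof -
  have "((\<lambda>t::real. t ^ n / exp t) \<longlongrightarrow> 0) at_top" by (rule tendsto_power_div_exp_0)
  then have "((\<lambda>x::real. inverse x ^ n / exp (inverse x)) \<longlongrightarrow> 0) (at_right 0)"
    by (rule filterlim_compose[OF _ filterlim_inverse_at_top_right])
  then show ?thesis
  proof (rule Lim_transform_eventually)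
    show "\<forall>\<^sub>F x in at_right 0. inverse x ^ n / exp (inverse x) = flat n x"
      using eventually_at_right_less[of 0]
      by eventually_elim (simp add: flat_def exp_minus inverse_eq_divide power_divide)
  qed
qed

lemma flat_deriv: "(flat n has_real_derivative (- real n) * flat (Suc n) x + 1 * flat (n + 2) x) (at x)"
proof -
  consider "0 < x" | "x < 0" | "x = 0" by linarith
  then show ?thesis
  proof cases
    case 1
    have "((\<lambda>x. exp (- 1 / x) * inverse (x ^ n)) has_real_derivative
       (exp (- 1 / x) * (1 / x\<^sup>2)) * inverse (x ^ n) + (- (real n * x ^ (n - 1)) * inverse ((x ^ n)\<^sup>2)) * exp (- 1 / x)) (at x)"
    proof (rule DERIV_mult)
      show "((\<lambda>x. exp (- 1 / x)) has_real_derivative exp (- 1 / x) * (1 / x\<^sup>2)) (at x)"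
        using 1 by (auto intro!: derivative_eq_intros simp: power2_eq_square)
      have "((\<lambda>x. x ^ n) has_real_derivative real n * x ^ (n - 1)) (at x)" by (auto intro!: derivative_eq_intros)
      from DERIV_inverse'[OF this] 1
      show "((\<lambda>x. inverse (x ^ n)) has_real_derivative - (real n * x ^ (n - 1)) * inverse ((x ^ n)\<^sup>2)) (at x)"
        by (simp add: power2_eq_square field_simps)
    qed
    also have "(exp (- 1 / x) * (1 / x\<^sup>2)) * inverse (x ^ n) + (- (real n * x ^ (n - 1)) * inverse ((x ^ n)\<^sup>2)) * exp (- 1 / x)
      = (- real n) * flat (Suc n) x + 1 * flat (n + 2) x"
    proof (cases n)
      case 0
      then show ?thesis using 1 by (simp add: flat_def power2_eq_square)
    next
      case (Suc m)
      then show ?thesis using 1 by (simp add: flat_def power2_eq_square field_simps)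
    qed
    finally have d: "((\<lambda>x. exp (- 1 / x) * inverse (x ^ n)) has_real_derivative (- real n) * flat (Suc n) x + 1 * flat (n + 2) x) (at x)" .
    have "\<forall>\<^sub>F y in nhds x. flat n y = exp (- 1 / y) * inverse (y ^ n)"
      using eventually_nhds_in_open[of "{0<..}" x] 1
      by (auto simp: flat_def divide_inverse elim!: eventually_mono)
    from DERIV_cong_ev[OF refl this refl] d show ?thesis by blast
  next
    case 2
    have "\<forall>\<^sub>F y in nhds x. flat n y = 0"
      using eventually_nhds_in_open[of "{..<0}" x] 2 by (auto simp: flat_def elim!: eventually_mono)
    from DERIV_cong_ev[OF refl this refl] have "(flat n has_real_derivative 0) (at x)" by simp
    then show ?thesis using 2 by (simp add: flat_def)
  next
    case 3
    have "((\<lambda>h. (flat n (0 + h) - flat n 0) / h) \<longlongrightarrow> 0) (at 0)"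
      unfolding filterlim_at_split
    proof
      show "((\<lambda>h. (flat n (0 + h) - flat n 0) / h) \<longlongrightarrow> 0) (at_left 0)"
      proof (rule tendsto_eventually)
        show "\<forall>\<^sub>F h in at_left 0. (flat n (0 + h) - flat n 0) / h = 0"
        proof -
          have "\<forall>\<^sub>F h::real in at_left 0. h < 0" by (simp add: eventually_at_filter)
          then show ?thesis by eventually_elim (simp add: flat_def)
        qed
      qed
      show "((\<lambda>h. (flat n (0 + h) - flat n 0) / h) \<longlongrightarrow> 0) (at_right 0)"
      proof (rule Lim_transform_eventually[OF flat_limit[of "Suc n"]])
        show "\<forall>\<^sub>F h in at_right 0. flat (Suc n) h = (flat n (0 + h) - flat n 0) / h"
          using eventually_at_right_less[of 0] by eventually_elim (simp add: flat_def)
      qed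
    qed
    then have "(flat n has_real_derivative 0) (at 0)" unfolding DERIV_def .
    then show ?thesis using 3 by (simp add: flat_def)
  qed
qed

lemma diff_times_flat: "diff_times k (flat n)"
proof (induction k arbitrary: n)
  case (Suc k)
  show ?case by (rule diff_times_SucI[OF flat_deriv diff_times_lincomb[OF Suc.IH Suc.IH]])
qed simp

lemma flat_0_range: "0 \<le> flat 0 x" "flat 0 x \<le> 1"
  by (auto simp: flat_def)

text \<open>The argument is scaled by \<open>n + 1\<close>, so that the bumps increase to the indicator of the open interval as \<open>n\<close> grows.\<close>
definition bump :: "nat \<Rightarrow> real \<Rightarrow> real \<Rightarrow> real \<Rightarrow> real" where
  "bump n l r x = flat 0 (real (Suc n) * (x - l)) * flat 0 (real (Suc n) * (r - x))"

lemma bump_smooth: "smooth (bump n l r)"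
proof (rule diff_times_smooth)
  fix k
  have "diff_times k (\<lambda>x. flat 0 (real (Suc n) * x + (- real (Suc n) * l)) * flat 0 ((- real (Suc n)) * x + real (Suc n) * r))"
    by (intro diff_times_mult diff_times_affine diff_times_flat)
  moreover have "bump n l r = (\<lambda>x. flat 0 (real (Suc n) * x + (- real (Suc n) * l)) * flat 0 ((- real (Suc n)) * x + real (Suc n) * r))"
    by (auto simp: bump_def fun_eq_iff algebra_simps)
  ultimately show "diff_times k (bump n l r)" by simp
qed

lemma bump_range: "0 \<le> bump n l r x" "bump n l r x \<le> 1"
  unfolding bump_def using flat_0_range by (auto intro: mult_le_one)

lemma bump_outside: "x \<le> l \<or> r \<le> x \<Longrightarrow> bump n l r x = 0"
  unfolding bump_def flat_def by (auto simp: mult_le_0_iff zero_less_mult_iff not_less)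

lemma bump_shift: "bump n (l + t) (r + t) x = bump n l r (x - t)"
  by (simp add: bump_def algebra_simps)

lemma bump_limit: "(\<lambda>n. bump n l r x) \<longlonglongrightarrow> indicator {l<..<r} x"
proof (cases "l < x \<and> x < r")
  case True
  have lim: "(\<lambda>n. flat 0 (real (Suc n) * d)) \<longlonglongrightarrow> 1" if "0 < d" for d
  proof -
    have "(\<lambda>n. exp (- (1 / d) * inverse (real (Suc n)))) \<longlonglongrightarrow> exp (- (1 / d) * 0)"
      by (intro tendsto_intros LIMSEQ_inverse_real_of_nat)
    moreover have "exp (- (1 / d) * inverse (real (Suc n))) = flat 0 (real (Suc n) * d)" for n
      using that by (simp add: flat_def divide_inverse del: of_nat_Suc)
    ultimately show ?thesis by simp
  qed
  have "(\<lambda>n. bump n l r x) \<longlonglongrightarrow> 1 * 1"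
    unfolding bump_def by (intro tendsto_mult lim) (use True in auto)
  then show ?thesis using True by simp
next
  case False
  then have "bump n l r x = 0" for n by (intro bump_outside) auto
  moreover have "x \<notin> {l<..<r}" using False by auto
  ultimately show ?thesis by simp
qed

lemma smooth_tent_avg:
  assumes "smooth b"
  shows "smooth (tent_avg 1 b)"
proof -
  have eq: "(deriv ^^ j) (tent_avg 1 b) = tent_avg 1 ((deriv ^^ j) b)" for j
  proof (induction j)
    case (Suc j)
    have "(tent_avg 1 ((deriv ^^ j) b) has_real_derivative tent_avg 1 ((deriv ^^ Suc j) b) x) (at x)" for x
      by (rule tent_avg_deriv[OF zero_less_one smooth_continuous[OF assms] smooth_has_derivative[OF assms]])
    then have "deriv (tent_avg 1 ((deriv ^^ j) b)) = tent_avg 1 ((deriv ^^ Suc j) b)"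
      by (intro ext DERIV_imp_deriv)
    then show ?case using Suc.IH by simp
  qed simp
  have "(tent_avg 1 ((deriv ^^ j) b) has_real_derivative tent_avg 1 ((deriv ^^ Suc j) b) x) (at x)" for j x
    by (rule tent_avg_deriv[OF zero_less_one smooth_continuous[OF assms] smooth_has_derivative[OF assms]])
  then show ?thesis unfolding smooth_def eq by (auto simp: real_differentiable_def)
qed

lemma tent_avg_outside:
  assumes "\<And>x. R \<le> \<bar>x\<bar> \<Longrightarrow> b x = 0" "R + 1 \<le> \<bar>x\<bar>"
  shows "tent_avg 1 b x = 0"
proof -
  have "tent y * b (x + 1 * y) = 0" for y
    using assms(1)[of "x + y"] assms(2) tent_outside[of y] by (cases "1 \<le> \<bar>y\<bar>") auto
  then show ?thesis unfolding tent_avg_def by (simp only:) simp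
qed

lemma test_functionI:
  assumes "smooth f" "\<And>x. R \<le> \<bar>x\<bar> \<Longrightarrow> f x = 0"
  shows "test_function f"
proof -
  have "bounded {x. f x \<noteq> 0}"
    unfolding bounded_iff
  proof (intro exI[of _ R] ballI)
    fix x assume "x \<in> {x. f x \<noteq> 0}"
    then show "norm x \<le> R" using assms(2)[of x] by (cases "R \<le> \<bar>x\<bar>") auto
  qed
  then show ?thesis using assms(1) by (simp add: test_function_def)
qed

lemma integrable_bounded_compact:
  fixes u c :: "real \<Rightarrow> real"
  assumes u: "u \<in> borel_measurable borel" "\<And>x. \<bar>u x\<bar> \<le> B"
    and c: "continuous_on UNIV c" "\<And>x. R \<le> \<bar>x\<bar> \<Longrightarrow> c x = 0"
  shows "integrable lborel (\<lambda>x. u x * c x)" "integrable lborel c"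
proof -
  have "integrable lborel (\<lambda>x. indicator {-R..R} x *\<^sub>R c x)"
    using continuous_on_subset[OF c(1)] by (intro borel_integrable_compact) auto
  moreover have "(\<lambda>x. indicator {-R..R} x *\<^sub>R c x) = c"
  proof
    fix x show "indicator {-R..R} x *\<^sub>R c x = c x"
      using c(2)[of x] by (cases "R \<le> \<bar>x\<bar>") (auto simp: indicator_def)
  qed
  ultimately show ic: "integrable lborel c" by (simp only:)
  have [measurable]: "c \<in> borel_measurable borel" by (rule borel_measurable_continuous_onI[OF c(1)])
  show "integrable lborel (\<lambda>x. u x * c x)"
  proof (rule Bochner_Integration.integrable_bound[OF integrable_mult_right[OF integrable_abs[OF ic], of "\<bar>B\<bar>"]])
    show "(\<lambda>x. u x * c x) \<in> borel_measurable lborel" using u(1) by measurable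
    show "AE x in lborel. norm (u x * c x) \<le> norm (\<bar>B\<bar> * \<bar>c x\<bar>)"
    proof (rule AE_I2)
      fix x
      have "\<bar>u x\<bar> * \<bar>c x\<bar> \<le> \<bar>B\<bar> * \<bar>c x\<bar>" using u(2)[of x] by (intro mult_right_mono) auto
      then show "norm (u x * c x) \<le> norm (\<bar>B\<bar> * \<bar>c x\<bar>)" by (simp add: abs_mult)
    qed
  qed
qed

text \<open>The pairing with \<open>u \<in> L\<^sup>2\<close> vanishes as the compactly supported function is moved to infinity; this is where the square integrability of a distributional solution enters.\<close>
lemma translated_pairing_tendsto_zero:
  fixes u c :: "real \<Rightarrow> real"
  assumes u: "u \<in> borel_measurable borel" "\<And>x. \<bar>u x\<bar> \<le> B" "integrable lborel (\<lambda>x. (u x)\<^sup>2)"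
    and c: "continuous_on UNIV c" "\<And>x. R \<le> \<bar>x\<bar> \<Longrightarrow> c x = 0" "\<And>x. \<bar>c x\<bar> \<le> L"
  shows "(\<lambda>n. LINT x|lborel. u x * c (x - real n)) \<longlonglongrightarrow> 0"
proof (rule LIMSEQ_I)
  fix r :: real assume "0 < r"
  have [measurable]: "c \<in> borel_measurable borel" "u \<in> borel_measurable borel"
    using borel_measurable_continuous_onI[OF c(1)] u(1) by auto
  note ic = integrable_bounded_compact(2)[OF u(1,2) c(1,2)]
  define M where "M = (LINT x|lborel. \<bar>c x\<bar>)"
  have M0: "0 \<le> M" unfolding M_def by (rule integral_nonneg_AE) auto
  (* The weight in Young's inequality |u| <= K / 2 * u^2 + 1 / (2 * K): the constant term contributes less
     than r / 2, and the quadratic term vanishes in the limit. *)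
  define K where "K = (M + 1) / r"
  have K: "0 < K" using M0 \<open>0 < r\<close> by (simp add: K_def)
  have cn: "continuous_on UNIV (\<lambda>x. c (x - real n))" for n
    by (rule continuous_on_compose2[OF c(1)]) (auto intro!: continuous_intros)
  have cz: "c (x - real n) = 0" if "R + real n \<le> \<bar>x\<bar>" for x n using that c(2)[of "x - real n"] by auto
  have icn: "integrable lborel (\<lambda>x. \<bar>c (x - real n)\<bar>)" for n
    using integrable_abs[OF integrable_bounded_compact(2)[OF u(1,2) cn cz]] .
  have Mn: "(LINT x|lborel. \<bar>c (x - real n)\<bar>) = M" for n
    unfolding M_def using lborel_integral_real_affine[of 1 "\<lambda>x. \<bar>c x\<bar>" "- real n"] by (simp add: algebra_simps)
  have i2: "integrable lborel (\<lambda>x. (u x)\<^sup>2 * \<bar>c (x - real n)\<bar>)" for n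
  proof (rule Bochner_Integration.integrable_bound[OF integrable_mult_left[OF u(3), of L]])
    show "AE x in lborel. norm ((u x)\<^sup>2 * \<bar>c (x - real n)\<bar>) \<le> norm ((u x)\<^sup>2 * L)"
    proof (rule AE_I2)
      fix x
      have "0 \<le> L" using c(3)[of 0] by linarith
      then show "norm ((u x)\<^sup>2 * \<bar>c (x - real n)\<bar>) \<le> norm ((u x)\<^sup>2 * L)"
        using c(3)[of "x - real n"] by (simp add: abs_mult mult_left_mono)
    qed
  qed measurable
  have "(\<lambda>n. LINT x|lborel. (u x)\<^sup>2 * \<bar>c (x - real n)\<bar>) \<longlonglongrightarrow> (LINT x::real|lborel. 0)"
  proof (rule integral_dominated_convergence[where w="\<lambda>x. (u x)\<^sup>2 * L"])
    show "AE x in lborel. (\<lambda>n. (u x)\<^sup>2 * \<bar>c (x - real n)\<bar>) \<longlonglongrightarrow> 0"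
    proof (rule AE_I2, rule tendsto_eventually)
      fix x
      obtain n0 where n0: "x + \<bar>R\<bar> \<le> real n0" using real_arch_simple by blast
      have "c (x - real n) = 0" if "n0 \<le> n" for n
      proof -
        have "real n0 \<le> real n" using that by simp
        then show ?thesis using n0 by (intro c(2)) linarith
      qed
      then show "\<forall>\<^sub>F n in sequentially. (u x)\<^sup>2 * \<bar>c (x - real n)\<bar> = 0"
        by (auto simp: eventually_sequentially)
    qed
    show "AE x in lborel. norm ((u x)\<^sup>2 * \<bar>c (x - real n)\<bar>) \<le> (u x)\<^sup>2 * L" for n
      using c(3) by (intro AE_I2) (simp add: abs_mult mult_left_mono)
  qed (use integrable_mult_left[OF u(3), of L] in auto)
  then have "(\<lambda>n. LINT x|lborel. (u x)\<^sup>2 * \<bar>c (x - real n)\<bar>) \<longlonglongrightarrow> 0" by simp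
  then obtain n0 where n0: "\<And>n. n0 \<le> n \<Longrightarrow> norm ((LINT x|lborel. (u x)\<^sup>2 * \<bar>c (x - real n)\<bar>) - 0) < r / K"
    using LIMSEQ_D[of _ 0 "r / K"] \<open>0 < r\<close> K by (meson divide_pos_pos)
  show "\<exists>no. \<forall>n\<ge>no. norm ((LINT x|lborel. u x * c (x - real n)) - 0) < r"
  proof (intro exI[of _ n0] allI impI)
    fix n assume "n0 \<le> n"
    have "\<bar>LINT x|lborel. u x * c (x - real n)\<bar> \<le> (LINT x|lborel. \<bar>u x * c (x - real n)\<bar>)"
      by (rule integral_abs_bound)
    also have "\<dots> \<le> (LINT x|lborel. K / 2 * ((u x)\<^sup>2 * \<bar>c (x - real n)\<bar>) + 1 / (2 * K) * \<bar>c (x - real n)\<bar>)"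
    proof (rule integral_mono)
      show "integrable lborel (\<lambda>x. \<bar>u x * c (x - real n)\<bar>)"
        by (rule integrable_abs[OF integrable_bounded_compact(1)[OF u(1,2) cn cz]])
      show "integrable lborel (\<lambda>x. K / 2 * ((u x)\<^sup>2 * \<bar>c (x - real n)\<bar>) + 1 / (2 * K) * \<bar>c (x - real n)\<bar>)"
        using i2 icn by (intro Bochner_Integration.integrable_add integrable_mult_right)
      fix x
      have "\<bar>u x\<bar> \<le> K / 2 * (u x)\<^sup>2 + 1 / (2 * K)"
      proof -
        have "0 \<le> (K * \<bar>u x\<bar> - 1)\<^sup>2" by simp
        then have "2 * K * \<bar>u x\<bar> \<le> K * K * (u x)\<^sup>2 + 1" by (simp add: power2_diff power_mult_distrib power2_eq_square[of K])
        then have "\<bar>u x\<bar> \<le> (K * K * (u x)\<^sup>2 + 1) / (2 * K)" using K by (simp add: field_simps)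
        also have "\<dots> = K / 2 * (u x)\<^sup>2 + 1 / (2 * K)" using K by (simp add: field_simps)
        finally show ?thesis .
      qed
      then have "\<bar>u x\<bar> * \<bar>c (x - real n)\<bar> \<le> (K / 2 * (u x)\<^sup>2 + 1 / (2 * K)) * \<bar>c (x - real n)\<bar>"
        by (intro mult_right_mono) auto
      then show "\<bar>u x * c (x - real n)\<bar> \<le> K / 2 * ((u x)\<^sup>2 * \<bar>c (x - real n)\<bar>) + 1 / (2 * K) * \<bar>c (x - real n)\<bar>"
        by (simp add: abs_mult distrib_right)
    qed
    also have "\<dots> = K / 2 * (LINT x|lborel. (u x)\<^sup>2 * \<bar>c (x - real n)\<bar>) + 1 / (2 * K) * M"
      using i2[of n] icn[of n] Mn[of n] by simp
    also have "\<dots> < r"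
    proof -
      have "(LINT x|lborel. (u x)\<^sup>2 * \<bar>c (x - real n)\<bar>) < r / K" using n0[OF \<open>n0 \<le> n\<close>] by simp
      then have "K / 2 * (LINT x|lborel. (u x)\<^sup>2 * \<bar>c (x - real n)\<bar>) < K / 2 * (r / K)" using K by (intro mult_strict_left_mono) auto
      then have 1: "K / 2 * (LINT x|lborel. (u x)\<^sup>2 * \<bar>c (x - real n)\<bar>) < r / 2" using K by simp
      have "1 / (2 * K) * M = r / 2 * (M / (M + 1))" using \<open>0 < r\<close> M0 by (simp add: K_def)
      also have "\<dots> \<le> r / 2 * 1" using \<open>0 < r\<close> M0 by (intro mult_left_mono) auto
      finally show ?thesis using 1 by simp
    qed
    finally show "norm ((LINT x|lborel. u x * c (x - real n)) - 0) < r" by simp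
  qed
qed

text \<open>A sequence with vanishing second differences is affine.\<close>
lemma affine_null_sequence:
  fixes D :: "nat \<Rightarrow> real"
  assumes "\<And>n. D (n + 2) - 2 * D (n + 1) + D n = 0" "D \<longlonglongrightarrow> 0"
  shows "D 0 = 0"
proof -
  have c: "D (Suc n) - D n = D 1 - D 0" for n
  proof (induction n)
    case (Suc n)
    then show ?case using assms(1)[of n] by simp
  qed simp
  have "(\<lambda>n. D (Suc n) - D n) \<longlonglongrightarrow> 0 - 0"
    by (intro tendsto_diff LIMSEQ_Suc assms(2))
  then have "D 1 - D 0 = 0" unfolding c by (simp add: LIMSEQ_const_iff)
  then have st: "D (Suc n) = D n" for n using c[of n] by linarith
  have "D n = D 0" for n by (induction n) (simp_all only: st)
  then have "D = (\<lambda>_. D 0)" by blast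
  then show ?thesis using assms(2) by (metis LIMSEQ_const_iff)
qed

section \<open>Distributional solutions are mild\<close>

lemma tent_avg_centred: "tent_avg 1 f x = (LINT y|lborel. tent (y - x) * f y)"
  unfolding tent_avg_def using lborel_integral_real_affine[of 1 "\<lambda>y. tent y * f (x + 1 * y)" "- x"]
  by (simp add: add.commute)

text \<open>Fubini's theorem and the symmetry of the tent.\<close>
lemma tent_avg_adjoint:
  fixes h b :: "real \<Rightarrow> real"
  assumes h: "h \<in> borel_measurable borel" "\<And>x. \<bar>h x\<bar> \<le> B"
    and b: "continuous_on UNIV b" "\<And>x. R \<le> \<bar>x\<bar> \<Longrightarrow> b x = 0" "\<And>x. \<bar>b x\<bar> \<le> L"
  shows "(LINT x|lborel. h x * tent_avg 1 b x) = (LINT x|lborel. tent_avg 1 h x * b x)"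
proof -
  have bm: "b \<in> borel_measurable borel" by (rule borel_measurable_continuous_onI[OF b(1)])
  have [measurable]: "h \<in> borel_measurable borel" "b \<in> borel_measurable borel" using h(1) bm by auto
  define f where "f x y = h x * (tent (y - x) * b y)" for x y
  define S where "S = {- \<bar>R\<bar> - 1..\<bar>R\<bar> + 1}"
  have B0: "0 \<le> B" "0 \<le> L" using h(2)[of 0] b(3)[of 0] by linarith+
  have le: "\<bar>f x y\<bar> \<le> (B * L) * indicator (S \<times> S) (x, y)" for x y
  proof (cases "f x y = 0")
    case True
    then show ?thesis using B0 by (simp add: indicator_def)
  next
    case False
    then have "tent (y - x) \<noteq> 0" "b y \<noteq> 0" by (auto simp: f_def)
    then have "\<not> 1 \<le> \<bar>y - x\<bar>" "\<not> R \<le> \<bar>y\<bar>" using tent_outside[of "y - x"] b(2)[of y] by auto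
    then have "(x, y) \<in> S \<times> S" by (auto simp: S_def)
    moreover have "\<bar>h x\<bar> * (tent (y - x) * \<bar>b y\<bar>) \<le> B * (1 * L)"
      using h(2)[of x] b(3)[of y] B0 by (intro mult_mono mult_nonneg_nonneg) (auto simp: tent_def)
    ultimately show ?thesis by (simp add: f_def abs_mult)
  qed
  have "integrable (lborel \<Otimes>\<^sub>M lborel) (case_prod f)"
  proof (rule Bochner_Integration.integrable_bound)
    have "emeasure (lborel \<Otimes>\<^sub>M lborel) (S \<times> S) < \<infinity>"
      unfolding S_def by (subst lborel.emeasure_pair_measure_Times) (auto simp: ennreal_mult_less_top)
    then have "integrable (lborel \<Otimes>\<^sub>M lborel) (indicator (S \<times> S) :: real \<times> real \<Rightarrow> real)"
      by (intro integrable_real_indicator) (auto simp: S_def)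
    then show "integrable (lborel \<Otimes>\<^sub>M lborel) (\<lambda>p. (B * L) * indicator (S \<times> S) p :: real)"
      by (rule integrable_mult_right)
    show "case_prod f \<in> borel_measurable (lborel \<Otimes>\<^sub>M lborel)"
      unfolding f_def by measurable
    show "AE p in lborel \<Otimes>\<^sub>M lborel. norm (case_prod f p) \<le> norm ((B * L) * indicator (S \<times> S) p :: real)"
    proof (rule AE_I2)
      fix p :: "real \<times> real"
      obtain x y where p: "p = (x, y)" by (cases p)
      have "0 \<le> (B * L) * indicator (S \<times> S) (x, y)" using B0 by (simp add: indicator_def)
      then show "norm (case_prod f p) \<le> norm ((B * L) * indicator (S \<times> S) p :: real)"
        using le[of x y] unfolding p by simp
    qed
  qed
  from lborel_pair.Fubini_integral[OF this]
  have "(LINT y|lborel. LINT x|lborel. f x y) = (LINT x|lborel. LINT y|lborel. f x y)" .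
  moreover have "(LINT y|lborel. f x y) = h x * tent_avg 1 b x" for x
    unfolding f_def tent_avg_centred by simp
  moreover have "(LINT x|lborel. f x y) = tent_avg 1 h y * b y" for y
  proof -
    have "f x y = (tent (x - y) * h x) * b y" for x
      using tent_minus[of "x - y"] by (simp add: f_def)
    then show ?thesis by (simp add: tent_avg_centred)
  qed
  ultimately show ?thesis by simp
qed

text \<open>Adding a constant and rescaling makes \<open>u\<close> the perturbation of a positive density whose measure agrees with Lebesgue measure on intervals; by uniqueness
  of Lebesgue measure and of densities the perturbation vanishes.\<close>
lemma AE_zero_of_interval_integrals:
  fixes u :: "real \<Rightarrow> real"
  assumes u: "u \<in> borel_measurable borel" "\<And>x. \<bar>u x\<bar> \<le> B"
    and z: "\<And>l r. l < r \<Longrightarrow> (LINT x|lborel. u x * indicator {l<..<r} x) = 0"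
  shows "AE x in lborel. u x = 0"
proof -
  have [measurable]: "u \<in> borel_measurable borel" by (rule u(1))
  (* Large enough for the density 1 + u / c to be positive. *)
  define c where "c = 2 * (\<bar>B\<bar> + 1)"
  have c: "0 < c" by (simp add: c_def)
  define f where "f x = 1 + u x / c" for x
  have f0: "0 \<le> f x" for x
  proof -
    have "- c \<le> u x" using u(2)[of x] by (simp add: c_def)
    then show ?thesis using c by (simp add: f_def field_simps)
  qed
  have fm: "(\<lambda>x. ennreal (f x)) \<in> borel_measurable lborel" unfolding f_def by measurable
  have fin: "emeasure lborel {l<..<r} < \<infinity>" for l r :: real
    by (cases "l \<le> r") auto
  have iu: "integrable lborel (\<lambda>x. u x * indicator {l<..<r} x)" for l r :: real
  proof (rule Bochner_Integration.integrable_bound)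
    show "integrable lborel (\<lambda>x. \<bar>B\<bar> * indicator {l<..<r} x :: real)"
      by (intro integrable_mult_right integrable_real_indicator fin) auto
    show "AE x in lborel. norm (u x * indicator {l<..<r} x) \<le> norm (\<bar>B\<bar> * indicator {l<..<r} x :: real)"
    proof (rule AE_I2)
      fix x show "norm (u x * indicator {l<..<r} x) \<le> norm (\<bar>B\<bar> * indicator {l<..<r} x :: real)"
        using u(2)[of x] by (auto simp: indicator_def)
    qed
  qed measurable
  have i1: "integrable lborel (indicator {l<..<r} :: real \<Rightarrow> real)" for l r :: real
    by (intro integrable_real_indicator fin) auto
  have "lborel = density lborel (\<lambda>x. ennreal (f x))"
  proof (rule lborel_eqI)
    fix l r :: real assume "\<And>b. b \<in> Basis \<Longrightarrow> l \<bullet> b \<le> r \<bullet> b"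
    then have lr: "l \<le> r" by simp
    have eq: "f x * indicator {l<..<r} x = indicator {l<..<r} x + u x * indicator {l<..<r} x / c" for x
      by (simp add: f_def algebra_simps add_divide_distrib)
    have "emeasure (density lborel (\<lambda>x. ennreal (f x))) (box l r) = (\<integral>\<^sup>+x. ennreal (f x) * indicator {l<..<r} x \<partial>lborel)"
      by (subst emeasure_density[OF fm]) (auto simp: box_real)
    also have "\<dots> = (\<integral>\<^sup>+x. ennreal (f x * indicator {l<..<r} x) \<partial>lborel)"
      by (intro nn_integral_cong) (auto simp: indicator_def)
    also have "\<dots> = ennreal (LINT x|lborel. f x * indicator {l<..<r} x)"
    proof (rule nn_integral_eq_integral)
      show "integrable lborel (\<lambda>x. f x * indicator {l<..<r} x)"
        unfolding eq using iu i1 by (intro Bochner_Integration.integrable_add integrable_divide)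
    qed (use f0 in \<open>auto simp: indicator_def\<close>)
    also have "(LINT x|lborel. f x * indicator {l<..<r} x) = r - l"
    proof -
      have "(LINT x|lborel. f x * indicator {l<..<r} x)
          = (LINT x|lborel. indicator {l<..<r} x) + (LINT x|lborel. u x * indicator {l<..<r} x) / c"
        unfolding eq using iu[of l r] i1[of l r] by simp
      moreover have "(LINT x|lborel. u x * indicator {l<..<r} x) = 0"
        using z[of l r] lr by (cases "l = r") auto
      ultimately show ?thesis using lr by simp
    qed
    finally show "emeasure (density lborel (\<lambda>x. ennreal (f x))) (box l r) = ennreal (\<Prod>b\<in>Basis. (r - l) \<bullet> b)"
      by simp
  qed simp
  then have "density lborel (\<lambda>x. ennreal (f x)) = density lborel (\<lambda>x. 1)" by (simp add: density_1)
  then have "AE x in lborel. ennreal (f x) = 1"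
    by (intro sigma_finite_measure.density_unique[OF sigma_finite_lborel]) (use fm in auto)
  then show ?thesis
  proof eventually_elim
    case (elim x)
    then have "f x = 1" using f0[of x] by (metis ennreal_1 ennreal_inj zero_le_one)
    then show ?case using c by (simp add: f_def)
  qed
qed

lemma tent_avg_lipschitz:
  fixes h :: "real \<Rightarrow> real"
  assumes h: "h \<in> borel_measurable borel" "\<And>x. \<bar>h x\<bar> \<le> B" and x: "\<bar>x - z\<bar> \<le> 1"
  shows "\<bar>tent_avg 1 h x - tent_avg 1 h z\<bar> \<le> 4 * B * \<bar>x - z\<bar>"
proof -
  have [measurable]: "h \<in> borel_measurable borel" by (rule h(1))
  have i: "integrable lborel (\<lambda>y. tent (y - x) * h y)" for x
    using lborel_integrable_real_affine[OF integrable_tent_mult[OF h, of x 1], of 1 "- x"] by (simp add: add.commute)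
  have B0: "0 \<le> B" using h(2)[of 0] by linarith
  have pt: "\<bar>tent (y - x) * h y - tent (y - z) * h y\<bar> \<le> (B * \<bar>x - z\<bar>) * indicator {z - 2..z + 2} y" for y
  proof (cases "y \<in> {z - 2..z + 2}")
    case True
    have "\<bar>tent (y - x) - tent (y - z)\<bar> \<le> \<bar>x - z\<bar>" by (auto simp: tent_def)
    then have "\<bar>tent (y - x) - tent (y - z)\<bar> * \<bar>h y\<bar> \<le> \<bar>x - z\<bar> * B"
      using h(2)[of y] by (intro mult_mono) auto
    then show ?thesis using True unfolding left_diff_distrib[symmetric] abs_mult by (simp add: mult.commute)
  next
    case False
    then have "1 \<le> \<bar>y - x\<bar>" "1 \<le> \<bar>y - z\<bar>" using x by auto
    then show ?thesis using False by (simp add: tent_outside)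
  qed
  have ii: "integrable lborel (\<lambda>y. (B * \<bar>x - z\<bar>) * indicator {z - 2..z + 2} y :: real)"
    by (intro integrable_mult_right integrable_real_indicator) (auto simp: emeasure_lborel_Icc_eq)
  have "tent_avg 1 h x - tent_avg 1 h z = (LINT y|lborel. tent (y - x) * h y - tent (y - z) * h y)"
    using i by (simp add: tent_avg_centred)
  also have "\<bar>\<dots>\<bar> \<le> (LINT y|lborel. \<bar>tent (y - x) * h y - tent (y - z) * h y\<bar>)"
    by (rule integral_abs_bound)
  also have "\<dots> \<le> (LINT y|lborel. (B * \<bar>x - z\<bar>) * indicator {z - 2..z + 2} y)"
    by (rule integral_mono[OF integrable_abs[OF Bochner_Integration.integrable_diff[OF i i]] ii pt])
  also have "\<dots> = 4 * B * \<bar>x - z\<bar>" by simp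
  finally show ?thesis .
qed

text \<open>The tent is Lipschitz, so averages of merely bounded measurable functions are continuous.\<close>
lemma continuous_tent_avg_bounded:
  fixes h :: "real \<Rightarrow> real"
  assumes h: "h \<in> borel_measurable borel" "\<And>x. \<bar>h x\<bar> \<le> B"
  shows "continuous_on UNIV (tent_avg 1 h)"
proof (rule continuous_at_imp_continuous_on, intro ballI)
  fix z :: real
  have B0: "0 \<le> B" using h(2)[of 0] by linarith
  show "isCont (tent_avg 1 h) z"
    unfolding isCont_def
  proof (rule LIM_I)
    fix r :: real assume "0 < r"
    define s where "s = min 1 (r / (4 * B + 1))"
    have s: "0 < s" "s \<le> 1" using \<open>0 < r\<close> B0 by (auto simp: s_def)
    have "norm (tent_avg 1 h x - tent_avg 1 h z) < r" if "norm (x - z) < s" for x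
    proof -
      have "\<bar>tent_avg 1 h x - tent_avg 1 h z\<bar> \<le> 4 * B * \<bar>x - z\<bar>"
        using that s by (intro tent_avg_lipschitz[OF h]) auto
      also have "\<dots> \<le> 4 * B * s" using that B0 by (intro mult_left_mono) auto
      also have "\<dots> < (4 * B + 1) * s" using s by simp
      also have "\<dots> \<le> (4 * B + 1) * (r / (4 * B + 1))" using B0 by (intro mult_left_mono) (auto simp: s_def)
      also have "\<dots> = r"
      proof -
        have "4 * B + 1 \<noteq> 0" using B0 by linarith
        then show ?thesis by (metis nonzero_mult_div_cancel_left times_divide_eq_right)
      qed
      finally show ?thesis by simp
    qed
    then show "\<exists>s>0. \<forall>x. x \<noteq> z \<and> norm (x - z) < s \<longrightarrow> norm (tent_avg 1 h x - tent_avg 1 h z) < r"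
      using s(1) by blast
  qed
qed

lemma tent_avg_deriv2:
  assumes "smooth b"
  shows "(deriv ^^ 2) (tent_avg 1 b) x = b (x + 1) - 2 * b x + b (x - 1)"
proof -
  have cb: "continuous_on UNIV b" using smooth_continuous[OF assms, of 0] by simp
  obtain Th where Th: "\<And>x. (Th has_real_derivative b x) (at x)" using exists_antiderivative[OF cb] by blast
  have "deriv (tent_avg 1 b) = (\<lambda>x. (Th (x + 1) - 2 * Th x + Th (x - 1)) / 1\<^sup>2)"
    by (intro ext DERIV_imp_deriv tent_avg_has_derivative[OF zero_less_one cb Th])
  moreover have "deriv (\<lambda>x. (Th (x + 1) - 2 * Th x + Th (x - 1)) / 1\<^sup>2) x = (b (x + 1) - 2 * b x + b (x - 1)) / 1\<^sup>2"
    by (intro DERIV_imp_deriv tent_avg_second_derivative[OF zero_less_one cb Th])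
  ultimately show ?thesis by (simp add: numeral_2_eq_2)
qed

text \<open>The weak equation is tested with \<open>T b\<close> for a bump \<open>b\<close>, translated by \<open>t\<close>. Since the second derivative of \<open>T b\<close> is the second difference of \<open>b\<close>, the
  difference of the two sides of the mild equation, paired with the translates of \<open>b\<close>, has vanishing second differences in \<open>t\<close>. It tends to zero as \<open>t\<close> grows,
  hence is zero. Thus the inversion of the second difference, which has an affine kernel, is controlled by decay at infinity.\<close>
lemma mild_of_weak:
  fixes v h :: "real \<Rightarrow> real"
  assumes v: "v \<in> borel_measurable borel" "\<And>x. \<bar>v x\<bar> \<le> B" "integrable lborel (\<lambda>x. (v x)\<^sup>2)"
    and h: "h \<in> borel_measurable borel" "\<And>x. \<bar>h x\<bar> \<le> B" "integrable lborel (\<lambda>x. (h x)\<^sup>2)"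
    and weak: "\<And>\<phi>. test_function \<phi> \<Longrightarrow> c * (LINT x|lborel. v x * (deriv ^^ 2) \<phi> x) = (LINT x|lborel. second_diff h x * \<phi> x)"
  shows "AE x in lborel. c * v x = tent_avg 1 h x"
proof -
  have [measurable]: "v \<in> borel_measurable borel" "h \<in> borel_measurable borel" using v h by auto
  have pair: "c * (LINT x|lborel. v x * bump n l r x) = (LINT x|lborel. tent_avg 1 h x * bump n l r x)" for n l r
  proof -
    define b where "b t = bump n (l + t) (r + t)" for t
    define psi where "psi t = tent_avg 1 (b t)" for t
    define R where "R t = max \<bar>l + t\<bar> \<bar>r + t\<bar>" for t
    have bs: "smooth (b t)" for t by (simp add: b_def bump_smooth)
    have bsh: "b t (x + s) = b (t - s) x" for t s x by (simp only: b_def bump_shift) (simp add: algebra_simps)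
    have psh: "psi t (x + s) = psi (t - s) x" for t s x
      unfolding psi_def tent_avg_def by (simp add: bsh[symmetric] algebra_simps)
    have bz: "b t x = 0" if "R t \<le> \<bar>x\<bar>" for t x
      unfolding b_def by (rule bump_outside) (use that in \<open>auto simp: R_def\<close>)
    have pz: "psi t x = 0" if "R t + 1 \<le> \<bar>x\<bar>" for t x
      unfolding psi_def by (rule tent_avg_outside[OF bz that])
    have cb: "continuous_on UNIV (b t)" for t using smooth_continuous[OF bs, of 0] by simp
    have cp: "continuous_on UNIV (psi t)" for t
      unfolding psi_def by (rule continuous_on_tent_avg[OF zero_less_one cb])
    have bb: "\<bar>b t x\<bar> \<le> 1" for t x using bump_range[of n "l + t" "r + t" x] by (simp add: b_def)
    have pb: "\<bar>psi t x\<bar> \<le> 1" for t x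
      unfolding psi_def using bb by (intro tent_avg_abs_le borel_measurable_continuous_onI cb) auto
    define T where "T t = (LINT x|lborel. v x * b t x)" for t
    define H where "H t = (LINT x|lborel. h x * psi t x)" for t
    have iT: "integrable lborel (\<lambda>x. v x * b t x)" for t
      by (rule integrable_bounded_compact(1)[OF v(1,2) cb bz])
    have iH: "integrable lborel (\<lambda>x. h x * psi t x)" for t
      by (rule integrable_bounded_compact(1)[OF h(1,2) cp pz])
    have Hs: "(LINT x|lborel. h (x + s) * psi t x) = H (t + s)" "integrable lborel (\<lambda>x. h (x + s) * psi t x)" for s t
    proof -
      have e: "psi t x = psi (t + s) (x + s)" for x by (simp add: psh)
      have "H (t + s) = (LINT x|lborel. h (s + 1 * x) * psi (t + s) (s + 1 * x))"
        unfolding H_def by (subst lborel_integral_real_affine[where c=1 and t=s]) auto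
      then show "(LINT x|lborel. h (x + s) * psi t x) = H (t + s)" unfolding e by (simp add: add.commute)
      show "integrable lborel (\<lambda>x. h (x + s) * psi t x)"
        unfolding e using lborel_integrable_real_affine[OF iH[of "t + s"], of 1 s] by (simp add: add.commute)
    qed
    have step: "c * (T (t - 1) - 2 * T t + T (t + 1)) = H (t + 1) - 2 * H t + H (t - 1)" for t
    proof -
      have "test_function (psi t)"
        by (rule test_functionI[OF _ pz]) (simp add: psi_def smooth_tent_avg bs)
      then have "c * (LINT x|lborel. v x * (deriv ^^ 2) (psi t) x) = (LINT x|lborel. second_diff h x * psi t x)"
        by (rule weak)
      moreover have "(LINT x|lborel. v x * (deriv ^^ 2) (psi t) x) = T (t - 1) - 2 * T t + T (t + 1)"
      proof -
        have "(deriv ^^ 2) (psi t) x = b (t - 1) x - 2 * b t x + b (t + 1) x" for x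
          using bsh[of t x 1] bsh[of t x "- 1"] by (simp add: psi_def tent_avg_deriv2[OF bs])
        then have "v x * (deriv ^^ 2) (psi t) x = v x * b (t - 1) x - 2 * (v x * b t x) + v x * b (t + 1) x" for x
          by (simp only: distrib_left right_diff_distrib mult.left_commute[of "v x"])
        then show ?thesis using iT by (simp add: T_def)
      qed
      moreover have "(LINT x|lborel. second_diff h x * psi t x) = H (t + 1) - 2 * H t + H (t - 1)"
      proof -
        have "second_diff h x * psi t x = h (x + 1) * psi t x - 2 * (h x * psi t x) + h (x + (- 1)) * psi t x" for x
          by (simp add: second_diff_def algebra_simps)
        then show ?thesis using Hs(2)[of 1 t] Hs(2)[of "- 1" t] iH[of t] Hs(1)[of 1 t] Hs(1)[of "- 1" t] by (simp add: H_def)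
      qed
      ultimately show ?thesis by simp
    qed
    (* The defect of the mild equation against the bump translated by m. *)
    define D where "D m = c * T (real m) - H (real m)" for m
    have "D 0 = 0"
    proof (rule affine_null_sequence)
      fix m
      have "real (m + 1) - 1 = real m" "real (m + 1) + 1 = real (m + 2)" by simp_all
      then show "D (m + 2) - 2 * D (m + 1) + D m = 0"
        using step[of "real (m + 1)"] by (simp add: D_def algebra_simps)
    next
      have bt: "b t = (\<lambda>x. b 0 (x - t))" and pt: "psi t = (\<lambda>x. psi 0 (x - t))" for t
        using bsh[of 0 _ "- t"] psh[of 0 _ "- t"] by (simp_all add: fun_eq_iff)
      have "(\<lambda>m. LINT x|lborel. v x * b 0 (x - real m)) \<longlonglongrightarrow> 0"
        by (rule translated_pairing_tendsto_zero[OF v cb bz bb])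
      then have "(\<lambda>m. T (real m)) \<longlonglongrightarrow> 0" unfolding T_def by (subst bt)
      have "(\<lambda>m. LINT x|lborel. h x * psi 0 (x - real m)) \<longlonglongrightarrow> 0"
        by (rule translated_pairing_tendsto_zero[OF h cp pz pb])
      then have "(\<lambda>m. H (real m)) \<longlonglongrightarrow> 0" unfolding H_def by (subst pt)
      with \<open>(\<lambda>m. T (real m)) \<longlonglongrightarrow> 0\<close>
      have "(\<lambda>m. c * T (real m) - H (real m)) \<longlonglongrightarrow> c * 0 - 0" by (intro tendsto_intros)
      then show "D \<longlonglongrightarrow> 0" by (simp add: D_def[abs_def])
    qed
    then have "c * T 0 = (LINT x|lborel. h x * tent_avg 1 (b 0) x)" by (simp add: D_def H_def psi_def)
    also have "\<dots> = (LINT x|lborel. tent_avg 1 h x * b 0 x)"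
      by (rule tent_avg_adjoint[OF h(1,2) cb bz bb])
    finally show ?thesis by (simp add: T_def b_def)
  qed
  define u where "u x = c * v x - tent_avg 1 h x" for x
  have mt: "tent_avg 1 h \<in> borel_measurable borel"
    by (rule borel_measurable_continuous_onI[OF continuous_tent_avg_bounded[OF h(1,2)]])
  have tb: "\<bar>tent_avg 1 h x\<bar> \<le> B" for x by (rule tent_avg_abs_le[OF h(1,2)])
  have um: "u \<in> borel_measurable borel" unfolding u_def[abs_def] using mt by measurable
  have ub: "\<bar>u x\<bar> \<le> \<bar>c\<bar> * B + B" for x
  proof -
    have "\<bar>c * v x\<bar> \<le> \<bar>c\<bar> * B" unfolding abs_mult by (rule mult_left_mono[OF v(2)]) simp
    then show ?thesis using tb[of x] abs_triangle_ineq4[of "c * v x" "tent_avg 1 h x"] unfolding u_def by linarith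
  qed
  have "AE x in lborel. u x = 0"
  proof (rule AE_zero_of_interval_integrals[OF um ub])
    fix l r :: real
    have [measurable]: "u \<in> borel_measurable borel" by (rule um)
    have mb: "bump n l r \<in> borel_measurable borel" for n
      by (rule borel_measurable_continuous_onI) (use smooth_continuous[OF bump_smooth, of 0] in simp)
    have cb: "continuous_on UNIV (bump n l r)" for n using smooth_continuous[OF bump_smooth, of 0 n l r] by simp
    have bz: "bump n l r x = 0" if "max \<bar>l\<bar> \<bar>r\<bar> \<le> \<bar>x\<bar>" for n x
      by (rule bump_outside) (use that in auto)
    have zero: "(LINT x|lborel. u x * bump n l r x) = 0" for n
    proof -
      have "u x * bump n l r x = c * (v x * bump n l r x) - tent_avg 1 h x * bump n l r x" for x
        by (simp add: u_def algebra_simps)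
      moreover have "integrable lborel (\<lambda>x. v x * bump n l r x)"
        by (rule integrable_bounded_compact(1)[OF v(1,2) cb bz])
      moreover have "integrable lborel (\<lambda>x. tent_avg 1 h x * bump n l r x)"
        by (rule integrable_bounded_compact(1)[OF mt tb cb bz])
      ultimately show ?thesis using pair[of n l r] by simp
    qed
    have "(\<lambda>n. LINT x|lborel. u x * bump n l r x) \<longlonglongrightarrow> (LINT x|lborel. u x * indicator {l<..<r} x)"
    proof (rule integral_dominated_convergence[where w="\<lambda>x. (\<bar>c\<bar> * B + B) * indicator {l..r} x"])
      show "integrable lborel (\<lambda>x. (\<bar>c\<bar> * B + B) * indicator {l..r} x :: real)"
        by (intro integrable_mult_right integrable_real_indicator) (auto simp: emeasure_lborel_Icc_eq)
      show "AE x in lborel. (\<lambda>n. u x * bump n l r x) \<longlonglongrightarrow> u x * indicator {l<..<r} x"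
        by (intro AE_I2 tendsto_mult tendsto_const bump_limit)
      show "AE x in lborel. norm (u x * bump n l r x) \<le> (\<bar>c\<bar> * B + B) * indicator {l..r} x" for n
      proof (rule AE_I2)
        fix x
        show "norm (u x * bump n l r x) \<le> (\<bar>c\<bar> * B + B) * indicator {l..r} x"
        proof (cases "x \<in> {l..r}")
          case True
          have "\<bar>u x\<bar> * bump n l r x \<le> (\<bar>c\<bar> * B + B) * 1"
            using ub[of x] bump_range[of n l r x] by (intro mult_mono) auto
          then show ?thesis using True bump_range(1)[of n l r x] by (simp add: abs_mult)
        next
          case False
          then show ?thesis using bump_outside[of x l r n] by auto
        qed
      qed
    qed (use mb in measurable)
    then show "(LINT x|lborel. u x * indicator {l<..<r} x) = 0"
      unfolding zero by (simp add: LIMSEQ_const_iff)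
  qed
  then show ?thesis by eventually_elim (simp add: u_def)
qed

section \<open>The solution in the original variable\<close>

lemma tent_avg_rescale: "tent_avg 1 (\<lambda>z. f (e * z)) z = tent_avg e f (e * z)"
  by (simp add: tent_avg_def algebra_simps)

lemma deriv_rescale:
  assumes "smooth f"
  shows "(deriv ^^ k) (\<lambda>z. f (e * z)) = (\<lambda>z. e ^ k * (deriv ^^ k) f (e * z))"
    and "smooth (\<lambda>z. f (e * z))"
proof -
  have l: "((\<lambda>z. e * z) has_real_derivative e) (at z)" for z by (auto intro!: derivative_eq_intros)
  have d: "((\<lambda>z. e ^ k * (deriv ^^ k) f (e * z)) has_real_derivative e ^ Suc k * (deriv ^^ Suc k) f (e * z)) (at z)" for k z
    using DERIV_cmult[OF DERIV_chain'[OF l[of z] smooth_has_derivative[OF assms, of k "e * z"]], of "e ^ k"] by (simp add: mult_ac)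
  show eq: "(deriv ^^ k) (\<lambda>z. f (e * z)) = (\<lambda>z. e ^ k * (deriv ^^ k) f (e * z))" for k
  proof (induction k)
    case (Suc k)
    have "deriv (\<lambda>z. e ^ k * (deriv ^^ k) f (e * z)) = (\<lambda>z. e ^ Suc k * (deriv ^^ Suc k) f (e * z))"
      using DERIV_imp_deriv[OF d[of k]] by (rule ext)
    then show ?case using Suc by (simp del: power_Suc)
  qed simp
  show "smooth (\<lambda>z. f (e * z))"
    unfolding smooth_def eq using d by (auto simp: real_differentiable_def)
qed

lemma AE_lborel_mem_closed:
  fixes C :: "real set"
  assumes "closed C" "AE x in lborel. x \<in> C"
  shows "x \<in> C"
  using mem_closed_if_AE_lebesgue[OF assms(1) AE_completion[OF assms(2)]] .

context ground_state
begin

lemma F_abs_le: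
  obtains C where "0 \<le> C" "\<And>e u. e \<in> eps_range \<Longrightarrow> e \<noteq> 0 \<Longrightarrow> u \<in> value_range \<Longrightarrow> \<bar>F e u\<bar> \<le> C * \<bar>u\<bar>"
proof -
  obtain C where C: "\<forall>e\<in>eps_range. \<forall>u\<in>value_range. \<bar>F_derivs 1 e u\<bar> \<le> C" using F_derivs_bounded by blast
  have "\<bar>F e u\<bar> \<le> \<bar>C\<bar> * \<bar>u\<bar>" if "e \<in> eps_range" "e \<noteq> 0" "u \<in> value_range" for e u
  proof -
    have "norm (F e u - F e 0) \<le> \<bar>C\<bar> * norm (u - 0)"
    proof (rule field_differentiable_bound[of value_range])
      show "convex value_range" by (simp add: value_range_def)
      fix s assume s: "s \<in> value_range"
      show "(F e has_real_derivative F' e s) (at s within value_range)"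
        by (rule has_field_derivative_at_within, rule F_deriv) (use s in \<open>simp add: value_range_def\<close>)
      show "norm (F' e s) \<le> \<bar>C\<bar>" using C that s by (force simp: F_derivs_def)
    qed (use that wmax in \<open>auto simp: value_range_def\<close>)
    then show ?thesis by (simp add: F_zero)
  qed
  then show thesis by (intro that[of "\<bar>C\<bar>"]) auto
qed

text \<open>For small \<open>u\<close> the slope of \<open>F e\<close> is close to one and thus below \<open>lam\<close>; this is the condition for decay at infinity.\<close>
lemma F_small_le:
  assumes e: "e \<in> eps_range" "0 < e" "C_F * e\<^sup>2 \<le> (lam - 1) / 4"
    and del: "0 < del" "del \<le> 1 / 4" "del \<le> (lam - 1) / 16" and u: "\<bar>u\<bar> \<le> 2 * del"
  shows "\<bar>F e u\<bar> \<le> (1 + lam) / 2 * \<bar>u\<bar>"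
proof -
  have "norm (F e u - F e 0) \<le> (1 + lam) / 2 * norm (u - 0)"
  proof (rule field_differentiable_bound[of "{- (2 * del)..2 * del}"])
    fix s assume s: "s \<in> {- (2 * del)..2 * del}"
    have r: "- 1 / 2 \<le> s" "s \<le> wmax + 1" using s del wmax(1) by auto
    show "(F e has_real_derivative F' e s) (at s within {- (2 * del)..2 * del})"
      by (rule has_field_derivative_at_within, rule F_deriv) (use r in simp)
    have "\<bar>ln (1 + s)\<bar> \<le> 2 * \<bar>s\<bar>" using ln_diff_near[of s 0] r by simp
    moreover have "\<bar>s\<bar> \<le> 2 * del" using s by auto
    moreover have "\<bar>F' e s - (1 + ln (1 + s))\<bar> \<le> C_F * e\<^sup>2"
      using e r by (intro F_near) (auto simp: eps_range_def)
    moreover have "\<bar>F' e s\<bar> \<le> \<bar>F' e s - (1 + ln (1 + s))\<bar> + \<bar>ln (1 + s)\<bar> + 1" by linarith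
    ultimately have "\<bar>F' e s\<bar> \<le> 1 + 4 * del + (lam - 1) / 4"
      using e(3) by argo
    then show "norm (F' e s) \<le> (1 + lam) / 2"
      using del(3) unfolding real_norm_def by argo
  qed (use u del in \<open>auto simp: abs_le_iff\<close>)
  then show ?thesis by (simp add: F_zero)
qed

lemma W_small_outside: "0 < del \<Longrightarrow> \<exists>R\<ge>0. \<forall>x. R \<le> \<bar>x\<bar> \<longrightarrow> W x \<le> del"
proof -
  assume "0 < del"
  then have "\<forall>\<^sub>F x in at_top. \<bar>W x\<bar> < del" using tendstoD[OF W_tendsto, of del] by (simp add: dist_real_def)
  then obtain X where X: "\<And>x. X \<le> x \<Longrightarrow> \<bar>W x\<bar> < del" by (auto simp: eventually_at_top_linorder)
  have "W x \<le> del" if "\<bar>X\<bar> \<le> \<bar>x\<bar>" for x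
  proof -
    have "\<bar>W \<bar>x\<bar>\<bar> < del" by (rule X) (use that in linarith)
    moreover have "W \<bar>x\<bar> = W x" using W_even by (cases "0 \<le> x") auto
    ultimately show ?thesis by simp
  qed
  then show ?thesis by (intro exI[of _ "\<bar>X\<bar>"]) auto
qed

text \<open>In the region where \<open>W\<close> is small the equation gives \<open>|w| \<le> rho T |w|\<close> with \<open>rho = (1 + e\<^sup>2 m) / (1 + e\<^sup>2 lam)\<close> and \<open>m < lam\<close>. Decay of \<open>w\<close> passes to all derivatives
  by bootstrapping in the weighted spaces. The rate depends on \<open>e\<close>, which is harmless because only membership in the Sobolev spaces is concluded.\<close>
lemma solution_decay:
  assumes e: "e \<in> eps_range" "0 < e" "C_F * e\<^sup>2 \<le> (lam - 1) / 4"
    and del: "0 < del" "del \<le> 1 / 4" "del \<le> (lam - 1) / 16"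
    and u: "near del u" "resolves lam e (\<lambda>x. F e (u x)) u"
  obtains th where "0 < th" "\<And>k. ubd k {()} (\<lambda>x. exp (- th * \<bar>x\<bar>)) (\<lambda>_ z. u (e * z))"
proof -
  define w where "w z = u (e * z)" for z
  define h where "h z = w z + e\<^sup>2 * F e (w z)" for z
  define mu where "mu = 1 + e\<^sup>2 * lam"
  have mu: "0 < mu" using lam by (simp add: mu_def add_pos_nonneg)
  have ub: "u \<in> bcontfun" using u(1) by (simp add: near_def)
  obtain B where B: "\<And>x. \<bar>u x\<bar> \<le> B" using bcontfunD(3)[OF ub] by metis
  have cw: "continuous_on UNIV w"
    unfolding w_def[abs_def] by (rule continuous_on_compose2[OF bcontfunD(1)[OF ub]]) (auto intro!: continuous_intros)
  have wR: "w z \<in> value_range" for z unfolding w_def by (rule near_value_range[OF u(1)]) (use del in simp)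
  have eq: "mu * w z = tent_avg 1 h z" for z
    using u(2) tent_avg_rescale[of "\<lambda>x. u x + e\<^sup>2 * F e (u x)" e z]
    by (simp add: resolves_def w_def h_def[abs_def] mu_def)
  have cF: "continuous_on UNIV (\<lambda>z. F e (w z))"
  proof -
    have n: "1 + w z \<noteq> 0" for z using wR[of z] by (auto simp: value_range_def)
    show ?thesis unfolding F_def using n e by (intro continuous_intros cw) auto
  qed
  have ch: "continuous_on UNIV h" unfolding h_def[abs_def] by (intro continuous_intros cw cF)
  obtain R0 where R0: "0 \<le> R0" "\<And>x. R0 \<le> \<bar>x\<bar> \<Longrightarrow> W x \<le> del" using W_small_outside[OF del(1)] by blast
  define m where "m = (1 + lam) / 2"
  define g where "g z = \<bar>h z\<bar> / mu" for z
  define rho where "rho = (1 + e\<^sup>2 * m) / mu"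
  have m: "0 < m" "m < lam" using lam by (auto simp: m_def)
  have rho: "0 < rho" "rho < 1"
    using m mu e by (auto simp: rho_def mu_def intro!: divide_pos_pos add_pos_pos)
  have cg: "continuous_on UNIV g" unfolding g_def[abs_def] using mu by (intro continuous_intros ch) auto
  have wg: "\<bar>w z\<bar> \<le> tent_avg 1 g z" for z
  proof -
    have "mu * \<bar>w z\<bar> = \<bar>tent_avg 1 h z\<bar>" using eq[of z] mu by (metis abs_mult abs_of_pos)
    also have "\<dots> \<le> tent_avg 1 (\<lambda>y. \<bar>h y\<bar>) z" by (rule abs_tent_avg_le[OF ch])
    finally have "\<bar>w z\<bar> \<le> tent_avg 1 (\<lambda>y. \<bar>h y\<bar>) z / mu" using mu by (simp add: field_simps)
    also have "\<dots> = tent_avg 1 g z" by (simp add: tent_avg_def g_def)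
    finally show ?thesis .
  qed
  have far: "g y \<le> rho * \<bar>w y\<bar>" if "R0 / e \<le> \<bar>y\<bar>" for y
  proof -
    have "R0 \<le> \<bar>e * y\<bar>" using that e by (simp add: abs_mult field_simps)
    then have "W (e * y) \<le> del" by (rule R0)
    moreover have "\<bar>w y - W (e * y)\<bar> \<le> del" using u(1) by (simp add: near_def w_def)
    ultimately have "\<bar>w y\<bar> \<le> 2 * del" using W_pos[of "e * y"] by (simp add: abs_le_iff)
    then have "\<bar>F e (w y)\<bar> \<le> m * \<bar>w y\<bar>" unfolding m_def by (rule F_small_le[OF e del])
    then have "\<bar>e\<^sup>2 * F e (w y)\<bar> \<le> e\<^sup>2 * (m * \<bar>w y\<bar>)" by (simp add: abs_mult mult_left_mono)
    then have "\<bar>h y\<bar> \<le> (1 + e\<^sup>2 * m) * \<bar>w y\<bar>"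
      using abs_triangle_ineq[of "w y" "e\<^sup>2 * F e (w y)"] by (simp add: h_def algebra_simps)
    then show ?thesis using mu by (simp add: g_def rho_def divide_right_mono)
  qed
  have R0e: "0 \<le> R0 / e" using R0 e by simp
  have wB: "\<bar>w z\<bar> \<le> B" for z using B by (simp add: w_def)
  obtain K th where th: "0 < th" and K: "\<And>z. \<bar>w z\<bar> \<le> K * exp (- th * \<bar>z\<bar>)"
    using exp_decay[OF cg wg far rho wB R0e] by metis
  let ?om = "\<lambda>x. exp (- th * \<bar>x\<bar>)"
  have om: "0 \<le> ?om x" "?om x \<le> 1" for x using th by auto
  obtain C0 where C0: "0 \<le> C0" "\<And>e u. e \<in> eps_range \<Longrightarrow> e \<noteq> 0 \<Longrightarrow> u \<in> value_range \<Longrightarrow> \<bar>F e u\<bar> \<le> C0 * \<bar>u\<bar>"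
    using F_abs_le by metis
  have "ubd k {()} ?om (\<lambda>_. w)" for k
  proof (induction k)
    case 0
    show ?case unfolding ubd.simps using cw K by blast
  next
    case (Suc k)
    have "ubd k {()} ?om (\<lambda>_ x. F_derivs 0 e (w x))"
    proof (rule ubd_comp_decay[where G="\<lambda>j _. F_derivs j e" and R=value_range and E="{()}" and U="\<lambda>_. w", OF _ _ C0(1) _ Suc.IH _ om])
      show "(F_derivs j e has_real_derivative F_derivs (Suc j) e s) (at s)" if "s \<in> value_range" for j s
        using that by (intro F_derivs_deriv) (simp add: value_range_def)
      show "\<exists>C. \<forall>i\<in>{()}. \<forall>s\<in>value_range. \<bar>F_derivs j e s\<bar> \<le> C" for j
        using F_derivs_bounded[of j] e(1) by auto
      show "\<bar>F_derivs 0 e s\<bar> \<le> C0 * \<bar>s\<bar>" if "s \<in> value_range" for s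
        using C0(2)[OF e(1) _ that] e(2) by (simp add: F_derivs_def)
    qed (use wR in auto)
    then have f: "ubd k {()} ?om (\<lambda>_ x. F e (w x))" using e(2) by (simp add: F_derivs_def)
    have "ubd k {()} ?om (\<lambda>_ x. w x + e\<^sup>2 * F e (w x))"
      by (intro ubd_add ubd_mult ubd_const Suc.IH f om)
    then have "ubd (Suc k) {()} ?om (\<lambda>_. tent_avg 1 h)"
      using ubd_tent_avg[OF th, of k "{()}" "\<lambda>_. h"] by (simp only: h_def[abs_def])
    then have "ubd (Suc k) {()} ?om (\<lambda>_ x. (1 / mu) * tent_avg 1 h x)"
      by (intro ubd_mult ubd_const om)
    moreover have "(1 / mu) * tent_avg 1 h x = w x" for x using eq[of x] mu by (simp add: field_simps)
    ultimately show ?case by (simp only:)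
  qed
  then show thesis using that[OF th] unfolding w_def[abs_def] by blast
qed

lemma solution_properties:
  assumes e: "e \<in> eps_range" "0 < e" "C_F * e\<^sup>2 \<le> (lam - 1) / 4"
    and del: "0 < del" "del \<le> 1 / 4" "del \<le> (lam - 1) / 16"
    and u: "near del u" "resolves lam e (\<lambda>x. F e (u x)) u"
  shows "smooth (\<lambda>z. u (e * z))" "(\<lambda>z. u (e * z)) \<in> H_infinity"
    "advance_delay_solution e (e\<^sup>2 * lam) (\<lambda>z. u (e * z))"
proof -
  define w where "w z = u (e * z)" for z
  obtain th where th: "0 < th" "\<And>k. ubd k {()} (\<lambda>x. exp (- th * \<bar>x\<bar>)) (\<lambda>_ z. u (e * z))"
    using solution_decay[OF assms] by metis
  then have ubw: "ubd k {()} (\<lambda>x. exp (- th * \<bar>x\<bar>)) (\<lambda>_. w)" for k by (simp add: w_def[abs_def])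
  have sw: "smooth w" by (rule ubd_smooth[OF ubw]) simp
  then show "smooth (\<lambda>z. u (e * z))" by (simp add: w_def[abs_def])
  have dec: "\<exists>C. \<forall>x. \<bar>(deriv ^^ j) w x\<bar> \<le> C * exp (- th * \<bar>x\<bar>)" for j
    using ubd_deriv_bounded[OF ubw[of j] order_refl] by simp
  have Hw: "w \<in> H_infinity" by (rule exp_decay_H_infinity[OF sw th(1) dec])
  then show "(\<lambda>z. u (e * z)) \<in> H_infinity" by (simp add: w_def[abs_def])
  have cw: "continuous_on UNIV w" using smooth_continuous[OF sw, of 0] by simp
  have wR: "w z \<in> value_range" for z unfolding w_def by (rule near_value_range[OF u(1)]) (use del in simp)
  have wL2: "w \<in> L2" using Hw by (auto simp: H_infinity_def Sobolev_H_def)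
  have wLinf: "w \<in> Linf"
  proof -
    have "\<bar>w z\<bar> \<le> wmax + 1" for z using wR[of z] wmax(1) unfolding value_range_def atLeastAtMost_iff by argo
    then show ?thesis unfolding Linf_def using borel_measurable_continuous_onI[OF cw] by (auto intro!: exI[of _ "wmax + 1"])
  qed
  define h where "h z = dV e (w z)" for z
  have eq: "(1 + e\<^sup>2 * lam) * w z = tent_avg 1 h z" for z
    using u(2) tent_avg_rescale[of "\<lambda>x. u x + e\<^sup>2 * F e (u x)" e z] e(2)
    by (simp add: resolves_def w_def h_def[abs_def] dV_eq)
  have ch: "continuous_on UNIV h"
  proof -
    have n: "1 + w z \<noteq> 0" for z using wR[of z] by (auto simp: value_range_def)
    show ?thesis unfolding h_def[abs_def] dV_def using n by (intro continuous_intros cw) auto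
  qed
  obtain Th where Th: "\<And>x. (Th has_real_derivative h x) (at x)" using exists_antiderivative[OF ch] by blast
  have feq: "(\<lambda>z. (1 + e\<^sup>2 * lam) * w z) = tent_avg 1 h" using eq by (rule ext)
  have "deriv (tent_avg 1 h) = (\<lambda>x. (Th (x + 1) - 2 * Th x + Th (x - 1)) / 1\<^sup>2)"
    by (intro ext DERIV_imp_deriv tent_avg_has_derivative[OF zero_less_one ch Th])
  moreover have "deriv (\<lambda>x. (Th (x + 1) - 2 * Th x + Th (x - 1)) / 1\<^sup>2) x = (h (x + 1) - 2 * h x + h (x - 1)) / 1\<^sup>2" for x
    by (intro DERIV_imp_deriv tent_avg_second_derivative[OF zero_less_one ch Th])
  ultimately have d2: "(deriv ^^ 2) (\<lambda>z. (1 + e\<^sup>2 * lam) * w z) = second_diff h"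
    unfolding feq by (simp add: numeral_2_eq_2 second_diff_def[abs_def] ext)
  have "diff_times k w" for k
  proof -
    have "diff_times k f" if "smooth f" for f using that
    proof (induction k arbitrary: f)
      case (Suc k)
      show ?case by (rule diff_times_SucI[OF _ Suc.IH[OF smooth_deriv[OF Suc.prems]]])
        (use smooth_has_derivative[OF Suc.prems, of 0] in simp)
    qed simp
    then show ?thesis using sw by blast
  qed
  then have "diff_times k (\<lambda>z. (1 + e\<^sup>2 * lam) * w z + 0 * w z)" for k by (intro diff_times_lincomb)
  then have "smooth (\<lambda>z. (1 + e\<^sup>2 * lam) * w z)" by (intro diff_times_smooth) simp
  from smooth_weak_deriv[OF this, of 2]
  have "weak_deriv 2 (\<lambda>z. (1 + e\<^sup>2 * lam) * w z) (second_diff (\<lambda>z. dV e (w z)))"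
    unfolding d2 by (simp only: h_def[abs_def])
  moreover have "- 1 < w z" for z using wR[of z] unfolding value_range_def by simp
  then have "AE z in lborel. w z > -1" by simp
  ultimately show "advance_delay_solution e (e\<^sup>2 * lam) (\<lambda>z. u (e * z))"
    unfolding advance_delay_solution_def using wL2 wLinf by (simp add: w_def[abs_def])
qed

text \<open>A distributional solution satisfies its bounds almost everywhere only. Truncating it to the admissible range changes it on a null set; the
  mild equation then provides a continuous function that agrees with it almost everywhere, and closed conditions that hold almost
  everywhere hold for a continuous function at every point.\<close>
lemma solution_continuous_version:
  fixes v :: "real \<Rightarrow> real"
  assumes e: "e \<in> eps_range" "0 < e" and del: "del \<le> 1 / 2" "C * e powr (1 / 6) \<le> del"
    and v: "even_solution_near lam W C e v"
  obtains V where "near del V" "resolves lam e (\<lambda>x. F e (V x)) V" "AE z in lborel. v z = V (e * z)"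
proof -
  have vm: "v \<in> borel_measurable borel" and v2: "integrable lborel (\<lambda>x. (v x)\<^sup>2)"
    and vw: "weak_deriv 2 (\<lambda>z. (1 + e\<^sup>2 * lam) * v z) (second_diff (\<lambda>z. dV e (v z)))"
    and ve: "AE z in lborel. v (- z) = v z" and vn: "AE z in lborel. \<bar>v z - W (e * z)\<bar> \<le> C * e powr (1 / 6)"
    using v by (auto simp: even_solution_near_def advance_delay_solution_def L2_def)
  define mu where "mu = 1 + e\<^sup>2 * lam"
  have mu: "0 < mu" using lam by (simp add: mu_def add_pos_nonneg)
  (* The pointwise bounds needed to estimate dV hold only almost everywhere for v itself. *)
  define vc where "vc x = max (- 1 / 2) (min (wmax + 1) (v x))" for x
  define h where "h x = dV e (vc x)" for x
  have [measurable]: "v \<in> borel_measurable borel" by (rule vm)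
  have vcm [measurable]: "vc \<in> borel_measurable borel" unfolding vc_def[abs_def] by measurable
  have hm [measurable]: "h \<in> borel_measurable borel" unfolding h_def[abs_def] dV_def by measurable
  have AEv: "AE x in lborel. vc x = v x"
    using vn
  proof eventually_elim
    case (elim z)
    then have "\<bar>v z - W (e * z)\<bar> \<le> 1 / 2" using del by linarith
    then have "- 1 / 2 \<le> v z" "v z \<le> wmax + 1" using W_pos[of "e * z"] wmax(2)[of "e * z"] by linarith+
    then show ?case by (simp add: vc_def)
  qed
  have vR: "vc x \<in> value_range" for x using wmax(1) by (auto simp: vc_def value_range_def)
  obtain C0 where C0: "0 \<le> C0" "\<And>e u. e \<in> eps_range \<Longrightarrow> e \<noteq> 0 \<Longrightarrow> u \<in> value_range \<Longrightarrow> \<bar>F e u\<bar> \<le> C0 * \<bar>u\<bar>"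
    using F_abs_le by metis
  define Ch where "Ch = 1 + e\<^sup>2 * C0"
  have Ch: "1 \<le> Ch" using C0 by (simp add: Ch_def)
  have hv: "\<bar>h x\<bar> \<le> Ch * \<bar>vc x\<bar>" for x
  proof -
    have "\<bar>e\<^sup>2 * F e (vc x)\<bar> \<le> e\<^sup>2 * (C0 * \<bar>vc x\<bar>)"
      using C0(2)[OF e(1) _ vR[of x]] e(2) by (simp add: abs_mult mult_left_mono)
    then show ?thesis using abs_triangle_ineq[of "vc x" "e\<^sup>2 * F e (vc x)"] e(2)
      by (simp add: h_def dV_eq Ch_def algebra_simps)
  qed
  have vb0: "\<bar>vc x\<bar> \<le> wmax + 1" for x using vR[of x] wmax(1) by (auto simp: value_range_def abs_le_iff)
  define B where "B = Ch * (wmax + 1)"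
  have hb: "\<bar>h x\<bar> \<le> B" for x
    unfolding B_def by (rule order_trans[OF hv mult_left_mono[OF vb0]]) (use Ch in simp)
  have vb: "\<bar>vc x\<bar> \<le> B" for x
    using order_trans[OF vb0[of x]] mult_right_mono[OF Ch, of "wmax + 1"] wmax(1) by (simp add: B_def)
  have vc2: "integrable lborel (\<lambda>x. (vc x)\<^sup>2)"
    by (rule integrable_cong_AE_imp[OF v2]) (use AEv in \<open>auto elim!: eventually_mono\<close>)
  have h2: "integrable lborel (\<lambda>x. (h x)\<^sup>2)"
  proof (rule Bochner_Integration.integrable_bound[OF integrable_mult_right[OF vc2, of "Ch\<^sup>2"]])
    show "AE x in lborel. norm ((h x)\<^sup>2) \<le> norm (Ch\<^sup>2 * (vc x)\<^sup>2)"
    proof (rule AE_I2)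
      fix x
      have "\<bar>h x\<bar>\<^sup>2 \<le> (Ch * \<bar>vc x\<bar>)\<^sup>2" using hv[of x] by (intro power_mono) auto
      then show "norm ((h x)\<^sup>2) \<le> norm (Ch\<^sup>2 * (vc x)\<^sup>2)" by (simp add: power_mult_distrib)
    qed
  qed measurable
  have AEh: "AE x in lborel. second_diff h x = second_diff (\<lambda>z. dV e (v z)) x"
  proof -
    have "AE x in lborel. vc (1 + 1 * x) = v (1 + 1 * x)" by (rule AE_borel_affine[OF _ _ AEv]) auto
    moreover have "AE x in lborel. vc (- 1 + 1 * x) = v (- 1 + 1 * x)" by (rule AE_borel_affine[OF _ _ AEv]) auto
    ultimately show ?thesis using AEv
      by eventually_elim (simp add: second_diff_def h_def add.commute)
  qed
  have weak: "mu * (LINT x|lborel. vc x * (deriv ^^ 2) \<phi> x) = (LINT x|lborel. second_diff h x * \<phi> x)"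
    if t: "test_function \<phi>" for \<phi>
  proof -
    have s: "smooth \<phi>" using t by (simp add: test_function_def)
    have [measurable]: "(deriv ^^ 2) \<phi> \<in> borel_measurable borel" "\<phi> \<in> borel_measurable borel"
      using smooth_continuous[OF s, of 2] smooth_continuous[OF s, of 0] by (auto intro: borel_measurable_continuous_onI)
    have "mu * (LINT x|lborel. vc x * (deriv ^^ 2) \<phi> x) = (LINT x|lborel. (mu * vc x) * (deriv ^^ 2) \<phi> x)"
      by (simp add: mult.assoc)
    also have "\<dots> = (LINT x|lborel. (mu * v x) * (deriv ^^ 2) \<phi> x)"
      by (rule integral_cong_AE) (use AEv in \<open>auto elim!: eventually_mono\<close>)
    also have "\<dots> = (-1) ^ 2 * (LINT x|lborel. second_diff (\<lambda>z. dV e (v z)) x * \<phi> x)"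
      using vw t unfolding weak_deriv_def mu_def by blast
    also have "\<dots> = (LINT x|lborel. second_diff (\<lambda>z. dV e (v z)) x * \<phi> x)" by simp
    also have "\<dots> = (LINT x|lborel. second_diff h x * \<phi> x)"
    proof (rule integral_cong_AE)
      show "(\<lambda>x. second_diff (\<lambda>z. dV e (v z)) x * \<phi> x) \<in> borel_measurable lborel"
        unfolding second_diff_def dV_def by measurable
      show "(\<lambda>x. second_diff h x * \<phi> x) \<in> borel_measurable lborel"
        unfolding second_diff_def by measurable
      show "AE x in lborel. second_diff (\<lambda>z. dV e (v z)) x * \<phi> x = second_diff h x * \<phi> x"
        using AEh by eventually_elim simp
    qed
    finally show ?thesis .
  qed
  have mild: "AE x in lborel. mu * vc x = tent_avg 1 h x"
    by (rule mild_of_weak[OF vcm vb vc2 hm hb h2 weak])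
  define vt where "vt x = tent_avg 1 h x / mu" for x
  have ct: "continuous_on UNIV vt"
    unfolding vt_def[abs_def] using mu by (intro continuous_intros continuous_tent_avg_bounded[OF hm hb]) auto
  have AEt: "AE x in lborel. vc x = vt x"
    using mild by eventually_elim (use mu in \<open>simp add: vt_def field_simps\<close>)
  have AEvt: "AE x in lborel. v x = vt x" using AEv AEt by eventually_elim simp
  have vtm [measurable]: "vt \<in> borel_measurable borel" by (rule borel_measurable_continuous_onI[OF ct])
  have vtR: "vt x \<in> value_range" for x
  proof -
    have "x \<in> {x. vt x \<in> value_range}"
    proof (rule AE_lborel_mem_closed)
      have "closed (vt -` value_range)" unfolding value_range_def by (rule continuous_closed_vimage) (use ct in \<open>auto simp: continuous_on_eq_continuous_at\<close>)
      then show "closed {x. vt x \<in> value_range}" by (simp add: vimage_def)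
      show "AE x in lborel. x \<in> {x. vt x \<in> value_range}" using AEt by eventually_elim (use vR in \<open>metis mem_Collect_eq\<close>)
    qed
    then show ?thesis by simp
  qed
  have vtn: "\<bar>vt x - W (e * x)\<bar> \<le> del" for x
  proof -
    have cW: "continuous_on UNIV (\<lambda>x. W (e * x))"
      by (rule continuous_on_compose2[OF continuous_W]) (auto intro!: continuous_intros)
    have "x \<in> {x. \<bar>vt x - W (e * x)\<bar> \<le> del}"
    proof (rule AE_lborel_mem_closed)
      show "closed {x. \<bar>vt x - W (e * x)\<bar> \<le> del}" by (intro closed_Collect_le continuous_intros ct cW)
      show "AE x in lborel. x \<in> {x. \<bar>vt x - W (e * x)\<bar> \<le> del}"
        using vn AEvt by eventually_elim (use del in auto)
    qed
    then show ?thesis by simp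
  qed
  have vte: "vt (- x) = vt x" for x
  proof -
    have cm: "continuous_on UNIV (\<lambda>x. vt (- x))"
      by (rule continuous_on_compose2[OF ct]) (auto intro!: continuous_intros)
    have "AE x in lborel. v (0 + (- 1) * x) = vt (0 + (- 1) * x)" by (rule AE_borel_affine[OF _ _ AEvt]) auto
    then have "AE x in lborel. x \<in> {x. vt (- x) = vt x}"
      using ve AEvt by eventually_elim simp
    moreover have "closed {x. vt (- x) = vt x}" by (intro closed_Collect_eq ct cm)
    ultimately have "x \<in> {x. vt (- x) = vt x}" by (intro AE_lborel_mem_closed)
    then show ?thesis by simp
  qed
  have eqt: "mu * vt x = tent_avg 1 (\<lambda>y. vt y + e\<^sup>2 * F e (vt y)) x" for x
  proof -
    have "mu * vt x = tent_avg 1 h x" using mu by (simp add: vt_def)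
    also have "\<dots> = tent_avg 1 (\<lambda>y. dV e (vt y)) x"
      unfolding tent_avg_def
    proof (rule integral_cong_AE)
      have "AE y in lborel. vc (x + 1 * y) = vt (x + 1 * y)" by (rule AE_borel_affine[OF _ _ AEt]) auto
      then show "AE y in lborel. tent y * h (x + 1 * y) = tent y * dV e (vt (x + 1 * y))"
        by eventually_elim (simp add: h_def)
      show "(\<lambda>y. tent y * dV e (vt (x + 1 * y))) \<in> borel_measurable lborel"
        unfolding dV_def by measurable
    qed measurable
    finally show ?thesis using e(2) by (simp add: dV_eq)
  qed
  define V where "V x = vt (x / e)" for x
  have cV: "continuous_on UNIV V"
    unfolding V_def[abs_def] by (rule continuous_on_compose2[OF ct]) (use e in \<open>auto intro!: continuous_intros\<close>)
  have Vb: "\<bar>V x\<bar> \<le> wmax + 1" for x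
    using vtR[of "x / e"] wmax(1) by (auto simp: V_def value_range_def abs_le_iff)
  have VB: "V \<in> bcontfun" by (rule bcontfunI'[OF cV Vb])
  show thesis
  proof (rule that[of V])
    have "\<bar>V x - W x\<bar> \<le> del" for x using vtn[of "x / e"] e(2) by (simp add: V_def)
    then show "near del V" using VB vte by (simp add: near_def V_def)
    have vV: "vt y = V (e * y)" for y using e(2) by (simp add: V_def)
    have "(1 + e\<^sup>2 * lam) * V x = tent_avg e (\<lambda>y. V y + e\<^sup>2 * F e (V y)) x" for x
    proof -
      have "mu * V x = tent_avg 1 (\<lambda>y. V (e * y) + e\<^sup>2 * F e (V (e * y))) (x / e)"
        using eqt[of "x / e"] unfolding vV using e(2) by simp
      also have "\<dots> = tent_avg e (\<lambda>y. V y + e\<^sup>2 * F e (V y)) x"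
        using tent_avg_rescale[of "\<lambda>y. V y + e\<^sup>2 * F e (V y)" e "x / e"] e(2) by simp
      finally show ?thesis by (simp add: mu_def)
    qed
    then show "resolves lam e (\<lambda>x. F e (V x)) V" using VB by (simp add: resolves_def)
    show "AE z in lborel. v z = V (e * z)" using AEvt vV by simp
  qed
qed

end

theorem theorem1:
  fixes lam :: real and W :: "real \<Rightarrow> real"
  assumes "lam > 1"
    and "log_KdV_ground_state lam W"
  shows "\<exists>\<epsilon>0 C0 Cminus Cplus :: real. \<exists>w :: real \<Rightarrow> real \<Rightarrow> real.
    \<epsilon>0 > 0 \<and> C0 > 0 \<and> -1 < Cminus \<and> Cminus \<le> Cplus \<and>
    (\<forall>\<epsilon>\<in>{0<..<\<epsilon>0}.
       even_solution_near lam W C0 \<epsilon> (w \<epsilon>) \<and>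
       (\<forall>v. even_solution_near lam W C0 \<epsilon> v \<longrightarrow> (AE z in lborel. v z = w \<epsilon> z)) \<and>
       w \<epsilon> \<in> H_infinity \<and> smooth (w \<epsilon>) \<and>
       (\<forall>z. w \<epsilon> (- z) = w \<epsilon> z) \<and>
       (\<forall>z. w \<epsilon> z \<in> {Cminus..Cplus}) \<and>
       (\<forall>z. \<bar>w \<epsilon> z - W (\<epsilon> * z)\<bar> \<le> C0 * \<epsilon> powr (1 / 6))) \<and>
    (\<forall>k::nat. \<exists>C>0. \<forall>\<epsilon>\<in>{0<..<\<epsilon>0}. \<forall>z.
       \<bar>(deriv ^^ k) (w \<epsilon>) z - \<epsilon> ^ k * (deriv ^^ k) W (\<epsilon> * z)\<bar> \<le> C * \<epsilon> powr (real k + 1 / 6))"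
proof -
  interpret ground_state lam W by unfold_locales (rule assms)+
  (* The radius has to be small for the contraction (second entry) and for the slope of F to stay
     below lam wherever W is small (third entry). *)
  define del where "del = min (1 / 4) (min (1 / (8 * C_green)) ((lam - 1) / 16))"
  have del: "0 < del" "del \<le> 1 / 4" "del \<le> 1 / (8 * C_green)" "del \<le> (lam - 1) / 16"
    unfolding del_def using C_green_pos lam by (simp, intro min.cobounded1, intro min.coboundedI2 min.cobounded1, intro min.coboundedI2 min.cobounded2)
  have dCS: "8 * C_green * del \<le> 1" using del(3) C_green_pos by (simp add: field_simps)
  define C0 where "C0 = 2 * K2"
  have C0: "0 < C0" using K2_pos by (simp add: C0_def)
  (* The thresholds are, in this order, for: e <= 1; the bound on the logarithm; the contraction
     factor; the ball being mapped to itself; the decay rate; and C0 * e powr (1/6) <= del, which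
     places every competitor of the uniqueness claim in the ball. *)
  define e0 where "e0 = Min {1, 1 / ell, 1 / (4 * K1), del / C0, (lam - 1) / (4 * C_F), (del / C0) ^ 6}"
  have pos: "0 < ell" "0 < K1" "0 < C_F" "0 < del / C0" using ell_ge K1_pos C_F_pos del C0 by auto
  have e0: "0 < e0" unfolding e0_def using pos lam by (subst Min_gr_iff) auto
  have small: "e \<in> eps_range" "0 < e" "e \<le> 1" "e\<^sup>2 * ell \<le> 1" "K1 * e \<le> 1 / 4" "K2 * e \<le> del / 2"
      "C_F * e\<^sup>2 \<le> (lam - 1) / 4" "C0 * e powr (1 / 6) \<le> del" "2 * K2 * e \<le> C0 * e powr (1 / 6)"
    if e: "e \<in> {0<..<e0}" for e
  proof -
    have le: "e < 1" "e < 1 / ell" "e < 1 / (4 * K1)" "e < del / C0" "e < (lam - 1) / (4 * C_F)" "e < (del / C0) ^ 6"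
      using e unfolding e0_def by simp_all
    show e1: "0 < e" "e \<le> 1" using e le by auto
    have e2: "e\<^sup>2 \<le> e" using e1 by (simp add: power2_eq_square mult_left_le)
    have "e\<^sup>2 * ell \<le> e * ell" using e2 pos by (intro mult_right_mono) auto
    also have "\<dots> \<le> 1" using le(2) pos by (simp add: field_simps)
    finally show l: "e\<^sup>2 * ell \<le> 1" .
    then show "e \<in> eps_range" using e1 by (simp add: eps_range_def)
    show "K1 * e \<le> 1 / 4" using le(3) pos by (simp add: field_simps)
    show "K2 * e \<le> del / 2" using le(4) C0 by (simp add: C0_def field_simps)
    have "C_F * e\<^sup>2 \<le> C_F * e" using e2 pos by (intro mult_left_mono) auto
    also have "\<dots> \<le> (lam - 1) / 4" using le(5) pos by (simp add: field_simps)
    finally show "C_F * e\<^sup>2 \<le> (lam - 1) / 4" .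
    have "e powr (1 / 6) \<le> ((del / C0) ^ 6) powr (1 / 6)" using le(6) e1 by (intro powr_mono2) auto
    also have "\<dots> = del / C0"
    proof -
      have "(del / C0) ^ 6 = (del / C0) powr 6" using pos(4) by (simp only: powr_numeral)
      then show ?thesis using abs_of_pos[OF pos(4)] by (simp only: powr_powr) simp
    qed
    finally show "C0 * e powr (1 / 6) \<le> del" using C0 by (simp add: field_simps)
    have "e powr 1 \<le> e powr (1 / 6)" using e1 by (intro powr_mono') auto
    then show "2 * K2 * e \<le> C0 * e powr (1 / 6)" using e1 C0 by (simp add: C0_def)
  qed
  have "\<forall>e\<in>{0<..<e0}. \<exists>u. near del u \<and> resolves lam e (\<lambda>x. F e (u x)) u \<and> (\<forall>x. \<bar>u x - W x\<bar> \<le> 2 * K2 * e) \<and>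
     (\<forall>w. near del w \<longrightarrow> resolves lam e (\<lambda>x. F e (w x)) w \<longrightarrow> (\<forall>x. w x = u x))"
  proof
    fix e assume "e \<in> {0<..<e0}"
    note s = small[OF this]
    have d2: "del \<le> 1 / 2" using del by simp
    show "\<exists>u. near del u \<and> resolves lam e (\<lambda>x. F e (u x)) u \<and> (\<forall>x. \<bar>u x - W x\<bar> \<le> 2 * K2 * e) \<and>
     (\<forall>w. near del w \<longrightarrow> resolves lam e (\<lambda>x. F e (w x)) w \<longrightarrow> (\<forall>x. w x = u x))"
      by (rule continuous_solution[OF s(2-6) del(1) d2 dCS]) blast
  qed
  from bchoice[OF this] obtain U where U: "\<And>e. e \<in> {0<..<e0} \<Longrightarrow> near del (U e)"
    "\<And>e. e \<in> {0<..<e0} \<Longrightarrow> resolves lam e (\<lambda>x. F e (U e x)) (U e)"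
    "\<And>e x. e \<in> {0<..<e0} \<Longrightarrow> \<bar>U e x - W x\<bar> \<le> 2 * K2 * e"
    "\<And>e w x. e \<in> {0<..<e0} \<Longrightarrow> near del w \<Longrightarrow> resolves lam e (\<lambda>x. F e (w x)) w \<Longrightarrow> w x = U e x"
    by blast
  define w where "w e z = U e (e * z)" for e z
  have props: "smooth (w e)" "w e \<in> H_infinity" "advance_delay_solution e (e\<^sup>2 * lam) (w e)" if e: "e \<in> {0<..<e0}" for e
    using solution_properties[OF small(1)[OF e] small(2)[OF e] small(7)[OF e] del(1,2,4) U(1)[OF e] U(2)[OF e]]
    by (simp_all add: w_def[abs_def])
  have wev: "w e (- z) = w e z" if "e \<in> {0<..<e0}" for e z
    using U(1)[OF that] by (simp add: w_def near_def)
  have wR: "w e z \<in> {- 1 / 2..wmax + 1}" if "e \<in> {0<..<e0}" for e z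
    using near_value_range[OF U(1)[OF that], of "e * z"] del by (simp add: w_def value_range_def)
  have wW: "\<bar>w e z - W (e * z)\<bar> \<le> C0 * e powr (1 / 6)" if "e \<in> {0<..<e0}" for e z
    using U(3)[OF that, of "e * z"] small(9)[OF that] by (simp add: w_def)
  have sol: "even_solution_near lam W C0 e (w e)" if "e \<in> {0<..<e0}" for e
    unfolding even_solution_near_def using props(3)[OF that] wev[OF that] wW[OF that] by (auto intro!: AE_I2)
  have uniq: "AE z in lborel. v z = w e z" if e: "e \<in> {0<..<e0}" and v: "even_solution_near lam W C0 e v" for e v
  proof -
    have d2: "del \<le> 1 / 2" using del by simp
    obtain V where V: "near del V" "resolves lam e (\<lambda>x. F e (V x)) V" "AE z in lborel. v z = V (e * z)"
      by (rule solution_continuous_version[OF small(1)[OF e] small(2)[OF e] d2 small(8)[OF e] v])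
    from V(3) show ?thesis by eventually_elim (simp only: w_def U(4)[OF e V(1,2)])
  qed
  have rates: "\<exists>C>0. \<forall>\<epsilon>\<in>{0<..<e0}. \<forall>z. \<bar>(deriv ^^ k) (w \<epsilon>) z - \<epsilon> ^ k * (deriv ^^ k) W (\<epsilon> * z)\<bar> \<le> C * \<epsilon> powr (real k + 1 / 6)" for k
  proof -
    have E: "{0<..<e0} \<subseteq> eps_range - {0}" using small(1,2) by fastforce
    have n2: "near (1 / 2) (U e)" if "e \<in> {0<..<e0}" for e
    proof -
      have "\<bar>U e x - W x\<bar> \<le> del" for x using U(1)[OF that] by (simp add: near_def)
      then have "\<bar>U e x - W x\<bar> \<le> 1 / 2" for x by (rule order_trans) (use del(2) in simp)
      then show ?thesis using U(1)[OF that] by (simp add: near_def)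
    qed
    have "\<exists>C. \<forall>e\<in>{0<..<e0}. \<forall>x. \<bar>(deriv ^^ k) (U e) x - (deriv ^^ k) W x\<bar> \<le> C * e powr (1 / 6)"
      by (rule derivative_rates[OF E n2 U(2) U(3)])
    then obtain C where C: "\<And>e x. e \<in> {0<..<e0} \<Longrightarrow> \<bar>(deriv ^^ k) (U e) x - (deriv ^^ k) W x\<bar> \<le> C * e powr (1 / 6)"
      by blast
    have "\<bar>(deriv ^^ k) (w e) z - e ^ k * (deriv ^^ k) W (e * z)\<bar> \<le> (\<bar>C\<bar> + 1) * e powr (real k + 1 / 6)"
      if e: "e \<in> {0<..<e0}" for e z
    proof -
      have e1: "0 < e" by (rule small(2)[OF e])
      have "smooth (U e)" by (rule ubd_smooth[OF ubd_solution[OF E n2 U(2)] e])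
      then have "(deriv ^^ k) (w e) z = e ^ k * (deriv ^^ k) (U e) (e * z)"
        using deriv_rescale(1)[of "U e" k e] by (simp add: w_def[abs_def])
      then have "\<bar>(deriv ^^ k) (w e) z - e ^ k * (deriv ^^ k) W (e * z)\<bar>
          = e ^ k * \<bar>(deriv ^^ k) (U e) (e * z) - (deriv ^^ k) W (e * z)\<bar>"
        using e1 by (simp add: abs_mult flip: right_diff_distrib)
      also have "\<dots> \<le> e ^ k * (C * e powr (1 / 6))"
        using e1 by (intro mult_left_mono C[OF e]) auto
      also have "\<dots> \<le> e ^ k * ((\<bar>C\<bar> + 1) * e powr (1 / 6))"
        using e1 by (intro mult_left_mono mult_right_mono) auto
      also have "\<dots> = (\<bar>C\<bar> + 1) * e powr (real k + 1 / 6)"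
        using e1 by (simp add: powr_add powr_realpow)
      finally show ?thesis .
    qed
    then show ?thesis by (intro exI[of _ "\<bar>C\<bar> + 1"]) auto
  qed
  show ?thesis
  proof (rule exI[of _ e0], rule exI[of _ C0], rule exI[of _ "- 1 / 2"], rule exI[of _ "wmax + 1"], rule exI[of _ w],
      intro conjI ballI)
    fix e assume e: "e \<in> {0<..<e0}"
    show "\<forall>v. even_solution_near lam W C0 e v \<longrightarrow> (AE z in lborel. v z = w e z)"
      by (intro allI impI uniq e)
    show "\<forall>z. w e (- z) = w e z" "\<forall>z. w e z \<in> {- 1 / 2..wmax + 1}" "\<forall>z. \<bar>w e z - W (e * z)\<bar> \<le> C0 * e powr (1 / 6)"
      by (intro allI wev wR wW e)+
  qed (use e0 C0 wmax(1) sol props rates in simp_all)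
qed

end
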